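(* Let $\mathbf H_{\mathcal{LFG}}=\{f:I(\mathcal{LFG})\to\mathbb Q \mid |\mathrm{supp}(f)|<\infty\}$ be the $\mathbb Q$-vector space of finitely supported $\mathbb Q$-valued functions on the set $I(\mathcal{LFG})$ of isomorphism classes of labeled Feynman graphs (including the empty graph), equipped with the product $$(f\times g)(\Gamma)=\sum_{\gamma\subset\Gamma}f(\gamma)\,g(\Gamma/\gamma)$$ (sum over subgraphs $\gamma$ of $\Gamma$) and the coproduct $\Delta:\mathbf H_{\mathcal{LFG}}\to\mathbf H_{\mathcal{LFG}}\otimes\mathbf H_{\mathcal{LFG}}$, $\Delta(f)(\Gamma_1,\Gamma_2)=f(\Gamma_1\oplus\Gamma_2)$, where $\Gamma_1\oplus\Gamma_2$ is the disjoint union. Then $\mathbf H_{\mathcal{LFG}}$ is a Hopf algebra isomorphic to $U(\mathfrak n_{LFG})$, the universal enveloping algebra of the Connes-Kreimer Lie algebra $\mathfrak n_{LFG}$ on Feynman graphs.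
   Context: Graphs. A graph $\Gamma$ consists of a set $H(\Gamma)$ of half-edges, a set $V(\Gamma)$ of vertices, a set of vertex/half-edge adjacency relations ($\subset V\times H$), and a set of half-edge/half-edge adjacency relations ($\subset H\times H$), such that each half-edge is adjacent to at most one other half-edge and to exactly one vertex. Graphs may be disconnected. Half-edges not adjacent to another half-edge are called external edges and form the set $Ex(\Gamma)$; pairs of adjacent half-edges are called internal edges and form the set $Int(\Gamma)$. For a vertex $v$, $H(v)$ is the set of half-edges incident to $v$. Feynman graphs ($\phi^3$ theory). A Feynman graph is a graph in which each vertex is incident to exactly three half-edges and each connected component has 2 or 3 external edges. A labeled Feynman graph is a Feynman graph $\Gamma$ together with a set $S$ and a bijection $\rho:H(\Gamma)\to S$. The objects of $\mathcal{LFG}$ are the labeled Feynman graphs together with the empty Feynman graph $\emptyset$, which plays the role of zero object; objects may have several connected components. Two labeled Feynman graphs are isomorphic if there are bijections between their vertex sets and between their half-edge sets which induce bijections on all incidences. Subgraphs. A subgraph $\gamma$ of a Feynman graph $\Gamma$, written $\gamma\subset\Gamma$, is a Feynman graph with $V(\gamma)\subset V(\Gamma)$ and $H(\gamma)\subset H(\Gamma)$, containing all half-edges of $\Gamma$ incident to its vertices, and such that $\dim_{\mathbb Q}H_1(\gamma,\mathbb Q)>0$ (that is, $\gamma$ contains at least one loop). The same definition applies to labeled graphs. The empty graph $\emptyset$ is also admitted as a subgraph. Quotients. Let $\gamma\subset\Gamma$ be a connected subgraph. If $\gamma$ has 3 external edges, $\Gamma/\gamma$ is the Feynman graph whose vertex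 set is that of $\Gamma$ with all vertices of $\gamma$ removed and a new trivalent vertex $v$ added, whose half-edge set is that of $\Gamma$ with all half-edges corresponding to internal half-edges of $\gamma$ removed, and whose adjacencies are those inherited from $\Gamma$, with the external half-edges of $\gamma$ joined to $v$. If $\gamma$ has 2 external edges, $\Gamma/\gamma$ is the Feynman graph whose vertex set is $V(\Gamma)$ with all vertices of $\gamma$ removed, whose half-edge set is $H(\Gamma)$ with all half-edges of $\gamma$ removed, and whose adjacencies are all those inherited from $\Gamma$, as well as the adjacency of the external half-edges of $\gamma$. For an arbitrary (not necessarily connected) subgraph $\gamma$, $\Gamma/\gamma$ is obtained by performing successive quotients by each connected component of $\gamma$; the order does not matter. Lie algebra $\mathfrak n_{LFG}$. As a vector space it is the $\mathbb Q$-vector space spanned by unlabeled Feynman graphs, i.e. the span of labeled Feynman graphs modulo $\Gamma\sim\Gamma'$ iff $\overline\Gamma=\overline{\Gamma'}$, where $\overline\Gamma$ denotes the unlabeled Feynman graph corresponding to $\Gamma$. Insertion: if $\Gamma_1$ has three external edges, $v\in V(\Gamma_2)$ and $f:Ex(\Gamma_1)\to H(v)$ is a bijection, then $\Gamma_2\circ_{v,f}\Gamma_1$ is the labeled Feynman graph with vertex set $V(\Gamma_2)\cup V(\Gamma_1)\setminus v$, half-edge set the union $H(\Gamma_1)\cup_f H(\Gamma_2)$ with the identifications induced by $f$, and the adjacencies induced from those of $\Gamma_1$ and $\Gamma_2$. If $\Gamma_1$ has two external edges, $e=\{e_1,e_2\}\in Int(\Gamma_2)$ and $f$ is a bijection between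 $Ex(\Gamma_1)$ and $\{e_1,e_2\}$, then $\Gamma_2\circ_{e,f}\Gamma_1$ is the labeled Feynman graph with vertex set $V(\Gamma_1)\cup V(\Gamma_2)$, half-edge set $H(\Gamma_1)\cup H(\Gamma_2)$, and the adjacency induced by $f$ as well as those induced from $\Gamma_1$ and $\Gamma_2$. The pre-Lie product $\star$ is defined by $$\overline{\Gamma_1}\star\overline{\Gamma_2}=\sum_{v\in V(\Gamma_2),\ f:Ex(\Gamma_1)\to H(v)}\overline{\Gamma_2\circ_{v,f}\Gamma_1}$$ if $\Gamma_1$ has three external edges, and $$\overline{\Gamma_1}\star\overline{\Gamma_2}=\sum_{e\in Int(\Gamma_2),\ f:Ex(\Gamma_1)\to\{e_1,e_2\}}\overline{\Gamma_2\circ_{e,f}\Gamma_1}$$ if $\Gamma_1$ has two external edges (sums over bijections $f$; arbitrary labelings are chosen first), extended linearly. The Lie bracket is $[\overline{\Gamma_1},\overline{\Gamma_2}]=\overline{\Gamma_1}\star\overline{\Gamma_2}-\overline{\Gamma_2}\star\overline{\Gamma_1}$.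
   Formalization: Objects have no bare-vertex component and bare vertices left by quotients are dropped; a 2-leg component of a subgraph has both or none of its legs external in Γ; subgraphs may cut internal edges; each component has a loop; n_LFG is spanned by connected graphs. *)

theory Defs
  imports Complex_Main "HOL-Library.Poly_Mapping" "HOL-Library.FuncSet"
begin

alias lookup = Poly_Mapping.lookup
alias keys = Poly_Mapping.keys
alias single = Poly_Mapping.single

section \<open>Rational vector spaces\<close>

class rat_vector = ab_group_add +
  fixes scaleQ :: "rat \<Rightarrow> 'a \<Rightarrow> 'a"  (infixr \<open>*\<^sub>Q\<close> 75)
  assumes scaleQ_add_right: "a *\<^sub>Q (x + y) = a *\<^sub>Q x + a *\<^sub>Q y"
    and scaleQ_add_left: "(a + b) *\<^sub>Q x = a *\<^sub>Q x + b *\<^sub>Q x"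
    and scaleQ_scaleQ: "a *\<^sub>Q (b *\<^sub>Q x) = (a * b) *\<^sub>Q x"
    and scaleQ_one: "1 *\<^sub>Q x = x"

global_interpretation ratvec: vector_space "scaleQ :: rat \<Rightarrow> 'a \<Rightarrow> 'a::rat_vector"
  by unfold_locales (simp_all add: scaleQ_add_right scaleQ_add_left scaleQ_scaleQ scaleQ_one)

instantiation rat :: rat_vector
begin
definition scaleQ_rat :: "rat \<Rightarrow> rat \<Rightarrow> rat" where "scaleQ_rat = (*)"
instance by standard (simp_all add: scaleQ_rat_def algebra_simps)
end

instantiation poly_mapping :: (type, rat_vector) rat_vector
begin
lift_definition scaleQ_poly_mapping :: "rat \<Rightarrow> ('a \<Rightarrow>\<^sub>0 'b) \<Rightarrow> ('a \<Rightarrow>\<^sub>0 'b)"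
  is "\<lambda>r f k. r *\<^sub>Q f k"
  by (erule finite_subset[rotated]) auto
instance
  by standard (transfer; simp add: fun_eq_iff scaleQ_add_right scaleQ_add_left)+
end

lemma lookup_scaleQ: "lookup (r *\<^sub>Q f) k = r *\<^sub>Q lookup f k"
  by transfer simp

abbreviation qlinear :: "('a::rat_vector \<Rightarrow> 'b::rat_vector) \<Rightarrow> bool"
  where "qlinear \<equiv> Vector_Spaces.linear scaleQ scaleQ"

definition qbilinear :: "('a::rat_vector \<Rightarrow> 'b::rat_vector \<Rightarrow> 'c::rat_vector) \<Rightarrow> bool"
  where "qbilinear B \<longleftrightarrow> (\<forall>a. qlinear (B a)) \<and> (\<forall>b. qlinear (\<lambda>a. B a b))"

lemma qlinearI:
  assumes "\<And>x y. f (x + y) = f x + f y" "\<And>r x. f (r *\<^sub>Q x) = r *\<^sub>Q f x"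
  shows "qlinear f"
  by unfold_locales (use assms in auto)

lemma qlinear_add: "qlinear f \<Longrightarrow> f (x + y) = f x + f y"
  and qlinear_scale: "qlinear f \<Longrightarrow> f (r *\<^sub>Q x) = r *\<^sub>Q f x"
  and qlinear_diff: "qlinear f \<Longrightarrow> f (x - y) = f x - f y"
  and qlinear_zero: "qlinear f \<Longrightarrow> f 0 = 0"
  by (simp_all add: linear_iff_module_hom module_hom.add module_hom.scale module_hom.diff
      module_hom.zero)

lemma qlinear_vanish_span:
  assumes "qlinear f" "p \<in> ratvec.span S" "\<And>x. x \<in> S \<Longrightarrow> f x = 0"
  shows "f p = 0"
  using assms(2)
  by (induction rule: ratvec.span_induct_alt)
     (simp_all add: qlinear_zero[OF assms(1)] qlinear_add[OF assms(1)] qlinear_scale[OF assms(1)] assms(3))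

text \<open>The linear extension of a map defined on the basis \<open>'k\<close> of \<open>'k \<Rightarrow>\<^sub>0 rat\<close>.\<close>

definition lin_ext :: "('k \<Rightarrow> 'v::rat_vector) \<Rightarrow> ('k \<Rightarrow>\<^sub>0 rat) \<Rightarrow> 'v"
  where "lin_ext F p = (\<Sum>k\<in>keys p. lookup p k *\<^sub>Q F k)"

lemma lin_ext_superset:
  "finite K \<Longrightarrow> keys p \<subseteq> K \<Longrightarrow> lin_ext F p = (\<Sum>k\<in>K. lookup p k *\<^sub>Q F k)"
  unfolding lin_ext_def by (rule sum.mono_neutral_left) (auto simp: in_keys_iff)

lemma qlinear_lin_ext: "qlinear (lin_ext F)"
proof (rule qlinearI)
  fix p q :: "'a \<Rightarrow>\<^sub>0 rat"
  let ?K = "keys p \<union> keys q"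
  have "lin_ext F (p + q) = (\<Sum>k\<in>?K. lookup (p + q) k *\<^sub>Q F k)"
    by (rule lin_ext_superset) (auto simp: in_keys_iff lookup_add)
  also have "\<dots> = (\<Sum>k\<in>?K. lookup p k *\<^sub>Q F k) + (\<Sum>k\<in>?K. lookup q k *\<^sub>Q F k)"
    by (simp add: lookup_add scaleQ_add_left sum.distrib)
  also have "\<dots> = lin_ext F p + lin_ext F q"
    by (simp add: lin_ext_superset[of ?K])
  finally show "lin_ext F (p + q) = lin_ext F p + lin_ext F q" .
next
  fix r :: rat and p :: "'a \<Rightarrow>\<^sub>0 rat"
  have "lin_ext F (r *\<^sub>Q p) = (\<Sum>k\<in>keys p. lookup (r *\<^sub>Q p) k *\<^sub>Q F k)"
    by (rule lin_ext_superset) (auto simp: in_keys_iff lookup_scaleQ scaleQ_rat_def)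
  then show "lin_ext F (r *\<^sub>Q p) = r *\<^sub>Q lin_ext F p"
    by (simp add: lin_ext_def lookup_scaleQ scaleQ_rat_def ratvec.scale_sum_right scaleQ_scaleQ)
qed

lemma lin_ext_single [simp]: "lin_ext F (single k c) = c *\<^sub>Q F k"
  by (subst lin_ext_superset[of "{k}"]) auto


section \<open>Tensor products\<close>

text \<open>\<open>V \<otimes> W\<close> is the free vector space on the set \<open>V \<times> W\<close> modulo the bilinearity relations.\<close>

inductive_set tensor_relations :: "('a::rat_vector \<times> 'b::rat_vector \<Rightarrow>\<^sub>0 rat) set" where
  "single (a + a', b) 1 - single (a, b) 1 - single (a', b) 1
     \<in> tensor_relations"
| "single (a, b + b') 1 - single (a, b) 1 - single (a, b') 1
     \<in> tensor_relations"
| "single (r *\<^sub>Q a, b) 1 - single (a, b) r \<in> tensor_relations"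
| "single (a, r *\<^sub>Q b) 1 - single (a, b) r \<in> tensor_relations"

definition tensor_rel ::
  "('a::rat_vector \<times> 'b::rat_vector \<Rightarrow>\<^sub>0 rat) \<Rightarrow> ('a \<times> 'b \<Rightarrow>\<^sub>0 rat) \<Rightarrow> bool"
  where "tensor_rel p q \<longleftrightarrow> p - q \<in> ratvec.span tensor_relations"

lemma equivp_span_diff:
  fixes S :: "'a::rat_vector set"
  shows "equivp (\<lambda>p q. p - q \<in> ratvec.span S)"
proof (rule equivpI)
  show "reflp (\<lambda>p q. p - q \<in> ratvec.span S)"
    by (rule reflpI) (simp add: ratvec.span_zero)
  show "symp (\<lambda>p q. p - q \<in> ratvec.span S)"
    by (rule sympI) (metis minus_diff_eq ratvec.span_neg)
  show "transp (\<lambda>p q. p - q \<in> ratvec.span S)"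
  proof (rule transpI)
    fix x y z assume "x - y \<in> ratvec.span S" "y - z \<in> ratvec.span S"
    from ratvec.span_add[OF this] show "x - z \<in> ratvec.span S" by simp
  qed
qed

lemma span_diff_add:
  "p - q \<in> ratvec.span S \<Longrightarrow> p' - q' \<in> ratvec.span S \<Longrightarrow> (p + p') - (q + q') \<in> ratvec.span S"
  by (metis add_diff_add ratvec.span_add)

lemma span_diff_diff:
  assumes "p - q \<in> ratvec.span S" "p' - q' \<in> ratvec.span S"
  shows "(p - p') - (q - q') \<in> ratvec.span S"
proof -
  have "(p - p') - (q - q') = (p - q) - (p' - q')" by simp
  then show ?thesis using assms by (metis ratvec.span_diff)
qed

lemma span_diff_uminus: "p - q \<in> ratvec.span S \<Longrightarrow> - p - (- q) \<in> ratvec.span S"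
  by (metis minus_diff_minus ratvec.span_neg)

lemma span_diff_scale:
  "p - q \<in> ratvec.span S \<Longrightarrow> r *\<^sub>Q p - r *\<^sub>Q q \<in> ratvec.span S"
  by (metis ratvec.scale_right_diff_distrib ratvec.span_scale)

quotient_type (overloaded) ('a, 'b) tensor  (infixr \<open>\<otimes>\<^sub>Q\<close> 26) =
  "'a::rat_vector \<times> 'b::rat_vector \<Rightarrow>\<^sub>0 rat" / tensor_rel
  unfolding tensor_rel_def[abs_def] by (rule equivp_span_diff)

instantiation tensor :: (rat_vector, rat_vector) rat_vector
begin
lift_definition zero_tensor :: "'a \<otimes>\<^sub>Q 'b" is 0 .
lift_definition plus_tensor :: "'a \<otimes>\<^sub>Q 'b \<Rightarrow> 'a \<otimes>\<^sub>Q 'b \<Rightarrow> 'a \<otimes>\<^sub>Q 'b" is "(+)"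
  unfolding tensor_rel_def by (rule span_diff_add)
lift_definition minus_tensor :: "'a \<otimes>\<^sub>Q 'b \<Rightarrow> 'a \<otimes>\<^sub>Q 'b \<Rightarrow> 'a \<otimes>\<^sub>Q 'b" is "(-)"
  unfolding tensor_rel_def by (rule span_diff_diff)
lift_definition uminus_tensor :: "'a \<otimes>\<^sub>Q 'b \<Rightarrow> 'a \<otimes>\<^sub>Q 'b" is uminus
  unfolding tensor_rel_def by (rule span_diff_uminus)
lift_definition scaleQ_tensor :: "rat \<Rightarrow> 'a \<otimes>\<^sub>Q 'b \<Rightarrow> 'a \<otimes>\<^sub>Q 'b" is "(*\<^sub>Q)"
  unfolding tensor_rel_def by (rule span_diff_scale)
instance
  by (standard; transfer; simp add: tensor_rel_def ratvec.span_zero scaleQ_add_right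
      scaleQ_add_left scaleQ_scaleQ scaleQ_one algebra_simps)
end

lift_definition tens :: "'a::rat_vector \<Rightarrow> 'b::rat_vector \<Rightarrow> 'a \<otimes>\<^sub>Q 'b"  (infixr \<open>\<otimes>\<close> 76)
  is "\<lambda>a b. single (a, b) 1" .

text \<open>The linear map on \<open>V \<otimes> W\<close> induced by a bilinear map (\<open>tensor_lift_tens\<close> below). The
  definition picks a representative in the free vector space on \<open>V \<times> W\<close>; for bilinear \<open>B\<close> the
  value does not depend on it.\<close>

definition tensor_lift ::
  "('a::rat_vector \<Rightarrow> 'b::rat_vector \<Rightarrow> 'c::rat_vector) \<Rightarrow> 'a \<otimes>\<^sub>Q 'b \<Rightarrow> 'c"
  where "tensor_lift B t = lin_ext (\<lambda>(a, b). B a b) (rep_tensor t)"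

lemma tensor_lift_abs:
  assumes "qbilinear B"
  shows "tensor_lift B (abs_tensor p) = lin_ext (\<lambda>(a, b). B a b) p"
proof -
  let ?F = "lin_ext (\<lambda>(a, b). B a b)"
  have l: "qlinear ?F" by (rule qlinear_lin_ext)
  have B: "B (x + y) b = B x b + B y b" "B a (z + w) = B a z + B a w"
     "B (r *\<^sub>Q x) b = r *\<^sub>Q B x b" "B a (r *\<^sub>Q z) = r *\<^sub>Q B a z" for x y z w a b r
    using assms qlinear_add[of "\<lambda>a. B a b"] qlinear_scale[of "\<lambda>a. B a b"]
      qlinear_add[of "B a"] qlinear_scale[of "B a"]
    by (simp_all add: qbilinear_def)
  have "tensor_rel (rep_tensor (abs_tensor p)) p"
    by (rule Quotient3_rep_abs[OF Quotient3_tensor])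
       (simp add: tensor_rel_def ratvec.span_zero)
  then have "?F (rep_tensor (abs_tensor p) - p) = 0"
    unfolding tensor_rel_def
    by (rule qlinear_vanish_span[OF l])
       (erule tensor_relations.cases; simp add: qlinear_diff[OF l] B scaleQ_one)
  then show ?thesis by (simp add: tensor_lift_def qlinear_diff[OF l])
qed

lemma tensor_lift_tens: "qbilinear B \<Longrightarrow> tensor_lift B (a \<otimes> b) = B a b"
  by (simp add: tens.abs_eq tensor_lift_abs scaleQ_one)

lemma qlinear_tensor_lift:
  assumes "qbilinear B"
  shows "qlinear (tensor_lift B)"
proof (rule qlinearI)
  fix x y :: "'a \<otimes>\<^sub>Q 'b" and r :: rat
  obtain p q where pq: "x = abs_tensor p" "y = abs_tensor q"
    by (metis Quotient3_abs_rep[OF Quotient3_tensor])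
  show "tensor_lift B (x + y) = tensor_lift B x + tensor_lift B y"
    by (simp add: pq plus_tensor.abs_eq tensor_lift_abs[OF assms] qlinear_add[OF qlinear_lin_ext])
  show "tensor_lift B (r *\<^sub>Q x) = r *\<^sub>Q tensor_lift B x"
    by (simp add: pq scaleQ_tensor.abs_eq tensor_lift_abs[OF assms]
        qlinear_scale[OF qlinear_lin_ext])
qed

definition tensor_map ::
  "('a::rat_vector \<Rightarrow> 'c::rat_vector) \<Rightarrow> ('b::rat_vector \<Rightarrow> 'd::rat_vector) \<Rightarrow> 'a \<otimes>\<^sub>Q 'b \<Rightarrow> 'c \<otimes>\<^sub>Q 'd"
  where "tensor_map f g = tensor_lift (\<lambda>a b. f a \<otimes> g b)"

definition tensor_assoc ::
  "('a::rat_vector \<otimes>\<^sub>Q 'b::rat_vector) \<otimes>\<^sub>Q 'c::rat_vector \<Rightarrow> 'a \<otimes>\<^sub>Q ('b \<otimes>\<^sub>Q 'c)"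
  where "tensor_assoc = tensor_lift (\<lambda>s c. tensor_lift (\<lambda>a b. a \<otimes> (b \<otimes> c)) s)"

text \<open>\<open>(a \<otimes> b) \<cdot> (c \<otimes> d) = ac \<otimes> bd\<close>\<close>

definition tensor_mult ::
  "('a::rat_vector \<Rightarrow> 'a \<Rightarrow> 'a) \<Rightarrow> 'a \<otimes>\<^sub>Q 'a \<Rightarrow> 'a \<otimes>\<^sub>Q 'a \<Rightarrow> 'a \<otimes>\<^sub>Q 'a"
  where "tensor_mult m s t =
    tensor_lift (\<lambda>a b. tensor_lift (\<lambda>c d. m a c \<otimes> m b d) t) s"


section \<open>Hopf algebras\<close>

definition unital_algebra :: "('a::rat_vector \<Rightarrow> 'a \<Rightarrow> 'a) \<Rightarrow> 'a \<Rightarrow> bool"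
  where "unital_algebra m e \<longleftrightarrow> qbilinear m \<and>
    (\<forall>x y z. m (m x y) z = m x (m y z)) \<and> (\<forall>x. m e x = x \<and> m x e = x)"

definition counital_coalgebra :: "('a::rat_vector \<Rightarrow> 'a \<otimes>\<^sub>Q 'a) \<Rightarrow> ('a \<Rightarrow> rat) \<Rightarrow> bool"
  where "counital_coalgebra D c \<longleftrightarrow> qlinear D \<and> qlinear c \<and>
    (\<forall>x. tensor_assoc (tensor_map D id (D x)) = tensor_map id D (D x)) \<and>
    (\<forall>x. tensor_lift (\<lambda>a b. c a *\<^sub>Q b) (D x) = x \<and> tensor_lift (\<lambda>a b. c b *\<^sub>Q a) (D x) = x)"

definition bialgebra ::
  "('a::rat_vector \<Rightarrow> 'a \<Rightarrow> 'a) \<Rightarrow> 'a \<Rightarrow> ('a \<Rightarrow> 'a \<otimes>\<^sub>Q 'a) \<Rightarrow> ('a \<Rightarrow> rat) \<Rightarrow> bool"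
  where "bialgebra m e D c \<longleftrightarrow> unital_algebra m e \<and> counital_coalgebra D c \<and>
    (\<forall>x y. D (m x y) = tensor_mult m (D x) (D y)) \<and> D e = e \<otimes> e \<and>
    (\<forall>x y. c (m x y) = c x * c y) \<and> c e = 1"

definition antipode ::
  "('a::rat_vector \<Rightarrow> 'a \<Rightarrow> 'a) \<Rightarrow> 'a \<Rightarrow> ('a \<Rightarrow> 'a \<otimes>\<^sub>Q 'a) \<Rightarrow> ('a \<Rightarrow> rat) \<Rightarrow> ('a \<Rightarrow> 'a) \<Rightarrow> bool"
  where "antipode m e D c S \<longleftrightarrow> qlinear S \<and>
    (\<forall>x. tensor_lift (\<lambda>a b. m (S a) b) (D x) = c x *\<^sub>Q e \<and>
         tensor_lift (\<lambda>a b. m a (S b)) (D x) = c x *\<^sub>Q e)"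

definition hopf_algebra ::
  "('a::rat_vector \<Rightarrow> 'a \<Rightarrow> 'a) \<Rightarrow> 'a \<Rightarrow> ('a \<Rightarrow> 'a \<otimes>\<^sub>Q 'a) \<Rightarrow> ('a \<Rightarrow> rat) \<Rightarrow> bool"
  where "hopf_algebra m e D c \<longleftrightarrow> bialgebra m e D c \<and> (\<exists>S. antipode m e D c S)"

text \<open>Compatibility with the antipodes is automatic for bialgebra maps.\<close>

definition hopf_iso ::
  "('a::rat_vector \<Rightarrow> 'a \<Rightarrow> 'a) \<Rightarrow> 'a \<Rightarrow> ('a \<Rightarrow> 'a \<otimes>\<^sub>Q 'a) \<Rightarrow> ('a \<Rightarrow> rat) \<Rightarrow>
   ('b::rat_vector \<Rightarrow> 'b \<Rightarrow> 'b) \<Rightarrow> 'b \<Rightarrow> ('b \<Rightarrow> 'b \<otimes>\<^sub>Q 'b) \<Rightarrow> ('b \<Rightarrow> rat) \<Rightarrow> ('a \<Rightarrow> 'b) \<Rightarrow> bool"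
  where "hopf_iso m e D c m' e' D' c' \<phi> \<longleftrightarrow> qlinear \<phi> \<and> bij \<phi> \<and>
    (\<forall>x y. \<phi> (m x y) = m' (\<phi> x) (\<phi> y)) \<and> \<phi> e = e' \<and>
    (\<forall>x. D' (\<phi> x) = tensor_map \<phi> \<phi> (D x)) \<and> (\<forall>x. c' (\<phi> x) = c x)"


section \<open>Lie algebras and their universal enveloping algebras\<close>

definition lie_algebra :: "('g::rat_vector \<Rightarrow> 'g \<Rightarrow> 'g) \<Rightarrow> bool"
  where "lie_algebra br \<longleftrightarrow> qbilinear br \<and> (\<forall>x. br x x = 0) \<and>
    (\<forall>x y z. br x (br y z) + br y (br z x) + br z (br x y) = 0)"

text \<open>The class only fixes a bracket operation, so that the type of the enveloping algebra can
  depend on it; that it is a Lie bracket is expressed by \<open>lie_algebra lie_bracket\<close>.\<close>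

class lie_bracket = rat_vector +
  fixes lie_bracket :: "'a \<Rightarrow> 'a \<Rightarrow> 'a"

text \<open>\<open>'g list \<Rightarrow>\<^sub>0 rat\<close> is the free associative algebra on the set \<open>'g\<close>. \<open>U(g)\<close> is its quotient by
  the two-sided ideal generated by the relations below: the first two families cut the free
  algebra down to the tensor algebra \<open>T(g)\<close>, the last one is \<open>x \<otimes> y - y \<otimes> x - [x, y]\<close>.\<close>

definition free_mult :: "('g list \<Rightarrow>\<^sub>0 rat) \<Rightarrow> ('g list \<Rightarrow>\<^sub>0 rat) \<Rightarrow> ('g list \<Rightarrow>\<^sub>0 rat)"
  where "free_mult p q = lin_ext (\<lambda>u. lin_ext (\<lambda>w. single (u @ w) 1) q) p"

inductive_set uea_relations :: "('g::lie_bracket list \<Rightarrow>\<^sub>0 rat) set" where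
  "single [x + y] 1 - single [x] 1 - single [y] 1
     \<in> uea_relations"
| "single [r *\<^sub>Q x] 1 - single [x] r \<in> uea_relations"
| "single [x, y] 1 - single [y, x] 1
     - single [lie_bracket x y] 1 \<in> uea_relations"

definition uea_ideal :: "('g::lie_bracket list \<Rightarrow>\<^sub>0 rat) set"
  where "uea_ideal = ratvec.span {free_mult p (free_mult r q) | p r q. r \<in> uea_relations}"

definition uea_rel :: "('g::lie_bracket list \<Rightarrow>\<^sub>0 rat) \<Rightarrow> ('g list \<Rightarrow>\<^sub>0 rat) \<Rightarrow> bool"
  where "uea_rel p q \<longleftrightarrow> p - q \<in> uea_ideal"

quotient_type (overloaded) 'g uea = "'g::lie_bracket list \<Rightarrow>\<^sub>0 rat" / uea_rel
  unfolding uea_rel_def[abs_def] uea_ideal_def by (rule equivp_span_diff)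

instantiation uea :: (lie_bracket) rat_vector
begin
lift_definition zero_uea :: "'a uea" is 0 .
lift_definition plus_uea :: "'a uea \<Rightarrow> 'a uea \<Rightarrow> 'a uea" is "(+)"
  unfolding uea_rel_def uea_ideal_def by (rule span_diff_add)
lift_definition minus_uea :: "'a uea \<Rightarrow> 'a uea \<Rightarrow> 'a uea" is "(-)"
  unfolding uea_rel_def uea_ideal_def by (rule span_diff_diff)
lift_definition uminus_uea :: "'a uea \<Rightarrow> 'a uea" is uminus
  unfolding uea_rel_def uea_ideal_def by (rule span_diff_uminus)
lift_definition scaleQ_uea :: "rat \<Rightarrow> 'a uea \<Rightarrow> 'a uea" is "(*\<^sub>Q)"
  unfolding uea_rel_def uea_ideal_def by (rule span_diff_scale)
instance
  by (standard; transfer; simp add: uea_rel_def uea_ideal_def ratvec.span_zero scaleQ_add_right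
      scaleQ_add_left scaleQ_scaleQ scaleQ_one algebra_simps)
end

lemma free_mult_add_left: "free_mult (p + p') q = free_mult p q + free_mult p' q"
  and free_mult_scale_left: "free_mult (r *\<^sub>Q p) q = r *\<^sub>Q free_mult p q"
  and free_mult_diff_left: "free_mult (p - p') q = free_mult p q - free_mult p' q"
  by (simp_all add: free_mult_def qlinear_add[OF qlinear_lin_ext] qlinear_scale[OF qlinear_lin_ext]
      qlinear_diff[OF qlinear_lin_ext])

lemma free_mult_swap: "free_mult p q = lin_ext (\<lambda>w. lin_ext (\<lambda>u. single (u @ w) 1) p) q"
  unfolding free_mult_def lin_ext_def
  by (simp add: ratvec.scale_sum_right scaleQ_scaleQ mult.commute sum.swap[of _ "keys q"])

lemma free_mult_add_right: "free_mult p (q + q') = free_mult p q + free_mult p q'"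
  and free_mult_scale_right: "free_mult p (r *\<^sub>Q q) = r *\<^sub>Q free_mult p q"
  and free_mult_diff_right: "free_mult p (q - q') = free_mult p q - free_mult p q'"
  by (simp_all add: free_mult_swap qlinear_add[OF qlinear_lin_ext] qlinear_scale[OF qlinear_lin_ext]
      qlinear_diff[OF qlinear_lin_ext])

lemma poly_mapping_expand: "p = (\<Sum>k\<in>keys p. lookup p k *\<^sub>Q single k (1::rat))"
  by (rule poly_mapping_eqI)
     (simp add: lookup_sum lookup_scaleQ scaleQ_rat_def lookup_single when_def if_distrib
       sum.delta in_keys_iff cong: if_cong)

lemma qlinear_sum: "qlinear f \<Longrightarrow> f (\<Sum>i\<in>I. g i) = (\<Sum>i\<in>I. f (g i))"
  by (induction I rule: infinite_finite_induct) (simp_all add: qlinear_zero qlinear_add)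

lemma qlinear_eq_on_basis:
  assumes "qlinear f" "qlinear g" "\<And>k. f (single k 1) = g (single k (1::rat))"
  shows "f p = g p"
  by (subst (1 2) poly_mapping_expand)
     (simp only: qlinear_sum[OF assms(1)] qlinear_sum[OF assms(2)] qlinear_scale[OF assms(1)]
       qlinear_scale[OF assms(2)] assms(3))

lemma free_mult_single: "free_mult (single u 1) (single w 1) = single (u @ w) 1"
  by (simp add: free_mult_def scaleQ_one)

lemma free_mult_assoc: "free_mult (free_mult p q) r = free_mult p (free_mult q r)"
proof -
  note fm = free_mult_add_left free_mult_add_right free_mult_scale_left free_mult_scale_right
  have "free_mult (free_mult (single u 1) (single v 1)) r
      = free_mult (single u 1) (free_mult (single v 1) r)" for u v r
    by (rule qlinear_eq_on_basis) (auto intro!: qlinearI simp: fm free_mult_single)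
  then have "free_mult (free_mult (single u 1) q) r
      = free_mult (single u 1) (free_mult q r)" for u q r
    by (intro qlinear_eq_on_basis[of "\<lambda>q. free_mult (free_mult _ q) r" _ q])
       (auto intro!: qlinearI simp: fm)
  then show ?thesis
    by (intro qlinear_eq_on_basis[of "\<lambda>p. free_mult (free_mult p q) r" _ p])
       (auto intro!: qlinearI simp: fm)
qed

lemma uea_ideal_mult:
  assumes "p \<in> uea_ideal"
  shows "free_mult p q \<in> uea_ideal" "free_mult q p \<in> uea_ideal"
proof -
  let ?G = "{free_mult p (free_mult r q) | p r q. r \<in> uea_relations}"
  have "free_mult p q \<in> ratvec.span ?G \<and> free_mult q p \<in> ratvec.span ?G"
    using assms unfolding uea_ideal_def
  proof (induction rule: ratvec.span_induct_alt)
    case base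
    have "free_mult 0 q = 0" "free_mult q 0 = 0"
      using free_mult_scale_left[of 0 0 q] free_mult_scale_right[of q 0 0] by simp_all
    then show ?case by (simp add: ratvec.span_zero)
  next
    case (step c x y)
    then obtain a r b where x: "x = free_mult a (free_mult r b)" "r \<in> uea_relations" by auto
    have "free_mult x q \<in> ?G" "free_mult q x \<in> ?G"
      using x(2) by (auto simp: x(1) free_mult_assoc) (metis free_mult_assoc)
    with step show ?case
      by (auto simp: free_mult_add_left free_mult_add_right free_mult_scale_left
          free_mult_scale_right intro!: ratvec.span_add ratvec.span_scale intro: ratvec.span_base)
  qed
  then show "free_mult p q \<in> uea_ideal" "free_mult q p \<in> uea_ideal"
    by (simp_all add: uea_ideal_def)
qed

lift_definition uea_mult :: "'g::lie_bracket uea \<Rightarrow> 'g uea \<Rightarrow> 'g uea" is free_mult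
proof -
  fix p p' q q' :: "'g list \<Rightarrow>\<^sub>0 rat"
  assume "uea_rel p p'" "uea_rel q q'"
  then have "free_mult (p - p') q \<in> uea_ideal" "free_mult p' (q - q') \<in> uea_ideal"
    unfolding uea_rel_def by (auto intro: uea_ideal_mult)
  then have "free_mult (p - p') q + free_mult p' (q - q') \<in> uea_ideal"
    unfolding uea_ideal_def by (rule ratvec.span_add)
  then show "uea_rel (free_mult p q) (free_mult p' q')"
    by (simp add: uea_rel_def free_mult_diff_left free_mult_diff_right)
qed

lift_definition uea_one :: "'g::lie_bracket uea" is "single [] 1" .

lift_definition uea_incl :: "'g::lie_bracket \<Rightarrow> 'g uea" is "\<lambda>x. single [x] 1" .

text \<open>The algebra map \<open>U(g) \<rightarrow> A\<close> extending a Lie map \<open>\<phi> : g \<rightarrow> A\<close> into a unital algebra with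
  product \<open>m\<close> and unit \<open>e\<close> (the universal property \<open>uea_lift\<close> below). As for \<open>tensor_lift\<close>, the
  value does not depend on the representative chosen in the free algebra.\<close>

definition uea_lift ::
  "('a::rat_vector \<Rightarrow> 'a \<Rightarrow> 'a) \<Rightarrow> 'a \<Rightarrow> ('g::lie_bracket \<Rightarrow> 'a) \<Rightarrow> 'g uea \<Rightarrow> 'a"
  where "uea_lift m e \<phi> u = lin_ext (\<lambda>w. foldr (\<lambda>x a. m (\<phi> x) a) w e) (rep_uea u)"

context
  fixes m :: "'a::rat_vector \<Rightarrow> 'a \<Rightarrow> 'a" and e :: 'a and \<phi> :: "'g::lie_bracket \<Rightarrow> 'a"
  assumes alg: "unital_algebra m e" and lin: "qlinear \<phi>"
    and lie: "\<And>x y. \<phi> (lie_bracket x y) = m (\<phi> x) (\<phi> y) - m (\<phi> y) (\<phi> x)"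
begin

lemma uea_lift_mult_simps:
  "m (x + y) b = m x b + m y b" "m a (z + w) = m a z + m a w"
  "m (r *\<^sub>Q x) b = r *\<^sub>Q m x b" "m a (r *\<^sub>Q z) = r *\<^sub>Q m a z"
  "m (x - y) b = m x b - m y b" "m a (z - w) = m a z - m a w"
  using alg qlinear_add[of "\<lambda>a. m a b"] qlinear_scale[of "\<lambda>a. m a b"] qlinear_diff[of "\<lambda>a. m a b"]
    qlinear_add[of "m a"] qlinear_scale[of "m a"] qlinear_diff[of "m a"]
  by (simp_all add: unital_algebra_def qbilinear_def)

lemma uea_lift_free_mult:
  fixes p q :: "'g list \<Rightarrow>\<^sub>0 rat"
  defines "F \<equiv> lin_ext (\<lambda>w. foldr (\<lambda>x a. m (\<phi> x) a) w e)"
  shows "F (free_mult p q) = m (F p) (F q)"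
proof -
  have l: "qlinear F" unfolding F_def by (rule qlinear_lin_ext)
  note simps = free_mult_add_left free_mult_add_right free_mult_scale_left free_mult_scale_right
    qlinear_add[OF l] qlinear_scale[OF l] uea_lift_mult_simps
  have assoc: "m (m x y) z = m x (m y z)" "m e x = x" for x y z
    using alg by (auto simp: unital_algebra_def)
  have fold: "foldr (\<lambda>x a. m (\<phi> x) a) (u @ w) e
      = m (foldr (\<lambda>x a. m (\<phi> x) a) u e) (foldr (\<lambda>x a. m (\<phi> x) a) w e)" for u w
    by (induction u) (simp_all add: assoc)
  have basis: "F (free_mult (single u 1) (single w 1)) = m (F (single u 1)) (F (single w 1))" for u w
    by (simp only: free_mult_single F_def lin_ext_single scaleQ_one fold)
  have left: "F (free_mult (single u 1) q) = m (F (single u 1)) (F q)" for u q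
    by (rule qlinear_eq_on_basis[of "\<lambda>q. F (free_mult (single u 1) q)" "\<lambda>q. m (F (single u 1)) (F q)"];
        (rule qlinearI | rule basis); simp only: simps)
  show ?thesis
    by (rule qlinear_eq_on_basis[of "\<lambda>p. F (free_mult p q)" "\<lambda>p. m (F p) (F q)"];
        (rule qlinearI | rule left); simp only: simps)
qed

lemma uea_lift_abs:
  "uea_lift m e \<phi> (abs_uea p) = lin_ext (\<lambda>w. foldr (\<lambda>x a. m (\<phi> x) a) w e) p"
proof -
  let ?F = "lin_ext (\<lambda>w. foldr (\<lambda>x a. m (\<phi> x) a) w e)"
  have l: "qlinear ?F" by (rule qlinear_lin_ext)
  have e: "m x e = x" for x using alg by (auto simp: unital_algebra_def)
  have F0: "?F r = 0" if "r \<in> uea_relations" for r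
    using that by cases (simp_all add: qlinear_diff[OF l] scaleQ_one e lie
        qlinear_add[OF lin] qlinear_scale[OF lin])
  have m0: "m 0 x = 0" "m x 0 = 0" for x
    using uea_lift_mult_simps(3)[of 0 0 x] uea_lift_mult_simps(4)[of x 0 0] by simp_all
  have "uea_rel (rep_uea (abs_uea p)) p"
    by (rule Quotient3_rep_abs[OF Quotient3_uea])
       (simp add: uea_rel_def uea_ideal_def ratvec.span_zero)
  then have "?F (rep_uea (abs_uea p) - p) = 0"
    unfolding uea_rel_def uea_ideal_def
    by (rule qlinear_vanish_span[OF l]) (auto simp: uea_lift_free_mult F0 m0)
  then show ?thesis by (simp add: uea_lift_def qlinear_diff[OF l])
qed

lemma uea_lift:
  "qlinear (uea_lift m e \<phi>)"
  "uea_lift m e \<phi> (uea_mult u v) = m (uea_lift m e \<phi> u) (uea_lift m e \<phi> v)"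
  "uea_lift m e \<phi> uea_one = e"
  "uea_lift m e \<phi> (uea_incl x) = \<phi> x"
proof -
  have ex: "\<exists>p. u = abs_uea p" for u :: "'g uea"
    by (metis Quotient3_abs_rep[OF Quotient3_uea])
  show "qlinear (uea_lift m e \<phi>)"
  proof (rule qlinearI)
    fix u v :: "'g uea" and r
    obtain p q where pq: "u = abs_uea p" "v = abs_uea q" using ex by metis
    show "uea_lift m e \<phi> (u + v) = uea_lift m e \<phi> u + uea_lift m e \<phi> v"
      by (simp add: pq plus_uea.abs_eq uea_lift_abs qlinear_add[OF qlinear_lin_ext])
    show "uea_lift m e \<phi> (r *\<^sub>Q u) = r *\<^sub>Q uea_lift m e \<phi> u"
      by (simp add: pq scaleQ_uea.abs_eq uea_lift_abs qlinear_scale[OF qlinear_lin_ext])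
  qed
  obtain p q where pq: "u = abs_uea p" "v = abs_uea q" using ex by metis
  show "uea_lift m e \<phi> (uea_mult u v) = m (uea_lift m e \<phi> u) (uea_lift m e \<phi> v)"
    by (simp add: pq uea_mult.abs_eq uea_lift_abs uea_lift_free_mult)
  show "uea_lift m e \<phi> uea_one = e"
    by (simp add: uea_one.abs_eq uea_lift_abs scaleQ_one)
  show "uea_lift m e \<phi> (uea_incl x) = \<phi> x"
    using alg by (simp add: uea_incl.abs_eq uea_lift_abs scaleQ_one unital_algebra_def)
qed

end

text \<open>The standard Hopf structure on \<open>U(g)\<close>: the elements of \<open>g\<close> are primitive.\<close>

definition uea_comult :: "'g::lie_bracket uea \<Rightarrow> 'g uea \<otimes>\<^sub>Q 'g uea"
  where "uea_comult = uea_lift (tensor_mult uea_mult) (uea_one \<otimes> uea_one)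
    (\<lambda>x. uea_incl x \<otimes> uea_one + uea_one \<otimes> uea_incl x)"

definition uea_counit :: "'g::lie_bracket uea \<Rightarrow> rat"
  where "uea_counit = uea_lift (*) 1 (\<lambda>_. 0)"


section \<open>Graphs\<close>

text \<open>Finite graphs occur only up to isomorphism, so vertices and half-edges are taken from \<open>nat\<close>.\<close>

record graph =
  verts :: "nat set"
  halves :: "nat set"
  inc :: "(nat \<times> nat) set"  \<comment> \<open>pairs (vertex, half-edge)\<close>
  adj :: "(nat \<times> nat) set"  \<comment> \<open>pairs of half-edges\<close>

definition finite_graph :: "graph \<Rightarrow> bool"
  where "finite_graph G \<longleftrightarrow> finite (verts G) \<and> finite (halves G) \<and>
    inc G \<subseteq> verts G \<times> halves G \<and> adj G \<subseteq> halves G \<times> halves G \<and>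
    sym (adj G) \<and> irrefl (adj G) \<and>
    (\<forall>h\<in>halves G. \<exists>!v. (v, h) \<in> inc G) \<and>
    (\<forall>h k k'. (h, k) \<in> adj G \<longrightarrow> (h, k') \<in> adj G \<longrightarrow> k = k')"

definition half_edges_at :: "graph \<Rightarrow> nat \<Rightarrow> nat set"
  where "half_edges_at G v = {h. (v, h) \<in> inc G}"

definition external_edges :: "graph \<Rightarrow> nat set"
  where "external_edges G = {h \<in> halves G. \<forall>k. (h, k) \<notin> adj G}"

definition internal_edges :: "graph \<Rightarrow> nat set set"
  where "internal_edges G = {{h, k} | h k. (h, k) \<in> adj G}"

definition empty_graph :: graph
  where "empty_graph = \<lparr>verts = {}, halves = {}, inc = {}, adj = {}\<rparr>"

definition linked :: "graph \<Rightarrow> (nat \<times> nat) set"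
  where "linked G = {(v, w). \<exists>h k. (v, h) \<in> inc G \<and> (h, k) \<in> adj G \<and> (w, k) \<in> inc G}"

definition component :: "graph \<Rightarrow> nat \<Rightarrow> graph"
  where "component G v =
    (let W = {w. (v, w) \<in> (linked G)\<^sup>*}; H = {h. \<exists>w\<in>W. (w, h) \<in> inc G} in
     \<lparr>verts = W, halves = H, inc = inc G \<inter> W \<times> H, adj = adj G \<inter> H \<times> H\<rparr>)"

definition components :: "graph \<Rightarrow> graph set"
  where "components G = component G ` verts G"

definition connected_graph :: "graph \<Rightarrow> bool"
  where "connected_graph G \<longleftrightarrow> verts G \<noteq> {} \<and> (\<forall>v\<in>verts G. \<forall>w\<in>verts G. (v, w) \<in> (linked G)\<^sup>*)"

text \<open>\<open>H\<^sub>1(G, \<rat>)\<close> is the kernel of the boundary map. A 1-chain is a function on the half-edges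
  belonging to internal edges that changes sign under reversal of the edge.\<close>

definition H1 :: "graph \<Rightarrow> (nat \<Rightarrow>\<^sub>0 rat) set"
  where "H1 G = {c. keys c \<subseteq> Domain (adj G) \<and>
    (\<forall>(h, k)\<in>adj G. lookup c k = - lookup c h) \<and>
    (\<forall>v\<in>verts G. (\<Sum>h\<in>half_edges_at G v. lookup c h) = 0)}"

definition graph_iso :: "graph \<Rightarrow> graph \<Rightarrow> bool"
  where "graph_iso G G' \<longleftrightarrow> (\<exists>\<phi> \<psi>. bij_betw \<phi> (verts G) (verts G') \<and> bij_betw \<psi> (halves G) (halves G') \<and>
    (\<forall>v\<in>verts G. \<forall>h\<in>halves G. (v, h) \<in> inc G \<longleftrightarrow> (\<phi> v, \<psi> h) \<in> inc G') \<and>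
    (\<forall>h\<in>halves G. \<forall>k\<in>halves G. (h, k) \<in> adj G \<longleftrightarrow> (\<psi> h, \<psi> k) \<in> adj G'))"


section \<open>Feynman graphs, subgraphs and quotients\<close>

definition feynman_graph :: "graph \<Rightarrow> bool"
  where "feynman_graph G \<longleftrightarrow> finite_graph G \<and>
    (\<forall>v\<in>verts G. card (half_edges_at G v) = 3) \<and>
    (\<forall>C\<in>components G. card (external_edges C) \<in> {2, 3})"

text \<open>The objects of \<open>LFG\<close>. The only connected Feynman graph without a loop is the bare vertex
  with three external edges. It is not an object: it is identified with the empty graph, since
  otherwise \<open>\<Gamma>/\<Gamma>\<close> would not be empty and the product would have no unit. The loop condition on
  subgraphs is likewise required of each component.\<close>

definition lfg_graph :: "graph \<Rightarrow> bool"
  where "lfg_graph G \<longleftrightarrow> feynman_graph G \<and> (\<forall>C\<in>components G. ratvec.dim (H1 C) > 0)"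

text \<open>A subgraph may cut internal edges of \<open>G\<close> (\<open>adj g \<subseteq> adj G\<close>). The quotient by a component with
  two external edges joins the partners of these edges; so either both partners exist, or (both
  edges being external in \<open>G\<close>) it is a connected component of \<open>G\<close>. This excludes self-energy
  subgraphs sitting on an external leg, for which the product would fail to be associative and
  which are not produced by insertions either. On 1PI graphs the condition is vacuous.\<close>

definition subgraph :: "graph \<Rightarrow> graph \<Rightarrow> bool"
  where "subgraph g G \<longleftrightarrow> lfg_graph g \<and> verts g \<subseteq> verts G \<and> halves g \<subseteq> halves G \<and>
    inc g = {(v, h) \<in> inc G. v \<in> verts g} \<and> adj g \<subseteq> adj G \<and>
    (\<forall>C\<in>components g. card (external_edges C) = 2 \<longrightarrow>
       external_edges C \<subseteq> external_edges G \<or> external_edges C \<inter> external_edges G = {})"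

text \<open>Quotient by a connected subgraph. In the first case the new vertex is named \<open>Min (verts c)\<close>,
  which is not among the remaining vertices.\<close>

definition contract :: "graph \<Rightarrow> graph \<Rightarrow> graph"
  where "contract c G =
    (if card (external_edges c) = 3 then
       let v = Min (verts c); H = halves G - (halves c - external_edges c) in
       \<lparr>verts = insert v (verts G - verts c), halves = H,
        inc = {(w, h) \<in> inc G. w \<notin> verts c} \<union> {v} \<times> external_edges c,
        adj = adj G \<inter> H \<times> H\<rparr>
     else
       let H = halves G - halves c in
       \<lparr>verts = verts G - verts c, halves = H,
        inc = {(w, h) \<in> inc G. w \<notin> verts c},
        adj = (adj G \<inter> H \<times> H) \<union>
          {(h, k). \<exists>a b. external_edges c = {a, b} \<and> a \<noteq> b \<and> (a, h) \<in> adj G \<and> (b, k) \<in> adj G}\<rparr>)"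

definition drop_bare_vertices :: "graph \<Rightarrow> graph"
  where "drop_bare_vertices G =
    (let B = {v \<in> verts G. half_edges_at G v \<subseteq> external_edges G};
         H = halves G - (\<Union>v\<in>B. half_edges_at G v) in
     \<lparr>verts = verts G - B, halves = H, inc = {(v, h) \<in> inc G. v \<notin> B}, adj = adj G \<inter> H \<times> H\<rparr>)"

text \<open>Successive quotients by the components of \<open>g\<close>, in an arbitrary order. Bare vertices arise
  exactly from those components of \<open>g\<close> with three external edges that are components of \<open>G\<close>.\<close>

definition graph_quotient :: "graph \<Rightarrow> graph \<Rightarrow> graph"  (infixl \<open>'/'/\<^sub>G\<close> 70)
  where "G //\<^sub>G g =
    drop_bare_vertices (fold contract (SOME cs. distinct cs \<and> set cs = components g) G)"


section \<open>Labeled Feynman graphs and their isomorphism classes\<close>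

text \<open>The pair \<open>(G, \<rho>)\<close> stands for \<open>G\<close> with the label set \<open>S = \<rho> ` halves G\<close> and the bijection
  \<open>\<rho> : halves G \<rightarrow> S\<close>.\<close>

type_synonym labeled_graph = "graph \<times> (nat \<Rightarrow> nat)"

definition labeled_feynman_graph :: "labeled_graph \<Rightarrow> bool"
  where "labeled_feynman_graph \<Gamma> \<longleftrightarrow> lfg_graph (fst \<Gamma>) \<and> inj_on (snd \<Gamma>) (halves (fst \<Gamma>))"

text \<open>Isomorphisms do not have to preserve labels; hence an isomorphism class of labeled Feynman
  graphs is the same thing as an unlabeled Feynman graph.\<close>

definition labeled_iso :: "labeled_graph \<Rightarrow> labeled_graph \<Rightarrow> bool"
  where "labeled_iso \<Gamma> \<Gamma>' \<longleftrightarrow>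
    labeled_feynman_graph \<Gamma> \<and> labeled_feynman_graph \<Gamma>' \<and> graph_iso (fst \<Gamma>) (fst \<Gamma>')"

lemma graph_iso_refl: "graph_iso G G"
  unfolding graph_iso_def by (rule exI[of _ id], rule exI[of _ id]) simp

lemma graph_iso_sym:
  assumes "graph_iso G G'"
  shows "graph_iso G' G"
proof -
  from assms obtain \<phi> \<psi> where
    \<phi>: "bij_betw \<phi> (verts G) (verts G')" and \<psi>: "bij_betw \<psi> (halves G) (halves G')" and
    i: "\<And>v h. v \<in> verts G \<Longrightarrow> h \<in> halves G \<Longrightarrow> (v, h) \<in> inc G \<longleftrightarrow> (\<phi> v, \<psi> h) \<in> inc G'" and
    a: "\<And>h k. h \<in> halves G \<Longrightarrow> k \<in> halves G \<Longrightarrow> (h, k) \<in> adj G \<longleftrightarrow> (\<psi> h, \<psi> k) \<in> adj G'"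
    unfolding graph_iso_def by blast
  let ?\<phi> = "inv_into (verts G) \<phi>" and ?\<psi> = "inv_into (halves G) \<psi>"
  note inv = bij_betw_inv_into_right[OF \<phi>] bij_betw_inv_into_right[OF \<psi>]
    bij_betwE[OF bij_betw_inv_into[OF \<phi>]] bij_betwE[OF bij_betw_inv_into[OF \<psi>]]
  show ?thesis unfolding graph_iso_def
    by (rule exI[of _ ?\<phi>], rule exI[of _ ?\<psi>])
       (use \<phi> \<psi> inv i a in \<open>auto intro: bij_betw_inv_into\<close>)
qed

lemma graph_iso_trans:
  assumes "graph_iso G1 G2" "graph_iso G2 G3"
  shows "graph_iso G1 G3"
proof -
  from assms(1) obtain \<phi> \<psi> where 1: "bij_betw \<phi> (verts G1) (verts G2)"
    "bij_betw \<psi> (halves G1) (halves G2)"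
    "\<forall>v\<in>verts G1. \<forall>h\<in>halves G1. (v, h) \<in> inc G1 \<longleftrightarrow> (\<phi> v, \<psi> h) \<in> inc G2"
    "\<forall>h\<in>halves G1. \<forall>k\<in>halves G1. (h, k) \<in> adj G1 \<longleftrightarrow> (\<psi> h, \<psi> k) \<in> adj G2"
    unfolding graph_iso_def by blast
  from assms(2) obtain \<phi>' \<psi>' where 2: "bij_betw \<phi>' (verts G2) (verts G3)"
    "bij_betw \<psi>' (halves G2) (halves G3)"
    "\<forall>v\<in>verts G2. \<forall>h\<in>halves G2. (v, h) \<in> inc G2 \<longleftrightarrow> (\<phi>' v, \<psi>' h) \<in> inc G3"
    "\<forall>h\<in>halves G2. \<forall>k\<in>halves G2. (h, k) \<in> adj G2 \<longleftrightarrow> (\<psi>' h, \<psi>' k) \<in> adj G3"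
    unfolding graph_iso_def by blast
  show ?thesis unfolding graph_iso_def
    by (rule exI[of _ "\<phi>' \<circ> \<phi>"], rule exI[of _ "\<psi>' \<circ> \<psi>"])
       (use 1 2 bij_betw_apply[OF 1(1)] bij_betw_apply[OF 1(2)] in \<open>simp add: bij_betw_trans\<close>)
qed

lemma labeled_feynman_graph_empty: "labeled_feynman_graph (empty_graph, \<rho>)"
  by (simp add: labeled_feynman_graph_def lfg_graph_def feynman_graph_def finite_graph_def
      empty_graph_def components_def sym_def irrefl_def)

quotient_type lfg_class = labeled_graph / partial: labeled_iso
proof (rule part_equivpI)
  show "\<exists>\<Gamma>. labeled_iso \<Gamma> \<Gamma>"
    using labeled_feynman_graph_empty by (auto simp: labeled_iso_def intro: graph_iso_refl)
  show "symp labeled_iso"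
    by (rule sympI) (auto simp: labeled_iso_def intro: graph_iso_sym)
  show "transp labeled_iso"
    by (rule transpI) (auto simp: labeled_iso_def intro: graph_iso_trans)
qed

abbreviation iso_class :: "labeled_graph \<Rightarrow> lfg_class"
  where "iso_class \<equiv> abs_lfg_class"

abbreviation representative :: "lfg_class \<Rightarrow> labeled_graph"
  where "representative \<equiv> rep_lfg_class"

definition relabel :: "(nat \<Rightarrow> nat) \<Rightarrow> graph \<Rightarrow> graph"
  where "relabel i G =
    \<lparr>verts = i ` verts G, halves = i ` halves G,
     inc = map_prod i i ` inc G, adj = map_prod i i ` adj G\<rparr>"

text \<open>Disjoint copies of two graphs, and the corresponding labeling of the union.\<close>

definition left_copy :: "graph \<Rightarrow> graph" where "left_copy = relabel (\<lambda>n. 2 * n)"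

definition right_copy :: "graph \<Rightarrow> graph" where "right_copy = relabel (\<lambda>n. 2 * n + 1)"

definition join_labels :: "(nat \<Rightarrow> nat) \<Rightarrow> (nat \<Rightarrow> nat) \<Rightarrow> nat \<Rightarrow> nat"
  where "join_labels \<rho> \<rho>' h = (if even h then 2 * \<rho> (h div 2) else 2 * \<rho>' (h div 2) + 1)"

definition graph_union :: "graph \<Rightarrow> graph \<Rightarrow> graph"
  where "graph_union G G' = \<lparr>verts = verts G \<union> verts G', halves = halves G \<union> halves G',
    inc = inc G \<union> inc G', adj = adj G \<union> adj G'\<rparr>"

definition disjoint_union :: "labeled_graph \<Rightarrow> labeled_graph \<Rightarrow> labeled_graph"  (infixl \<open>\<oplus>\<close> 65)
  where "\<Gamma> \<oplus> \<Gamma>' = (graph_union (left_copy (fst \<Gamma>)) (right_copy (fst \<Gamma>')),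
    join_labels (snd \<Gamma>) (snd \<Gamma>'))"


section \<open>The Hall algebra of labeled Feynman graphs\<close>

type_synonym hall = "lfg_class \<Rightarrow>\<^sub>0 rat"

definition hall_mult :: "hall \<Rightarrow> hall \<Rightarrow> hall"
  where "hall_mult f g = Abs_poly_mapping (\<lambda>X. let (G, \<rho>) = representative X in
    \<Sum>\<gamma> | subgraph \<gamma> G. lookup f (iso_class (\<gamma>, \<rho>)) * lookup g (iso_class (G //\<^sub>G \<gamma>, \<rho>)))"

definition hall_one :: hall
  where "hall_one = single (iso_class (empty_graph, id)) 1"

text \<open>An element of \<open>H \<otimes> H\<close> as a function of two arguments.\<close>

definition tensor_lookup :: "hall \<otimes>\<^sub>Q hall \<Rightarrow> lfg_class \<Rightarrow> lfg_class \<Rightarrow> rat"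
  where "tensor_lookup t X Y = tensor_lift (\<lambda>f g. lookup f X * lookup g Y) t"

text \<open>The element of \<open>H \<otimes> H\<close> with \<open>\<Delta>(f)(\<Gamma>\<^sub>1, \<Gamma>\<^sub>2) = f(\<Gamma>\<^sub>1 \<oplus> \<Gamma>\<^sub>2)\<close>, expanded in delta functions.\<close>

definition hall_comult :: "hall \<Rightarrow> hall \<otimes>\<^sub>Q hall"
  where "hall_comult f =
    (let s = (\<lambda>(X, Y). lookup f (iso_class (representative X \<oplus> representative Y))) in
     \<Sum>(X, Y) | s (X, Y) \<noteq> 0. s (X, Y) *\<^sub>Q (single X 1 \<otimes> single Y 1))"

definition hall_counit :: "hall \<Rightarrow> rat"
  where "hall_counit f = lookup f (iso_class (empty_graph, id))"


section \<open>The Connes-Kreimer Lie algebra on Feynman graphs\<close>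

text \<open>The insertions \<open>B \<circ>\<^bsub>v,f\<^esub> A\<close> and \<open>B \<circ>\<^bsub>e,f\<^esub> A\<close> for \<open>A\<close>, \<open>B\<close> without common vertices and
  half-edges. In the first one each external edge \<open>h\<close> of \<open>A\<close> is identified with \<open>f h\<close>, and the
  latter name is kept.\<close>

definition insert_at_vertex :: "graph \<Rightarrow> nat \<Rightarrow> (nat \<Rightarrow> nat) \<Rightarrow> graph \<Rightarrow> graph"
  where "insert_at_vertex B v f A =
    \<lparr>verts = (verts B - {v}) \<union> verts A,
     halves = halves B \<union> (halves A - external_edges A),
     inc = {(w, h) \<in> inc B. w \<noteq> v} \<union>
       (\<lambda>(w, h). (w, if h \<in> external_edges A then f h else h)) ` inc A,
     adj = adj B \<union> adj A\<rparr>"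

definition insert_at_edge :: "graph \<Rightarrow> nat set \<Rightarrow> (nat \<Rightarrow> nat) \<Rightarrow> graph \<Rightarrow> graph"
  where "insert_at_edge B e f A =
    \<lparr>verts = verts B \<union> verts A, halves = halves B \<union> halves A, inc = inc B \<union> inc A,
     adj = {(h, k) \<in> adj B. {h, k} \<noteq> e} \<union> adj A \<union>
       (\<Union>h\<in>external_edges A. {(h, f h), (f h, h)})\<rparr>"

definition bijections :: "nat set \<Rightarrow> nat set \<Rightarrow> (nat \<Rightarrow> nat) set"
  where "bijections X Y = {f \<in> X \<rightarrow>\<^sub>E Y. bij_betw f X Y}"

definition insertion_sum :: "labeled_graph \<Rightarrow> labeled_graph \<Rightarrow> hall"
  where "insertion_sum \<Gamma>1 \<Gamma>2 =
    (let A = left_copy (fst \<Gamma>1); B = right_copy (fst \<Gamma>2); \<rho> = join_labels (snd \<Gamma>1) (snd \<Gamma>2) in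
     if card (external_edges A) = 3 then
       \<Sum>v\<in>verts B. \<Sum>f\<in>bijections (external_edges A) (half_edges_at B v).
         single (iso_class (insert_at_vertex B v f A, \<rho>)) 1
     else
       \<Sum>e\<in>internal_edges B. \<Sum>f\<in>bijections (external_edges A) e.
         single (iso_class (insert_at_edge B e f A, \<rho>)) 1)"

definition pre_lie :: "hall \<Rightarrow> hall \<Rightarrow> hall"
  where "pre_lie x y =
    lin_ext (\<lambda>X. lin_ext (\<lambda>Y. insertion_sum (representative X) (representative Y)) y) x"

text \<open>Insertion is defined only for graphs with two or three external edges in total, so
  \<open>n\<^bsub>LFG\<^esub>\<close> is spanned by the connected graphs.\<close>

definition connected_class :: "lfg_class \<Rightarrow> bool"
  where "connected_class X \<longleftrightarrow> connected_graph (fst (representative X))"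

typedef nlfg = "{x :: lfg_class \<Rightarrow>\<^sub>0 rat. \<forall>X\<in>keys x. connected_class X}"
  by (rule exI[of _ 0]) simp

setup_lifting type_definition_nlfg

instantiation nlfg :: rat_vector
begin
lift_definition zero_nlfg :: nlfg is 0 by simp
lift_definition plus_nlfg :: "nlfg \<Rightarrow> nlfg \<Rightarrow> nlfg" is "(+)"
  by (auto simp: in_keys_iff lookup_add) (metis add.right_neutral)
lift_definition minus_nlfg :: "nlfg \<Rightarrow> nlfg \<Rightarrow> nlfg" is "(-)"
  by (auto simp: in_keys_iff lookup_minus) (metis diff_zero)
lift_definition uminus_nlfg :: "nlfg \<Rightarrow> nlfg" is uminus
  by (auto simp: in_keys_iff)
lift_definition scaleQ_nlfg :: "rat \<Rightarrow> nlfg \<Rightarrow> nlfg" is "(*\<^sub>Q)"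
  by (auto simp: in_keys_iff lookup_scaleQ scaleQ_rat_def)
instance
  by (standard; transfer; simp add: scaleQ_add_right scaleQ_add_left scaleQ_scaleQ scaleQ_one)
end

instantiation nlfg :: lie_bracket
begin
definition lie_bracket_nlfg :: "nlfg \<Rightarrow> nlfg \<Rightarrow> nlfg"
  where "lie_bracket_nlfg x y =
    Abs_nlfg (pre_lie (Rep_nlfg x) (Rep_nlfg y) - pre_lie (Rep_nlfg y) (Rep_nlfg x))"
instance ..
end

end

(* A vertex of a graph without isolated vertices is the set of its half-edges, so a graph is encoded
   as a partial matching on a finite set of half-edges together with an equivalence relation. This
   turns isomorphic images and quotients into identities of sets.

   The product with the class of a connected graph on the left counts the copies of that graph, and
   the subgraphs of h containing a connected subgraph c correspond to the subgraphs of h/c, with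
   (h/c)/(k/c) = h/k. Counting chains c <= k <= h both ways makes such products associate with all
   others. A product of connected classes has the disjoint union as its only term with the maximal
   number of components, with a positive coefficient; so the connected classes generate the algebra,
   which gives associativity in general, and their ordered monomials are linearly independent.

   Weighting each connected graph by the number of its automorphisms turns the insertion product into
   the commutator: the ways to identify a graph with an insertion of a into b are counted once by
   insertions and once by subgraphs, and in the commutator the disconnected terms cancel. The
   resulting homomorphism from the enveloping algebra is onto since connected classes generate, and
   injective since it carries the spanning ordered monomials of the Lie algebra to independent
   elements, so the Poincare-Birkhoff-Witt theorem is not needed. It respects the coproducts because
   it does so on generators, and thereby the Hopf axioms transfer from the enveloping algebra. *)
theory Submission
  imports Defs "HOL-Library.Multiset"
begin

section \<open>Graphs as matchings on half-edges\<close>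

text \<open>The quotient by a disconnected subgraph has no short description, so every fact about
  \<open>quo\<close> is proved for one connected \<open>c\<close> and then iterated. For connected
  \<open>c\<close> only three things can happen: \<open>c\<close> is a component and disappears, its
  three external edges become a vertex, or the partners of its two external edges are joined. The
  restriction on self-energy subgraphs in \<open>sub\<close> is what leaves no fourth case, and it
  is stable under passing to subgraphs of subgraphs. Iteration gives equal graphs, not only
  isomorphic ones, because surviving half-edges keep their names and no name is invented for a new
  vertex. The weights are forced: for each class \<open>g\<close>, its coefficient in the insertion
  product of \<open>a\<close> and \<open>b\<close> times \<open>aut g\<close> equals
  \<open>aut a * aut b\<close> times the number of copies of \<open>a\<close> in \<open>g\<close>
  that are no component and have quotient \<open>b\<close>. Over the rationals these weights can be
  divided out, and the top coefficients of products of connected classes, being numbers of copies,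
  can be inverted.\<close>

text \<open>Half-edges are related by \<open>vr\<close> if they lie at the same vertex and by \<open>ad\<close> if they form an
  internal edge; \<open>cext h x\<close> consists of the external edges of the component of \<open>x\<close>.\<close>

record hgraph =
  hs :: "nat set"
  vr :: "(nat \<times> nat) set"
  ad :: "(nat \<times> nat) set"

definition ext :: "hgraph \<Rightarrow> nat set"
  where "ext h = hs h - Domain (ad h)"

definition cn :: "hgraph \<Rightarrow> (nat \<times> nat) set"
  where "cn h = (vr h \<union> ad h)\<^sup>*"

definition cext :: "hgraph \<Rightarrow> nat \<Rightarrow> nat set"
  where "cext h x = ext h \<inter> cn h `` {x}"

definition cubic :: "hgraph \<Rightarrow> bool"
  where "cubic h \<longleftrightarrow> finite (hs h) \<and> equiv (hs h) (vr h) \<and> (\<forall>x\<in>hs h. card (vr h `` {x}) = 3) \<and>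
    ad h \<subseteq> hs h \<times> hs h \<and> sym (ad h) \<and> irrefl (ad h) \<and> single_valued (ad h)"

text \<open>The second clause stands for the loop condition: with trivalent vertices and 2 or 3
  external edges, a component has a loop exactly when it has an internal edge
  (\<open>dim_H1\<close>), that is, when it is not a bare vertex.\<close>

definition lfgh :: "hgraph \<Rightarrow> bool"
  where "lfgh h \<longleftrightarrow> cubic h \<and> (\<forall>x\<in>hs h. vr h `` {x} \<inter> Domain (ad h) \<noteq> {}) \<and>
    (\<forall>x\<in>hs h. card (cext h x) = 2 \<or> card (cext h x) = 3)"

text \<open>The equation for \<open>vr k\<close> makes a half-edge of \<open>k\<close> bring along
  its entire vertex of \<open>h\<close>, since \<open>lfgh k\<close> confines \<open>vr k\<close> to
  \<open>hs k\<close>.\<close>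

definition sub :: "hgraph \<Rightarrow> hgraph \<Rightarrow> bool"
  where "sub k h \<longleftrightarrow> lfgh k \<and> hs k \<subseteq> hs h \<and> vr k = vr h \<inter> hs k \<times> UNIV \<and> ad k \<subseteq> ad h \<and>
    (\<forall>x\<in>hs k. card (cext k x) = 2 \<longrightarrow> cext k x \<subseteq> ext h \<or> cext k x \<inter> ext h = {})"

definition conn :: "hgraph \<Rightarrow> bool"
  where "conn h \<longleftrightarrow> hs h \<noteq> {} \<and> (\<forall>x\<in>hs h. \<forall>y\<in>hs h. (x, y) \<in> cn h)"

text \<open>In \<open>h/k\<close> a component of \<open>k\<close> with two external edges is short-circuited (\<open>tau\<close>), and one with
  three becomes a vertex (\<open>keep\<close>), except for a whole component of \<open>h\<close>, whose image would be a bare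
  vertex. The closure in \<open>quo\<close> accounts for several components of \<open>k\<close> sitting in a row.\<close>

definition tau :: "hgraph \<Rightarrow> (nat \<times> nat) set"
  where "tau k = {(a, b). a \<in> ext k \<and> b \<in> cext k a \<and> card (cext k a) = 2}"

definition keep :: "hgraph \<Rightarrow> hgraph \<Rightarrow> nat set"
  where "keep k h = {x \<in> ext k. card (cext k x) = 3 \<and> \<not> cext k x \<subseteq> ext h}"

definition quo :: "hgraph \<Rightarrow> hgraph \<Rightarrow> hgraph"
  where "quo h k = (let H = (hs h - hs k) \<union> keep k h in
    \<lparr>hs = H, vr = vr h \<inter> (hs h - hs k) \<times> (hs h - hs k) \<union> cn k \<inter> keep k h \<times> keep k h,
     ad = {(x, y). x \<in> H \<and> y \<in> H \<and> x \<noteq> y \<and> (x, y) \<in> (ad h \<union> tau k)\<^sup>*}\<rparr>)"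

lemma quo_simps:
  "hs (quo h k) = (hs h - hs k) \<union> keep k h"
  "vr (quo h k) = vr h \<inter> (hs h - hs k) \<times> (hs h - hs k) \<union> cn k \<inter> keep k h \<times> keep k h"
  "ad (quo h k) = {(x, y). x \<in> hs (quo h k) \<and> y \<in> hs (quo h k) \<and> x \<noteq> y \<and> (x, y) \<in> (ad h \<union> tau k)\<^sup>*}"
  by (simp_all add: quo_def Let_def)

lemma cubicD:
  assumes "cubic h"
  shows "finite (hs h)" "equiv (hs h) (vr h)" "x \<in> hs h \<Longrightarrow> card (vr h `` {x}) = 3"
    "ad h \<subseteq> hs h \<times> hs h" "sym (ad h)" "irrefl (ad h)" "single_valued (ad h)"
    "vr h \<subseteq> hs h \<times> hs h" "sym (vr h)" "trans (vr h)" "x \<in> hs h \<Longrightarrow> (x, x) \<in> vr h"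
  using assms by (auto simp: cubic_def equiv_def refl_on_def)

lemma cubic_pairs:
  assumes "cubic h"
  shows "(x, y) \<in> vr h \<Longrightarrow> x \<in> hs h" "(x, y) \<in> vr h \<Longrightarrow> y \<in> hs h"
    "(x, y) \<in> ad h \<Longrightarrow> x \<in> hs h" "(x, y) \<in> ad h \<Longrightarrow> y \<in> hs h"
    "(x, y) \<in> vr h \<Longrightarrow> (y, x) \<in> vr h" "(x, y) \<in> ad h \<Longrightarrow> (y, x) \<in> ad h"
    "(x, y) \<in> ad h \<Longrightarrow> (x, z) \<in> ad h \<Longrightarrow> y = z" "(x, x) \<notin> ad h"
    "(y, x) \<in> ad h \<Longrightarrow> (z, x) \<in> ad h \<Longrightarrow> y = z"
  using cubicD[OF assms] by (auto simp: sym_def irrefl_def single_valued_def) (meson)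

lemma lfgh_cubic: "lfgh h \<Longrightarrow> cubic h"
  by (simp add: lfgh_def)

lemma cn_refl [simp]: "(x, x) \<in> cn h"
  by (simp add: cn_def)

lemma cn_trans: "(x, y) \<in> cn h \<Longrightarrow> (y, z) \<in> cn h \<Longrightarrow> (x, z) \<in> cn h"
  unfolding cn_def by (rule rtrancl_trans)

lemma cn_sym: "cubic h \<Longrightarrow> (x, y) \<in> cn h \<Longrightarrow> (y, x) \<in> cn h"
  unfolding cn_def by (metis cubicD(5,9) sym_Un sym_rtrancl symD)

lemma cn_base: "(x, y) \<in> vr h \<Longrightarrow> (x, y) \<in> cn h" "(x, y) \<in> ad h \<Longrightarrow> (x, y) \<in> cn h"
  by (auto simp: cn_def)

lemma cn_step: "(x, y) \<in> cn h \<Longrightarrow> (y, z) \<in> vr h \<Longrightarrow> (x, z) \<in> cn h"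
  "(x, y) \<in> cn h \<Longrightarrow> (y, z) \<in> ad h \<Longrightarrow> (x, z) \<in> cn h"
  by (meson cn_base cn_trans)+

lemma cn_hs: "(x, y) \<in> cn h \<Longrightarrow> cubic h \<Longrightarrow> x \<in> hs h \<longleftrightarrow> y \<in> hs h"
  unfolding cn_def by (induction rule: rtrancl_induct) (auto dest: cubic_pairs)

lemma cn_induct [consumes 1, case_names refl vr ad]:
  assumes "(x, y) \<in> cn h" "P x"
    "\<And>y z. (x, y) \<in> cn h \<Longrightarrow> (y, z) \<in> vr h \<Longrightarrow> P y \<Longrightarrow> P z"
    "\<And>y z. (x, y) \<in> cn h \<Longrightarrow> (y, z) \<in> ad h \<Longrightarrow> P y \<Longrightarrow> P z"
  shows "P y"
  using assms(1) unfolding cn_def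
  by (induction rule: rtrancl_induct) (use assms in \<open>auto simp: cn_def\<close>)

lemma cn_class_eq: "cubic h \<Longrightarrow> (x, y) \<in> cn h \<Longrightarrow> cn h `` {x} = cn h `` {y}"
  using cn_sym[of h x y] cn_trans[of x y h] cn_trans[of y x h] by blast

lemma cext_eq: "cubic h \<Longrightarrow> (x, y) \<in> cn h \<Longrightarrow> cext h x = cext h y"
  by (simp add: cext_def cn_class_eq)

lemma conn_cext: "cubic h \<Longrightarrow> conn h \<Longrightarrow> x \<in> hs h \<Longrightarrow> cext h x = ext h"
  unfolding cext_def conn_def ext_def by auto

text \<open>Steps along a matching only go back and forth. This collapses the closure in
  \<open>quo\<close> wherever \<open>tau\<close> contributes nothing.\<close>

lemma matching_rtrancl:
  assumes "cubic h" "(x, y) \<in> (ad h)\<^sup>*" "x \<noteq> y"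
  shows "(x, y) \<in> ad h"
proof -
  have "x = y \<or> (x, y) \<in> ad h"
    using assms(2) by induction (use cubic_pairs[OF assms(1)] in blast)+
  with assms show ?thesis by simp
qed

lemma subD:
  assumes "sub k h"
  shows "lfgh k" "cubic k" "hs k \<subseteq> hs h" "(x, y) \<in> vr k \<longleftrightarrow> (x, y) \<in> vr h \<and> x \<in> hs k" "ad k \<subseteq> ad h"
    "vr k = vr h \<inter> hs k \<times> UNIV"
  using assms by (auto simp: sub_def lfgh_cubic)

text \<open>Subgraphs consist of whole vertices.\<close>

lemma sub_vr_closed:
  assumes "sub k h" "cubic h" "(x, y) \<in> vr h"
  shows "x \<in> hs k \<longleftrightarrow> y \<in> hs k"
  using assms subD[OF assms(1)] cubic_pairs by metis

text \<open>Partners in \<open>h\<close> are unique, so the partner that \<open>x\<close> has in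
  \<open>k\<close> is the one it has in \<open>h\<close>.\<close>

lemma sub_internal:
  assumes "sub k h" "cubic h" "x \<in> hs k" "x \<notin> ext k" "(x, y) \<in> ad h"
  shows "(x, y) \<in> ad k" "y \<in> hs k" "y \<notin> ext k"
proof -
  obtain z where z: "(x, z) \<in> ad k" using assms by (auto simp: ext_def)
  then have "z = y" using assms subD[OF assms(1)] cubic_pairs(7) by blast
  with z show 1: "(x, y) \<in> ad k" by simp
  from cubic_pairs(4,6)[OF subD(2)[OF assms(1)] this]
  show "y \<in> hs k" "y \<notin> ext k" by (auto simp: ext_def)
qed

lemma sub_cn: "(x, y) \<in> cn k \<Longrightarrow> sub k h \<Longrightarrow> (x, y) \<in> cn h"
proof (induction rule: cn_induct)
  case (vr y z) then show ?case using subD(4)[of k h y z] cn_step by blast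
next
  case (ad y z) then show ?case using subD(5)[of k h] cn_step by blast
qed simp

lemma sub_ext: "sub k h \<Longrightarrow> ext h \<inter> hs k \<subseteq> ext k"
  using subD(5)[of k h] by (auto simp: ext_def)

text \<open>Only cubicity of \<open>h\<close> is assumed, because the locale also has to serve for
  graphs built by \<open>expand\<close>, whose conditions on components are derived from the
  quotient by \<open>lfgh_quo\<close>. The assumption \<open>no_loop\<close> forbids that the two
  external edges of \<open>c\<close> are joined to each other, which would leave no partners to
  connect.\<close>

locale contraction =
  fixes h c
  assumes cub: "cubic h" and sub: "sub c h" and conn: "conn c"
    and no_loop: "card (ext c) = 2 \<Longrightarrow> a \<in> ext c \<Longrightarrow> b \<in> ext c \<Longrightarrow> (a, b) \<notin> ad h"
begin

lemmas hp = cubic_pairs[OF cub]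
lemmas cp = cubic_pairs[OF subD(2)[OF sub]]
lemmas subD' = subD[OF sub]
lemmas internal = sub_internal[OF sub cub]

lemma cext_c: "x \<in> hs c \<Longrightarrow> cext c x = ext c"
  by (rule conn_cext[OF subD'(2) conn])

lemma cn_c: "x \<in> hs c \<Longrightarrow> y \<in> hs c \<Longrightarrow> (x, y) \<in> cn c"
  using conn by (auto simp: conn_def)

lemma ext_c_hs: "x \<in> ext c \<Longrightarrow> x \<in> hs c"
  by (simp add: ext_def)

lemma c_ne: "\<exists>x. x \<in> hs c"
  using conn by (auto simp: conn_def)

lemma card_ext: "card (ext c) = 2 \<or> card (ext c) = 3"
  using c_ne cext_c subD'(1) unfolding lfgh_def by metis

lemma keep_c: "keep c h = (if card (ext c) = 3 \<and> \<not> ext c \<subseteq> ext h then ext c else {})"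
  using cext_c ext_c_hs unfolding keep_def by auto

lemma tau_c: "tau c = (if card (ext c) = 2 then ext c \<times> ext c else {})"
  using cext_c ext_c_hs unfolding tau_def by auto

lemma cross: "x \<in> hs c \<Longrightarrow> (x, y) \<in> ad h \<Longrightarrow> y \<notin> hs c \<Longrightarrow> x \<in> ext c"
  using internal by blast

lemma two_ext: "card (ext c) = 2 \<Longrightarrow> ext c \<subseteq> ext h \<or> ext c \<inter> ext h = {}"
  using sub c_ne cext_c unfolding sub_def by metis

lemma quo_three:
  assumes "card (ext c) = 3" "\<not> ext c \<subseteq> ext h"
  shows "quo h c = \<lparr>hs = (hs h - hs c) \<union> ext c,
    vr = vr h \<inter> (hs h - hs c) \<times> (hs h - hs c) \<union> ext c \<times> ext c,
    ad = ad h \<inter> ((hs h - hs c) \<union> ext c) \<times> ((hs h - hs c) \<union> ext c)\<rparr>"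
proof (intro hgraph.equality)
  have "(x, y) \<in> cn c" if "x \<in> ext c" "y \<in> ext c" for x y
    using that cn_c ext_c_hs by blast
  then show "vr (quo h c) = vr \<lparr>hs = (hs h - hs c) \<union> ext c,
    vr = vr h \<inter> (hs h - hs c) \<times> (hs h - hs c) \<union> ext c \<times> ext c,
    ad = ad h \<inter> ((hs h - hs c) \<union> ext c) \<times> ((hs h - hs c) \<union> ext c)\<rparr>"
    using assms by (auto simp: quo_simps keep_c)
qed (use assms matching_rtrancl[OF cub] hp(8) in \<open>auto simp: quo_simps keep_c tau_c\<close>)

text \<open>A path starting outside the component \<open>c\<close> never enters it, so
  \<open>tau c\<close> has no effect and two or three external edges lead to the same
  formula.\<close>

lemma quo_comp:
  assumes "ext c \<subseteq> ext h"
  shows "quo h c = \<lparr>hs = hs h - hs c, vr = vr h \<inter> (hs h - hs c) \<times> (hs h - hs c),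
    ad = ad h \<inter> (hs h - hs c) \<times> (hs h - hs c)\<rparr>"
proof -
  have "(x, y) \<in> ad h" if "(x, y) \<in> (ad h \<union> tau c)\<^sup>*" "x \<in> hs h - hs c" "x \<noteq> y" for x y
  proof -
    have "(x, y) \<in> (ad h)\<^sup>* \<and> y \<notin> hs c"
      using that(1)
    proof induction
      case (step y z)
      then have yz: "(y, z) \<in> ad h" using tau_c ext_c_hs by (auto split: if_splits)
      moreover have "z \<notin> hs c"
      proof
        assume z: "z \<in> hs c"
        then have "z \<notin> ext c" using assms hp(6)[OF yz] by (auto simp: ext_def)
        with step.IH internal(2)[OF z _ hp(6)[OF yz]] show False by simp
      qed
      ultimately show ?case using step by auto
    qed (use that in auto)
    then show ?thesis using matching_rtrancl[OF cub] that by blast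
  qed
  then show ?thesis
    using assms hp(8) by (intro hgraph.equality) (auto simp: quo_simps keep_c)
qed

lemma quo_two:
  assumes e: "ext c = {a, b}" "a \<noteq> b" and pq: "(a, p) \<in> ad h" "(b, q) \<in> ad h"
  shows "quo h c = \<lparr>hs = hs h - hs c, vr = vr h \<inter> (hs h - hs c) \<times> (hs h - hs c),
    ad = ad h \<inter> (hs h - hs c) \<times> (hs h - hs c) \<union> {(p, q), (q, p)}\<rparr>"
    and "p \<in> hs h - hs c" "q \<in> hs h - hs c" "p \<noteq> q"
proof -
  have card: "card (ext c) = 2" using e by simp
  have ext: "x \<in> hs c" "x \<noteq> a" "x \<noteq> b" if "x \<in> hs c" "x \<notin> ext c" for x
    using that e by auto
  have nab: "(a, b) \<notin> ad h" using no_loop[OF card] e by auto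
  \<comment> \<open>Stated for both orders of the two external edges: their partners are neither
    internal to \<open>c\<close> nor, by \<open>no_loop\<close>, the other external edge.\<close>
  have p: "p \<in> hs h - hs c" if "(a, p) \<in> ad h" "{a, b} = ext c" "(a, b) \<notin> ad h" for a b p
  proof -
    have "p \<notin> hs c"
    proof
      assume p: "p \<in> hs c"
      show False
      proof (cases "p \<in> ext c")
        case True then show False using that(1,3) that(2)[symmetric] hp(8)[of a] by auto
      next
        case False then show False using that internal[OF p False hp(6)[OF that(1)]] by auto
      qed
    qed
    then show ?thesis using that(1) hp(4) by auto
  qed
  show P: "p \<in> hs h - hs c" using p[of a p b] pq nab e by auto
  have "(b, a) \<notin> ad h" using nab hp(6)[of b a] by blast
  then show Q: "q \<in> hs h - hs c" using p[of b q a] pq e by auto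
  show pq': "p \<noteq> q" using hp(9)[OF pq(1), of b] pq(2) e by auto
  \<comment> \<open>The four half-edges \<open>a\<close>, \<open>b\<close>, \<open>p\<close>,
    \<open>q\<close> form a set closed under \<open>ad h\<close> and \<open>tau c\<close>. Hence a
    path stays inside this set or avoids it, and in the latter case it uses the matching
    alone.\<close>
  have closed: "z \<notin> {a, b, p, q} \<and> (x, z) \<in> (ad h)\<^sup>*"
    if "(x, z) \<in> (ad h \<union> tau c)\<^sup>*" "x \<notin> {a, b, p, q}" for x z
    using that(1)
  proof induction
    case (step y z)
    then have yz: "(y, z) \<in> ad h" using tau_c e card by auto
    have "z \<notin> {a, b, p, q}"
    proof
      assume "z \<in> {a, b, p, q}"
      then have "y \<in> {a, b, p, q}"
        using hp(6)[OF yz] hp(7)[OF pq(1)] hp(7)[OF pq(2)] hp(7)[OF hp(6)[OF pq(1)]]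
          hp(7)[OF hp(6)[OF pq(2)]] by blast
      with step.IH show False by blast
    qed
    with yz step.IH show ?case by auto
  qed (use that in auto)
  have in_U: "z \<in> {a, b, p, q}" if "(x, z) \<in> (ad h \<union> tau c)\<^sup>*" "x \<in> {a, b, p, q}" for x z
    using that(1)
  proof induction
    case (step y z)
    then consider "(y, z) \<in> ad h" | "z \<in> {a, b}" using tau_c e card by auto
    then show ?case
    proof cases
      case 1
      then show ?thesis using step.IH hp(7)[OF pq(1)] hp(7)[OF pq(2)] hp(7)[OF hp(6)[OF pq(1)]]
          hp(7)[OF hp(6)[OF pq(2)]] by blast
    qed auto
  qed (use that in auto)
  have path: "(p, q) \<in> (ad h \<union> tau c)\<^sup>*" "(q, p) \<in> (ad h \<union> tau c)\<^sup>*"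
  proof -
    have "(p, a) \<in> ad h \<union> tau c" "(a, b) \<in> ad h \<union> tau c" "(b, q) \<in> ad h \<union> tau c"
      "(q, b) \<in> ad h \<union> tau c" "(b, a) \<in> ad h \<union> tau c" "(a, p) \<in> ad h \<union> tau c"
      using pq pq[THEN hp(6)] tau_c e card by auto
    then show "(p, q) \<in> (ad h \<union> tau c)\<^sup>*" "(q, p) \<in> (ad h \<union> tau c)\<^sup>*"
      by (meson converse_rtrancl_into_rtrancl r_into_rtrancl)+
  qed
  have keep: "keep c h = {}" by (simp add: keep_c card)
  have "ad (quo h c) = ad h \<inter> (hs h - hs c) \<times> (hs h - hs c) \<union> {(p, q), (q, p)}" (is "?L = ?R")
  proof (rule set_eqI, clarify)
    fix x y
    show "(x, y) \<in> ?L \<longleftrightarrow> (x, y) \<in> ?R"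
    proof
      assume "(x, y) \<in> ?L"
      then have l: "x \<in> hs h - hs c" "y \<in> hs h - hs c" "x \<noteq> y" "(x, y) \<in> (ad h \<union> tau c)\<^sup>*"
        by (auto simp: quo_simps keep)
      have ab: "a \<in> hs c" "b \<in> hs c" using e ext_c_hs by auto
      show "(x, y) \<in> ?R"
      proof (cases "x \<in> {a, b, p, q}")
        case True then show ?thesis using in_U[OF l(4)] l ab by auto
      next
        case False then show ?thesis using closed[OF l(4)] l matching_rtrancl[OF cub] by auto
      qed
    next
      assume "(x, y) \<in> ?R" then show "(x, y) \<in> ?L"
        using path P Q pq' hp(8)[of x] by (auto simp: quo_simps keep)
    qed
  qed
  then show "quo h c = \<lparr>hs = hs h - hs c, vr = vr h \<inter> (hs h - hs c) \<times> (hs h - hs c),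
    ad = ad h \<inter> (hs h - hs c) \<times> (hs h - hs c) \<union> {(p, q), (q, p)}\<rparr>"
    by (intro hgraph.equality) (auto simp: quo_simps keep)
qed

text \<open>The self-energy condition in \<open>sub\<close> excludes that just one of two external
  edges of \<open>c\<close> is external in \<open>h\<close>. What remains is a component, a new
  vertex or a new edge, and this case distinction drives all arguments about contraction.\<close>

lemma kinds [case_names comp three two]:
  obtains "ext c \<subseteq> ext h"
  | "card (ext c) = 3" "\<not> ext c \<subseteq> ext h"
  | a b p q where "ext c = {a, b}" "a \<noteq> b" "(a, p) \<in> ad h" "(b, q) \<in> ad h" "ext c \<inter> ext h = {}"
proof (cases "ext c \<subseteq> ext h")
  case False
  show ?thesis
  proof (cases "card (ext c) = 3")
    case F: False
    then obtain a b where ab: "ext c = {a, b}" "a \<noteq> b"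
      using card_ext by (metis card_2_iff)
    have "ext c \<inter> ext h = {}" using F card_ext two_ext False by blast
    then have "a \<in> Domain (ad h)" "b \<in> Domain (ad h)"
      using ab ext_c_hs subD'(3) by (auto simp: ext_def)
    then show ?thesis using ab that(3) \<open>ext c \<inter> ext h = {}\<close> by blast
  qed (use False that in blast)
qed (use that in blast)

end

section \<open>Contraction of a connected subgraph\<close>

context contraction
begin

abbreviation "h' \<equiv> quo h c"

lemma outside_c:
  assumes "x \<in> hs h" "x \<notin> hs c" "(x, y) \<in> vr h"
  shows "y \<in> hs h - hs c"
  using assms hp(2)[OF assms(3)] sub_vr_closed[OF sub cub assms(3)] by auto

lemma hs_quo: "hs h - hs c \<subseteq> hs h'" "hs h' \<subseteq> hs h" "hs h' \<inter> hs c \<subseteq> ext c"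
  using subD'(3) by (auto simp: quo_simps keep_def ext_def)

lemma vr_class_outside: "x \<in> hs h - hs c \<Longrightarrow> vr h' `` {x} = vr h `` {x}"
  using outside_c by (auto simp: quo_simps keep_def ext_def)

lemma restr_equiv: "equiv (hs h - hs c) (vr h \<inter> (hs h - hs c) \<times> (hs h - hs c))"
proof (rule equivI)
  show "refl_on (hs h - hs c) (vr h \<inter> (hs h - hs c) \<times> (hs h - hs c))"
    using cubicD(11)[OF cub] by (auto simp: refl_on_def)
  show "sym (vr h \<inter> (hs h - hs c) \<times> (hs h - hs c))"
    using cubicD(9)[OF cub] by (auto simp: sym_def)
  show "trans (vr h \<inter> (hs h - hs c) \<times> (hs h - hs c))"
    using cubicD(10)[OF cub] unfolding trans_def by blast
qed auto

lemma cubic_quo: "cubic h'"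
proof -
  have fin: "finite (hs h')" using hs_quo(2) cubicD(1)[OF cub] finite_subset by blast
  have card: "card (vr h `` {x}) = 3" if "x \<in> hs h" for x using cubicD(3)[OF cub that] .
  note o = vr_class_outside
  show ?thesis
  proof (cases rule: kinds)
    case comp
    have 1: "equiv (hs h') (vr h')" "hs h' = hs h - hs c"
      using restr_equiv by (simp_all add: quo_comp[OF comp])
    have 2: "card (vr h' `` {x}) = 3" if "x \<in> hs h'" for x
      using that 1(2) o card by auto
    have 3: "ad h' \<subseteq> hs h' \<times> hs h'" "sym (ad h')" "irrefl (ad h')" "single_valued (ad h')"
      using cubicD(5,6,7)[OF cub]
      by (auto simp: quo_comp[OF comp] sym_def irrefl_def single_valued_def)
    show ?thesis using fin 1(1) 2 3 by (simp add: cubic_def)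
  next
    case three
    note q = quo_three[OF three]
    have 1: "equiv (hs h') (vr h')"
    proof (rule equivI)
      show "refl_on (hs h') (vr h')" using cubicD(11)[OF cub] by (auto simp: refl_on_def q)
      show "sym (vr h')" using cubicD(9)[OF cub] by (auto simp: sym_def q)
      have "trans (vr h \<inter> (hs h - hs c) \<times> (hs h - hs c))" using restr_equiv by (simp add: equiv_def)
      then show "trans (vr h')" using ext_c_hs unfolding trans_def q by simp blast
    qed (auto simp: q)
    have "vr h' `` {x} = ext c" if "x \<in> ext c" for x
      using that ext_c_hs unfolding q by auto
    moreover have "hs h' = (hs h - hs c) \<union> ext c" unfolding q by simp
    ultimately have 2: "card (vr h' `` {x}) = 3" if "x \<in> hs h'" for x
      using that o[of x] card[of x] three by fastforce
    have 3: "ad h' \<subseteq> hs h' \<times> hs h'" "sym (ad h')" "irrefl (ad h')" "single_valued (ad h')"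
      using cubicD(5,6,7)[OF cub]
      by (auto simp: q sym_def irrefl_def single_valued_def)
    show ?thesis using fin 1(1) 2 3 by (simp add: cubic_def)
  next
    case (two a b p q)
    note qq = quo_two[OF two(1-4)]
    have 1: "equiv (hs h') (vr h')" "hs h' = hs h - hs c"
      using restr_equiv by (simp_all add: qq(1))
    have 2: "card (vr h' `` {x}) = 3" if "x \<in> hs h'" for x
      using that 1(2) o card by auto
    have ab: "a \<in> hs c" "b \<in> hs c" using two ext_c_hs by auto
    \<comment> \<open>In \<open>h\<close> the half-edges \<open>p\<close> and \<open>q\<close> are
      matched into \<open>c\<close>, so the new edge between them does not clash with an old
      one.\<close>
    have p: "y \<notin> hs h - hs c" if "(p, y) \<in> ad h" for y
      using hp(7)[OF hp(6)[OF two(3)] that] ab by auto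
    have q: "y \<notin> hs h - hs c" if "(q, y) \<in> ad h" for y
      using hp(7)[OF hp(6)[OF two(4)] that] ab by auto
    have "ad h' \<subseteq> hs h' \<times> hs h'" "sym (ad h')" "irrefl (ad h')"
      using cubicD(5,6)[OF cub] qq(2-4) by (auto simp: qq(1) sym_def irrefl_def)
    moreover have "single_valued (ad h')"
      using cubicD(7)[OF cub] p q qq(2-4) by (auto simp: qq(1) single_valued_def)
    ultimately show ?thesis using fin 1(1) 2 by (simp add: cubic_def)
  qed
qed

text \<open>Contraction replaces the adjacencies that it destroys: outside \<open>c\<close>, only
  \<open>p\<close> and \<open>q\<close> lose their partners, and they become partners of each
  other.\<close>

lemma ext_quo: "ext h' = ext h \<inter> hs h'"
proof (cases rule: kinds)
  case comp
  have "y \<notin> hs c" if "x \<in> hs h - hs c" "(x, y) \<in> ad h" for x y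
    using that comp hp(6)[OF that(2)] internal(2)[of y x] by (auto simp: ext_def)
  moreover have "y \<in> hs h" if "(x, y) \<in> ad h" for x y using that hp(4) by blast
  ultimately show ?thesis unfolding quo_comp[OF comp] ext_def Domain_iff by simp blast
next
  case three
  have "y \<in> (hs h - hs c) \<union> ext c" if "x \<in> (hs h - hs c) \<union> ext c" "(x, y) \<in> ad h" for x y
    using that hp(4)[OF that(2)] hp(6)[OF that(2)] internal(2,3)[of y x] by auto
  then show ?thesis using subD'(3) unfolding quo_three[OF three] ext_def Domain_iff by simp blast
next
  case (two a b p q)
  note qq = quo_two[OF two(1-4)]
  have "y \<in> hs h - hs c \<or> x = p \<or> x = q" if "x \<in> hs h - hs c" "(x, y) \<in> ad h" for x y
    using that hp(4)[OF that(2)] hp(6)[OF that(2)] internal(2)[of y x] two(1)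
      hp(7)[OF two(3), of x] hp(7)[OF two(4), of x] by auto
  then show ?thesis using qq(2,3) hp(6)[OF two(3)] hp(6)[OF two(4)]
    by (auto simp: qq(1) ext_def)
qed

lemma comp_closed:
  assumes "ext c \<subseteq> ext h" "x \<in> hs c" "(x, y) \<in> cn h"
  shows "y \<in> hs c"
  using assms(3)
proof (induction rule: cn_induct)
  case (vr y z) then show ?case using sub_vr_closed[OF sub cub] by blast
next
  case (ad y z)
  then have "y \<notin> ext c" using assms(1) by (auto simp: ext_def)
  with ad show ?case using internal(2) by blast
qed (use assms in simp)

text \<open>A path of \<open>h\<close> between half-edges of the quotient may run through \<open>c\<close>; the half-edges in \<open>N\<close>
  are the ones from which it enters \<open>c\<close>.\<close>

lemma cn_project:
  assumes "x \<in> hs h'" "(x, z) \<in> cn h"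
    and N: "\<And>m n. m \<in> N \<Longrightarrow> n \<in> N \<Longrightarrow> (m, n) \<in> cn h'" "hs h' \<inter> hs c \<subseteq> N" "N \<subseteq> hs h'"
    and enter: "\<And>z w. z \<in> hs h - hs c \<Longrightarrow> w \<in> hs c \<Longrightarrow> (z, w) \<in> ad h \<Longrightarrow> \<exists>n\<in>N. (z, n) \<in> cn h'"
    and outer: "\<And>z w. z \<in> hs h - hs c \<Longrightarrow> w \<in> hs h - hs c \<Longrightarrow> (z, w) \<in> ad h \<Longrightarrow> (z, w) \<in> ad h'"
  shows "z \<in> hs h' \<Longrightarrow> (x, z) \<in> cn h'"
proof -
  note symm = cn_sym[OF cubic_quo]
  \<comment> \<open>Strengthened for the induction: while the path is inside \<open>c\<close>, all
    of \<open>N\<close> is reachable from \<open>x\<close> in the quotient.\<close>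
  have "(z \<in> hs h' \<longrightarrow> (x, z) \<in> cn h') \<and> (z \<in> hs c \<longrightarrow> (\<forall>n\<in>N. (x, n) \<in> cn h') \<and> N \<noteq> {}) \<and> z \<in> hs h"
    using assms(2)
  proof (induction rule: cn_induct)
    case refl
    show ?case using assms(1) N hs_quo by auto
  next
    case (vr y z)
    show ?case
    proof (cases "y \<in> hs c")
      case True
      then have "z \<in> hs c" using sub_vr_closed[OF sub cub vr(2)] by simp
      then show ?thesis using True vr N(2) hp(2) by blast
    next
      case False
      then have z: "z \<in> hs h - hs c" using vr outside_c by blast
      then have "(y, z) \<in> vr h'" using False vr by (auto simp: quo_simps)
      moreover have "(x, y) \<in> cn h'" using vr False hs_quo(1) by blast
      ultimately show ?thesis using z cn_step(1) by blast
    qed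
  next
    case (ad y z)
    have zh: "z \<in> hs h" using ad hp(4) by blast
    consider "y \<in> hs c" "z \<in> hs c" | "y \<in> hs c" "z \<notin> hs c" | "y \<notin> hs c" "z \<in> hs c" | "y \<notin> hs c" "z \<notin> hs c"
      by blast
    then show ?case
    proof cases
      case 1 then show ?thesis using ad N(2) zh by blast
    next
      case 2
      then obtain n where n: "n \<in> N" "(z, n) \<in> cn h'" using enter[OF _ _ hp(6)[OF ad(2)]] zh by blast
      with ad 2 have "(x, n) \<in> cn h'" by blast
      with n show ?thesis using 2 zh symm cn_trans by blast
    next
      case 3
      then obtain n where n: "n \<in> N" "(y, n) \<in> cn h'" using enter[OF _ _ ad(2)] ad(3) by blast
      have "(x, y) \<in> cn h'" using ad 3 hs_quo(1) by blast
      with n have "(x, n) \<in> cn h'" using cn_trans by blast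
      then have "\<forall>m\<in>N. (x, m) \<in> cn h'" using n N(1) cn_trans by blast
      then show ?thesis using 3 n zh N(2) by blast
    next
      case 4
      then have "(y, z) \<in> ad h'" using outer ad zh by blast
      moreover have "(x, y) \<in> cn h'" using ad 4 hs_quo(1) by blast
      ultimately show ?thesis using 4 zh cn_step(2) by blast
    qed
  qed
  then show "z \<in> hs h' \<Longrightarrow> (x, z) \<in> cn h'" by simp
qed

lemma cn_h_c: "x \<in> hs c \<Longrightarrow> y \<in> hs c \<Longrightarrow> (x, y) \<in> cn h"
  using cn_c sub_cn[OF _ sub] by blast

lemma cn_quo_imp: "(x, y) \<in> cn h' \<Longrightarrow> (x, y) \<in> cn h"
proof (induction rule: cn_induct)
  case (vr y z)
  then have "(y, z) \<in> vr h \<or> y \<in> hs c \<and> z \<in> hs c"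
    by (auto simp: quo_simps keep_def ext_def)
  then have "(y, z) \<in> cn h" using cn_h_c cn_base by blast
  with vr show ?case using cn_trans by blast
next
  case (ad y z)
  have *: "(z, w) \<in> cn h" if "(z, w) \<in> ad h \<union> tau c" for z w
    using that cn_h_c cn_base ext_c_hs by (auto simp: tau_c split: if_splits)
  have "(y, z) \<in> (ad h \<union> tau c)\<^sup>*" using ad by (simp add: quo_simps)
  then have "(y, z) \<in> cn h"
  proof induction
    case (step u v)
    show ?case by (rule cn_trans[OF step.IH *[OF step.hyps(2)]])
  qed simp
  with ad show ?case using cn_trans by blast
qed simp

text \<open>The entry set \<open>N\<close> of \<open>cn_project\<close> is empty for a component,
  the new vertex \<open>ext c\<close> for three external edges, and the two ends \<open>p\<close>,
  \<open>q\<close> of the new edge otherwise.\<close>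

lemma cn_quo:
  assumes "x \<in> hs h'" "y \<in> hs h'"
  shows "(x, y) \<in> cn h' \<longleftrightarrow> (x, y) \<in> cn h"
proof
  assume xy: "(x, y) \<in> cn h"
  show "(x, y) \<in> cn h'"
  proof (cases rule: kinds)
    case comp
    show ?thesis
    proof (rule cn_project[OF assms(1) xy, of "{}"])
      fix z w assume "z \<in> hs h - hs c" "w \<in> hs c" "(z, w) \<in> ad h"
      then show "\<exists>n\<in>{}. (z, n) \<in> cn h'"
        using comp_closed[OF comp, of w z] cn_base(2)[OF hp(6)] by blast
    qed (use assms in \<open>auto simp: quo_comp[OF comp]\<close>)
  next
    case three
    note q = quo_three[OF three]
    show ?thesis
    proof (rule cn_project[OF assms(1) xy, of "ext c"])
      fix z w assume zw: "z \<in> hs h - hs c" "w \<in> hs c" "(z, w) \<in> ad h"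
      then have "w \<in> ext c" using cross[of w z] hp(6) by blast
      with zw have "(z, w) \<in> ad h'" by (auto simp: q)
      with \<open>w \<in> ext c\<close> show "\<exists>n\<in>ext c. (z, n) \<in> cn h'" using cn_base by blast
    qed (use assms ext_c_hs in \<open>auto simp: q intro: cn_base\<close>)
  next
    case (two a b p q)
    note qq = quo_two[OF two(1-4)]
    have pq: "(p, q) \<in> ad h'" "(q, p) \<in> ad h'" by (auto simp: qq(1))
    show ?thesis
    proof (rule cn_project[OF assms(1) xy, of "{p, q}"])
      fix z w assume zw: "z \<in> hs h - hs c" "w \<in> hs c" "(z, w) \<in> ad h"
      then have "w \<in> {a, b}" using cross[of w z] hp(6) two(1) by blast
      then have "z \<in> {p, q}" using hp(7)[OF two(3), of z] hp(7)[OF two(4), of z] hp(6)[OF zw(3)] by auto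
      then show "\<exists>n\<in>{p, q}. (z, n) \<in> cn h'" by (auto intro: bexI[of _ z])
    qed (use assms qq(2,3) pq cn_base(2) in \<open>auto simp: qq(1)\<close>)
  qed
qed (rule cn_quo_imp)

text \<open>An external edge of \<open>h\<close> inside \<open>c\<close> is lost only when
  \<open>c\<close> is a component: three external edges are kept, and two are all internal to
  \<open>h\<close> if \<open>c\<close> is not a component.\<close>

lemma cext_quo:
  assumes "x \<in> hs h'"
  shows "cext h' x = cext h x"
proof -
  have "y \<in> hs h'" if y: "y \<in> ext h" "(x, y) \<in> cn h" for y
  proof (cases "y \<in> hs c")
    case True
    then have yc: "y \<in> ext c" using sub_ext[OF sub] y by blast
    show ?thesis
    proof (cases rule: kinds)
      case comp
      then have "x \<in> hs c" using comp_closed[OF comp True] cn_sym[OF cub y(2)] by blast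
      with assms show ?thesis by (simp add: quo_comp[OF comp])
    next
      case three with yc show ?thesis by (simp add: quo_three[OF three])
    qed (use y yc in blast)
  next
    case False then show ?thesis using y hs_quo(1) by (auto simp: ext_def)
  qed
  then show ?thesis using cn_quo[OF assms] by (auto simp: cext_def ext_quo)
qed

lemma comp_cext:
  assumes "ext c \<subseteq> ext h" "x \<in> hs c"
  shows "cext h x = ext c"
proof -
  have "cn h `` {x} = hs c" using comp_closed[OF assms] cn_h_c assms(2) by blast
  then show ?thesis using sub_ext[OF sub] assms(1) ext_c_hs unfolding cext_def by blast
qed

text \<open>A contraction makes a component of \<open>h\<close> disappear only by contracting all of
  it. Statements on the components of \<open>h\<close> can therefore be checked at half-edges of the
  quotient.\<close>

lemma class_meets:
  assumes "x \<in> hs h" "\<not> (ext c \<subseteq> ext h \<and> x \<in> hs c)"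
  obtains y where "y \<in> hs h'" "(x, y) \<in> cn h"
proof (cases "x \<in> hs c")
  case True
  show ?thesis
  proof (cases rule: kinds)
    case three
    then obtain y where "y \<in> ext c" by auto
    then show ?thesis using that[of y] True cn_h_c ext_c_hs by (simp add: quo_three[OF three])
  next
    case (two a b p q)
    note qq = quo_two[OF two(1-4)]
    have "a \<in> hs c" using two ext_c_hs by auto
    then have "(x, p) \<in> cn h" using True cn_h_c cn_step(2)[OF _ two(3)] by blast
    then show ?thesis using that[of p] qq(2) by (simp add: qq(1))
  qed (use True assms in blast)
next
  case False then show ?thesis using that[of x] assms hs_quo(1) by auto
qed

lemma Domain_ad_quo: "Domain (ad h') = Domain (ad h) \<inter> hs h'"
proof -
  have "Domain (ad h') \<subseteq> hs h'" using cubic_pairs(3)[OF cubic_quo] by blast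
  then show ?thesis using ext_quo hs_quo(2) unfolding ext_def by blast
qed

lemmas dom = Domain_ad_quo

text \<open>Contraction preserves the external edges of each surviving component, and a vertex
  becomes bare only by swallowing a component. The implication from the quotient to \<open>h\<close>
  later shows that expansions and insertions are admissible graphs.\<close>

lemma lfgh_quo: "lfgh h' \<longleftrightarrow> lfgh h"
proof
  assume l: "lfgh h'"
  have "vr h `` {x} \<inter> Domain (ad h) \<noteq> {}" if x: "x \<in> hs h" for x
  proof (cases "x \<in> hs c")
    case True
    then have "vr c `` {x} \<inter> Domain (ad c) \<noteq> {}" using subD'(1) by (auto simp: lfgh_def)
    then show ?thesis using subD'(4,5) by blast
  next
    case False
    then have "vr h' `` {x} \<inter> Domain (ad h') \<noteq> {}" using l x hs_quo(1) by (auto simp: lfgh_def)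
    then show ?thesis using vr_class_outside[of x] False x dom by auto
  qed
  moreover have "card (cext h x) = 2 \<or> card (cext h x) = 3" if x: "x \<in> hs h" for x
  proof (cases "ext c \<subseteq> ext h \<and> x \<in> hs c")
    case True then show ?thesis using comp_cext card_ext by auto
  next
    case False
    then obtain y where "y \<in> hs h'" "(x, y) \<in> cn h" using class_meets x by blast
    then show ?thesis using cext_eq[OF cub] cext_quo[of y] l by (auto simp: lfgh_def)
  qed
  ultimately show "lfgh h" using cub by (simp add: lfgh_def)
next
  assume l: "lfgh h"
  have "vr h' `` {x} \<inter> Domain (ad h') \<noteq> {}" if x: "x \<in> hs h'" for x
  proof (cases "x \<in> hs c")
    case True
    then have "keep c h \<noteq> {}" "x \<in> keep c h" using x by (auto simp: quo_simps)
    then have three: "card (ext c) = 3" "\<not> ext c \<subseteq> ext h" "x \<in> ext c"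
      by (auto simp: keep_c split: if_splits)
    then obtain y where y: "y \<in> ext c" "y \<notin> ext h" by auto
    then have "y \<in> Domain (ad h)" using ext_c_hs[of y] subD'(3) by (auto simp: ext_def)
    then have "y \<in> vr h' `` {x} \<inter> Domain (ad h')"
      using three y unfolding dom by (auto simp: quo_three[OF three(1,2)])
    then show ?thesis by blast
  next
    case False
    then have o: "x \<in> hs h - hs c" using x hs_quo(2) by blast
    then have "vr h `` {x} \<inter> Domain (ad h) \<noteq> {}" using l by (simp add: lfgh_def)
    then obtain y where "y \<in> vr h `` {x}" "y \<in> Domain (ad h)" by blast
    moreover from this have "y \<in> hs h'" using outside_c[of x y] o hs_quo(1) by auto
    ultimately show ?thesis using vr_class_outside[OF o] dom by blast
  qed
  moreover have "card (cext h' x) = 2 \<or> card (cext h' x) = 3" if x: "x \<in> hs h'" for x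
    using cext_quo[OF x] x hs_quo(2) l by (auto simp: lfgh_def)
  ultimately show "lfgh h'" using cubic_quo by (simp add: lfgh_def)
qed

end

section \<open>Nested subgraphs and iterated quotients\<close>

definition csub :: "hgraph \<Rightarrow> hgraph \<Rightarrow> bool"
  where "csub c h \<longleftrightarrow> sub c h \<and> conn c"

text \<open>If the two external edges of \<open>c\<close> were joined in \<open>h\<close>, then
  \<open>c\<close> with that edge would be a component of \<open>h\<close> without external
  edges.\<close>

lemma contraction_lfgh:
  assumes "lfgh h" "csub c h"
  shows "contraction h c"
proof
  show cub: "cubic h" and sub: "sub c h" and conn: "conn c"
    using assms by (auto simp: lfgh_cubic csub_def)
  fix a b assume card: "card (ext c) = 2" and ab: "a \<in> ext c" "b \<in> ext c"
  show "(a, b) \<notin> ad h"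
  proof
    assume ad: "(a, b) \<in> ad h"
    note hp = cubic_pairs[OF cub]
    have "a \<noteq> b" using ad hp(8) by blast
    then have ext: "ext c = {a, b}" using card ab by (auto simp: card_2_iff)
    have a: "a \<in> hs c" using ab by (simp add: ext_def)
    have "a \<notin> ext h" using ad by (auto simp: ext_def)
    then have disj: "ext c \<inter> ext h = {}"
    proof -
      have "card (cext c a) = 2 \<longrightarrow> cext c a \<subseteq> ext h \<or> cext c a \<inter> ext h = {}"
        using sub a by (simp add: sub_def)
      then show ?thesis
        using card conn_cext[OF subD(2)[OF sub] conn a] ab(1) \<open>a \<notin> ext h\<close> by auto
    qed
    have "y \<in> hs c" if "(a, y) \<in> cn h" for y
      using that
    proof (induction rule: cn_induct)
      case (vr y z) then show ?case using sub_vr_closed[OF sub cub] by blast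
    next
      case y: (ad y z)
      show ?case
      proof (cases "y \<in> ext c")
        case True
        then have "y = a \<and> z = b \<or> y = b \<and> z = a"
          using hp(7)[OF ad, of z] hp(7)[OF hp(6)[OF ad], of z] ext y by auto
        then show ?thesis using ab by (auto simp: ext_def)
      qed (use y sub_internal[OF sub cub] in blast)
    qed (rule a)
    then have "cext h a = {}" using disj sub_ext[OF sub] by (auto simp: cext_def)
    then show False using assms(1) a subD(3)[OF sub] by (fastforce simp: lfgh_def)
  qed
qed

text \<open>A path of \<open>g\<close> can leave a component of \<open>k\<close> only through one of
  its external edges, and here these are external in \<open>g\<close> as well.\<close>

lemma sub_component:
  assumes "sub k g" "cubic g" "x \<in> hs k" "cext k x \<subseteq> ext g"
  shows "(x, z) \<in> cn g \<Longrightarrow> z \<in> hs k \<and> (x, z) \<in> cn k" "cext g x = cext k x"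
proof -
  show *: "z \<in> hs k \<and> (x, z) \<in> cn k" if "(x, z) \<in> cn g" for z
    using that
  proof (induction rule: cn_induct)
    case (vr y z)
    then have "z \<in> hs k" using sub_vr_closed[OF assms(1,2)] by blast
    then show ?case using vr subD(4)[OF assms(1)] cn_step(1) by blast
  next
    case (ad y z)
    then have "y \<notin> cext k x" using assms(4) by (auto simp: ext_def)
    then have "y \<notin> ext k" using ad by (simp add: cext_def)
    then have "(y, z) \<in> ad k" "z \<in> hs k" using sub_internal(1,2)[OF assms(1,2)] ad by blast+
    then show ?case using ad cn_step(2) by blast
  qed (use assms in simp)
  show "cext g x = cext k x"
    using * sub_ext[OF assms(1)] sub_cn[OF _ assms(1)] assms(4) unfolding cext_def by blast
qed

text \<open>The condition on two external edges is the point. If they are external in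
  \<open>g\<close>, the component of \<open>k\<close> is a component of \<open>g\<close> and
  inherits the condition from there; otherwise both are internal to \<open>g\<close>, hence to
  \<open>h\<close>.\<close>

lemma sub_trans:
  assumes "sub k g" "sub g h"
  shows "sub k h"
proof -
  have "cext k x \<subseteq> ext h \<or> cext k x \<inter> ext h = {}" if x: "x \<in> hs k" "card (cext k x) = 2" for x
  proof (cases "cext k x \<subseteq> ext g")
    case True
    then show ?thesis
      using sub_component(2)[OF assms(1) subD(2)[OF assms(2)] x(1)] x subD(3)[OF assms(1)] assms(2)
      unfolding sub_def by (metis subsetD)
  next
    case False
    then have "cext k x \<inter> ext g = {}" using assms(1) x by (auto simp: sub_def)
    moreover have "cext k x \<subseteq> hs g" using subD(3)[OF assms(1)] by (auto simp: cext_def ext_def)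
    ultimately show ?thesis using sub_ext[OF assms(2)] by blast
  qed
  then show ?thesis
    using subD[OF assms(1)] subD(3,5,6)[OF assms(2)] by (auto simp: sub_def)
qed

text \<open>This is why \<open>ad (quo h k)\<close> is defined by a closure: closing up in two
  stages, with a restriction to \<open>H\<close> in between, loses no connection as long as the
  links \<open>T\<close> of the second stage lie inside \<open>H\<close>.\<close>

lemma rtrancl_compose:
  fixes A C T :: "('a \<times> 'a) set"
  assumes T: "T \<subseteq> H \<times> H" and x: "x \<in> H" and y: "y \<in> H"
    and A': "A' = {(x, y). x \<in> H \<and> y \<in> H \<and> x \<noteq> y \<and> (x, y) \<in> (A \<union> C)\<^sup>*}"
  shows "(x, y) \<in> (A' \<union> T)\<^sup>* \<longleftrightarrow> (x, y) \<in> (A \<union> C \<union> T)\<^sup>*"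
proof
  assume "(x, y) \<in> (A' \<union> T)\<^sup>*"
  moreover have "(A' \<union> T)\<^sup>* \<subseteq> (A \<union> C \<union> T)\<^sup>*"
  proof (rule rtrancl_subset_rtrancl, rule subsetI)
    fix z assume z: "z \<in> A' \<union> T"
    have "(A \<union> C)\<^sup>* \<subseteq> (A \<union> C \<union> T)\<^sup>*" by (rule rtrancl_mono) auto
    then show "z \<in> (A \<union> C \<union> T)\<^sup>*" using z unfolding A' by blast
  qed
  ultimately show "(x, y) \<in> (A \<union> C \<union> T)\<^sup>*" by blast
next
  assume xy: "(x, y) \<in> (A \<union> C \<union> T)\<^sup>*"
  have step: "(u, v) \<in> (A' \<union> T)\<^sup>*" if "u \<in> H" "v \<in> H" "(u, v) \<in> (A \<union> C)\<^sup>*" for u v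
    using that by (cases "u = v") (auto simp: A')
  \<comment> \<open>The point \<open>u\<close> of \<open>H\<close> is where the part of the path
    already rewritten ends; after it only steps of \<open>A\<close> and \<open>C\<close> have
    occurred.\<close>
  have "\<exists>u\<in>H. (x, u) \<in> (A' \<union> T)\<^sup>* \<and> (u, y) \<in> (A \<union> C)\<^sup>*"
    using xy
  proof induction
    case base then show ?case using x by blast
  next
    case (step v w)
    then obtain u where u: "u \<in> H" "(x, u) \<in> (A' \<union> T)\<^sup>*" "(u, v) \<in> (A \<union> C)\<^sup>*" by blast
    show ?case
    proof (cases "(v, w) \<in> T")
      case True
      then have vw: "v \<in> H" "w \<in> H" using T by auto
      then have "(x, v) \<in> (A' \<union> T)\<^sup>*"
        using u \<open>\<And>v u. u \<in> H \<Longrightarrow> v \<in> H \<Longrightarrow> (u, v) \<in> (A \<union> C)\<^sup>* \<Longrightarrow> (u, v) \<in> (A' \<union> T)\<^sup>*\<close>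
        by (meson rtrancl_trans)
      then have "(x, w) \<in> (A' \<union> T)\<^sup>*" using True by (meson UnI2 rtrancl.rtrancl_into_rtrancl)
      then show ?thesis using vw by blast
    next
      case False
      then have "(u, w) \<in> (A \<union> C)\<^sup>*" using step.hyps u by (meson Un_iff rtrancl.rtrancl_into_rtrancl)
      then show ?thesis using u by blast
    qed
  qed
  then show "(x, y) \<in> (A' \<union> T)\<^sup>*" using step y by (meson rtrancl_trans)
qed

locale nested_contraction =
  fixes h g c
  assumes lh: "lfgh h" and gh: "sub g h" and cg: "csub c g"
begin

lemma ch: "csub c h"
  using cg gh sub_trans by (auto simp: csub_def)

sublocale H: contraction h c
  by (rule contraction_lfgh[OF lh ch])

sublocale G: contraction g c
  by (rule contraction_lfgh[OF subD(1)[OF gh] cg])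

abbreviation "h' \<equiv> quo h c"
abbreviation "g' \<equiv> quo g c"

lemmas gD = subD[OF gh]
lemmas c_hs = subD(3)[OF G.sub]

lemma keep_mono: "keep c g \<subseteq> keep c h"
  using sub_ext[OF gh] c_hs G.ext_c_hs by (auto simp: G.keep_c H.keep_c)

lemma g'_hs: "hs g' \<subseteq> hs h'"
  using keep_mono gD(3) by (auto simp: quo_simps)

lemma sub_quo: "sub g' h'"
  unfolding sub_def
proof (intro conjI ballI impI)
  show "lfgh g'" using G.lfgh_quo gD(1) by simp
  show "hs g' \<subseteq> hs h'" by (rule g'_hs)
  show "vr g' = vr h' \<inter> hs g' \<times> UNIV"
  proof (rule set_eqI, clarify)
    fix x y
    have kc: "keep c k \<subseteq> hs c" for k by (auto simp: keep_def ext_def)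
    \<comment> \<open>If \<open>c\<close> survives as a vertex of \<open>g/c\<close>, it is the same
      vertex of \<open>h/c\<close>.\<close>
    have keep: "keep c g = keep c h" if "keep c g \<noteq> {}"
      using that keep_mono by (auto simp: G.keep_c H.keep_c split: if_splits)
    show "(x, y) \<in> vr g' \<longleftrightarrow> (x, y) \<in> vr h' \<inter> hs g' \<times> UNIV"
    proof (cases "x \<in> hs c")
      case True
      then show ?thesis using kc keep c_hs by (auto simp: quo_simps)
    next
      case False
      then show ?thesis using kc[of g] kc[of h] gD(3) gD(4)[of x y] sub_vr_closed[OF gh H.cub, of x y]
        by (auto simp: quo_simps)
    qed
  qed
  show "ad g' \<subseteq> ad h'"
  proof -
    have "(ad g \<union> tau c)\<^sup>* \<subseteq> (ad h \<union> tau c)\<^sup>*" using gD(5) by (intro rtrancl_mono) auto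
    then show ?thesis using g'_hs by (auto simp: quo_simps(3))
  qed
  fix x assume x: "x \<in> hs g'" "card (cext g' x) = 2"
  then have xg: "x \<in> hs g" using G.hs_quo by blast
  have sub: "cext g' x \<subseteq> hs h'" using g'_hs by (auto simp: cext_def ext_def)
  have "cext g x \<subseteq> ext h \<or> cext g x \<inter> ext h = {}"
    using gh x xg by (auto simp: sub_def G.cext_quo)
  then show "cext g' x \<subseteq> ext h' \<or> cext g' x \<inter> ext h' = {}"
    using sub by (auto simp: H.ext_quo G.cext_quo[OF x(1)])
qed

text \<open>A subgraph \<open>c\<close> with three external edges that is not a component of
  \<open>g\<close> keeps them, and one with two has none that are external in \<open>g\<close>. So
  only a component of \<open>g\<close> can swallow \<open>x\<close>.\<close>

lemma dropped:
  assumes "x \<in> ext g" "x \<notin> hs g'"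
  shows "ext c \<subseteq> ext g" "x \<in> ext c" "cext g x = ext c"
proof -
  have x: "x \<in> hs c" using assms G.hs_quo(1) by (auto simp: ext_def)
  then show 1: "x \<in> ext c" using sub_ext[OF G.sub] assms by blast
  show 2: "ext c \<subseteq> ext g"
  proof (cases rule: G.kinds)
    case three then show ?thesis using assms 1 by (simp add: quo_simps G.keep_c)
  qed (use 1 assms in auto)
  show "cext g x = ext c" by (rule G.comp_cext[OF 2 x])
qed

lemma keep_quo: "keep g' h' = keep g h \<inter> hs g'"
proof -
  have eq: "cext g x \<subseteq> ext h \<inter> hs h' \<longleftrightarrow> cext g x \<subseteq> ext h" if "x \<in> hs g'" for x
  proof -
    have "cext g x \<subseteq> hs g'" using G.cext_quo[OF that] by (auto simp: cext_def ext_def)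
    then show ?thesis using g'_hs by blast
  qed
  have "x \<in> keep g' h' \<longleftrightarrow> x \<in> keep g h \<inter> hs g'" for x
    using eq[of x]
    by (cases "x \<in> hs g'"; simp add: keep_def G.ext_quo G.cext_quo H.ext_quo; blast)
  then show ?thesis by blast
qed

text \<open>If \<open>c\<close> has three external edges and is a component of \<open>g\<close> but
  not of \<open>h\<close>, it is a vertex of \<open>h/c\<close> that \<open>g/c\<close> does not
  see. The quotient by \<open>g/c\<close> leaves this vertex alone, in accordance with
  \<open>h/g\<close>, which keeps it.\<close>

lemma keep_dropped: "keep g h - hs g' = keep c h - keep c g"
proof (intro set_eqI iffI)
  fix x assume x: "x \<in> keep g h - hs g'"
  then have "x \<in> ext g" "x \<notin> hs g'" "card (cext g x) = 3" "\<not> cext g x \<subseteq> ext h"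
    by (auto simp: keep_def)
  with dropped[OF this(1,2)] show "x \<in> keep c h - keep c g"
    by (auto simp: G.keep_c H.keep_c)
next
  fix x assume x: "x \<in> keep c h - keep c g"
  then have *: "card (ext c) = 3" "\<not> ext c \<subseteq> ext h" "x \<in> ext c" "ext c \<subseteq> ext g"
    by (auto simp: G.keep_c H.keep_c split: if_splits)
  then have "cext g x = ext c" using G.comp_cext G.ext_c_hs by blast
  moreover have "x \<notin> hs g'" using * G.ext_c_hs by (auto simp: G.quo_comp)
  ultimately show "x \<in> keep g h - hs g'" using * by (auto simp: keep_def)
qed

lemma hs_diff: "hs h' - hs g' = (hs h - hs g) \<union> (keep c h - keep c g)"
  using c_hs gD(3) keep_mono by (auto simp: quo_simps keep_def ext_def)

lemma hs_quo_quo: "hs (quo h' g') = hs (quo h g)"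
  using hs_diff keep_quo keep_dropped by (auto simp: quo_simps(1)[of h'] quo_simps(1)[of h g])

text \<open>If \<open>c\<close> is a component of \<open>g\<close> with two external edges, its
  short circuit is missing from \<open>tau g'\<close> but has been made in \<open>h/c\<close>.
  Adding \<open>tau c\<close> on both sides balances this.\<close>

lemma tau_quo: "tau g' \<union> tau c = tau g \<union> tau c" "tau g' \<subseteq> hs g' \<times> hs g'"
proof -
  have 1: "tau g' \<subseteq> tau g"
    using G.cext_quo by (auto simp: tau_def G.ext_quo)
  have "(a, b) \<in> tau g' \<union> tau c" if "(a, b) \<in> tau g" for a b
  proof (cases "a \<in> hs g'")
    case True
    then show ?thesis using that G.cext_quo[OF True] by (auto simp: tau_def G.ext_quo)
  next
    case False
    have "a \<in> ext g" "b \<in> cext g a" "card (cext g a) = 2" using that by (auto simp: tau_def)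
    then have "(a, b) \<in> tau c" using dropped(2,3)[of a] False by (simp add: G.tau_c)
    then show ?thesis by simp
  qed
  with 1 show "tau g' \<union> tau c = tau g \<union> tau c" by auto
  show "tau g' \<subseteq> hs g' \<times> hs g'" by (auto simp: tau_def ext_def cext_def)
qed

text \<open>The third isomorphism theorem, an equality because no half-edge is renamed. For the
  matching, \<open>rtrancl_compose\<close> merges the two closures, and it remains to see that
  \<open>tau c\<close> connects nothing that \<open>tau g\<close> does not connect.\<close>

lemma quo_quo: "quo h' g' = quo h g"
proof (rule hgraph.equality)
  show "hs (quo h' g') = hs (quo h g)" by (rule hs_quo_quo)
  show "vr (quo h' g') = vr (quo h g)"
  proof (rule set_eqI, clarify)
    fix x y
    have kc: "keep c k \<subseteq> hs c" for k by (auto simp: keep_def ext_def)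
    have hg: "keep g h \<subseteq> hs g" by (auto simp: keep_def ext_def)
    have c: "x \<in> keep c h - keep c g \<Longrightarrow> (x, y) \<in> cn g \<Longrightarrow> y \<in> hs c" for x y
      using G.comp_closed G.ext_c_hs by (auto simp: G.keep_c H.keep_c split: if_splits)
    have c': "x \<in> keep c h - keep c g \<Longrightarrow> x \<in> keep g h \<and> x \<notin> hs g'" for x
      using keep_dropped by blast
    have c'': "x \<in> keep g h \<Longrightarrow> x \<notin> hs g' \<Longrightarrow> x \<in> keep c h - keep c g" for x
      using keep_dropped by blast
    have chs: "x \<in> keep c h - keep c g \<Longrightarrow> x \<in> hs c" for x using kc by blast
    show "(x, y) \<in> vr (quo h' g') \<longleftrightarrow> (x, y) \<in> vr (quo h g)"
    proof
      assume "(x, y) \<in> vr (quo h' g')"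
      then consider "(x, y) \<in> vr h'" "x \<in> hs h' - hs g'" "y \<in> hs h' - hs g'"
        | "(x, y) \<in> cn g'" "x \<in> keep g' h'" "y \<in> keep g' h'" by (auto simp: quo_simps(2))
      then show "(x, y) \<in> vr (quo h g)"
      proof cases
        case 1
        then consider "(x, y) \<in> vr h" "x \<notin> hs c" "y \<notin> hs c" | "(x, y) \<in> cn c" "x \<in> keep c h" "y \<in> keep c h"
          by (auto simp: quo_simps(2))
        then show ?thesis
        proof cases
          case 1
          then have "x \<in> hs h - hs g" "y \<in> hs h - hs g"
            using \<open>x \<in> hs h' - hs g'\<close> \<open>y \<in> hs h' - hs g'\<close> chs unfolding hs_diff by blast+
          then show ?thesis using 1 by (simp add: quo_simps)
        next
          case 2
          then have "x \<in> keep c h - keep c g" "y \<in> keep c h - keep c g"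
            using \<open>x \<in> hs h' - hs g'\<close> \<open>y \<in> hs h' - hs g'\<close> kc[of h] c_hs unfolding hs_diff by blast+
          then show ?thesis using c' sub_cn[OF 2(1) G.sub] by (simp add: quo_simps)
        qed
      next
        case 2
        then show ?thesis using G.cn_quo_imp by (auto simp: quo_simps(2)[of h g] keep_quo)
      qed
    next
      assume "(x, y) \<in> vr (quo h g)"
      then consider "(x, y) \<in> vr h" "x \<in> hs h - hs g" "y \<in> hs h - hs g"
        | "(x, y) \<in> cn g" "x \<in> keep g h" "y \<in> keep g h" by (auto simp: quo_simps(2))
      then show "(x, y) \<in> vr (quo h' g')"
      proof cases
        case 1
        then have "x \<in> hs h' - hs g'" "y \<in> hs h' - hs g'" "x \<notin> hs c" "y \<notin> hs c"
          using c_hs unfolding hs_diff by blast+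
        then show ?thesis using 1 by (auto simp: quo_simps(2)[of h'] quo_simps(2)[of h c])
      next
        case 2
        \<comment> \<open>A component of \<open>g\<close> either survives in \<open>g/c\<close> or
          is \<open>c\<close> itself, so the two ends have the same fate.\<close>
        have xy: "x \<in> hs g' \<longleftrightarrow> y \<in> hs g'"
        proof -
          have "y \<notin> hs g'" if "x \<notin> hs g'" "x \<in> keep g h" "y \<in> keep g h" "(x, y) \<in> cn g" for x y
          proof -
            have "x \<in> keep c h - keep c g" using c'' that by blast
            then have "y \<in> hs c" "ext c \<subseteq> ext g" using c that
              by (auto simp: G.keep_c H.keep_c split: if_splits)
            then show ?thesis by (simp add: G.quo_comp)
          qed
          then show ?thesis using 2 cn_sym[OF gD(2)] by blast
        qed
        show ?thesis
        proof (cases "x \<in> hs g'")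
          case True
          then show ?thesis using 2 xy G.cn_quo by (auto simp: quo_simps(2)[of h'] keep_quo)
        next
          case False
          then have *: "x \<in> keep c h - keep c g" "y \<in> keep c h - keep c g" using xy 2 c'' by blast+
          then have "(x, y) \<in> cn c" using chs G.cn_c by blast
          then have "(x, y) \<in> vr h'" using * by (simp add: quo_simps)
          then show ?thesis using * hs_diff by (simp add: quo_simps(2)[of h'])
        qed
      qed
    qed
  qed
  have "(x, y) \<in> (ad h' \<union> tau g')\<^sup>* \<longleftrightarrow> (x, y) \<in> (ad h \<union> tau g)\<^sup>*"
    if xy: "x \<in> hs (quo h g)" "y \<in> hs (quo h g)" for x y
  proof -
    have "x \<in> hs h'" "y \<in> hs h'"
      using xy g'_hs unfolding hs_quo_quo[symmetric] by (auto simp: quo_simps(1)[of h'] keep_def ext_def)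
    then have "(x, y) \<in> (ad h' \<union> tau g')\<^sup>* \<longleftrightarrow> (x, y) \<in> (ad h \<union> tau c \<union> tau g')\<^sup>*"
      using tau_quo(2) g'_hs by (intro rtrancl_compose[of _ "hs h'"]) (auto simp: quo_simps(3)[of h c])
    also have "ad h \<union> tau c \<union> tau g' = ad h \<union> tau g \<union> tau c" using tau_quo(1) by blast
    also have "(x, y) \<in> (ad h \<union> tau g \<union> tau c)\<^sup>* \<longleftrightarrow> (x, y) \<in> (ad h \<union> tau g)\<^sup>*"
    proof
      assume "(x, y) \<in> (ad h \<union> tau g)\<^sup>*"
      moreover have "(ad h \<union> tau g)\<^sup>* \<subseteq> (ad h \<union> tau g \<union> tau c)\<^sup>*" by (intro rtrancl_mono) auto
      ultimately show "(x, y) \<in> (ad h \<union> tau g \<union> tau c)\<^sup>*" by blast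
    next
      assume path: "(x, y) \<in> (ad h \<union> tau g \<union> tau c)\<^sup>*"
      show "(x, y) \<in> (ad h \<union> tau g)\<^sup>*"
      proof (cases "tau c \<subseteq> tau g")
        case True
        then have "ad h \<union> tau g \<union> tau c = ad h \<union> tau g" by blast
        then show ?thesis using path by simp
      next
        case False
        then have two: "card (ext c) = 2" by (auto simp: G.tau_c split: if_splits)
        have "\<not> ext c \<subseteq> ext g"
        proof
          assume e: "ext c \<subseteq> ext g"
          then have "cext g a = ext c" if "a \<in> ext c" for a using G.comp_cext G.ext_c_hs that by blast
          then have "tau c \<subseteq> tau g" using e two by (auto simp: tau_def G.cext_c G.ext_c_hs)
          with False show False by simp
        qed
        \<comment> \<open>The external edges of \<open>c\<close> are now internal to
          \<open>g\<close>. A path that starts outside the internal edges of \<open>g\<close> stays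
          outside them and never meets \<open>c\<close>.\<close>
        then have disj: "ext c \<inter> ext g = {}" using G.two_ext two by blast
        have x: "x \<notin> Domain (ad g)"
          using xy(1) cubic_pairs(3)[OF gD(2)] by (auto simp: quo_simps(1) keep_def ext_def)
        have "(x, y) \<in> (ad h \<union> tau g)\<^sup>* \<and> y \<notin> Domain (ad g)"
          using path
        proof induction
          case (step y z)
          have "y \<notin> ext c"
            using step.IH disj G.ext_c_hs c_hs by (auto simp: ext_def)
          then have yz: "(y, z) \<in> ad h \<union> tau g" using step.hyps(2) by (auto simp: G.tau_c split: if_splits)
          have "z \<notin> Domain (ad g)"
          proof
            assume z: "z \<in> Domain (ad g)"
            then have "z \<in> hs g" "z \<notin> ext g" using cubic_pairs(3)[OF gD(2)] by (auto simp: ext_def)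
            moreover from this have "(y, z) \<in> ad h" using yz by (auto simp: tau_def cext_def)
            ultimately have "(z, y) \<in> ad g" using sub_internal(1)[OF gh H.cub] H.hp(6) by blast
            then show False using step.IH cubic_pairs(6)[OF gD(2)] by blast
          qed
          then show ?case using step.IH yz by (meson rtrancl.rtrancl_into_rtrancl)
        qed (use x in simp)
        then show ?thesis by simp
      qed
    qed
    finally show ?thesis .
  qed
  then show "ad (quo h' g') = ad (quo h g)"
    by (auto simp: quo_simps(3)[of h'] quo_simps(3)[of h g] hs_quo_quo)
qed simp

end

section \<open>Undoing a contraction\<close>

text \<open>Recovers \<open>g\<close> from \<open>c\<close> and \<open>e = g/c\<close>: \<open>N\<close> is the edge of \<open>e\<close> to be cut, if any, and \<open>L\<close> joins its
  ends to \<open>c\<close>.\<close>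

definition expand :: "hgraph \<Rightarrow> hgraph \<Rightarrow> (nat \<times> nat) set \<Rightarrow> (nat \<times> nat) set \<Rightarrow> hgraph"
  where "expand c e N L = \<lparr>hs = hs c \<union> hs e, vr = vr c \<union> vr e \<inter> (hs e - hs c) \<times> (hs e - hs c),
    ad = ad c \<union> (ad e - N) \<union> L\<rparr>"

text \<open>The assumption \<open>closed\<close> says that a vertex of \<open>e\<close> lies inside
  \<open>hs c\<close> entirely or not at all, so old and new vertices do not mix.\<close>

lemma cubic_union_vr:
  assumes c: "cubic c" and e: "cubic e" and closed: "\<And>x y. (x, y) \<in> vr e \<Longrightarrow> x \<in> hs c \<longleftrightarrow> y \<in> hs c"
    and g: "hs g = hs c \<union> hs e" "vr g = vr c \<union> vr e \<inter> (hs e - hs c) \<times> (hs e - hs c)"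
  shows "finite (hs g)" "equiv (hs g) (vr g)" "x \<in> hs g \<Longrightarrow> card (vr g `` {x}) = 3"
proof -
  show "finite (hs g)" using g cubicD(1)[OF c] cubicD(1)[OF e] by simp
  show "equiv (hs g) (vr g)"
  proof (rule equivI)
    show "vr g \<subseteq> hs g \<times> hs g" using cubicD(8)[OF c] by (auto simp: g)
    show "refl_on (hs g) (vr g)" using cubicD(11)[OF c] cubicD(11)[OF e] by (auto simp: refl_on_def g)
    show "sym (vr g)" using cubicD(9)[OF c] cubicD(9)[OF e] by (auto simp: sym_def g)
    have tr: "\<And>x y z. (x, y) \<in> vr c \<Longrightarrow> (y, z) \<in> vr c \<Longrightarrow> (x, z) \<in> vr c"
      "\<And>x y z. (x, y) \<in> vr e \<Longrightarrow> (y, z) \<in> vr e \<Longrightarrow> (x, z) \<in> vr e"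
      using cubicD(10)[OF c] cubicD(10)[OF e] by (auto dest: transD)
    show "trans (vr g)"
    proof (rule transI)
      fix x y z assume "(x, y) \<in> vr g" "(y, z) \<in> vr g"
      then show "(x, z) \<in> vr g"
        using tr(1)[of x y z] tr(2)[of x y z] cubic_pairs(1,2)[OF c] unfolding g by blast
    qed
  qed
  assume x: "x \<in> hs g"
  show "card (vr g `` {x}) = 3"
  proof (cases "x \<in> hs c")
    case True
    then have "vr g `` {x} = vr c `` {x}" by (auto simp: g)
    then show ?thesis using cubicD(3)[OF c True] by simp
  next
    case False
    then have "vr g `` {x} = vr e `` {x}"
      using closed[of x] cubic_pairs(1)[OF c] cubic_pairs(1,2)[OF e] unfolding g by blast
    then show ?thesis using cubicD(3)[OF e, of x] False x g by simp
  qed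
qed

lemma expand_disjoint:
  assumes c: "lfgh c" "conn c" and e: "cubic e" and disj: "hs c \<inter> hs e = {}"
  defines "g \<equiv> expand c e {} {}"
  shows "contraction g c" "quo g c = e" "ext c \<subseteq> ext g"
proof -
  note cc = lfgh_cubic[OF c(1)]
  have g: "hs g = hs c \<union> hs e" "vr g = vr c \<union> vr e" "ad g = ad c \<union> ad e"
    using cubicD(8)[OF e] disj unfolding g_def expand_def by auto
  have closed: "x \<in> hs c \<longleftrightarrow> y \<in> hs c" if "(x, y) \<in> vr e" for x y
    using that cubic_pairs(1,2)[OF e] disj by blast
  have vr: "vr e = vr e \<inter> (hs e - hs c) \<times> (hs e - hs c)" using cubicD(8)[OF e] disj by auto
  note u = cubic_union_vr[OF cc e closed g(1), unfolded vr[symmetric], OF _ g(2)]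
  have "ad g \<subseteq> hs g \<times> hs g" "sym (ad g)" "irrefl (ad g)" "single_valued (ad g)"
    using cubicD(4-7)[OF cc] cubicD(4-7)[OF e] disj
    by (auto simp: g sym_def irrefl_def single_valued_def)
  then have cg: "cubic g" using u by (simp add: cubic_def)
  show ext: "ext c \<subseteq> ext g"
    using cubic_pairs(3)[OF e] disj by (auto simp: ext_def g)
  have "x \<in> ext c" if "x \<in> cext c y" for x y using that by (simp add: cext_def)
  then have s: "sub c g"
    using c(1) ext cubic_pairs(1)[OF cc] cubic_pairs(1)[OF e] disj by (auto simp: sub_def g)
  show con: "contraction g c"
  proof
    fix a b assume "a \<in> ext c" then show "(a, b) \<notin> ad g" using ext by (auto simp: ext_def)
  qed (use cg s c in auto)
  show "quo g c = e"
    using contraction.quo_comp[OF con ext] cubicD(4,8)[OF e] cubicD(4,8)[OF cc] disj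
    by (intro hgraph.equality) (auto simp: g)
qed

text \<open>By \<open>int\<close> and \<open>vertex\<close> the external edges of \<open>c\<close>
  form a vertex of \<open>e\<close>. This vertex must not be bare, since otherwise \<open>c\<close>
  would be a component of the expansion and would vanish in its quotient.\<close>

lemma expand_vertex:
  assumes c: "lfgh c" "conn c" and e: "cubic e" and int: "hs c \<inter> hs e = ext c"
    and vertex: "\<And>x. x \<in> ext c \<Longrightarrow> vr e `` {x} = ext c" "card (ext c) = 3" "\<not> ext c \<subseteq> ext e"
  defines "g \<equiv> expand c e {} {}"
  shows "contraction g c" "quo g c = e" "\<not> ext c \<subseteq> ext g"
proof -
  note cc = lfgh_cubic[OF c(1)]
  have g: "hs g = hs c \<union> hs e" "vr g = vr c \<union> vr e \<inter> (hs e - hs c) \<times> (hs e - hs c)" "ad g = ad c \<union> ad e"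
    unfolding g_def expand_def by auto
  have closed: "x \<in> hs c \<longleftrightarrow> y \<in> hs c" if "(x, y) \<in> vr e" for x y
    using that cubic_pairs(1,2,5)[OF e that] int vertex(1)[of x] vertex(1)[of y] by blast
  note u = cubic_union_vr[OF cc e closed g(1,2)]
  have dj: "(x, y) \<in> ad c \<Longrightarrow> x \<notin> hs e \<and> y \<notin> hs e" for x y
    using int cubic_pairs(3,4,6)[OF cc, of x y] by (auto simp: ext_def)
  have "ad g \<subseteq> hs g \<times> hs g" "sym (ad g)" "irrefl (ad g)"
    using cubicD(4-7)[OF cc] cubicD(4-7)[OF e]
    by (auto simp: g sym_def irrefl_def)
  moreover have "single_valued (ad g)"
    using cubicD(7)[OF cc] cubicD(7)[OF e] dj cubic_pairs(3)[OF e]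
    unfolding g single_valued_def by blast
  ultimately have cg: "cubic g" using u by (simp add: cubic_def)
  show ext: "\<not> ext c \<subseteq> ext g"
    using vertex(3) int by (auto simp: ext_def g)
  have "cext c x = ext c" if "x \<in> hs c" for x using conn_cext[OF cc c(2) that] .
  then have s: "sub c g"
    using c(1) vertex(2) cubic_pairs(1)[OF cc] by (auto simp: sub_def g)
  show con: "contraction g c"
    by standard (use cg s c vertex(2) in auto)
  have vr_e: "vr e = vr g \<inter> (hs g - hs c) \<times> (hs g - hs c) \<union> ext c \<times> ext c"
  proof -
    have "(x, y) \<in> vr e \<longleftrightarrow> (x, y) \<in> ext c \<times> ext c" if "x \<in> hs c" for x y
      using that vertex(1)[of x] int cubic_pairs(1)[OF e, of x y] by blast
    moreover have "(x, y) \<in> vr e \<longleftrightarrow> (x, y) \<in> vr g \<inter> (hs g - hs c) \<times> (hs g - hs c)" if "x \<notin> hs c" for x y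
      using that closed[of x y] cubic_pairs(1,2)[OF e, of x y] cubic_pairs(1)[OF cc, of x y]
      unfolding g by blast
    moreover have "ext c \<subseteq> hs c" by (auto simp: ext_def)
    ultimately have "(x, y) \<in> vr e \<longleftrightarrow> (x, y) \<in> vr g \<inter> (hs g - hs c) \<times> (hs g - hs c) \<union> ext c \<times> ext c" for x y
      by (cases "x \<in> hs c") auto
    then show ?thesis by auto
  qed
  have hs_e: "hs e = (hs g - hs c) \<union> ext c" using int by (auto simp: g)
  have ad_e: "ad e = ad g \<inter> hs e \<times> hs e" using dj cubic_pairs(3,4)[OF e] unfolding g by auto
  show "quo g c = e"
    using contraction.quo_three[OF con vertex(2) ext] hs_e vr_e ad_e
    by (intro hgraph.equality) simp_all
qed

lemma expand_edge:
  assumes c: "lfgh c" "conn c" and e: "cubic e" and disj: "hs c \<inter> hs e = {}"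
    and ab: "ext c = {a, b}" "a \<noteq> b" and pq: "(p, q) \<in> ad e"
  defines "g \<equiv> expand c e {(p, q), (q, p)} {(a, p), (b, q), (p, a), (q, b)}"
  shows "contraction g c" "quo g c = e" "ext c \<inter> ext g = {}"
proof -
  note cc = lfgh_cubic[OF c(1)]
  note ep = cubic_pairs[OF e] and cp = cubic_pairs[OF cc]
  have pq': "p \<in> hs e" "q \<in> hs e" "p \<noteq> q" "(q, p) \<in> ad e" using ep(3,4,6,8) pq by auto
  have g: "hs g = hs c \<union> hs e" "vr g = vr c \<union> vr e"
    "ad g = ad c \<union> (ad e - {(p, q), (q, p)}) \<union> {(a, p), (b, q), (p, a), (q, b)}"
    using cubicD(8)[OF e] disj unfolding g_def expand_def by auto
  have abc: "a \<in> hs c" "b \<in> hs c" "a \<notin> hs e" "b \<notin> hs e" "p \<notin> hs c" "q \<notin> hs c"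
    "a \<notin> Domain (ad c)" "b \<notin> Domain (ad c)"
    using ab disj pq' by (auto simp: ext_def)
  have closed: "x \<in> hs c \<longleftrightarrow> y \<in> hs c" if "(x, y) \<in> vr e" for x y
    using that ep(1,2) disj by blast
  have vr: "vr e = vr e \<inter> (hs e - hs c) \<times> (hs e - hs c)" using cubicD(8)[OF e] disj by auto
  note u = cubic_union_vr[OF cc e closed g(1), unfolded vr[symmetric], OF _ g(2)]
  \<comment> \<open>The partner of each half-edge in closed form, from which single-valuedness can
    be read off.\<close>
  have adj: "(x, y) \<in> ad g \<longleftrightarrow>
     (if x = a then y = p else if x = b then y = q else if x = p then y = a else if x = q then y = b
      else if x \<in> hs c then (x, y) \<in> ad c else (x, y) \<in> ad e)" for x y
  proof -
    have "(p, y) \<in> ad e \<longleftrightarrow> y = q" "(q, y) \<in> ad e \<longleftrightarrow> y = p"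
      using pq pq'(4) ep(7)[OF pq, of y] ep(7)[OF pq'(4), of y] by auto
    moreover have "(a, y) \<notin> ad c" "(b, y) \<notin> ad c" "(x, y) \<in> ad e \<Longrightarrow> x \<notin> hs c"
      "(x, y) \<in> ad c \<Longrightarrow> x \<in> hs c" "(p, y) \<notin> ad c" "(q, y) \<notin> ad c" "(a, y) \<notin> ad e" "(b, y) \<notin> ad e"
      using abc ep(3) cp(3) disj by blast+
    ultimately show ?thesis using abc(3-6) pq'(1-3) ab(2) unfolding g(3) by auto
  qed
  have ad1: "ad g \<subseteq> hs g \<times> hs g" "irrefl (ad g)"
    using cubicD(4,6)[OF cc] cubicD(4,6)[OF e] abc pq' by (auto simp: g irrefl_def)
  have ad2: "sym (ad g)" using cubicD(5)[OF cc] cubicD(5)[OF e] by (auto simp: g sym_def)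
  have ad3: "single_valued (ad g)"
    unfolding single_valued_def adj using cp(7) ep(7) by (auto split: if_splits)
  have cg: "cubic g" using u ad1 ad2 ad3 by (simp add: cubic_def)
  show ext: "ext c \<inter> ext g = {}" using ab(1) by (auto simp: ext_def g)
  have "cext c x = ext c" if "x \<in> hs c" for x using conn_cext[OF cc c(2) that] .
  then have s: "sub c g"
    using c(1) ext cp(1) ep(1) disj by (auto simp: sub_def g)
  show con: "contraction g c"
  proof
    fix x y assume "x \<in> ext c" "y \<in> ext c" then show "(x, y) \<notin> ad g"
      using ab abc pq' unfolding adj by auto
  qed (use cg s c in auto)
  have ad: "ad e = ad g \<inter> (hs g - hs c) \<times> (hs g - hs c) \<union> {(p, q), (q, p)}"
  proof (rule set_eqI, clarify)
    fix x y
    have 1: "hs g - hs c = hs e" using disj by (auto simp: g)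
    have "x \<in> hs e \<Longrightarrow> (x, y) \<notin> ad c" using cp(3) disj by blast
    then show "(x, y) \<in> ad e \<longleftrightarrow> (x, y) \<in> ad g \<inter> (hs g - hs c) \<times> (hs g - hs c) \<union> {(p, q), (q, p)}"
      unfolding 1 using ep(3,4)[of x y] abc(3,4) pq pq'(4) by (auto simp: g(3))
  qed
  have "hs g - hs c = hs e" "vr g \<inter> hs e \<times> hs e = vr e"
    using disj cubicD(8)[OF cc] cubicD(8)[OF e] by (auto simp: g)
  moreover have "(a, p) \<in> ad g" "(b, q) \<in> ad g" by (auto simp: g)
  ultimately show "quo g c = e"
    using contraction.quo_two(1)[OF con ab, of p q] ad by (intro hgraph.equality) simp_all
qed

context
  fixes h c assumes lh: "lfgh h" and ch: "csub c h"
begin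

interpretation H: contraction h c
  by (rule contraction_lfgh[OF lh ch])

text \<open>The common part of all expansions. The condition on components with two external edges
  is \<open>two_ext\<close> for \<open>c\<close> itself and is inherited from \<open>quo h c\<close>
  for the others, whose external edges do not change.\<close>

lemma sub_expand:
  assumes e: "sub e (quo h c)" and con: "contraction g c" and qg: "quo g c = e"
    and hs: "hs g = hs c \<union> hs e" and ad: "ad g \<subseteq> ad h" and vr: "vr g = vr c \<union> vr e \<inter> (hs e - hs c) \<times> (hs e - hs c)"
  shows "sub g h" "csub c g"
proof -
  interpret G: contraction g c by (rule con)
  show "csub c g" using G.sub G.conn by (simp add: csub_def)
  have e_hs: "hs e \<subseteq> hs (quo h c)" using subD(3)[OF e] .
  show "sub g h"
    unfolding sub_def
  proof (intro conjI ballI impI)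
    show "lfgh g" using G.lfgh_quo qg subD(1)[OF e] by simp
    show "hs g \<subseteq> hs h" using hs e_hs H.hs_quo(2) H.subD'(3) by auto
    show "ad g \<subseteq> ad h" by (rule ad)
    show "vr g = vr h \<inter> hs g \<times> UNIV"
    proof (rule set_eqI, clarify)
      fix x y
      show "(x, y) \<in> vr g \<longleftrightarrow> (x, y) \<in> vr h \<inter> hs g \<times> UNIV"
      proof (cases "x \<in> hs c")
        case True
        then show ?thesis using H.subD'(4)[of x y] by (auto simp: vr hs)
      next
        case False
        have 1: "(x, y) \<in> vr e \<longleftrightarrow> (x, y) \<in> vr (quo h c) \<and> x \<in> hs e" using subD(4)[OF e] .
        have 2: "(x, y) \<in> vr (quo h c) \<longleftrightarrow> (x, y) \<in> vr h" if "x \<in> hs h"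
          using H.vr_class_outside[of x] that False by auto
        have 3: "y \<notin> hs c" if "(x, y) \<in> vr h" using that False sub_vr_closed[OF H.sub H.cub] by blast
        have 4: "y \<in> hs e" if "(x, y) \<in> vr e" using that cubic_pairs(2)[OF subD(2)[OF e]] by blast
        have 5: "x \<in> hs e \<Longrightarrow> x \<in> hs h" using e_hs H.hs_quo(2) by auto
        have 6: "(x, y) \<notin> vr c" using False H.cp(1) by blast
        show ?thesis using 1 2 3 4 5 6 False by (auto simp: vr hs)
      qed
    qed
    fix x assume x: "x \<in> hs g" "card (cext g x) = 2"
    show "cext g x \<subseteq> ext h \<or> cext g x \<inter> ext h = {}"
    proof (cases "ext c \<subseteq> ext g \<and> x \<in> hs c")
      case True
      then have "cext g x = ext c" using G.comp_cext by blast
      then show ?thesis using H.two_ext x by simp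
    next
      case False
      then obtain y where y: "y \<in> hs e" "(x, y) \<in> cn g" using G.class_meets x(1) qg by metis
      then have eq: "cext g x = cext e y" using cext_eq[OF G.cub y(2)] G.cext_quo[of y] qg by simp
      then have "cext e y \<subseteq> ext (quo h c) \<or> cext e y \<inter> ext (quo h c) = {}"
        using e y(1) x(2) by (simp add: sub_def)
      moreover have "cext e y \<subseteq> hs (quo h c)" using e_hs by (auto simp: cext_def ext_def)
      ultimately show ?thesis unfolding eq H.ext_quo by blast
    qed
  qed
qed

text \<open>If \<open>e\<close> contains the vertex or edge left behind by \<open>c\<close>, put
  \<open>c\<close> back there. If it does not, or if \<open>c\<close> left nothing behind, the
  disjoint union of \<open>c\<close> and \<open>e\<close> works.\<close>

lemma quo_surj:
  assumes e: "sub e (quo h c)"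
  shows "\<exists>g. sub g h \<and> csub c g \<and> quo g c = e"
proof -
  note lc = H.subD'(1) H.conn and ee = subD(2)[OF e]
  have ex: ?thesis if "contraction (expand c e N L) c" "quo (expand c e N L) c = e" "ad (expand c e N L) \<subseteq> ad h" for N L
    using sub_expand[OF e that(1,2) _ that(3)] that(2) by (auto simp: expand_def)
  have hs_e: "hs e \<subseteq> hs (quo h c)" using subD(3)[OF e] .
  have disjoint: ?thesis if "hs c \<inter> hs e = {}" "ad e \<subseteq> ad h"
    using ex[OF expand_disjoint(1,2)[OF lc ee that(1)]] that(2) H.subD'(5) by (simp add: expand_def)
  show ?thesis
  proof (cases rule: H.kinds)
    case comp
    show ?thesis
      by (rule disjoint) (use hs_e subD(5)[OF e] in \<open>auto simp: H.quo_comp[OF comp]\<close>)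
  next
    case three
    note q = H.quo_three[OF three]
    have ad: "ad e \<subseteq> ad h" using subD(5)[OF e] by (auto simp: q)
    show ?thesis
    proof (cases "ext c \<inter> hs e = {}")
      case True
      then have "hs c \<inter> hs e = {}" using hs_e by (auto simp: q)
      then show ?thesis using ad by (rule disjoint)
    next
      case False
      then obtain x where x: "x \<in> ext c" "x \<in> hs e" by blast
      have vr_e: "vr e `` {y} = ext c" if "y \<in> ext c" "y \<in> hs e" for y
        using that H.ext_c_hs subD(6)[OF e] by (auto simp: q)
      then have "ext c \<subseteq> hs e" using x cubic_pairs(2)[OF ee] by blast
      moreover from this have vr_e': "vr e `` {y} = ext c" if "y \<in> ext c" for y
        using that vr_e by blast
      moreover have "hs c \<inter> hs e \<subseteq> ext c" using hs_e by (auto simp: q)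
      ultimately have int: "hs c \<inter> hs e = ext c" using H.ext_c_hs by blast
      \<comment> \<open>Admissible graphs such as \<open>e\<close> have no bare vertices.\<close>
      have "\<not> ext c \<subseteq> ext e"
        using subD(1)[OF e] x vr_e by (fastforce simp: lfgh_def ext_def)
      then show ?thesis
        using ex[OF expand_vertex(1,2)[OF lc ee int vr_e' three(1)]] int ad H.subD'(5)
        by (simp add: expand_def)
    qed
  next
    case (two a b p q)
    note qq = H.quo_two[OF two(1-4)]
    have disj: "hs c \<inter> hs e = {}" using hs_e by (auto simp: qq(1))
    show ?thesis
    proof (cases "(p, q) \<in> ad e")
      case True
      have "ad (expand c e {(p, q), (q, p)} {(a, p), (b, q), (p, a), (q, b)}) \<subseteq> ad h"
        using subD(5)[OF e] H.subD'(5) two H.hp(6) by (auto simp: expand_def qq(1))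
      then show ?thesis
        by (rule ex[OF expand_edge(1,2)[OF lc ee disj two(1,2) True]])
    next
      case False
      then have "(q, p) \<notin> ad e" using cubic_pairs(6)[OF ee] by blast
      then have "ad e \<subseteq> ad h" using False subD(5)[OF e] by (auto simp: qq(1))
      with disj show ?thesis by (rule disjoint)
    qed
  qed
qed

text \<open>The edges that are visible neither in \<open>c\<close> nor in the quotient are those
  joining two external edges of \<open>c\<close> to their partners \<open>p\<close> and
  \<open>q\<close>. The edge from \<open>p\<close> to \<open>q\<close> is not in \<open>h\<close>,
  so its presence in the quotient of \<open>g2\<close> shows that \<open>g2\<close> has these edges
  too.\<close>

lemma quo_inj_ad:
  assumes g1: "sub g1 h" "csub c g1" and g2: "sub g2 h" "csub c g2" and eq: "quo g1 c = quo g2 c"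
    and uv: "(u, v) \<in> ad g1"
  shows "(u, v) \<in> ad g2"
proof -
  interpret G1: contraction g1 c by (rule contraction_lfgh[OF subD(1)[OF g1(1)] g1(2)])
  interpret G2: contraction g2 c by (rule contraction_lfgh[OF subD(1)[OF g2(1)] g2(2)])
  have ah: "(u, v) \<in> ad h" if "(u, v) \<in> ad g1 \<or> (u, v) \<in> ad g2" for u v
    using that subD(5)[OF g1(1)] subD(5)[OF g2(1)] by blast
  have key: "(u, v) \<in> ad g2" if uv: "(u, v) \<in> ad g1" "u \<notin> hs (quo g1 c)" for u v
  proof (cases "u \<in> ext c")
    case False
    have "u \<in> hs c" using that G1.hs_quo(1) G1.hp(3) by blast
    then show ?thesis using G1.internal(1)[OF _ False uv(1)] G2.subD'(5) by blast
  next
    case True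
    have "u \<notin> ext g1" using uv by (auto simp: ext_def)
    show ?thesis
    proof (cases rule: G1.kinds)
      case three then show ?thesis using True uv(2) by (simp add: G1.quo_three)
    next
      case (two a b p q)
      note qq = G1.quo_two[OF two(1-4)]
      have "(p, q) \<in> ad (quo g2 c)" by (simp add: qq(1) flip: eq)
      \<comment> \<open>In \<open>h\<close> the half-edge \<open>p\<close> already has the partner
        \<open>a\<close>.\<close>
      moreover have nad: "(p, q) \<notin> ad h"
        using H.hp(7)[OF H.hp(6)[OF ah[of a p]], of q] two(3) qq(3) True two(1) H.ext_c_hs by auto
      ultimately have new: "(p, q) \<in> ad (quo g2 c) - ad g2" using ah by blast
      have "p \<in> Domain (ad g2) \<and> q \<in> Domain (ad g2)"
      proof (cases rule: G2.kinds)
        case (two a' b' p' q')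
        note qq' = G2.quo_two[OF two(1-4)]
        show ?thesis using new G2.hp(6)[OF two(3)] G2.hp(6)[OF two(4)] by (auto simp: qq'(1))
      qed (use new in \<open>auto simp: G2.quo_comp G2.quo_three\<close>)
      then obtain s t where st: "(p, s) \<in> ad g2" "(q, t) \<in> ad g2" by blast
      have "s = a" using H.hp(7)[OF ah[of p s] H.hp(6)[OF ah[of a p]]] st two(3) by simp
      moreover have "t = b" using H.hp(7)[OF ah[of q t] H.hp(6)[OF ah[of b q]]] st two(4) by simp
      ultimately have ab: "(a, p) \<in> ad g2" "(b, q) \<in> ad g2" using st G2.hp(6) by auto
      have "u = a \<and> v = p \<or> u = b \<and> v = q"
        using True two(1) G1.hp(7)[OF two(3), of v] G1.hp(7)[OF two(4), of v] uv(1) by auto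
      then show ?thesis using ab by auto
    qed (use True \<open>u \<notin> ext g1\<close> in auto)
  qed
  consider "u \<notin> hs (quo g1 c)" | "v \<notin> hs (quo g1 c)" | "u \<in> hs (quo g1 c)" "v \<in> hs (quo g1 c)" by blast
  then show ?thesis
  proof cases
    case 1 then show ?thesis using key uv by blast
  next
    case 2 then show ?thesis using key[OF G1.hp(6)[OF uv]] G2.hp(6) by blast
  next
    case 3
    have "u \<noteq> v" using uv G1.hp(8) by blast
    then have "(u, v) \<in> ad (quo g1 c)" using 3 uv by (auto simp: quo_simps(3))
    then have uv2: "(u, v) \<in> ad (quo g2 c)" by (simp add: eq)
    show ?thesis
    proof (cases rule: G2.kinds)
      case (two a b p q)
      note qq = G2.quo_two[OF two(1-4)]
      have "a \<in> hs c" "b \<in> hs c" using two(1) H.ext_c_hs by auto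
      then have "(p, q) \<notin> ad h" "(q, p) \<notin> ad h"
        using H.hp(7)[OF H.hp(6)[OF ah[of a p]], of q] H.hp(7)[OF H.hp(6)[OF ah[of b q]], of p] two(3,4) qq(2,3) by auto
      then show ?thesis using uv2 ah[of u v] uv by (auto simp: qq(1))
    qed (use uv2 in \<open>auto simp: G2.quo_comp G2.quo_three\<close>)
  qed
qed

lemma quo_inj:
  assumes g1: "sub g1 h" "csub c g1" and g2: "sub g2 h" "csub c g2" and eq: "quo g1 c = quo g2 c"
  shows "g1 = g2"
proof -
  have hs: "hs g = hs c \<union> hs (quo g c)" if "sub g h" "csub c g" for g
  proof -
    have "hs c \<subseteq> hs g" using that subD(3) by (auto simp: csub_def)
    then show ?thesis by (auto simp: quo_simps keep_def ext_def)
  qed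
  have 1: "hs g1 = hs g2" using hs[OF g1] hs[OF g2] eq by simp
  moreover have "vr g1 = vr g2" using subD(6)[OF g1(1)] subD(6)[OF g2(1)] 1 by simp
  moreover have "ad g1 = ad g2"
    using quo_inj_ad[OF g1 g2 eq] quo_inj_ad[OF g2 g1 eq[symmetric]] by auto
  ultimately show ?thesis by (intro hgraph.equality) simp_all
qed

lemma quo_bij: "bij_betw (\<lambda>g. quo g c) {g. sub g h \<and> csub c g} {e. sub e (quo h c)}"
  unfolding bij_betw_def
proof (intro conjI set_eqI iffI)
  show "inj_on (\<lambda>g. quo g c) {g. sub g h \<and> csub c g}"
    by (rule inj_onI) (use quo_inj in blast)
  fix e
  show "e \<in> {e. sub e (quo h c)}" if e: "e \<in> (\<lambda>g. quo g c) ` {g. sub g h \<and> csub c g}"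
  proof -
    from e obtain g where g: "sub g h" "csub c g" "e = quo g c" by auto
    interpret nested_contraction h g c using lh g by unfold_locales
    show ?thesis using sub_quo g by simp
  qed
  show "e \<in> (\<lambda>g. quo g c) ` {g. sub g h \<and> csub c g}" if "e \<in> {e. sub e (quo h c)}"
    using quo_surj[of e] that by (auto simp: image_iff)
qed

end

section \<open>Translation to graphs with vertices\<close>

definition shape :: "graph \<Rightarrow> hgraph"
  where "shape G = \<lparr>hs = halves G, vr = {(x, y). \<exists>v. (v, x) \<in> inc G \<and> (v, y) \<in> inc G}, ad = adj G\<rparr>"

lemma shape_simps [simp]:
  "hs (shape G) = halves G" "ad (shape G) = adj G"
  "(x, y) \<in> vr (shape G) \<longleftrightarrow> (\<exists>v. (v, x) \<in> inc G \<and> (v, y) \<in> inc G)"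
  by (auto simp: shape_def)

definition trivalent :: "graph \<Rightarrow> bool"
  where "trivalent G \<longleftrightarrow> finite_graph G \<and> (\<forall>v\<in>verts G. card (half_edges_at G v) = 3)"

lemma trivalentD:
  assumes "trivalent G"
  shows "finite (verts G)" "finite (halves G)" "(v, x) \<in> inc G \<Longrightarrow> v \<in> verts G"
    "(v, x) \<in> inc G \<Longrightarrow> x \<in> halves G" "(x, y) \<in> adj G \<Longrightarrow> x \<in> halves G" "(x, y) \<in> adj G \<Longrightarrow> y \<in> halves G"
    "(x, y) \<in> adj G \<Longrightarrow> (y, x) \<in> adj G" "(x, x) \<notin> adj G"
    "(v, x) \<in> inc G \<Longrightarrow> (w, x) \<in> inc G \<Longrightarrow> v = w" "x \<in> halves G \<Longrightarrow> \<exists>v. (v, x) \<in> inc G"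
    "(x, y) \<in> adj G \<Longrightarrow> (x, z) \<in> adj G \<Longrightarrow> y = z" "v \<in> verts G \<Longrightarrow> card (half_edges_at G v) = 3"
proof -
  have f: "finite_graph G" using assms by (simp add: trivalent_def)
  then show "finite (verts G)" "finite (halves G)" "(v, x) \<in> inc G \<Longrightarrow> v \<in> verts G"
    "(v, x) \<in> inc G \<Longrightarrow> x \<in> halves G" "(x, y) \<in> adj G \<Longrightarrow> x \<in> halves G" "(x, y) \<in> adj G \<Longrightarrow> y \<in> halves G"
    "(x, y) \<in> adj G \<Longrightarrow> (y, x) \<in> adj G" "(x, x) \<notin> adj G"
    "x \<in> halves G \<Longrightarrow> \<exists>v. (v, x) \<in> inc G" "(x, y) \<in> adj G \<Longrightarrow> (x, z) \<in> adj G \<Longrightarrow> y = z"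
    by (auto simp: finite_graph_def sym_def irrefl_def)
  show "(v, x) \<in> inc G \<Longrightarrow> (w, x) \<in> inc G \<Longrightarrow> v = w"
    using f unfolding finite_graph_def by blast
  show "v \<in> verts G \<Longrightarrow> card (half_edges_at G v) = 3" using assms by (simp add: trivalent_def)
qed

lemma half_edges_at_ne: "trivalent G \<Longrightarrow> v \<in> verts G \<Longrightarrow> \<exists>x. (v, x) \<in> inc G"
  using trivalentD(12)[of G v] by (metis card.empty empty_Collect_eq half_edges_at_def zero_neq_numeral)

lemma vr_shape_class: "trivalent G \<Longrightarrow> (v, x) \<in> inc G \<Longrightarrow> vr (shape G) `` {x} = half_edges_at G v"
proof (intro set_eqI iffI)
  fix y assume G: "trivalent G" "(v, x) \<in> inc G" and y: "y \<in> vr (shape G) `` {x}"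
  then obtain w where w: "(w, x) \<in> inc G" "(w, y) \<in> inc G" by auto
  with trivalentD(9)[OF G w(1)] show "y \<in> half_edges_at G v" by (simp add: half_edges_at_def)
qed (auto simp: half_edges_at_def)

lemma cubic_shape:
  assumes "trivalent G"
  shows "cubic (shape G)"
  unfolding cubic_def
proof (intro conjI ballI)
  note G = trivalentD[OF assms]
  show "finite (hs (shape G))" "ad (shape G) \<subseteq> hs (shape G) \<times> hs (shape G)"
    "sym (ad (shape G))" "irrefl (ad (shape G))" "single_valued (ad (shape G))"
    using G(2,5,6,7,8,11) by (auto simp: sym_def irrefl_def single_valued_def)
  show "equiv (hs (shape G)) (vr (shape G))"
  proof (rule equivI)
    show "vr (shape G) \<subseteq> hs (shape G) \<times> hs (shape G)" using G(4) by auto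
    show "refl_on (hs (shape G)) (vr (shape G))" using G(10) by (auto simp: refl_on_def)
    show "sym (vr (shape G))" by (auto simp: sym_def)
    show "trans (vr (shape G))" unfolding trans_def using G(9) by simp blast
  qed
  fix x assume "x \<in> hs (shape G)"
  then obtain v where "(v, x) \<in> inc G" using G(10) by auto
  then show "card (vr (shape G) `` {x}) = 3" using G(3,12) vr_shape_class[OF assms] by auto
qed

text \<open>Bridges the two notions of component: a step of \<open>linked\<close> is a change of
  half-edge at a vertex followed by an internal edge.\<close>

lemma linked_cn:
  assumes G: "trivalent G" and vx: "(v, x) \<in> inc G" and wy: "(w, y) \<in> inc G"
  shows "(v, w) \<in> (linked G)\<^sup>* \<longleftrightarrow> (x, y) \<in> cn (shape G)"
proof
  note g = trivalentD[OF G]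
  assume "(v, w) \<in> (linked G)\<^sup>*"
  then have "\<forall>y. (w, y) \<in> inc G \<longrightarrow> (x, y) \<in> cn (shape G)"
  proof induction
    case base then show ?case using vx cn_base(1)[of x _ "shape G"] by auto
  next
    case (step u w)
    then obtain h k where hk: "(u, h) \<in> inc G" "(h, k) \<in> adj G" "(w, k) \<in> inc G"
      by (auto simp: linked_def)
    then have "(x, h) \<in> cn (shape G)" using step by blast
    then have "(x, k) \<in> cn (shape G)" using hk cn_step(2)[of x h "shape G" k] by simp
    then show ?case using hk cn_step(1)[of x k "shape G"] by auto
  qed
  then show "(x, y) \<in> cn (shape G)" using wy by blast
next
  note g = trivalentD[OF G]
  assume "(x, y) \<in> cn (shape G)"
  then have "\<forall>w. (w, y) \<in> inc G \<longrightarrow> (v, w) \<in> (linked G)\<^sup>*"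
  proof (induction rule: cn_induct)
    case refl then show ?case using g(9) vx by blast
  next
    case (vr y z) then show ?case using g(9) unfolding shape_simps by blast
  next
    case (ad y z)
    then have yz: "(y, z) \<in> adj G" by simp
    obtain u where u: "(u, y) \<in> inc G" using g(5,10) yz by blast
    show ?case
    proof (intro allI impI)
      fix w assume "(w, z) \<in> inc G"
      then have "(u, w) \<in> linked G" using u yz by (auto simp: linked_def)
      then show "(v, w) \<in> (linked G)\<^sup>*" using ad u by (meson rtrancl.rtrancl_into_rtrancl)
    qed
  qed
  then show "(v, w) \<in> (linked G)\<^sup>*" using wy by blast
qed

definition comp :: "hgraph \<Rightarrow> nat \<Rightarrow> hgraph"
  where "comp h x = (let S = cn h `` {x} in \<lparr>hs = S, vr = vr h \<inter> S \<times> S, ad = ad h \<inter> S \<times> S\<rparr>)"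

lemma comp_simps [simp]:
  "hs (comp h x) = cn h `` {x}" "vr (comp h x) = vr h \<inter> cn h `` {x} \<times> cn h `` {x}"
  "ad (comp h x) = ad h \<inter> cn h `` {x} \<times> cn h `` {x}"
  by (simp_all add: comp_def Let_def)

lemma ext_comp:
  assumes "cubic h" "x \<in> hs h"
  shows "ext (comp h x) = cext h x"
proof -
  have "y \<in> hs h" if "(x, y) \<in> cn h" for y using cn_hs[OF that assms(1)] assms(2) by simp
  moreover have "(x, z) \<in> cn h" if "(x, y) \<in> cn h" "(y, z) \<in> ad h" for y z
    using that by (rule cn_step(2))
  ultimately show ?thesis by (auto simp: ext_def cext_def)
qed

lemma component_simps:
  assumes G: "trivalent G" and vx: "(v, x) \<in> inc G"
  shows "verts (component G v) = {w. (v, w) \<in> (linked G)\<^sup>*}"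
    "halves (component G v) = cn (shape G) `` {x}"
    "inc (component G v) = {(w, y) \<in> inc G. (x, y) \<in> cn (shape G)}"
    "adj (component G v) = {(y, z) \<in> adj G. (x, y) \<in> cn (shape G)}"
    "shape (component G v) = comp (shape G) x"
proof -
  note g = trivalentD[OF G]
  note l = linked_cn[OF G vx]
  show 1: "verts (component G v) = {w. (v, w) \<in> (linked G)\<^sup>*}" by (simp add: component_def Let_def)
  have xh: "x \<in> halves G" using g(4) vx by blast
  have hs: "\<exists>w. (w, y) \<in> inc G" if "(x, y) \<in> cn (shape G)" for y
    using cn_hs[OF that cubic_shape[OF G]] xh g(10) by simp
  show 2: "halves (component G v) = cn (shape G) `` {x}"
  proof (intro set_eqI iffI)
    fix y assume "y \<in> cn (shape G) `` {x}"
    then obtain w where "(w, y) \<in> inc G" "(x, y) \<in> cn (shape G)" using hs by blast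
    then show "y \<in> halves (component G v)" using l by (auto simp: component_def Let_def)
  qed (use l in \<open>auto simp: component_def Let_def\<close>)
  show 3: "inc (component G v) = {(w, y) \<in> inc G. (x, y) \<in> cn (shape G)}"
    using l 2 by (auto simp: component_def Let_def)
  have st: "(x, z) \<in> cn (shape G)" if "(x, y) \<in> cn (shape G)" "(y, z) \<in> adj G" for y z
    using cn_step(2)[OF that(1), of z] that(2) by simp
  show 4: "adj (component G v) = {(y, z) \<in> adj G. (x, y) \<in> cn (shape G)}"
    using l 2 st by (auto simp: component_def Let_def)
  show "shape (component G v) = comp (shape G) x"
    using 2 3 4 st by (intro hgraph.equality) auto
qed

lemma external_edges_shape: "external_edges G = ext (shape G)"
  by (auto simp: external_edges_def ext_def)

lemma component_in: 
  assumes G: "trivalent G" and C: "C \<in> components G"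
  obtains v x where "(v, x) \<in> inc G" "C = component G v"
  using C half_edges_at_ne[OF G] unfolding components_def by blast

lemma inc_component:
  assumes G: "trivalent G" and x: "x \<in> halves G"
  obtains v where "(v, x) \<in> inc G" "component G v \<in> components G"
  using trivalentD(3,10)[OF G] x unfolding components_def by blast

lemma external_edges_component:
  assumes G: "trivalent G" and vx: "(v, x) \<in> inc G"
  shows "external_edges (component G v) = cext (shape G) x"
  using component_simps(5)[OF assms] ext_comp[OF cubic_shape[OF G]] trivalentD(4)[OF G vx]
  by (simp add: external_edges_shape)

lemma ball_components:
  assumes G: "trivalent G"
  shows "(\<forall>C\<in>components G. Q (external_edges C)) \<longleftrightarrow> (\<forall>x\<in>halves G. Q (cext (shape G) x))"
proof (intro iffI ballI)
  fix x assume "\<forall>C\<in>components G. Q (external_edges C)" "x \<in> halves G"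
  then show "Q (cext (shape G) x)"
    using inc_component[OF G] external_edges_component[OF G] by metis
next
  fix C assume "\<forall>x\<in>halves G. Q (cext (shape G) x)" "C \<in> components G"
  then show "Q (external_edges C)"
    using component_in[OF G] external_edges_component[OF G] trivalentD(4)[OF G] by metis
qed

lemma feynman_shape:
  "feynman_graph G \<longleftrightarrow> trivalent G \<and>
    (\<forall>x\<in>halves G. card (cext (shape G) x) = 2 \<or> card (cext (shape G) x) = 3)"
proof (cases "trivalent G")
  case True
  then show ?thesis using ball_components[OF True, of "\<lambda>X. card X = 2 \<or> card X = 3"]
    by (auto simp: feynman_graph_def trivalent_def)
qed (auto simp: feynman_graph_def trivalent_def)

lemma trivalent_component:
  assumes G: "trivalent G" and vx: "(v, x) \<in> inc G"
  shows "trivalent (component G v)"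
proof -
  note g = trivalentD[OF G] and c = component_simps[OF G vx]
  have l: "(v, w) \<in> (linked G)\<^sup>* \<longleftrightarrow> (x, y) \<in> cn (shape G)" if "(w, y) \<in> inc G" for w y
    using linked_cn[OF G vx that] .
  have hs: "y \<in> halves G" if "(x, y) \<in> cn (shape G)" for y
    using cn_hs[OF that cubic_shape[OF G]] g(4)[OF vx] by simp
  have vs: "w \<in> verts G" if "(v, w) \<in> (linked G)\<^sup>*" for w
    using that by induction (use g(3) vx in \<open>auto simp: linked_def\<close>)
  have st: "(x, z) \<in> cn (shape G)" if "(x, y) \<in> cn (shape G)" "(y, z) \<in> adj G" for y z
    using cn_step(2)[OF that(1), of z] that(2) by simp
  have "finite (verts (component G v))" "finite (halves (component G v))"
    using finite_subset[OF _ g(1), of "verts (component G v)"]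
      finite_subset[OF _ g(2), of "halves (component G v)"] vs hs by (auto simp: c)
  moreover have "\<exists>!w. (w, y) \<in> inc (component G v)" if "y \<in> halves (component G v)" for y
    using that g(9,10) hs by (auto simp: c)
  moreover have "inc (component G v) \<subseteq> verts (component G v) \<times> halves (component G v)"
    using l by (auto simp: c)
  moreover have "adj (component G v) \<subseteq> halves (component G v) \<times> halves (component G v)"
    using st by (auto simp: c)
  moreover have "sym (adj (component G v))" "irrefl (adj (component G v))"
    using g(7,8) st by (auto simp: c sym_def irrefl_def)
  moreover have "half_edges_at (component G v) w = half_edges_at G w" if "w \<in> verts (component G v)" for w
    using that l by (auto simp: c half_edges_at_def)
  moreover have "k = k'" if "(h, k) \<in> adj (component G v)" "(h, k') \<in> adj (component G v)" for h k k'
    using that g(11) by (auto simp: c)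
  ultimately show ?thesis using g(12) vs unfolding trivalent_def finite_graph_def
    by (auto simp: c(1))
qed

section \<open>Loops and internal edges\<close>

lemma dim_pos_iff:
  fixes V :: "'a::rat_vector set"
  assumes "V \<subseteq> ratvec.span W" "finite W"
  shows "ratvec.dim V > 0 \<longleftrightarrow> \<not> V \<subseteq> {0}"
proof -
  obtain B where B: "B \<subseteq> V" "ratvec.independent B" "V \<subseteq> ratvec.span B" "card B = ratvec.dim V"
    using ratvec.basis_exists by blast
  \<comment> \<open>Finiteness matters since \<open>dim\<close> of an infinite-dimensional space is
    0.\<close>
  have "finite B" using ratvec.independent_span_bound[OF assms(2) B(2)] B(1) assms(1) by blast
  moreover have "B = {}" if "V \<subseteq> {0}"
    using that B(1,2) ratvec.dependent_zero by blast
  moreover have "V \<subseteq> {0}" if "B = {}" using B(3) that by simp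
  ultimately show ?thesis using B(4) card_gt_0_iff[of B] by auto
qed

text \<open>More edges than \<open>card V - 1\<close> force a cycle: the boundaries of the edges lie in the span of the
  vectors \<open>v - v0\<close>.\<close>

lemma ex_cycle:
  fixes s t :: "'e \<Rightarrow> 'v"
  assumes fin: "finite V" "finite E" and st: "\<And>e. e \<in> E \<Longrightarrow> s e \<in> V \<and> t e \<in> V"
    and card: "card V \<le> card E" and ne: "V \<noteq> {}"
  shows "\<exists>u. (\<exists>e\<in>E. u e \<noteq> (0::rat)) \<and> (\<Sum>e\<in>E. u e *\<^sub>Q (single (s e) (1::rat) - single (t e) 1)) = 0"
proof -
  let ?d = "\<lambda>e. single (s e) (1::rat) - single (t e) 1"
  obtain v0 where v0: "v0 \<in> V" using ne by blast
  let ?W = "(\<lambda>v. single v (1::rat) - single v0 1) ` (V - {v0})"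
  have W: "finite ?W" "card ?W < card E"
  proof -
    have "card ?W \<le> card (V - {v0})" using fin by (intro card_image_le) auto
    also have "\<dots> < card V" using v0 fin by (intro psubset_card_mono) auto
    finally show "card ?W < card E" using card by simp
  qed (use fin in simp)
  have span1: "single v (1::rat) - single v0 1 \<in> ratvec.span ?W" if "v \<in> V" for v
    using that by (cases "v = v0") (auto intro: ratvec.span_base ratvec.span_zero)
  have span: "?d ` E \<subseteq> ratvec.span ?W"
  proof safe
    fix e assume "e \<in> E"
    then have "(single (s e) 1 - single v0 1) - (single (t e) (1::rat) - single v0 1) \<in> ratvec.span ?W"
      using st by (intro ratvec.span_diff span1) auto
    then show "?d e \<in> ratvec.span ?W" by simp
  qed
  show ?thesis
  proof (cases "inj_on ?d E")
    case True
    have "ratvec.dependent (?d ` E)"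
      using ratvec.independent_span_bound[OF W(1) _ span] W(2) card_image[OF True] by force
    then obtain u where u: "\<exists>v\<in>?d ` E. u v \<noteq> 0" "(\<Sum>v\<in>?d ` E. u v *\<^sub>Q v) = 0"
      using ratvec.dependent_finite[of "?d ` E"] fin by auto
    have "(\<Sum>e\<in>E. u (?d e) *\<^sub>Q ?d e) = 0"
      using u(2) by (simp add: sum.reindex[OF True])
    with u(1) show ?thesis by (intro exI[of _ "\<lambda>e. u (?d e)"]) auto
  next
    case False
    \<comment> \<open>Linear dependence concerns the set of boundaries, so two edges with equal
      boundary need their own cycle, namely their difference.\<close>
    then obtain a b where ab: "a \<in> E" "b \<in> E" "a \<noteq> b" "?d a = ?d b" by (auto simp: inj_on_def)
    let ?u = "\<lambda>e. if e = a then 1 else if e = b then - 1 else (0::rat)"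
    have "(\<Sum>e\<in>E. ?u e *\<^sub>Q ?d e) = (\<Sum>e\<in>{a, b}. ?u e *\<^sub>Q ?d e)"
      using fin ab by (intro sum.mono_neutral_right) auto
    also have "\<dots> = 0" using ab by (simp add: scaleQ_one ratvec.scale_minus_left)
    finally show ?thesis using ab by (intro exI[of _ ?u]) auto
  qed
qed

text \<open>Double counting of half-edges, with each internal edge represented by the orientation in
  which \<open>x < y\<close>.\<close>

lemma edge_count:
  assumes C: "trivalent C"
  shows "3 * card (verts C) = 2 * card {(x, y) \<in> adj C. x < y} + card (external_edges C)"
proof -
  note g = trivalentD[OF C]
  let ?E = "{(x, y) \<in> adj C. x < y}"
  have "halves C = (\<Union>v\<in>verts C. half_edges_at C v)"
    using g(3,4,10) by (fastforce simp: half_edges_at_def)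
  moreover have "card (\<Union>v\<in>verts C. half_edges_at C v) = (\<Sum>v\<in>verts C. card (half_edges_at C v))"
    using g(1,2,4,9) by (intro card_UN_disjoint) (auto simp: half_edges_at_def intro: finite_subset[OF _ g(2)])
  ultimately have 1: "card (halves C) = 3 * card (verts C)" using g(12) by simp
  have finE: "finite ?E" using g(2,5,6) finite_subset[of ?E "halves C \<times> halves C"] by auto
  have inj: "inj_on fst ?E" "inj_on snd ?E"
  proof -
    show "inj_on fst ?E" using g(11) by (auto simp: inj_on_def)
    have "a = a'" if "(a, b) \<in> adj C" "(a', b) \<in> adj C" for a a' b using g(7)[OF that(1)] g(7)[OF that(2)] g(11) by blast
    then show "inj_on snd ?E" by (auto simp: inj_on_def)
  qed
  have dom: "Domain (adj C) = fst ` ?E \<union> snd ` ?E"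
  proof -
    have "x \<in> fst ` ?E \<union> snd ` ?E" if "(x, y) \<in> adj C" for x y
    proof (cases "x < y")
      case True then show ?thesis using that by force
    next
      case False
      then have "y < x" using g(8) that by (metis linorder_neqE_nat)
      then show ?thesis using g(7)[OF that] by force
    qed
    moreover have "a \<in> Domain (adj C) \<and> b \<in> Domain (adj C)" if "(a, b) \<in> adj C" for a b
      using that g(7)[OF that] by blast
    ultimately show ?thesis by auto
  qed
  have "fst ` ?E \<inter> snd ` ?E = {}"
  proof -
    have False if "(x, y) \<in> adj C" "x < y" "(z, x) \<in> adj C" "z < x" for x y z
      using g(11)[OF that(1) g(7)[OF that(3)]] that by simp
    then show ?thesis by auto
  qed
  then have "card (Domain (adj C)) = 2 * card ?E"
    unfolding dom using finE inj by (simp add: card_Un_disjoint card_image)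
  moreover have "halves C = Domain (adj C) \<union> external_edges C" "Domain (adj C) \<inter> external_edges C = {}"
    using g(5) by (auto simp: external_edges_def)
  moreover have "finite (Domain (adj C))" "finite (external_edges C)"
    using g(2,5) by (auto intro: finite_subset[OF _ g(2)] simp: external_edges_def)
  ultimately show ?thesis using 1 card_Un_disjoint by metis
qed

text \<open>For 2 or 3 external edges, a single internal edge already forces at least as many
  internal edges as vertices, by \<open>edge_count\<close>; then \<open>ex_cycle\<close>
  applies.\<close>

lemma dim_H1:
  assumes C: "trivalent C" and ext: "card (external_edges C) = 2 \<or> card (external_edges C) = 3"
  shows "ratvec.dim (H1 C) > 0 \<longleftrightarrow> adj C \<noteq> {}"
proof -
  note g = trivalentD[OF C]
  let ?D = "Domain (adj C)"
  have finD: "finite ?D" using g(5) by (auto intro: finite_subset[OF _ g(2)])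
  have span: "H1 C \<subseteq> ratvec.span ((\<lambda>h. single h (1::rat)) ` ?D)"
  proof
    fix c assume "c \<in> H1 C"
    then have keys: "keys c \<subseteq> ?D" by (simp add: H1_def)
    have "(\<Sum>k\<in>keys c. lookup c k *\<^sub>Q single k (1::rat)) \<in> ratvec.span ((\<lambda>h. single h (1::rat)) ` ?D)"
      using keys by (intro ratvec.span_sum ratvec.span_scale ratvec.span_base) auto
    then show "c \<in> ratvec.span ((\<lambda>h. single h (1::rat)) ` ?D)" using poly_mapping_expand[of c] by simp
  qed
  have "H1 C \<subseteq> {0}" if "adj C = {}" using that by (auto simp: H1_def)
  moreover have "\<not> H1 C \<subseteq> {0}" if ne: "adj C \<noteq> {}"
  proof -
    let ?E = "{(x, y) \<in> adj C. x < y}"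
    have finE: "finite ?E" using g(2,5,6) finite_subset[of ?E "halves C \<times> halves C"] by auto
    obtain x0 y0 where x0: "(x0, y0) \<in> adj C" using ne by auto
    then have E_ne: "?E \<noteq> {}" using g(7,8) by (metis (mono_tags, lifting) case_prodI empty_Collect_eq linorder_neqE_nat)
    then have "card ?E > 0" using finE by (simp add: card_gt_0_iff del: empty_Collect_eq)
    then have le: "card (verts C) \<le> card ?E" and pos: "verts C \<noteq> {}"
    proof -
      \<comment> \<open>The inequality could only fail for \<open>b\<close> equal to 1 or 2, and
        divisibility by 3 rules these cases out.\<close>
      have *: "a \<le> b \<and> a \<noteq> 0" if "3 * a = 2 * b + e" "e = 2 \<or> e = 3" "b > 0" for a b e :: nat
        using that by presburger
      show "card (verts C) \<le> card ?E" "verts C \<noteq> {}"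
        using *[OF edge_count[OF C] ext \<open>card ?E > 0\<close>] by auto
    qed
    define vt where "vt x = (THE v. (v, x) \<in> inc C)" for x
    have vt: "(v, x) \<in> inc C \<longleftrightarrow> v = vt x" if "x \<in> halves C" for v x
      unfolding vt_def using g(9,10) that by (metis (mono_tags, lifting) the_equality)
    have vv: "vt x \<in> verts C" if "x \<in> halves C" for x using vt[OF that, of "vt x"] g(3) by blast
    have "vt (fst e) \<in> verts C \<and> vt (snd e) \<in> verts C" if "e \<in> ?E" for e
      using that vv g(5,6) by (cases e) auto
    then obtain u where u: "\<exists>e\<in>?E. u e \<noteq> (0::rat)"
      "(\<Sum>e\<in>?E. u e *\<^sub>Q (single (vt (fst e)) (1::rat) - single (vt (snd e)) 1)) = 0"
      using ex_cycle[OF g(1) finE _ le pos, of "\<lambda>e. vt (fst e)" "\<lambda>e. vt (snd e)"] by blast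
    \<comment> \<open>The cycle as an antisymmetric chain on half-edges: the coefficient of an
      oriented edge on its first half, the negative on its second.\<close>
    define c where "c = (\<Sum>e\<in>?E. u e *\<^sub>Q (single (fst e) (1::rat) - single (snd e) 1))"
    have look: "lookup c x = (\<Sum>e\<in>?E. u e * ((if fst e = x then 1 else 0) - (if snd e = x then 1 else 0)))" for x
      by (simp add: c_def lookup_sum lookup_scaleQ scaleQ_rat_def lookup_minus lookup_single when_def)
    have fst_x: "lookup c x = u (x, y)" and snd_x: "lookup c y = - u (x, y)" if xy: "(x, y) \<in> ?E" for x y
    proof -
      have A: "e = (x, y)" if "e \<in> ?E" "fst e = x" for e using that xy g(11)[of x y "snd e"] by (cases e) auto
      have B: "snd e \<noteq> x" if "e \<in> ?E" for e
      proof
        assume "snd e = x"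
        then have "(x, fst e) \<in> adj C" "fst e < x" using that g(7) by auto
        then show False using g(11)[of x y "fst e"] xy by auto
      qed
      have "u e * ((if fst e = x then 1 else 0) - (if snd e = x then 1 else 0)) = (if e = (x, y) then u e else 0)"
        if "e \<in> ?E" for e
        using A[OF that] B[OF that] by (cases "e = (x, y)") auto
      then have "lookup c x = (\<Sum>e\<in>?E. if e = (x, y) then u e else 0)"
        unfolding look by (rule sum.cong[OF refl])
      also have "\<dots> = u (x, y)" using xy finE by (subst sum.delta) auto
      finally show "lookup c x = u (x, y)" .
      have A: "e = (x, y)" if "e \<in> ?E" "snd e = y" for e
      proof -
        have "(y, fst e) \<in> adj C" "(y, x) \<in> adj C" using that xy g(7) by auto
        then show ?thesis using g(11) that(2) by (cases e) auto
      qed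
      have B: "fst e \<noteq> y" if "e \<in> ?E" for e
      proof
        assume "fst e = y"
        then have "(y, snd e) \<in> adj C" "y < snd e" using that by auto
        then show False using g(11)[of y "snd e" x] g(7) xy by auto
      qed
      have "u e * ((if fst e = y then 1 else 0) - (if snd e = y then 1 else 0)) = (if e = (x, y) then - u e else 0)"
        if "e \<in> ?E" for e
        using A[OF that] B[OF that] by (cases "e = (x, y)") auto
      then have "lookup c y = (\<Sum>e\<in>?E. if e = (x, y) then - u e else 0)"
        unfolding look by (rule sum.cong[OF refl])
      also have "\<dots> = - u (x, y)" using xy finE by (subst sum.delta) auto
      finally show "lookup c y = - u (x, y)" .
    qed
    have "c \<noteq> 0" using u(1) fst_x by force
    moreover have "c \<in> H1 C"
      unfolding H1_def
    proof (intro CollectI conjI ballI)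
      show "keys c \<subseteq> ?D"
      proof
        fix x assume "x \<in> keys c"
        then have "lookup c x \<noteq> 0" by (simp add: in_keys_iff)
        then obtain e where "e \<in> ?E" "fst e = x \<or> snd e = x"
          unfolding look by (auto elim!: sum.not_neutral_contains_not_neutral split: if_splits)
        moreover have "a \<in> ?D \<and> b \<in> ?D" if "(a, b) \<in> adj C" for a b
          using that g(7)[OF that] by blast
        ultimately show "x \<in> ?D" by auto
      qed
      fix e assume "e \<in> adj C"
      then obtain h k where e: "e = (h, k)" "(h, k) \<in> adj C" by (cases e) auto
      then have "h \<noteq> k" using g(8) by blast
      then consider "(h, k) \<in> ?E" | "(k, h) \<in> ?E" using g(7) e by force
      then show "case e of (h, k) \<Rightarrow> lookup c k = - lookup c h"
        unfolding e(1) by cases (simp_all add: fst_x snd_x)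
    next
      fix v assume v: "v \<in> verts C"
      have fin: "finite (half_edges_at C v)" using g(4) by (auto simp: half_edges_at_def intro: finite_subset[OF _ g(2)])
      have ind: "(\<Sum>h\<in>half_edges_at C v. if x = h then 1 else (0::rat)) = (if vt x = v then 1 else 0)"
        if "x \<in> halves C" for x
        using fin vt[OF that, of v] by (auto simp: half_edges_at_def)
      have "(\<Sum>h\<in>half_edges_at C v. lookup c h)
          = (\<Sum>e\<in>?E. u e * ((\<Sum>h\<in>half_edges_at C v. if fst e = h then 1 else 0) - (\<Sum>h\<in>half_edges_at C v. if snd e = h then 1 else 0)))"
        unfolding look by (subst sum.swap) (simp only: sum_distrib_left[symmetric] sum_subtractf)
      also have "\<dots> = (\<Sum>e\<in>?E. u e * ((if vt (fst e) = v then 1 else 0) - (if vt (snd e) = v then 1 else 0)))"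
        using ind g(5,6) by (intro sum.cong refl) auto
      also have "\<dots> = lookup (\<Sum>e\<in>?E. u e *\<^sub>Q (single (vt (fst e)) (1::rat) - single (vt (snd e)) 1)) v"
        by (simp add: lookup_sum lookup_scaleQ scaleQ_rat_def lookup_minus lookup_single when_def)
      finally show "(\<Sum>h\<in>half_edges_at C v. lookup c h) = 0" by (simp add: u(2))
    qed
    ultimately show ?thesis by auto
  qed
  ultimately show ?thesis using dim_pos_iff[OF span] finD by auto
qed

text \<open>By \<open>dim_H1\<close> a loop in a component amounts to an internal edge, and a
  component without internal edge is a single bare vertex.\<close>

lemma lfg_graph_shape: "lfg_graph G \<longleftrightarrow> trivalent G \<and> lfgh (shape G)"
proof (cases "feynman_graph G")
  case False
  then show ?thesis by (auto simp: lfg_graph_def feynman_shape lfgh_def)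
next
  case True
  then have G: "trivalent G"
    and ext: "\<forall>x\<in>halves G. card (cext (shape G) x) = 2 \<or> card (cext (shape G) x) = 3"
    by (auto simp: feynman_shape)
  have "(\<forall>C\<in>components G. ratvec.dim (H1 C) > 0) \<longleftrightarrow> (\<forall>C\<in>components G. adj C \<noteq> {})"
  proof (rule ball_cong[OF refl])
    fix C assume "C \<in> components G"
    then obtain v x where vx: "(v, x) \<in> inc G" "C = component G v" by (rule component_in[OF G])
    then show "ratvec.dim (H1 C) > 0 \<longleftrightarrow> adj C \<noteq> {}"
      using dim_H1[OF trivalent_component[OF G vx(1)]] external_edges_component[OF G vx(1)] ext
        trivalentD(4)[OF G vx(1)] by auto
  qed
  also have "\<dots> \<longleftrightarrow> (\<forall>x\<in>halves G. vr (shape G) `` {x} \<inter> Domain (adj G) \<noteq> {})"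
  proof (intro iffI ballI)
    fix x assume a: "\<forall>C\<in>components G. adj C \<noteq> {}" and x: "x \<in> halves G"
    show "vr (shape G) `` {x} \<inter> Domain (adj G) \<noteq> {}"
    proof
      assume bare: "vr (shape G) `` {x} \<inter> Domain (adj G) = {}"
      obtain v where v: "(v, x) \<in> inc G" "component G v \<in> components G" using inc_component[OF G x] by blast
      have cl: "y \<in> vr (shape G) `` {x}" if "(x, y) \<in> cn (shape G)" for y
        using that
      proof (induction rule: cn_induct)
        case refl then show ?case using v by auto
      next
        case (vr y z) then show ?case using cubicD(10)[OF cubic_shape[OF G]] by (auto dest: transD simp del: shape_simps(3))
      next
        case (ad y z)
        then have "y \<in> Domain (adj G)" by auto
        with ad bare show ?case by blast
      qed
      have "adj (component G v) = {}"
        using bare cl unfolding component_simps(4)[OF G v(1)] by blast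
      with a v(2) show False by blast
    qed
  next
    fix C assume a: "\<forall>x\<in>halves G. vr (shape G) `` {x} \<inter> Domain (adj G) \<noteq> {}" and "C \<in> components G"
    then obtain v x where vx: "(v, x) \<in> inc G" "C = component G v" by (metis component_in[OF G])
    then obtain y z where "(x, y) \<in> vr (shape G)" "(y, z) \<in> adj G" using a trivalentD(4)[OF G vx(1)] by blast
    then have "(y, z) \<in> adj C" using cn_base(1) unfolding vx(2) component_simps(4)[OF G vx(1)] by blast
    then show "adj C \<noteq> {}" by blast
  qed
  finally show ?thesis using True G ext cubic_shape[OF G] by (simp add: lfg_graph_def lfgh_def)
qed

section \<open>Components of half-edge graphs\<close>

definition comps :: "hgraph \<Rightarrow> hgraph set"
  where "comps h = comp h ` hs h"

lemma cn_comp: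
  assumes "cubic h" "(x, y) \<in> cn h"
  shows "(y, z) \<in> cn (comp h x) \<longleftrightarrow> (y, z) \<in> cn h"
proof
  assume "(y, z) \<in> cn (comp h x)" then show "(y, z) \<in> cn h"
    by (induction rule: cn_induct) (auto intro: cn_step)
next
  assume "(y, z) \<in> cn h"
  then have "(y, z) \<in> cn (comp h x) \<and> (x, z) \<in> cn h"
  proof (induction rule: cn_induct)
    case (vr u w)
    then have "(u, w) \<in> vr (comp h x)" using cn_step(1)[of x u h w] by auto
    then show ?case using vr cn_step(1) by blast
  next
    case (ad u w)
    then have "(u, w) \<in> ad (comp h x)" using cn_step(2)[of x u h w] by auto
    then show ?case using ad cn_step(2) by blast
  qed (use assms in simp)
  then show "(y, z) \<in> cn (comp h x)" by simp
qed

lemma cubic_comp: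
  assumes "cubic h" "x \<in> hs h"
  shows "cubic (comp h x)"
proof -
  note hp = cubic_pairs[OF assms(1)] and D = cubicD[OF assms(1)]
  let ?S = "cn h `` {x}"
  have S: "?S \<subseteq> hs h" using cn_hs[OF _ assms(1), of x] assms(2) by auto
  have st: "(y, z) \<in> vr h \<Longrightarrow> y \<in> ?S \<Longrightarrow> z \<in> ?S" for y z using cn_step(1) by blast
  have "equiv ?S (vr h \<inter> ?S \<times> ?S)"
  proof (rule equivI)
    show "refl_on ?S (vr h \<inter> ?S \<times> ?S)" using S D(11) unfolding refl_on_def by blast
    show "sym (vr h \<inter> ?S \<times> ?S)" using D(9) by (auto simp: sym_def)
    show "trans (vr h \<inter> ?S \<times> ?S)" using D(10) unfolding trans_def by blast
  qed auto
  moreover have "(vr h \<inter> ?S \<times> ?S) `` {y} = vr h `` {y}" if "y \<in> ?S" for y using st that by auto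
  moreover have "sym (ad (comp h x))" "irrefl (ad (comp h x))" "single_valued (ad (comp h x))"
    using D(5,6,7) by (auto simp: sym_def irrefl_def single_valued_def)
  ultimately show ?thesis
    using D(3) S finite_subset[OF S D(1)] unfolding cubic_def by (simp add: subset_iff)
qed

lemma comp_props:
  assumes "lfgh h" "x \<in> hs h"
  shows "csub (comp h x) h" "ext (comp h x) \<subseteq> ext h"
proof -
  note cub = lfgh_cubic[OF assms(1)]
  note c = cubic_comp[OF cub assms(2)]
  have S: "(x, y) \<in> cn h \<Longrightarrow> y \<in> hs h" for y using cn_hs[OF _ cub, of x] assms(2) by auto
  have cnn: "(y, z) \<in> cn (comp h x)" if "(x, y) \<in> cn h" "(x, z) \<in> cn h" for y z
    using cn_comp[OF cub that(1)] cn_trans[OF cn_sym[OF cub that(1)] that(2)] by simp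
  have conn: "conn (comp h x)"
    unfolding conn_def
  proof (intro conjI ballI)
    have "x \<in> hs (comp h x)" by simp
    then show "hs (comp h x) \<noteq> {}" by blast
  qed (use cnn in simp)
  have ext: "ext (comp h x) = cext h x" by (rule ext_comp[OF cub assms(2)])
  then show e: "ext (comp h x) \<subseteq> ext h" by (auto simp: cext_def)
  have cext: "cext (comp h x) y = cext h x" if "(x, y) \<in> cn h" for y
    using conn_cext[OF c conn, of y] that ext by simp
  have st: "(y, z) \<in> vr h \<Longrightarrow> (x, y) \<in> cn h \<Longrightarrow> (x, z) \<in> cn h"
    "(y, z) \<in> ad h \<Longrightarrow> (x, y) \<in> cn h \<Longrightarrow> (x, z) \<in> cn h" for y z
    using cn_step by blast+
  have "vr (comp h x) `` {y} \<inter> Domain (ad (comp h x)) \<noteq> {}" if "(x, y) \<in> cn h" for y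
  proof -
    have "vr h `` {y} \<inter> Domain (ad h) \<noteq> {}" using assms(1) S[OF that] by (simp add: lfgh_def)
    then obtain z w where zw: "(y, z) \<in> vr h" "(z, w) \<in> ad h" by auto
    then have "(x, z) \<in> cn h" using st that by blast
    then have "(z, w) \<in> ad (comp h x)" "(y, z) \<in> vr (comp h x)" using st zw that by auto
    then show ?thesis by blast
  qed
  moreover have "card (cext (comp h x) y) = 2 \<or> card (cext (comp h x) y) = 3" if "(x, y) \<in> cn h" for y
    using assms cext[OF that] by (simp add: lfgh_def)
  ultimately have l: "lfgh (comp h x)" using c by (simp add: lfgh_def)
  have "sub (comp h x) h"
    unfolding sub_def
  proof (intro conjI ballI impI)
    show "vr (comp h x) = vr h \<inter> hs (comp h x) \<times> UNIV" using st by auto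
  qed (use l S e cext in \<open>auto simp: cext_def\<close>)
  then show "csub (comp h x) h" using conn by (simp add: csub_def)
qed

lemma comp_eq: "cubic h \<Longrightarrow> (x, y) \<in> cn h \<Longrightarrow> comp h x = comp h y"
  by (simp add: comp_def cn_class_eq)

lemma comps_disjoint:
  assumes "cubic h" "c \<in> comps h" "d \<in> comps h" "x \<in> hs c" "x \<in> hs d"
  shows "c = d"
proof -
  obtain y z where yz: "c = comp h y" "d = comp h z" using assms by (auto simp: comps_def)
  then have "c = comp h x" "d = comp h x" using assms comp_eq by auto
  then show ?thesis by simp
qed

lemma comps_quo:
  assumes "lfgh h" "c \<in> comps h"
  shows "comps (quo h c) = comps h - {c}"
proof -
  obtain x where x: "x \<in> hs h" "c = comp h x" using assms(2) by (auto simp: comps_def)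
  note p = comp_props[OF assms(1) x(1), folded x(2)]
  interpret contraction h c by (rule contraction_lfgh[OF assms(1) p(1)])
  note q = quo_comp[OF p(2)]
  have eq: "comp (quo h c) y = comp h y" if y: "y \<in> hs h - hs c" for y
  proof -
    have yh: "y \<in> hs (quo h c)" using y by (simp add: q)
    have out: "z \<in> hs h - hs c" if "(y, z) \<in> cn h" for z
    proof -
      have "z \<notin> hs c" using comp_closed[OF p(2) _ cn_sym[OF cub that]] y by blast
      then show ?thesis using cn_hs[OF that cub] y by simp
    qed
    then have S: "cn (quo h c) `` {y} = cn h `` {y}"
      using cn_quo_imp[of y] cn_quo[OF yh] by (auto simp: q)
    have "vr (quo h c) \<inter> cn h `` {y} \<times> cn h `` {y} = vr h \<inter> cn h `` {y} \<times> cn h `` {y}"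
      "ad (quo h c) \<inter> cn h `` {y} \<times> cn h `` {y} = ad h \<inter> cn h `` {y} \<times> cn h `` {y}"
      using out by (auto simp: q)
    then show ?thesis by (intro hgraph.equality) (auto simp: S)
  qed
  have "comp h y \<noteq> c" if "y \<in> hs h - hs c" for y
  proof
    assume e: "comp h y = c"
    have "y \<in> hs (comp h y)" by simp
    then show False using that unfolding e by simp
  qed
  moreover have "comp h y = c" if "y \<in> hs c" for y using that x comp_eq[OF cub] by auto
  moreover have "hs (quo h c) = hs h - hs c" by (simp add: q)
  ultimately show ?thesis using eq unfolding comps_def by (auto simp: image_iff)
qed

lemma quo_empty:
  assumes "cubic h" "hs g = {}"
  shows "quo h g = h"
proof (rule hgraph.equality)
  have k: "keep g h = {}" "tau g = {}" using assms(2) by (auto simp: keep_def tau_def ext_def)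
  show h: "hs (quo h g) = hs h" by (simp add: quo_simps k assms)
  show "vr (quo h g) = vr h" using cubicD(8)[OF assms(1)] by (auto simp: quo_simps k assms)
  show "ad (quo h g) = ad h"
    using cubicD(4)[OF assms(1)] cubic_pairs(8)[OF assms(1)] matching_rtrancl[OF assms(1)]
    unfolding quo_simps(3) h k by auto
qed simp

section \<open>Contraction in graphs with vertices\<close>

definition nonbare :: "hgraph \<Rightarrow> hgraph"
  where "nonbare h = (let S = {x \<in> hs h. vr h `` {x} \<inter> Domain (ad h) \<noteq> {}} in
    \<lparr>hs = S, vr = vr h \<inter> S \<times> S, ad = ad h\<rparr>)"

lemma nonbare_simps [simp]:
  "hs (nonbare h) = {x \<in> hs h. vr h `` {x} \<inter> Domain (ad h) \<noteq> {}}"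
  "vr (nonbare h) = vr h \<inter> hs (nonbare h) \<times> hs (nonbare h)" "ad (nonbare h) = ad h"
  by (simp_all add: nonbare_def Let_def)

text \<open>Contracting a component with three external edges by \<open>contract\<close> leaves a
  bare vertex, which \<open>quo\<close> removes at once. Graphs in the middle of a sequence of
  contractions may thus carry bare vertices, and they are compared with half-edge graphs only
  through \<open>nonbare\<close>.\<close>

locale graph_contraction =
  fixes G c
  assumes G: "trivalent G" and lfg: "lfgh (nonbare (shape G))" and c: "trivalent c"
    and cs: "csub (shape c) (nonbare (shape G))"
    and inc_c: "inc c = {(v, x) \<in> inc G. v \<in> verts c}" and verts_c: "verts c \<subseteq> verts G"
begin

abbreviation "h \<equiv> nonbare (shape G)"
abbreviation "k \<equiv> shape c"

sublocale contraction h k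
  by (rule contraction_lfgh[OF lfg cs])

lemmas g = trivalentD[OF G]

lemma in_c: "(v, x) \<in> inc G \<Longrightarrow> v \<in> verts c \<longleftrightarrow> x \<in> halves c"
  using inc_c trivalentD(4,10)[OF c] g(9) by blast

lemma halves_c: "halves c \<subseteq> hs h"
  using subD'(3) by simp

lemma ext_eq: "external_edges c = ext k"
  by (rule external_edges_shape)


lemma adj_contract: "adj (contract c G) = ad (quo h k)"
proof -
  have a1: "(x, y) \<in> adj G \<Longrightarrow> x \<in> hs h" "(x, y) \<in> adj G \<Longrightarrow> y \<in> hs h" for x y
    using hp(3,4)[of x y] by (simp_all only: nonbare_simps shape_simps)
  have a2: "x \<notin> ext h" "y \<notin> ext h" if "(x, y) \<in> adj G" for x y
    using that hp(6)[of x y] by (auto simp: ext_def simp del: nonbare_simps(1,2))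
  have hG: "hs h \<subseteq> halves G" by auto
  \<comment> \<open>Half-edges at bare vertices have no partners, so for the matching it makes no
    difference whether they are present.\<close>
  have R: "adj G \<inter> (halves G - X) \<times> (halves G - X) = adj G \<inter> (hs h - X) \<times> (hs h - X)" for X
  proof (rule set_eqI, clarify)
    fix x y
    show "(x, y) \<in> adj G \<inter> (halves G - X) \<times> (halves G - X) \<longleftrightarrow> (x, y) \<in> adj G \<inter> (hs h - X) \<times> (hs h - X)"
      using a1[of x y] hG by blast
  qed
  show ?thesis
  proof (cases rule: kinds)
    case comp
    have "adj (contract c G) = adj G \<inter> (hs h - halves c) \<times> (hs h - halves c)"
    proof (cases "card (ext k) = 3")
      case True
      then have "adj (contract c G) = adj G \<inter> (halves G - (halves c - ext k)) \<times> (halves G - (halves c - ext k))"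
        by (simp add: contract_def Let_def ext_eq)
      also have "\<dots> = adj G \<inter> (hs h - (halves c - ext k)) \<times> (hs h - (halves c - ext k))"
        by (rule R)
      also have "\<dots> = adj G \<inter> (hs h - halves c) \<times> (hs h - halves c)"
      proof (rule set_eqI, clarify)
        fix x y
        show "(x, y) \<in> adj G \<inter> (hs h - (halves c - ext k)) \<times> (hs h - (halves c - ext k)) \<longleftrightarrow>
            (x, y) \<in> adj G \<inter> (hs h - halves c) \<times> (hs h - halves c)"
          using a2[of x y] comp by blast
      qed
      finally show ?thesis .
    next
      case False
      then have "adj (contract c G) = adj G \<inter> (halves G - halves c) \<times> (halves G - halves c) \<union>
          {(h, k'). \<exists>a b. ext k = {a, b} \<and> a \<noteq> b \<and> (a, h) \<in> adj G \<and> (b, k') \<in> adj G}"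
        by (simp add: contract_def Let_def ext_eq)
      also have "{(h, k'). \<exists>a b. ext k = {a, b} \<and> a \<noteq> b \<and> (a, h) \<in> adj G \<and> (b, k') \<in> adj G} = {}"
        using a2 comp by blast
      finally show ?thesis unfolding R by simp
    qed
    then show ?thesis by (simp only: quo_comp[OF comp] hgraph.simps nonbare_simps(3) shape_simps)
  next
    case three
    have "adj (contract c G) = adj G \<inter> (halves G - (halves c - ext k)) \<times> (halves G - (halves c - ext k))"
      using three by (simp add: contract_def Let_def ext_eq)
    also have "\<dots> = adj G \<inter> (hs h - (halves c - ext k)) \<times> (hs h - (halves c - ext k))"
      by (rule R)
    also have "hs h - (halves c - ext k) = (hs h - halves c) \<union> ext k"
      using halves_c ext_c_hs unfolding shape_simps by blast
    finally show ?thesis by (simp only: quo_three[OF three] hgraph.simps nonbare_simps(3) shape_simps)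
  next
    case (two a b p q)
    have "card (ext k) \<noteq> 3" using two by simp
    then have "adj (contract c G) = adj G \<inter> (halves G - halves c) \<times> (halves G - halves c) \<union>
          {(h, k'). \<exists>a b. ext k = {a, b} \<and> a \<noteq> b \<and> (a, h) \<in> adj G \<and> (b, k') \<in> adj G}"
      by (simp add: contract_def Let_def ext_eq)
    also have "{(h, k'). \<exists>a b. ext k = {a, b} \<and> a \<noteq> b \<and> (a, h) \<in> adj G \<and> (b, k') \<in> adj G} = {(p, q), (q, p)}" (is "?S = _")
    proof
      have ap: "(a, p) \<in> adj G" "(b, q) \<in> adj G" using two by auto
      show "?S \<subseteq> {(p, q), (q, p)}"
      proof
        fix z assume "z \<in> ?S"
        then obtain x y a' b' where *: "z = (x, y)" "ext k = {a', b'}" "(a', x) \<in> adj G" "(b', y) \<in> adj G"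
          by blast
        then have "a' = a \<and> b' = b \<or> a' = b \<and> b' = a" using two(1) by (auto simp: doubleton_eq_iff)
        then show "z \<in> {(p, q), (q, p)}" using * ap g(11) by blast
      qed
      show "{(p, q), (q, p)} \<subseteq> ?S"
        using two(1,2) ap by (auto simp: doubleton_eq_iff)
    qed
    also have "adj G \<inter> (halves G - halves c) \<times> (halves G - halves c) = adj G \<inter> (hs h - halves c) \<times> (hs h - halves c)"
      by (rule R)
    finally show ?thesis
      by (simp only: quo_two(1)[OF two(1-4)] hgraph.simps nonbare_simps(3) shape_simps)
  qed
qed

lemma contract_parts:
  "halves (contract c G) = (halves G - halves c) \<union> (if card (ext k) = 3 then ext k else {})"
  "inc (contract c G) = {(w, x) \<in> inc G. w \<notin> verts c} \<union>
     (if card (ext k) = 3 then {Min (verts c)} \<times> ext k else {})"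
  "verts (contract c G) = (verts G - verts c) \<union> (if card (ext k) = 3 then {Min (verts c)} else {})"
  using halves_c ext_c_hs by (auto simp: contract_def Let_def ext_eq)

lemma Min_c: "Min (verts c) \<in> verts c"
proof -
  obtain x where "x \<in> hs k" using c_ne by blast
  then have "x \<in> halves c" by simp
  then have "verts c \<noteq> {}" using trivalentD(3,10)[OF c] by blast
  then show ?thesis using trivalentD(1)[OF c] by simp
qed

lemma hs_quo_halves: "hs (quo h k) \<subseteq> halves (contract c G)"
proof -
  have "keep k h \<subseteq> (if card (ext k) = 3 then ext k else {})" by (simp only: keep_c) auto
  moreover have "hs h - hs k \<subseteq> halves G - halves c" by auto
  ultimately show ?thesis unfolding quo_simps(1) contract_parts(1) by blast
qed

lemma trivalent_contract: "trivalent (contract c G)"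
proof -
  note cq = cubicD[OF cubic_quo, folded adj_contract] and M = Min_c
  let ?G = "contract c G"
  have ec: "ext k \<subseteq> halves c" using ext_c_hs by auto
  have "adj ?G \<subseteq> halves ?G \<times> halves ?G" using cq(4) hs_quo_halves by auto
  moreover have "h = k'" if "(x, h) \<in> adj ?G" "(x, k') \<in> adj ?G" for x h k'
    using that cq(7) by (auto dest: single_valuedD)
  moreover have "finite (verts ?G)" using g(1) by (simp add: contract_parts)
  moreover have "finite (halves ?G)" using g(2) ec trivalentD(2)[OF c] finite_subset by (auto simp: contract_parts)
  moreover have "inc ?G \<subseteq> verts ?G \<times> halves ?G"
    using g(3,4) in_c unfolding contract_parts by auto
  moreover have "\<exists>!v. (v, x) \<in> inc ?G" if x: "x \<in> halves ?G" for x
  proof (cases "x \<in> halves c")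
    case True
    then have "card (ext k) = 3" "x \<in> ext k" using x by (auto simp: contract_parts split: if_splits)
    then show ?thesis using True in_c by (auto simp: contract_parts)
  next
    case False
    then have "x \<in> halves G" "x \<notin> ext k" using x ec by (auto simp: contract_parts split: if_splits)
    then obtain v where "(v, x) \<in> inc G" using g(10) by blast
    then show ?thesis using False in_c g(9) \<open>x \<notin> ext k\<close> by (auto simp: contract_parts intro!: ex1I[of _ v])
  qed
  moreover have "card (half_edges_at ?G v) = 3" if v: "v \<in> verts ?G" for v
  proof (cases "v \<in> verts c")
    case True
    then have "card (ext k) = 3" "half_edges_at ?G v = ext k"
      using v M by (auto simp: contract_parts half_edges_at_def split: if_splits)
    then show ?thesis by simp
  next
    case False
    then have "half_edges_at ?G v = half_edges_at G v" "v \<in> verts G"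
      using v M by (auto simp: contract_parts half_edges_at_def split: if_splits)
    then show ?thesis using g(12) by simp
  qed
  ultimately show ?thesis using cq(5,6) unfolding trivalent_def finite_graph_def by blast
qed

lemma vr_contract: "vr (quo h k) = vr (shape (contract c G)) \<inter> hs (quo h k) \<times> UNIV"
proof -
  let ?G = "contract c G"
  have ec: "ext k \<subseteq> halves c" using ext_c_hs by auto
  have vh: "vr h = vr (shape G) \<inter> hs h \<times> hs h" by simp
  have nb: "y \<in> hs h" if "x \<in> hs h" "(x, y) \<in> vr (shape G)" for x y
  proof -
    have "vr (shape G) `` {x} = vr (shape G) `` {y}"
      using that(2) cubicD(2)[OF cubic_shape[OF G]] by (meson equiv_class_eq)
    moreover have "y \<in> hs (shape G)" using that(2) cubic_pairs(2)[OF cubic_shape[OF G]] by blast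
    ultimately show ?thesis using that(1) unfolding nonbare_simps(1) mem_Collect_eq by metis
  qed
  \<comment> \<open>A half-edge of \<open>c\<close> can only end up at the new vertex. The statement
    \<open>B\<close> below treats the other half-edges, whose vertices are untouched.\<close>
  have A: "(x, y) \<in> vr (quo h k) \<longleftrightarrow> (x, y) \<in> vr (shape ?G) \<and> x \<in> hs (quo h k)" if "x \<in> halves c" for x y
  proof -
    have kp: "x \<in> keep k h \<longleftrightarrow> x \<in> hs (quo h k)"
      unfolding quo_simps(1) using that by (auto simp del: nonbare_simps(1,2))
    have 1: "(x, y) \<in> vr (quo h k) \<longleftrightarrow> (x, y) \<in> cn k \<and> x \<in> keep k h \<and> y \<in> keep k h"
      unfolding quo_simps(2) using that by (auto simp del: nonbare_simps(1,2))
    show ?thesis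
    proof (cases "keep k h = {}")
      case True
      then show ?thesis using 1 kp by blast
    next
      case False
      then have K: "keep k h = ext k" "card (ext k) = 3" unfolding keep_c by (auto split: if_splits)
      have "(x, y) \<in> vr (shape ?G) \<longleftrightarrow> x \<in> ext k \<and> y \<in> ext k"
        using that K in_c Min_c by (auto simp: contract_parts(2))
      moreover have "(x, y) \<in> cn k" if "x \<in> ext k" "y \<in> ext k" using that cn_c ext_c_hs by blast
      ultimately show ?thesis using 1 kp K by blast
    qed
  qed
  have B: "(x, y) \<in> vr (quo h k) \<longleftrightarrow> (x, y) \<in> vr (shape ?G) \<and> x \<in> hs (quo h k)" if "x \<notin> halves c" for x y
  proof -
    have kp: "x \<notin> keep k h" "x \<notin> ext k" using that ec unfolding keep_def by auto
    have "(x, y) \<in> vr (shape ?G) \<longleftrightarrow> (x, y) \<in> vr (shape G)"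
      using that kp in_c Min_c unfolding contract_parts shape_simps by auto
    moreover have "(x, y) \<in> vr (quo h k) \<longleftrightarrow> (x, y) \<in> vr h \<and> x \<in> hs h - hs k \<and> y \<in> hs h - hs k"
      unfolding quo_simps(2) using kp by blast
    moreover have "x \<in> hs (quo h k) \<longleftrightarrow> x \<in> hs h - hs k" using kp that unfolding quo_simps(1) by auto
    moreover have "y \<in> hs h - hs k" if "(x, y) \<in> vr h" "x \<in> hs h - hs k" using outside_c that by blast
    ultimately show ?thesis using vh nb by blast
  qed
  show ?thesis
  proof (rule set_eqI, clarify)
    fix x y
    show "(x, y) \<in> vr (quo h k) \<longleftrightarrow> (x, y) \<in> vr (shape ?G) \<inter> hs (quo h k) \<times> UNIV"
      using A[of x y] B[of x y] by blast
  qed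
qed

lemma nonbare_contract: "nonbare (shape (contract c G)) = quo h k"
proof -
  let ?G = "contract c G"
  have lq: "lfgh (quo h k)" using lfgh_quo lfg by blast
  have cub': "cubic (shape ?G)" by (rule cubic_shape[OF trivalent_contract])
  have "{x \<in> halves ?G. vr (shape ?G) `` {x} \<inter> Domain (ad (quo h k)) \<noteq> {}} = hs (quo h k)"
  proof (intro set_eqI iffI)
    fix x assume "x \<in> {x \<in> halves ?G. vr (shape ?G) `` {x} \<inter> Domain (ad (quo h k)) \<noteq> {}}"
    then obtain y where y: "(x, y) \<in> vr (shape ?G)" "y \<in> Domain (ad (quo h k))" by blast
    then have "y \<in> hs (quo h k)" "(y, x) \<in> vr (shape ?G)"
      using cubic_pairs(3)[OF cubic_quo] cubic_pairs(5)[OF cub'] by blast+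
    then have "(y, x) \<in> vr (quo h k)" using vr_contract by blast
    then show "x \<in> hs (quo h k)" using cubic_pairs(2)[OF cubic_quo] by blast
  next
    fix x assume x: "x \<in> hs (quo h k)"
    then have "vr (quo h k) `` {x} \<inter> Domain (ad (quo h k)) \<noteq> {}" using lq unfolding lfgh_def by blast
    then have "vr (shape ?G) `` {x} \<inter> Domain (ad (quo h k)) \<noteq> {}" using vr_contract by blast
    then show "x \<in> {x \<in> halves ?G. vr (shape ?G) `` {x} \<inter> Domain (ad (quo h k)) \<noteq> {}}"
      using x hs_quo_halves by blast
  qed
  then have hs: "hs (nonbare (shape ?G)) = hs (quo h k)"
    unfolding nonbare_simps(1) shape_simps(1,2) adj_contract .
  show ?thesis
  proof (rule hgraph.equality)
    show "vr (nonbare (shape ?G)) = vr (quo h k)"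
      unfolding nonbare_simps(2) hs using vr_contract cubicD(8)[OF cubic_quo] by blast
    show "ad (nonbare (shape ?G)) = ad (quo h k)"
      unfolding nonbare_simps(3) shape_simps(2) adj_contract ..
  qed (use hs in simp_all)
qed

end

lemma shape_drop_bare:
  assumes G: "trivalent G"
  shows "shape (drop_bare_vertices G) = nonbare (shape G)" "trivalent (drop_bare_vertices G)"
proof -
  note g = trivalentD[OF G]
  let ?D = "drop_bare_vertices G"
  define B where "B = {v \<in> verts G. half_edges_at G v \<subseteq> external_edges G}"
  define S where "S = hs (nonbare (shape G))"
  have bare: "v \<in> B \<longleftrightarrow> x \<notin> S" if vx: "(v, x) \<in> inc G" for v x
    using g(3,4)[OF vx] vr_shape_class[OF G vx] g(4)
    by (auto simp: B_def S_def external_edges_def half_edges_at_def)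
  have bare_halves: "halves G - (\<Union>v\<in>B. half_edges_at G v) = S"
  proof (intro set_eqI iffI)
    fix x assume x: "x \<in> halves G - (\<Union>v\<in>B. half_edges_at G v)"
    then obtain v where "(v, x) \<in> inc G" using g(10) by blast
    then show "x \<in> S" using x bare by (auto simp: half_edges_at_def)
  next
    fix x assume x: "x \<in> S"
    then show "x \<in> halves G - (\<Union>v\<in>B. half_edges_at G v)" using bare[of _ x] by (auto simp: half_edges_at_def S_def)
  qed
  have D: "halves ?D = S" "verts ?D = verts G - B" "inc ?D = {(v, x) \<in> inc G. v \<notin> B}"
    "adj ?D = adj G \<inter> S \<times> S"
    using bare_halves by (simp_all add: drop_bare_vertices_def Let_def flip: B_def)
  have adjS: "x \<in> S" "y \<in> S" if xy: "(x, y) \<in> adj G" for x y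
    using g(5,6)[OF xy] g(7)[OF xy] xy cubicD(11)[OF cubic_shape[OF G], of x]
      cubicD(11)[OF cubic_shape[OF G], of y] unfolding S_def nonbare_simps(1) shape_simps(1,2)
    by blast+
  then have adj: "adj ?D = adj G" using D by auto
  show "shape ?D = nonbare (shape G)"
  proof (rule hgraph.equality)
    show "vr (shape ?D) = vr (nonbare (shape G))"
    proof (rule set_eqI, clarify)
      fix x y
      have "(x, y) \<in> vr (shape ?D) \<longleftrightarrow> (\<exists>v. v \<notin> B \<and> (v, x) \<in> inc G \<and> (v, y) \<in> inc G)"
        using D by auto
      also have "\<dots> \<longleftrightarrow> (x, y) \<in> vr (shape G) \<and> x \<in> S \<and> y \<in> S" using bare by auto
      finally show "(x, y) \<in> vr (shape ?D) \<longleftrightarrow> (x, y) \<in> vr (nonbare (shape G))"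
        unfolding nonbare_simps(2) S_def by blast
    qed
  qed (use D adj in \<open>simp_all add: S_def\<close>)
  have fin: "finite (verts ?D)" "finite (halves ?D)"
    using g(1,2) D by (auto simp: S_def)
  have "inc ?D \<subseteq> verts ?D \<times> halves ?D" using g(3) bare D by auto
  moreover have "\<exists>!v. (v, x) \<in> inc ?D" if "x \<in> halves ?D" for x
  proof -
    have xS: "x \<in> S" using that D by simp
    then have "x \<in> halves G" by (auto simp: S_def)
    then obtain v where "(v, x) \<in> inc G" using g(10) by blast
    then show ?thesis using bare xS g(9) D by (auto intro!: ex1I[of _ v])
  qed
  moreover have "card (half_edges_at ?D v) = 3" if "v \<in> verts ?D" for v
  proof -
    have "half_edges_at ?D v = half_edges_at G v" using that D by (auto simp: half_edges_at_def)
    then show ?thesis using that D g(12) by simp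
  qed
  moreover have "adj ?D \<subseteq> halves ?D \<times> halves ?D" using D by auto
  moreover have "sym (adj ?D)" "irrefl (adj ?D)" using g(7,8) unfolding adj by (auto simp: sym_def irrefl_def)
  moreover have "k = k'" if "(x, k) \<in> adj ?D" "(x, k') \<in> adj ?D" for x k k'
    using that g(11) unfolding adj by blast
  ultimately show "trivalent ?D" using fin unfolding trivalent_def finite_graph_def by blast
qed

lemma components_shape:
  assumes G: "trivalent G"
  shows "shape ` components G = comps (shape G)" "inj_on shape (components G)"
proof -
  note g = trivalentD[OF G]
  show "shape ` components G = comps (shape G)"
  proof (intro set_eqI iffI)
    fix k assume "k \<in> shape ` components G"
    then obtain C where C: "k = shape C" "C \<in> components G" by blast
    obtain v x where "(v, x) \<in> inc G" "C = component G v" by (rule component_in[OF G C(2)])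
    then show "k \<in> comps (shape G)" using C component_simps(5)[OF G] g(4) by (auto simp: comps_def)
  next
    fix k assume "k \<in> comps (shape G)"
    then obtain x where x: "x \<in> halves G" "k = comp (shape G) x" by (auto simp: comps_def)
    then show "k \<in> shape ` components G" using inc_component[OF G x(1)] component_simps(5)[OF G] by (metis image_eqI)
  qed
  show "inj_on shape (components G)"
  proof (rule inj_onI)
    fix C D assume CD: "C \<in> components G" "D \<in> components G" "shape C = shape D"
    obtain v x where v: "(v, x) \<in> inc G" "C = component G v" by (rule component_in[OF G CD(1)])
    obtain w y where w: "(w, y) \<in> inc G" "D = component G w" by (rule component_in[OF G CD(2)])
    note cv = component_simps[OF G v(1)] and cw = component_simps[OF G w(1)]
    have h: "cn (shape G) `` {x} = cn (shape G) `` {y}"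
      using CD(3) cv(2) cw(2) unfolding v(2) w(2) by (metis shape_simps(1))
    then have cn: "(x, z) \<in> cn (shape G) \<longleftrightarrow> (y, z) \<in> cn (shape G)" for z by blast
    have "(v, u) \<in> (linked G)\<^sup>* \<longleftrightarrow> (w, u) \<in> (linked G)\<^sup>*" for u
    proof (cases "\<exists>z. (u, z) \<in> inc G")
      case True
      then show ?thesis using linked_cn[OF G v(1)] linked_cn[OF G w(1)] cn by blast
    next
      case False
      \<comment> \<open>A vertex without half-edges is reached from no other vertex.\<close>
      have "(a, u) \<notin> (linked G)\<^sup>*" if "a \<noteq> u" for a
      proof
        assume "(a, u) \<in> (linked G)\<^sup>*"
        then show False by (cases rule: rtranclE) (use that False in \<open>auto simp: linked_def\<close>)
      qed
      moreover have "v \<noteq> u" "w \<noteq> u" using False v(1) w(1) by auto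
      ultimately show ?thesis by blast
    qed
    then have "verts C = verts D" by (simp add: v(2) w(2) cv(1) cw(1))
    then show "C = D"
      using cn h by (intro graph.equality) (simp_all add: v(2) w(2) cv cw)
  qed
qed

lemma component_inc:
  assumes G: "trivalent G" and C: "C \<in> components G"
  shows "inc C = {(v, x) \<in> inc G. v \<in> verts C}" "verts C \<subseteq> verts G" "trivalent C"
proof -
  obtain v x where v: "(v, x) \<in> inc G" "C = component G v" by (rule component_in[OF G C])
  note c = component_simps[OF G v(1)]
  show "inc C = {(w, y) \<in> inc G. w \<in> verts C}"
    using linked_cn[OF G v(1)] unfolding v(2) c by auto
  show t: "trivalent C" unfolding v(2) by (rule trivalent_component[OF G v(1)])
  show "verts C \<subseteq> verts G"
  proof
    fix w assume w: "w \<in> verts C"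
    then obtain y where "(w, y) \<in> inc C" using half_edges_at_ne[OF t] by blast
    then have "(w, y) \<in> inc G" unfolding v(2) c by simp
    then show "w \<in> verts G" by (rule trivalentD(3)[OF G])
  qed
qed

lemma csub_nested: "csub c g \<Longrightarrow> sub g h \<Longrightarrow> csub c h"
  using sub_trans by (auto simp: csub_def)

text \<open>Each step replaces the graph and \<gamma> by their quotients by the same component, and
  \<open>quo_quo\<close> puts the steps together. As \<open>cs\<close> is any list of the
  components, the result does not depend on the order.\<close>

lemma fold_contract:
  assumes "trivalent G" "lfgh (nonbare (shape G))" "sub \<gamma> (nonbare (shape G))"
    "distinct (map shape cs)" "set (map shape cs) = comps \<gamma>"
    "\<And>c. c \<in> set cs \<Longrightarrow> trivalent c \<and> inc c = {(v, x) \<in> inc G. v \<in> verts c} \<and> verts c \<subseteq> verts G"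
  shows "trivalent (fold contract cs G) \<and> nonbare (shape (fold contract cs G)) = quo (nonbare (shape G)) \<gamma>"
  using assms
proof (induction cs arbitrary: G \<gamma>)
  case Nil
  then have "hs \<gamma> = {}" by (auto simp: comps_def)
  then show ?case using Nil quo_empty lfgh_cubic by auto
next
  case (Cons c cs)
  let ?h = "nonbare (shape G)" and ?k = "shape c"
  note lg = subD(1)[OF Cons.prems(3)]
  have kc: "?k \<in> comps \<gamma>" using Cons.prems(5) by auto
  then obtain x where x: "x \<in> hs \<gamma>" "?k = comp \<gamma> x" by (auto simp: comps_def)
  have cg: "csub ?k \<gamma>" using comp_props(1)[OF lg x(1)] x(2) by simp
  interpret graph_contraction G c
    using Cons.prems(1,2,6) csub_nested[OF cg Cons.prems(3)] by unfold_locales auto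
  interpret N: nested_contraction ?h \<gamma> ?k
    using Cons.prems(2,3) cg by unfold_locales
  have IH: "trivalent (fold contract cs (contract c G)) \<and>
      nonbare (shape (fold contract cs (contract c G))) = quo (nonbare (shape (contract c G))) (quo \<gamma> ?k)"
  proof (rule Cons.IH)
    show "trivalent (contract c G)" by (rule trivalent_contract)
    show "lfgh (nonbare (shape (contract c G)))"
      unfolding nonbare_contract using lfgh_quo lfg by blast
    show "sub (quo \<gamma> ?k) (nonbare (shape (contract c G)))"
      unfolding nonbare_contract by (rule N.sub_quo)
    show "distinct (map shape cs)" using Cons.prems(4) by simp
    show "set (map shape cs) = comps (quo \<gamma> ?k)"
    proof -
      have "?k \<notin> shape ` set cs" "comps \<gamma> = insert ?k (shape ` set cs)" using Cons.prems(4,5) by auto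
      then show ?thesis by (simp add: comps_quo[OF lg kc])
    qed
    fix d assume d: "d \<in> set cs"
    then have d': "trivalent d" "inc d = {(v, x) \<in> inc G. v \<in> verts d}" "verts d \<subseteq> verts G"
      using Cons.prems(6)[of d] by auto
    have "shape d \<in> shape ` set cs" "?k \<notin> shape ` set cs" using d Cons.prems(4) by auto
    then have "shape d \<noteq> ?k" "shape d \<in> comps \<gamma>" using Cons.prems(5) by auto
    then have disj: "halves d \<inter> halves c = {}"
      using comps_disjoint[OF lfgh_cubic[OF lg] _ kc] by force
    \<comment> \<open>The remaining components must survive the step unchanged, so they may contain
      neither vertices of \<open>c\<close> nor the name \<open>Min (verts c)\<close> given to the
      new vertex.\<close>
    have "verts d \<inter> verts c = {}"
    proof (rule ccontr)
      assume "verts d \<inter> verts c \<noteq> {}"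
      then obtain v where v: "v \<in> verts d" "v \<in> verts c" by blast
      then obtain x where x: "(v, x) \<in> inc d" using half_edges_at_ne[OF d'(1)] by blast
      then have "x \<in> halves d" "x \<in> halves c"
        using trivalentD(4)[OF d'(1) x] d'(2) in_c[of v x] v by auto
      with disj show False by blast
    qed
    moreover from this have "Min (verts c) \<notin> verts d" using Min_c by blast
    ultimately show "trivalent d \<and> inc d = {(v, x) \<in> inc (contract c G). v \<in> verts d} \<and> verts d \<subseteq> verts (contract c G)"
      using d' unfolding contract_parts by auto
  qed
  then show ?case using nonbare_contract N.quo_quo by simp
qed

lemma lfgh_nonbare: "lfgh h \<Longrightarrow> nonbare h = h"
  by (rule hgraph.equality) (use cubicD(8)[OF lfgh_cubic, of h] in \<open>auto simp: lfgh_def\<close>)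

text \<open>One component at a time: \<open>lfgh_quo\<close> handles the first,
  \<open>quo_quo\<close> reduces to the quotient by it.\<close>

lemma lfgh_quo_sub:
  assumes "lfgh h" "sub g h"
  shows "lfgh (quo h g)"
  using assms
proof (induction "card (comps g)" arbitrary: h g)
  case 0
  have "finite (comps g)" using cubicD(1)[OF subD(2)[OF 0(3)]] by (simp add: comps_def)
  then have "hs g = {}" using 0(1) by (auto simp: comps_def)
  then show ?case using quo_empty 0(2) lfgh_cubic by simp
next
  case (Suc n)
  note lg = subD(1)[OF Suc(4)]
  have fin: "finite (comps g)" using cubicD(1)[OF subD(2)[OF Suc(4)]] by (simp add: comps_def)
  obtain c where c: "c \<in> comps g" using Suc(2) by (metis card.empty equals0I nat.distinct(1))
  then obtain x where "x \<in> hs g" "c = comp g x" by (auto simp: comps_def)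
  then have cg: "csub c g" using comp_props(1)[OF lg] by simp
  interpret nested_contraction h g c using Suc(3,4) cg by unfold_locales
  have "card (comps (quo g c)) = n" using Suc(2) c fin by (simp add: comps_quo[OF lg c])
  then have "lfgh (quo (quo h c) (quo g c))"
    using Suc(1)[OF _ _ sub_quo] H.lfgh_quo Suc(3) by simp
  then show ?case by (simp add: quo_quo)
qed

section \<open>Subgraphs in the two encodings\<close>

lemma components_subgraph:
  assumes "trivalent g" "trivalent G"
  shows "(\<forall>C\<in>components g. card (external_edges C) = 2 \<longrightarrow>
       external_edges C \<subseteq> external_edges G \<or> external_edges C \<inter> external_edges G = {}) \<longleftrightarrow>
    (\<forall>x\<in>halves g. card (cext (shape g) x) = 2 \<longrightarrow>
       cext (shape g) x \<subseteq> ext (shape G) \<or> cext (shape g) x \<inter> ext (shape G) = {})"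
  unfolding external_edges_shape[of G] by (rule ball_components[OF assms(1)])

lemma subgraph_shape:
  assumes G: "trivalent G"
  shows "subgraph g G \<longleftrightarrow> trivalent g \<and> sub (shape g) (shape G) \<and> verts g \<subseteq> verts G \<and>
    inc g = {(v, h) \<in> inc G. v \<in> verts g}"
proof (cases "trivalent g \<and> verts g \<subseteq> verts G \<and> inc g = {(v, h) \<in> inc G. v \<in> verts g}")
  case True
  note g = trivalentD[of g] and gG = trivalentD[OF G]
  have vr: "vr (shape g) = vr (shape G) \<inter> halves g \<times> UNIV"
  proof -
    have "(x, y) \<in> vr (shape g) \<longleftrightarrow> (x, y) \<in> vr (shape G) \<and> x \<in> halves g" for x y
    proof
      assume "(x, y) \<in> vr (shape g)"
      then show "(x, y) \<in> vr (shape G) \<and> x \<in> halves g" using True g(4) by auto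
    next
      assume a: "(x, y) \<in> vr (shape G) \<and> x \<in> halves g"
      then obtain v where v: "(v, x) \<in> inc g" using True g(10) by blast
      from a obtain w where w: "(w, x) \<in> inc G" "(w, y) \<in> inc G" by auto
      have "(v, x) \<in> inc G" "v \<in> verts g" using v True by auto
      then have "w = v" using gG(9) w by blast
      then have "(v, y) \<in> inc g" using True w \<open>v \<in> verts g\<close> by auto
      then show "(x, y) \<in> vr (shape g)" using v by auto
    qed
    then show ?thesis by auto
  qed
  show ?thesis
    using True components_subgraph[of g G] G vr
    unfolding subgraph_def sub_def lfg_graph_shape shape_simps by auto
qed (auto simp: subgraph_def lfg_graph_shape)

text \<open>Every vertex carries half-edges, so the half-edges of a subgraph determine its
  vertices.\<close>

lemma subgraph_bij:
  assumes G: "trivalent G"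
  shows "bij_betw shape {g. subgraph g G} {k. sub k (shape G)}"
  unfolding bij_betw_def
proof (intro conjI set_eqI iffI)
  note gG = trivalentD[OF G]
  show "inj_on shape {g. subgraph g G}"
  proof (rule inj_onI)
    fix a b assume ab: "a \<in> {g. subgraph g G}" "b \<in> {g. subgraph g G}" "shape a = shape b"
    then have a: "trivalent a" "verts a \<subseteq> verts G" "inc a = {(v, h) \<in> inc G. v \<in> verts a}"
      and b: "trivalent b" "verts b \<subseteq> verts G" "inc b = {(v, h) \<in> inc G. v \<in> verts b}"
      using subgraph_shape[OF G] by auto
    have h: "halves a = halves b" "adj a = adj b" using ab(3) by (metis shape_simps(1), metis shape_simps(2))
    have vert: "v \<in> verts g \<longleftrightarrow> (\<exists>x\<in>halves g. (v, x) \<in> inc G)"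
      if g: "trivalent g" "inc g = {(v, h) \<in> inc G. v \<in> verts g}" for g v
    proof
      assume "v \<in> verts g"
      then obtain x where x: "(v, x) \<in> inc g" using half_edges_at_ne[OF g(1)] by blast
      then show "\<exists>x\<in>halves g. (v, x) \<in> inc G" using trivalentD(4)[OF g(1) x] g(2) by auto
    next
      assume "\<exists>x\<in>halves g. (v, x) \<in> inc G"
      then obtain x where x: "x \<in> halves g" "(v, x) \<in> inc G" by blast
      then obtain w where "(w, x) \<in> inc g" using trivalentD(10)[OF g(1)] by blast
      moreover from this have "w = v" using g(2) gG(9) x(2) by auto
      ultimately show "v \<in> verts g" using trivalentD(3)[OF g(1)] by blast
    qed
    have v: "verts a = verts b" using vert[OF a(1,3)] vert[OF b(1,3)] h by auto
    then have "inc a = inc b" using a(3) b(3) by simp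
    then show "a = b" using v h by (intro graph.equality) simp_all
  qed
  fix k
  show "k \<in> {k. sub k (shape G)}" if "k \<in> shape ` {g. subgraph g G}" using that subgraph_shape[OF G] by auto
  assume "k \<in> {k. sub k (shape G)}"
  then have k: "sub k (shape G)" by simp
  note kD = subD[OF k] and kc = cubic_pairs[OF subD(2)[OF k]]
  define g where "g = \<lparr>verts = {v. \<exists>x\<in>hs k. (v, x) \<in> inc G}, halves = hs k,
    inc = {(v, x) \<in> inc G. x \<in> hs k}, adj = ad k\<rparr>"
  have closed: "x \<in> hs k \<longleftrightarrow> y \<in> hs k" if "(v, x) \<in> inc G" "(v, y) \<in> inc G" for v x y
    using sub_vr_closed[OF k cubic_shape[OF G], of x y] that by auto
  have hsk: "x \<in> halves G" if "x \<in> hs k" for x using that kD(3) by auto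
  have "finite (verts g)" by (rule finite_subset[OF _ gG(1)]) (use gG(3) in \<open>auto simp: g_def\<close>)
  moreover have "finite (halves g)" using cubicD(1)[OF kD(2)] by (simp add: g_def)
  moreover have "inc g \<subseteq> verts g \<times> halves g" by (auto simp: g_def)
  moreover have "\<exists>!v. (v, x) \<in> inc g" if "x \<in> halves g" for x
  proof -
    have xk: "x \<in> hs k" using that by (simp add: g_def)
    then obtain v where "(v, x) \<in> inc G" using hsk gG(10) by blast
    then show ?thesis using gG(9) xk by (auto simp: g_def intro!: ex1I[of _ v])
  qed
  moreover have "adj g \<subseteq> halves g \<times> halves g" "sym (adj g)" "irrefl (adj g)"
    using cubicD(4,5,6)[OF kD(2)] by (simp_all add: g_def)
  moreover have "y = y'" if "(x, y) \<in> adj g" "(x, y') \<in> adj g" for x y y'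
    using that kc(7) by (auto simp: g_def)
  moreover have "card (half_edges_at g v) = 3" if "v \<in> verts g" for v
  proof -
    have "half_edges_at g v = half_edges_at G v" using that closed by (auto simp: g_def half_edges_at_def)
    moreover have "v \<in> verts G" using that gG(3) by (auto simp: g_def)
    ultimately show ?thesis using gG(12) by simp
  qed
  ultimately have t: "trivalent g" unfolding trivalent_def finite_graph_def by blast
  have vr: "(x, y) \<in> vr (shape g) \<longleftrightarrow> (x, y) \<in> vr k" for x y
    using closed unfolding shape_simps kD(4) by (auto simp: g_def)
  have s: "shape g = k"
    by (rule hgraph.equality) (use vr in \<open>auto simp: g_def\<close>)
  have "inc g = {(v, h) \<in> inc G. v \<in> verts g}" using closed by (auto simp: g_def)
  moreover have "verts g \<subseteq> verts G" using gG(3) by (auto simp: g_def)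
  ultimately have "subgraph g G" using t s k subgraph_shape[OF G] by simp
  then show "k \<in> shape ` {g. subgraph g G}" using s by blast
qed

text \<open>The list picked by \<open>SOME\<close> is harmless because \<open>fold_contract\<close>
  holds for every list of the components.\<close>

lemma shape_graph_quotient:
  assumes G: "lfg_graph G" and g: "subgraph g G"
  shows "shape (G //\<^sub>G g) = quo (shape G) (shape g)" "lfg_graph (G //\<^sub>G g)"
proof -
  have tG: "trivalent G" and lG: "lfgh (shape G)" using G by (auto simp: lfg_graph_shape)
  note s = g[unfolded subgraph_shape[OF tG]]
  have tg: "trivalent g" using s by simp
  define cs where "cs = (SOME cs. distinct cs \<and> set cs = components g)"
  have "finite (components g)" using trivalentD(1)[OF tg] by (simp add: components_def)
  then have "\<exists>cs. distinct cs \<and> set cs = components g" by (metis finite_distinct_list)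
  then have cs: "distinct cs" "set cs = components g"
    unfolding cs_def by (metis (mono_tags, lifting) someI_ex)+
  have nb: "nonbare (shape G) = shape G" by (rule lfgh_nonbare[OF lG])
  have "trivalent (fold contract cs G) \<and> nonbare (shape (fold contract cs G)) = quo (nonbare (shape G)) (shape g)"
  proof (rule fold_contract[OF tG])
    show "distinct (map shape cs)" using cs components_shape(2)[OF tg] by (simp add: distinct_map)
    show "set (map shape cs) = comps (shape g)" using cs components_shape(1)[OF tg] by simp
    fix c assume "c \<in> set cs"
    then have c: "c \<in> components g" using cs by simp
    show "trivalent c \<and> inc c = {(v, x) \<in> inc G. v \<in> verts c} \<and> verts c \<subseteq> verts G"
      using component_inc[OF tg c] s by auto
  qed (use lG s nb in simp_all)
  moreover have "G //\<^sub>G g = drop_bare_vertices (fold contract cs G)"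
    by (simp add: graph_quotient_def cs_def)
  ultimately show 1: "shape (G //\<^sub>G g) = quo (shape G) (shape g)" and "lfg_graph (G //\<^sub>G g)"
    using shape_drop_bare[of "fold contract cs G"] nb lfgh_quo_sub[OF lG] s
    by (auto simp: lfg_graph_shape)
qed

section \<open>Isomorphism classes\<close>

definition himg :: "(nat \<Rightarrow> nat) \<Rightarrow> hgraph \<Rightarrow> hgraph"
  where "himg f h = \<lparr>hs = f ` hs h, vr = map_prod f f ` vr h, ad = map_prod f f ` ad h\<rparr>"

lemma himg_simps [simp]:
  "hs (himg f h) = f ` hs h" "vr (himg f h) = map_prod f f ` vr h" "ad (himg f h) = map_prod f f ` ad h"
  by (simp_all add: himg_def)

lemma himg_cong:
  assumes "cubic h" "\<And>x. x \<in> hs h \<Longrightarrow> f x = g x"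
  shows "himg f h = himg g h"
proof (rule hgraph.equality)
  have "map_prod f f ` r = map_prod g g ` r" if "r \<subseteq> hs h \<times> hs h" for r
    using that assms(2) by (intro image_cong) auto
  then show "vr (himg f h) = vr (himg g h)" "ad (himg f h) = ad (himg g h)"
    using cubicD(4,8)[OF assms(1)] by simp_all
qed (use assms in auto)

lemma himg_comp: "himg f (himg g h) = himg (f \<circ> g) h"
  by (simp add: himg_def image_image prod.map_comp o_def flip: image_comp)

lemma himg_id: "himg id h = h"
  by (simp add: himg_def map_prod.id)

lemma map_prod_mem: "inj f \<Longrightarrow> (f x, f y) \<in> map_prod f f ` r \<longleftrightarrow> (x, y) \<in> r"
  by (auto dest: injD)

lemma rtrancl_map_prod:
  assumes "inj f"
  shows "(f x, w) \<in> (map_prod f f ` r)\<^sup>* \<longleftrightarrow> (\<exists>y. w = f y \<and> (x, y) \<in> r\<^sup>*)"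
proof
  assume "(f x, w) \<in> (map_prod f f ` r)\<^sup>*"
  then show "\<exists>y. w = f y \<and> (x, y) \<in> r\<^sup>*"
  proof induction
    case (step u w)
    then obtain y where y: "u = f y" "(x, y) \<in> r\<^sup>*" by blast
    then obtain z where "w = f z" "(y, z) \<in> r" using step.hyps(2) assms by (auto dest: injD)
    then have "(x, z) \<in> r\<^sup>*" using y by (meson rtrancl.rtrancl_into_rtrancl)
    then show ?case using \<open>w = f z\<close> by blast
  qed auto
next
  assume "\<exists>y. w = f y \<and> (x, y) \<in> r\<^sup>*"
  then obtain y where y: "w = f y" "(x, y) \<in> r\<^sup>*" by blast
  from y(2) have "(f x, f y) \<in> (map_prod f f ` r)\<^sup>*"
  proof induction
    case (step y z)
    then have "(f y, f z) \<in> map_prod f f ` r" by auto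
    then show ?case using step.IH by (meson rtrancl.rtrancl_into_rtrancl)
  qed simp
  then show "(f x, w) \<in> (map_prod f f ` r)\<^sup>*" using y(1) by simp
qed

context
  fixes f :: "nat \<Rightarrow> nat" assumes inj: "inj f"
begin

lemmas inj' = inj_eq[OF inj]

lemma ext_himg: "ext (himg f h) = f ` ext h"
proof -
  have "Domain (map_prod f f ` ad h) = f ` Domain (ad h)" by force
  then show ?thesis by (simp add: ext_def image_set_diff[OF inj])
qed

lemma cn_himg: "(f x, w) \<in> cn (himg f h) \<longleftrightarrow> (\<exists>y. w = f y \<and> (x, y) \<in> cn h)"
  unfolding cn_def himg_simps image_Un[symmetric] by (rule rtrancl_map_prod[OF inj])

lemma cn_himg_class: "cn (himg f h) `` {f x} = f ` (cn h `` {x})"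
  using cn_himg by auto

lemma cext_himg: "cext (himg f h) (f x) = f ` cext h x"
  unfolding cext_def ext_himg cn_himg_class image_Int[OF inj] ..

lemma card_img: "card (f ` A) = card A"
  using card_image[OF inj_on_subset[OF inj subset_UNIV]] .

lemma vr_himg_class: "vr (himg f h) `` {f x} = f ` (vr h `` {x})"
  using inj' by auto

lemma cubic_himg:
  assumes h: "cubic h"
  shows "cubic (himg f h)"
  unfolding cubic_def
proof (intro conjI ballI)
  note D = cubicD[OF h]
  show "finite (hs (himg f h))" using D(1) by simp
  show "equiv (hs (himg f h)) (vr (himg f h))"
  proof (rule equivI)
    show "vr (himg f h) \<subseteq> hs (himg f h) \<times> hs (himg f h)" using D(8) by auto
    show "refl_on (hs (himg f h)) (vr (himg f h))" using D(11) by (auto simp: refl_on_def)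
    show "sym (vr (himg f h))" using D(9) by (auto simp: sym_def)
    show "trans (vr (himg f h))"
    proof (rule transI)
      fix x y z assume "(x, y) \<in> vr (himg f h)" "(y, z) \<in> vr (himg f h)"
      then obtain a b c where "x = f a" "z = f c" "(a, b) \<in> vr h" "(b, c) \<in> vr h"
        using inj' by auto
      then show "(x, z) \<in> vr (himg f h)" using transD[OF D(10), of a b c] by auto
    qed
  qed
  show "ad (himg f h) \<subseteq> hs (himg f h) \<times> hs (himg f h)" using D(4) by auto
  show "sym (ad (himg f h))" using D(5) by (auto simp: sym_def)
  show "irrefl (ad (himg f h))" using cubic_pairs(8)[OF h] inj' by (auto simp: irrefl_def)
  show "single_valued (ad (himg f h))" using D(7) inj' by (auto simp: single_valued_def)
  fix x assume "x \<in> hs (himg f h)"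
  then obtain y where y: "x = f y" "y \<in> hs h" by auto
  show "card (vr (himg f h) `` {x}) = 3"
    unfolding y(1) vr_himg_class card_img by (rule D(3)[OF y(2)])
qed

lemma lfgh_himg:
  assumes h: "lfgh h"
  shows "lfgh (himg f h)"
  unfolding lfgh_def
proof (intro conjI ballI)
  show "cubic (himg f h)" using cubic_himg lfgh_cubic[OF h] by blast
  fix x assume "x \<in> hs (himg f h)"
  then obtain y where y: "x = f y" "y \<in> hs h" by auto
  have "vr h `` {y} \<inter> Domain (ad h) \<noteq> {}" using h y by (simp add: lfgh_def)
  then obtain z w where "(y, z) \<in> vr h" "(z, w) \<in> ad h" by auto
  then have "f z \<in> vr (himg f h) `` {x} \<inter> Domain (ad (himg f h))" using y by auto
  then show "vr (himg f h) `` {x} \<inter> Domain (ad (himg f h)) \<noteq> {}" by blast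
  show "card (cext (himg f h) x) = 2 \<or> card (cext (himg f h) x) = 3"
    unfolding y(1) cext_himg card_img using h y by (simp add: lfgh_def)
qed

lemma sub_himg:
  assumes k: "sub k h"
  shows "sub (himg f k) (himg f h)"
  unfolding sub_def
proof (intro conjI ballI impI)
  note D = subD[OF k]
  show "lfgh (himg f k)" using lfgh_himg D(1) by blast
  show "hs (himg f k) \<subseteq> hs (himg f h)" "ad (himg f k) \<subseteq> ad (himg f h)" using D(3,5) by auto
  show "vr (himg f k) = vr (himg f h) \<inter> hs (himg f k) \<times> UNIV"
    unfolding himg_simps D(6) using inj' by auto
  fix x assume x: "x \<in> hs (himg f k)" "card (cext (himg f k) x) = 2"
  then obtain y where y: "x = f y" "y \<in> hs k" by auto
  have "cext k y \<subseteq> ext h \<or> cext k y \<inter> ext h = {}"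
    using k x(2) y unfolding sub_def y(1) cext_himg card_img by blast
  then show "cext (himg f k) x \<subseteq> ext (himg f h) \<or> cext (himg f k) x \<inter> ext (himg f h) = {}"
    unfolding y(1) cext_himg ext_himg image_Int[OF inj, symmetric] by auto
qed

lemma conn_himg: "conn h \<Longrightarrow> conn (himg f h)"
  unfolding conn_def using cn_himg by auto

lemma csub_himg: "csub k h \<Longrightarrow> csub (himg f k) (himg f h)"
  by (simp add: csub_def sub_himg conn_himg)

lemma keep_himg: "keep (himg f k) (himg f h) = f ` keep k h"
proof -
  have sub: "f ` A \<subseteq> f ` B \<longleftrightarrow> A \<subseteq> B" for A B using inj_image_subset_iff[OF inj] .
  have "x \<in> keep (himg f k) (himg f h) \<longleftrightarrow> x \<in> f ` keep k h" for x
  proof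
    assume "x \<in> keep (himg f k) (himg f h)"
    then obtain y where "x = f y" "y \<in> ext k" by (auto simp: keep_def ext_himg)
    with \<open>x \<in> keep (himg f k) (himg f h)\<close> show "x \<in> f ` keep k h"
      by (auto simp: keep_def ext_himg cext_himg card_img sub)
  qed (auto simp: keep_def ext_himg cext_himg card_img sub)
  then show ?thesis by blast
qed

lemma tau_himg: "tau (himg f k) = map_prod f f ` tau k"
proof -
  have "(x, z) \<in> tau (himg f k) \<longleftrightarrow> (x, z) \<in> map_prod f f ` tau k" for x z
  proof
    assume a: "(x, z) \<in> tau (himg f k)"
    then obtain y where y: "x = f y" "y \<in> ext k" by (auto simp: tau_def ext_himg)
    with a show "(x, z) \<in> map_prod f f ` tau k"
      by (auto simp: tau_def ext_himg cext_himg card_img)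
  qed (auto simp: tau_def ext_himg cext_himg card_img)
  then show ?thesis by auto
qed

text \<open>The definition of \<open>quo\<close> chooses no names, so it commutes with renaming
  exactly.\<close>

lemma quo_himg: "quo (himg f h) (himg f k) = himg f (quo h k)"
proof (rule hgraph.equality)
  show H: "hs (quo (himg f h) (himg f k)) = hs (himg f (quo h k))"
    by (simp add: quo_simps(1) keep_himg image_Un image_set_diff[OF inj])
  have "cn (himg f k) \<inter> f ` keep k h \<times> f ` keep k h = map_prod f f ` (cn k \<inter> keep k h \<times> keep k h)"
    using cn_himg inj' by auto
  moreover have "map_prod f f ` vr h \<inter> f ` S \<times> f ` S = map_prod f f ` (vr h \<inter> S \<times> S)" for S
    using inj' by auto
  ultimately show "vr (quo (himg f h) (himg f k)) = vr (himg f (quo h k))"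
    by (simp add: quo_simps(2) keep_himg image_Un flip: image_set_diff[OF inj])
  have *: "(f x, w) \<in> (map_prod f f ` ad h \<union> map_prod f f ` tau k)\<^sup>* \<longleftrightarrow> (\<exists>y. w = f y \<and> (x, y) \<in> (ad h \<union> tau k)\<^sup>*)" for x w
    unfolding image_Un[symmetric] by (rule rtrancl_map_prod[OF inj])
  have "(x, w) \<in> ad (quo (himg f h) (himg f k)) \<longleftrightarrow> (x, w) \<in> map_prod f f ` ad (quo h k)" for x w
  proof
    assume "(x, w) \<in> ad (quo (himg f h) (himg f k))"
    then have a: "x \<in> f ` hs (quo h k)" "w \<in> f ` hs (quo h k)" "x \<noteq> w"
      "(x, w) \<in> (map_prod f f ` ad h \<union> map_prod f f ` tau k)\<^sup>*"
      unfolding quo_simps(3)[of "himg f h"] H tau_himg by auto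
    then obtain u v where uv: "x = f u" "u \<in> hs (quo h k)" "w = f v" "v \<in> hs (quo h k)" by auto
    then have "(u, v) \<in> (ad h \<union> tau k)\<^sup>*" using a(4) * inj' by auto
    then have "(u, v) \<in> ad (quo h k)" using uv a(3) by (auto simp: quo_simps(3)[of h])
    then show "(x, w) \<in> map_prod f f ` ad (quo h k)" using uv by auto
  next
    assume "(x, w) \<in> map_prod f f ` ad (quo h k)"
    then obtain u v where uv: "x = f u" "w = f v" "(u, v) \<in> ad (quo h k)" by auto
    then have "u \<in> hs (quo h k)" "v \<in> hs (quo h k)" "u \<noteq> v" "(u, v) \<in> (ad h \<union> tau k)\<^sup>*"
      by (simp_all add: quo_simps(3)[of h])
    then show "(x, w) \<in> ad (quo (himg f h) (himg f k))"
      unfolding quo_simps(3)[of "himg f h"] H tau_himg using uv(1,2) * inj' by auto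
  qed
  then show "ad (quo (himg f h) (himg f k)) = ad (himg f (quo h k))" by auto
qed simp

end

text \<open>An isomorphism is given only on the half-edges of one graph. Extended to a permutation
  of the whole type, it acts on subgraphs and quotients alike, and its inverse does so too.\<close>

lemma ex_bij_extending:
  fixes f :: "'a \<Rightarrow> 'a"
  assumes fin: "finite A" and inj: "inj_on f A"
  shows "\<exists>p. bij p \<and> (\<forall>x\<in>A. p x = f x)"
proof -
  \<comment> \<open>What the image adds to \<open>A\<close> is as large as the part of
    \<open>A\<close> that it leaves uncovered, so the former can be sent back onto the
    latter.\<close>
  have "card (f ` A - A) = card (A - f ` A)"
    using card_image[OF inj] fin by (simp add: card_Diff_subset_Int Int_commute)
  then obtain g where g: "bij_betw g (f ` A - A) (A - f ` A)"
    using fin by (metis finite_Diff finite_imageI finite_same_card_bij)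
  let ?p = "\<lambda>x. if x \<in> A then f x else if x \<in> f ` A then g x else x"
  have "bij_betw ?p A (f ` A)" using inj by (auto simp: bij_betw_def inj_on_def)
  moreover have "bij_betw ?p (f ` A - A) (A - f ` A)"
    using g by (subst bij_betw_cong[of _ _ g]) auto
  moreover have "bij_betw ?p (- (A \<union> f ` A)) (- (A \<union> f ` A))"
    by (subst bij_betw_cong[of _ _ id]) auto
  ultimately have "bij_betw ?p (A \<union> (f ` A - A) \<union> - (A \<union> f ` A)) (f ` A \<union> (A - f ` A) \<union> - (A \<union> f ` A))"
    by (intro bij_betw_combine) auto
  moreover have "A \<union> (f ` A - A) \<union> - (A \<union> f ` A) = UNIV" "f ` A \<union> (A - f ` A) \<union> - (A \<union> f ` A) = UNIV" by auto
  ultimately show ?thesis by (intro exI[of _ ?p]) auto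
qed

definition iso :: "hgraph \<Rightarrow> hgraph \<Rightarrow> bool"
  where "iso h h' \<longleftrightarrow> (\<exists>f. inj_on f (hs h) \<and> himg f h = h')"

lemma iso_bij:
  assumes "cubic h" "inj_on f (hs h)" "himg f h = h'"
  obtains p where "bij p" "himg p h = h'" "\<And>x. x \<in> hs h \<Longrightarrow> p x = f x"
proof -
  obtain p where p: "bij p" "\<forall>x\<in>hs h. p x = f x"
    using ex_bij_extending[OF cubicD(1)[OF assms(1)] assms(2)] by blast
  then have "himg p h = h'" using himg_cong[OF assms(1), of p f] assms(3) by simp
  then show ?thesis using that p by blast
qed

lemma iso_iff_bij:
  assumes "cubic h"
  shows "iso h h' \<longleftrightarrow> (\<exists>p. bij p \<and> himg p h = h')"
proof
  assume "iso h h'"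
  then obtain f where "inj_on f (hs h)" "himg f h = h'" by (auto simp: iso_def)
  then show "\<exists>p. bij p \<and> himg p h = h'" using iso_bij[OF assms] by metis
qed (auto simp: iso_def bij_def intro: inj_on_subset)

lemma himg_inv:
  assumes "bij p" "himg p h = h'"
  shows "himg (inv p) h' = h"
  using assms(2) himg_comp[of "inv p" p h] inj_iff[of p] assms(1) himg_id[of h] by (auto simp: bij_def)

lemma graph_iso_shape:
  assumes G: "trivalent G" and G': "trivalent G'"
  shows "graph_iso G G' \<longleftrightarrow> iso (shape G) (shape G')"
proof
  note g = trivalentD[OF G] and g' = trivalentD[OF G']
  assume "graph_iso G G'"
  then obtain \<phi> \<psi> where
    \<phi>: "bij_betw \<phi> (verts G) (verts G')" and \<psi>: "bij_betw \<psi> (halves G) (halves G')" and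
    i: "\<And>v h. v \<in> verts G \<Longrightarrow> h \<in> halves G \<Longrightarrow> (v, h) \<in> inc G \<longleftrightarrow> (\<phi> v, \<psi> h) \<in> inc G'" and
    a: "\<And>h k. h \<in> halves G \<Longrightarrow> k \<in> halves G \<Longrightarrow> (h, k) \<in> adj G \<longleftrightarrow> (\<psi> h, \<psi> k) \<in> adj G'"
    unfolding graph_iso_def by blast
  have im: "\<psi> ` halves G = halves G'" "\<phi> ` verts G = verts G'" using \<phi> \<psi> by (auto simp: bij_betw_def)
  have "himg \<psi> (shape G) = shape G'"
  proof (rule hgraph.equality)
    show "hs (himg \<psi> (shape G)) = hs (shape G')" using im by simp
    have "(x, y) \<in> map_prod \<psi> \<psi> ` vr (shape G) \<longleftrightarrow> (x, y) \<in> vr (shape G')" for x y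
    proof
      assume "(x, y) \<in> map_prod \<psi> \<psi> ` vr (shape G)"
      then obtain h k v where "x = \<psi> h" "y = \<psi> k" "(v, h) \<in> inc G" "(v, k) \<in> inc G" by auto
      then show "(x, y) \<in> vr (shape G')" using i[of v h] i[of v k] g(3,4) by auto
    next
      assume "(x, y) \<in> vr (shape G')"
      then obtain w where w: "(w, x) \<in> inc G'" "(w, y) \<in> inc G'" by auto
      have "w \<in> \<phi> ` verts G" "x \<in> \<psi> ` halves G" "y \<in> \<psi> ` halves G"
        using g'(3)[OF w(1)] g'(4)[OF w(1)] g'(4)[OF w(2)] unfolding im by simp_all
      then obtain v h k where v: "w = \<phi> v" "v \<in> verts G" "x = \<psi> h" "h \<in> halves G" "y = \<psi> k" "k \<in> halves G"
        by blast
      then have "(h, k) \<in> vr (shape G)" using w i[of v h] i[of v k] by auto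
      then show "(x, y) \<in> map_prod \<psi> \<psi> ` vr (shape G)" using v(3,5) by force
    qed
    then show "vr (himg \<psi> (shape G)) = vr (shape G')"
      by (simp only: himg_simps set_eq_iff split_paired_All) simp
    have "(x, y) \<in> map_prod \<psi> \<psi> ` adj G \<longleftrightarrow> (x, y) \<in> adj G'" for x y
    proof
      assume "(x, y) \<in> map_prod \<psi> \<psi> ` adj G"
      then obtain h k where "x = \<psi> h" "y = \<psi> k" "(h, k) \<in> adj G" by auto
      then show "(x, y) \<in> adj G'" using a[of h k] g(5,6) by auto
    next
      assume xy: "(x, y) \<in> adj G'"
      have "x \<in> \<psi> ` halves G" "y \<in> \<psi> ` halves G"
        using g'(5)[OF xy] g'(6)[OF xy] unfolding im by simp_all
      then obtain h k where v: "x = \<psi> h" "h \<in> halves G" "y = \<psi> k" "k \<in> halves G"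
        by blast
      then have "(h, k) \<in> adj G" using xy a[of h k] by auto
      then show "(x, y) \<in> map_prod \<psi> \<psi> ` adj G" using v(1,3) by force
    qed
    then show "ad (himg \<psi> (shape G)) = ad (shape G')" by auto
  qed simp
  then show "iso (shape G) (shape G')" using \<psi> by (auto simp: iso_def bij_betw_def)
next
  note g = trivalentD[OF G] and g' = trivalentD[OF G']
  assume "iso (shape G) (shape G')"
  then obtain p where p: "bij p" "himg p (shape G) = shape G'"
    using iso_iff_bij[OF cubic_shape[OF G]] by blast
  note inj = bij_is_inj[OF p(1)]
  have im: "p ` halves G = halves G'" using p(2) by (metis himg_simps(1) shape_simps(1))
  have vr: "(x, y) \<in> vr (shape G) \<longleftrightarrow> (p x, p y) \<in> vr (shape G')" for x y
    unfolding p(2)[symmetric] himg_simps map_prod_mem[OF inj] ..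
  have ad: "(x, y) \<in> adj G \<longleftrightarrow> (p x, p y) \<in> adj G'" for x y
    using map_prod_mem[OF inj, of x y "adj G"] p(2) by (metis himg_simps(3) shape_simps(2))
  \<comment> \<open>The vertex map is forced by the half-edges: as soon as one half-edge of
    \<open>v\<close> goes to \<open>w\<close>, all of them do, which is \<open>r2\<close>.\<close>
  define r where "r = (\<lambda>v w. \<exists>x. (v, x) \<in> inc G \<and> (w, p x) \<in> inc G')"
  have r1: "\<exists>w. r v w" if v: "v \<in> verts G" for v
  proof -
    obtain x where x: "(v, x) \<in> inc G" using half_edges_at_ne[OF G v] by blast
    then have "p x \<in> halves G'" using g(4) im by blast
    then obtain w where "(w, p x) \<in> inc G'" using g'(10) by blast
    then show ?thesis using x unfolding r_def by blast
  qed
  have r2: "(v, x) \<in> inc G \<longleftrightarrow> (w, p x) \<in> inc G'" if vw: "r v w" for v w x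
  proof -
    obtain y where y: "(v, y) \<in> inc G" "(w, p y) \<in> inc G'" using vw by (auto simp: r_def)
    have "(v, x) \<in> inc G \<longleftrightarrow> (y, x) \<in> vr (shape G)" using y(1) g(9) unfolding shape_simps by blast
    moreover have "(w, p x) \<in> inc G' \<longleftrightarrow> (p y, p x) \<in> vr (shape G')"
      using y(2) g'(9) unfolding shape_simps by blast
    ultimately show ?thesis using vr by blast
  qed
  define \<phi> where "\<phi> v = (SOME w. r v w)" for v
  have \<phi>: "r v (\<phi> v)" if "v \<in> verts G" for v unfolding \<phi>_def using r1[OF that] by (rule someI_ex)
  have "bij_betw \<phi> (verts G) (verts G')"
    unfolding bij_betw_def
  proof (intro conjI set_eqI iffI inj_onI)
    fix v w assume vw: "v \<in> verts G" "w \<in> verts G" "\<phi> v = \<phi> w"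
    obtain x where x: "(v, x) \<in> inc G" using half_edges_at_ne[OF G vw(1)] by blast
    then have "(w, x) \<in> inc G" using r2[OF \<phi>[OF vw(1)]] r2[OF \<phi>[OF vw(2)]] vw(3) by simp
    with x show "v = w" by (rule g(9))
  next
    fix w assume "w \<in> \<phi> ` verts G"
    then obtain v where "v \<in> verts G" "w = \<phi> v" by blast
    then show "w \<in> verts G'" using \<phi> g'(3) by (auto simp: r_def)
  next
    fix w assume w: "w \<in> verts G'"
    obtain y where y: "(w, y) \<in> inc G'" using half_edges_at_ne[OF G' w] by blast
    then obtain x where x: "x \<in> halves G" "y = p x" using g'(4) im by blast
    then obtain v where v: "(v, x) \<in> inc G" using g(10) by blast
    then have "(\<phi> v, p x) \<in> inc G'" using r2[OF \<phi>] g(3) by blast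
    then have "w = \<phi> v" using y x g'(9) by blast
    then show "w \<in> \<phi> ` verts G" using g(3) v by blast
  qed
  moreover have "bij_betw p (halves G) (halves G')" using im inj by (auto simp: bij_betw_def intro: inj_on_subset)
  ultimately show "graph_iso G G'"
    unfolding graph_iso_def using r2[OF \<phi>] ad by blast
qed

section \<open>Half-edge graphs as representatives of classes\<close>

definition graph_of :: "hgraph \<Rightarrow> graph"
  where "graph_of h = \<lparr>verts = (\<lambda>x. Min (vr h `` {x})) ` hs h, halves = hs h,
    inc = (\<lambda>x. (Min (vr h `` {x}), x)) ` hs h, adj = ad h\<rparr>"

lemma graph_of:
  assumes h: "cubic h"
  shows "trivalent (graph_of h)" "shape (graph_of h) = h"
proof -
  note D = cubicD[OF h] and hp = cubic_pairs[OF h]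
  have Min: "(x, Min (vr h `` {x})) \<in> vr h" if "x \<in> hs h" for x
  proof -
    have "finite (vr h `` {x})" by (rule finite_subset[OF _ D(1)]) (use hp(2) in auto)
    moreover have "vr h `` {x} \<noteq> {}" using D(11)[OF that] by blast
    ultimately show ?thesis using Min_in by blast
  qed
  have Min_eq: "Min (vr h `` {x}) = Min (vr h `` {y}) \<longleftrightarrow> (x, y) \<in> vr h" if xy: "x \<in> hs h" "y \<in> hs h" for x y
  proof
    assume "Min (vr h `` {x}) = Min (vr h `` {y})"
    then show "(x, y) \<in> vr h" using Min[OF xy(1)] hp(5)[OF Min[OF xy(2)]] transD[OF D(10)] by metis
  next
    assume "(x, y) \<in> vr h"
    then have "vr h `` {x} = vr h `` {y}" using D(2) by (meson equiv_class_eq)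
    then show "Min (vr h `` {x}) = Min (vr h `` {y})" by simp
  qed
  let ?G = "graph_of h"
  have half: "half_edges_at ?G (Min (vr h `` {x})) = vr h `` {x}" if "x \<in> hs h" for x
    using Min_eq[OF that] hp(2)[of x] by (auto simp: half_edges_at_def graph_of_def)
  have "finite (verts ?G)" "finite (halves ?G)" using D(1) by (simp_all add: graph_of_def)
  moreover have "\<forall>v\<in>verts ?G. card (half_edges_at ?G v) = 3"
    using half D(3) by (auto simp: graph_of_def)
  moreover have "inc ?G \<subseteq> verts ?G \<times> halves ?G" "\<forall>h\<in>halves ?G. \<exists>!v. (v, h) \<in> inc ?G"
    by (auto simp: graph_of_def)
  moreover have "adj ?G \<subseteq> halves ?G \<times> halves ?G" "sym (adj ?G)" "irrefl (adj ?G)"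
    using D(4,5,6) by (simp_all add: graph_of_def)
  moreover have "\<forall>h k k'. (h, k) \<in> adj ?G \<longrightarrow> (h, k') \<in> adj ?G \<longrightarrow> k = k'"
    using hp(7) by (auto simp: graph_of_def)
  ultimately show "trivalent ?G" unfolding trivalent_def finite_graph_def by blast
  have "(x, y) \<in> vr (shape ?G) \<longleftrightarrow> (x, y) \<in> vr h" for x y
  proof -
    have "(x, y) \<in> vr (shape ?G) \<longleftrightarrow> x \<in> hs h \<and> y \<in> hs h \<and> Min (vr h `` {x}) = Min (vr h `` {y})"
      by (auto simp: graph_of_def)
    then show ?thesis using Min_eq hp(1,2) by blast
  qed
  then show "shape ?G = h" by (intro hgraph.equality) (auto simp: graph_of_def)
qed

lemma lfg_graph_of: "lfgh h \<Longrightarrow> lfg_graph (graph_of h)"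
  using graph_of[of h] lfgh_cubic by (simp add: lfg_graph_shape)

definition cls :: "hgraph \<Rightarrow> lfg_class"
  where "cls h = iso_class (graph_of h, id)"

definition rep :: "lfg_class \<Rightarrow> hgraph"
  where "rep X = shape (fst (representative X))"

lemma iso_class_eq:
  assumes "labeled_feynman_graph \<Gamma>" "labeled_feynman_graph \<Gamma>'"
  shows "iso_class \<Gamma> = iso_class \<Gamma>' \<longleftrightarrow> iso (shape (fst \<Gamma>)) (shape (fst \<Gamma>'))"
proof -
  have "labeled_iso \<Gamma> \<Gamma>" "labeled_iso \<Gamma>' \<Gamma>'"
    using assms graph_iso_refl by (auto simp: labeled_iso_def)
  then have "iso_class \<Gamma> = iso_class \<Gamma>' \<longleftrightarrow> labeled_iso \<Gamma> \<Gamma>'"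
    using Quotient3_rel[OF Quotient3_lfg_class, of \<Gamma> \<Gamma>'] by blast
  then show ?thesis
    using assms graph_iso_shape by (auto simp: labeled_iso_def labeled_feynman_graph_def lfg_graph_shape)
qed

lemma labeled_graph_of: "lfgh h \<Longrightarrow> labeled_feynman_graph (graph_of h, id)"
  by (simp add: labeled_feynman_graph_def lfg_graph_of)

lemma cls_eq: "lfgh h \<Longrightarrow> lfgh h' \<Longrightarrow> cls h = cls h' \<longleftrightarrow> iso h h'"
  unfolding cls_def by (simp add: iso_class_eq labeled_graph_of graph_of lfgh_cubic)

lemma iso_refl: "iso h h"
  unfolding iso_def using himg_id by (intro exI[of _ id]) auto

lemma iso_class_cls:
  assumes "lfg_graph G" "inj_on \<rho> (halves G)"
  shows "iso_class (G, \<rho>) = cls (shape G)"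
  unfolding cls_def using assms
  by (subst iso_class_eq) (auto simp: labeled_feynman_graph_def lfg_graph_shape graph_of lfgh_cubic iso_refl labeled_graph_of)

lemma representative_lfg: "labeled_feynman_graph (representative X)"
  using Quotient3_rep_reflp[OF Quotient3_lfg_class, of X] by (simp add: labeled_iso_def)

lemma rep: "lfgh (rep X)" "cls (rep X) = X"
proof -
  obtain G \<rho> where G: "representative X = (G, \<rho>)" by fastforce
  then have l: "lfg_graph G" "inj_on \<rho> (halves G)"
    using representative_lfg[of X] by (auto simp: labeled_feynman_graph_def)
  then show "lfgh (rep X)" using G by (simp add: rep_def lfg_graph_shape)
  show "cls (rep X) = X"
    using iso_class_cls[OF l] Quotient3_abs_rep[OF Quotient3_lfg_class, of X] G by (simp add: rep_def)
qed

lemma cls_himg: "lfgh h \<Longrightarrow> inj f \<Longrightarrow> cls (himg f h) = cls h"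
proof -
  assume h: "lfgh h" "inj f"
  have "iso h (himg f h)" unfolding iso_def using inj_on_subset[OF h(2)] by blast
  then show ?thesis using cls_eq[OF h(1) lfgh_himg[OF h(2,1)]] by simp
qed

section \<open>The Hall product\<close>

lemma finite_hgraphs: "finite S \<Longrightarrow> finite {h :: hgraph. hs h \<subseteq> S \<and> vr h \<subseteq> S \<times> S \<and> ad h \<subseteq> S \<times> S}"
proof -
  assume S: "finite S"
  have "{h :: hgraph. hs h \<subseteq> S \<and> vr h \<subseteq> S \<times> S \<and> ad h \<subseteq> S \<times> S} \<subseteq>
    (\<lambda>(a, b, c). \<lparr>hs = a, vr = b, ad = c\<rparr>) ` (Pow S \<times> Pow (S \<times> S) \<times> Pow (S \<times> S))"
  proof
    fix h :: hgraph assume "h \<in> {h :: hgraph. hs h \<subseteq> S \<and> vr h \<subseteq> S \<times> S \<and> ad h \<subseteq> S \<times> S}"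
    then show "h \<in> (\<lambda>(a, b, c). \<lparr>hs = a, vr = b, ad = c\<rparr>) ` (Pow S \<times> Pow (S \<times> S) \<times> Pow (S \<times> S))"
      by (intro image_eqI[of _ _ "(hs h, vr h, ad h)"]) auto
  qed
  then show ?thesis by (rule finite_subset) (use S in simp)
qed

lemma finite_sub: "cubic h \<Longrightarrow> finite {k. sub k h}"
proof -
  assume h: "cubic h"
  have "{k. sub k h} \<subseteq> {k :: hgraph. hs k \<subseteq> hs h \<and> vr k \<subseteq> hs h \<times> hs h \<and> ad k \<subseteq> hs h \<times> hs h}"
  proof
    fix k assume "k \<in> {k. sub k h}"
    then have k: "sub k h" by simp
    have "vr k \<subseteq> hs k \<times> hs k" "ad k \<subseteq> hs k \<times> hs k" using cubicD(4,8)[OF subD(2)[OF k]] by auto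
    then show "k \<in> {k :: hgraph. hs k \<subseteq> hs h \<and> vr k \<subseteq> hs h \<times> hs h \<and> ad k \<subseteq> hs h \<times> hs h}"
      using subD(3)[OF k] by blast
  qed
  then show ?thesis using finite_hgraphs[OF cubicD(1)[OF h]] by (rule finite_subset)
qed

lemma hs_quo_sub: "sub k h \<Longrightarrow> hs (quo h k) \<subseteq> hs h"
  using subD(3) by (auto simp: quo_simps keep_def ext_def)

text \<open>Half-edges can be renamed to numbers below \<open>n\<close>, where only finitely many
  graphs live. This bounds the support of a product.\<close>

lemma finite_small_classes: "finite {X. card (hs (rep X)) \<le> n}"
proof -
  have "X \<in> cls ` {h :: hgraph. hs h \<subseteq> {..<n} \<and> vr h \<subseteq> {..<n} \<times> {..<n} \<and> ad h \<subseteq> {..<n} \<times> {..<n}}"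
    if X: "card (hs (rep X)) \<le> n" for X
  proof -
    note c = lfgh_cubic[OF rep(1)[of X]]
    obtain f where f: "inj_on f (hs (rep X))" "f ` hs (rep X) \<subseteq> {..<n}"
      using X inj_on_iff_card_le[OF cubicD(1)[OF c], of "{..<n}"] by auto
    obtain p where p: "bij p" "himg p (rep X) = himg f (rep X)" "\<And>x. x \<in> hs (rep X) \<Longrightarrow> p x = f x"
      using iso_bij[OF c f(1)] by blast
    have "cls (himg p (rep X)) = X" using cls_himg[OF rep(1) bij_is_inj[OF p(1)]] rep(2) by simp
    moreover have H: "hs (himg p (rep X)) \<subseteq> {..<n}" using f unfolding p(2) by simp
    have "cubic (himg p (rep X))" by (rule cubic_himg[OF bij_is_inj[OF p(1)] c])
    then have "vr (himg p (rep X)) \<subseteq> {..<n} \<times> {..<n}" "ad (himg p (rep X)) \<subseteq> {..<n} \<times> {..<n}"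
      using cubicD(4,8) H by (meson Sigma_mono order_trans)+
    with H have "himg p (rep X) \<in> {h :: hgraph. hs h \<subseteq> {..<n} \<and> vr h \<subseteq> {..<n} \<times> {..<n} \<and> ad h \<subseteq> {..<n} \<times> {..<n}}"
      by blast
    ultimately show ?thesis by (intro image_eqI[OF sym])
  qed
  then have "{X. card (hs (rep X)) \<le> n} \<subseteq> cls ` {h :: hgraph. hs h \<subseteq> {..<n} \<and> vr h \<subseteq> {..<n} \<times> {..<n} \<and> ad h \<subseteq> {..<n} \<times> {..<n}}"
    by blast
  then show ?thesis using finite_hgraphs[of "{..<n}"] by (meson finite_imageI finite_lessThan finite_subset)
qed

text \<open>The value of the product at a concrete graph, available before the support is known to
  be finite.\<close>

definition conv :: "hall \<Rightarrow> hall \<Rightarrow> hgraph \<Rightarrow> rat"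
  where "conv f g h = (\<Sum>k | sub k h. lookup f (cls k) * lookup g (cls (quo h k)))"

text \<open>The labeling \<rho> serves for \<gamma> and for the quotient at the same time, since the
  half-edges of both are among those of \<open>G\<close>.\<close>

lemma conv_shape:
  assumes G: "lfg_graph G" and \<rho>: "inj_on \<rho> (halves G)"
  shows "(\<Sum>\<gamma> | subgraph \<gamma> G. lookup f (iso_class (\<gamma>, \<rho>)) * lookup g (iso_class (G //\<^sub>G \<gamma>, \<rho>)))
    = conv f g (shape G)"
proof -
  have tG: "trivalent G" and lG: "lfgh (shape G)" using G by (auto simp: lfg_graph_shape)
  have "(\<Sum>\<gamma> | subgraph \<gamma> G. lookup f (iso_class (\<gamma>, \<rho>)) * lookup g (iso_class (G //\<^sub>G \<gamma>, \<rho>)))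
    = (\<Sum>\<gamma> | subgraph \<gamma> G. lookup f (cls (shape \<gamma>)) * lookup g (cls (quo (shape G) (shape \<gamma>))))"
  proof (rule sum.cong[OF refl])
    fix \<gamma> assume "\<gamma> \<in> {\<gamma>. subgraph \<gamma> G}"
    then have s: "subgraph \<gamma> G" by simp
    note q = shape_graph_quotient[OF G s]
    have sub: "sub (shape \<gamma>) (shape G)" using s subgraph_shape[OF tG] by blast
    have "halves \<gamma> \<subseteq> halves G" using subD(3)[OF sub] by simp
    moreover have "halves (G //\<^sub>G \<gamma>) \<subseteq> halves G" using hs_quo_sub[OF sub] q(1) by (metis shape_simps(1))
    moreover have "lfg_graph \<gamma>" using s by (simp add: subgraph_def)
    ultimately show "lookup f (iso_class (\<gamma>, \<rho>)) * lookup g (iso_class (G //\<^sub>G \<gamma>, \<rho>))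
        = lookup f (cls (shape \<gamma>)) * lookup g (cls (quo (shape G) (shape \<gamma>)))"
      using \<rho> q by (simp add: iso_class_cls inj_on_subset)
  qed
  also have "\<dots> = conv f g (shape G)"
    unfolding conv_def using sum.reindex_bij_betw[OF subgraph_bij[OF tG],
      of "\<lambda>k. lookup f (cls k) * lookup g (cls (quo (shape G) k))"] by simp
  finally show ?thesis .
qed

lemma sub_himg_bij:
  assumes p: "bij p"
  shows "bij_betw (himg p) {k. sub k h} {k. sub k (himg p h)}"
proof -
  have ip: "bij (inv p)" using p by (rule bij_imp_bij_inv)
  have 1: "himg (inv p) (himg p k) = k" for k using himg_inv[OF p refl] .
  have 2: "himg p (himg (inv p) k) = k" for k using himg_inv[OF ip refl] inv_inv_eq[OF p] by metis
  show ?thesis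
    using sub_himg[OF bij_is_inj[OF p]] sub_himg[OF bij_is_inj[OF ip], of _ "himg p h"] 1 2
    by (intro bij_betwI[of _ _ _ "himg (inv p)"]) auto
qed

lemma conv_iso:
  assumes "lfgh h" "lfgh h'" "cls h = cls h'"
  shows "conv f g h = conv f g h'"
proof -
  obtain p where p: "bij p" "himg p h = h'"
    using assms iso_iff_bij[OF lfgh_cubic] by (auto simp: cls_eq)
  note inj = bij_is_inj[OF p(1)]
  have "conv f g h' = (\<Sum>k | sub k h. lookup f (cls (himg p k)) * lookup g (cls (quo h' (himg p k))))"
    unfolding conv_def p(2)[symmetric] using sum.reindex_bij_betw[OF sub_himg_bij[OF p(1)],
      of "\<lambda>k. lookup f (cls k) * lookup g (cls (quo (himg p h) k))"] by simp
  also have "\<dots> = conv f g h"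
    unfolding conv_def
  proof (rule sum.cong[OF refl])
    fix k assume "k \<in> {k. sub k h}"
    then have k: "sub k h" by simp
    show "lookup f (cls (himg p k)) * lookup g (cls (quo h' (himg p k))) = lookup f (cls k) * lookup g (cls (quo h k))"
      using cls_himg[OF subD(1)[OF k] inj] cls_himg[OF lfgh_quo_sub[OF assms(1) k] inj]
      by (simp add: quo_himg[OF inj] flip: p(2))
  qed
  finally show ?thesis by simp
qed

lemma card_iso: "lfgh h \<Longrightarrow> card (hs (rep (cls h))) = card (hs h)"
proof -
  assume h: "lfgh h"
  then have "iso (rep (cls h)) h" using cls_eq rep by metis
  then obtain f where "inj_on f (hs (rep (cls h)))" "himg f (rep (cls h)) = h" by (auto simp: iso_def)
  then show ?thesis by (metis card_image himg_simps(1))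
qed

text \<open>Each half-edge of \<open>h\<close> occurs in \<open>k\<close> or in \<open>h/k\<close>.
  So a graph in the support is at most as large as a graph from each factor taken together, and
  \<open>n\<close> bounds this.\<close>

lemma finite_conv: "finite {X. conv f g (rep X) \<noteq> 0}"
proof -
  define n where "n = (\<Sum>X\<in>keys f. card (hs (rep X))) + (\<Sum>X\<in>keys g. card (hs (rep X)))"
  have "card (hs (rep X)) \<le> n" if nz: "conv f g (rep X) \<noteq> 0" for X
  proof -
    let ?h = "rep X"
    obtain k where k: "sub k ?h" "lookup f (cls k) * lookup g (cls (quo ?h k)) \<noteq> 0"
      using nz unfolding conv_def by (rule sum.not_neutral_contains_not_neutral) blast
    then have keys: "cls k \<in> keys f" "cls (quo ?h k) \<in> keys g" by (auto simp: in_keys_iff)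
    have "hs ?h \<subseteq> hs k \<union> hs (quo ?h k)" unfolding quo_simps(1) by blast
    then have "card (hs ?h) \<le> card (hs k \<union> hs (quo ?h k))"
      using cubicD(1)[OF subD(2)[OF k(1)]] cubicD(1)[OF lfgh_cubic[OF lfgh_quo_sub[OF rep(1) k(1)]]]
      by (intro card_mono) auto
    also have "\<dots> \<le> card (hs k) + card (hs (quo ?h k))" by (rule card_Un_le)
    also have "\<dots> = card (hs (rep (cls k))) + card (hs (rep (cls (quo ?h k))))"
      using card_iso subD(1)[OF k(1)] lfgh_quo_sub[OF rep(1) k(1)] by simp
    also have "\<dots> \<le> n"
      unfolding n_def using keys by (intro add_mono member_le_sum) auto
    finally show ?thesis .
  qed
  then show ?thesis by (intro finite_subset[OF _ finite_small_classes[of n]]) blast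
qed

text \<open>\<open>Abs_poly_mapping\<close> gives back the function under it only for finite
  support, which \<open>finite_conv\<close> provides; \<open>conv_iso\<close> then allows any graph
  of the class.\<close>

lemma lookup_hall_mult: "lfgh h \<Longrightarrow> lookup (hall_mult f g) (cls h) = conv f g h"
proof -
  assume h: "lfgh h"
  have "(\<lambda>X. let (G, \<rho>) = representative X in
      \<Sum>\<gamma> | subgraph \<gamma> G. lookup f (iso_class (\<gamma>, \<rho>)) * lookup g (iso_class (G //\<^sub>G \<gamma>, \<rho>)))
    = (\<lambda>X. conv f g (rep X))"
  proof
    fix X
    obtain G \<rho> where G: "representative X = (G, \<rho>)" by fastforce
    then have "lfg_graph G" "inj_on \<rho> (halves G)"
      using representative_lfg[of X] by (auto simp: labeled_feynman_graph_def)
    from conv_shape[OF this] G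
    show "(let (G, \<rho>) = representative X in
      \<Sum>\<gamma> | subgraph \<gamma> G. lookup f (iso_class (\<gamma>, \<rho>)) * lookup g (iso_class (G //\<^sub>G \<gamma>, \<rho>)))
      = conv f g (rep X)" by (simp add: rep_def)
  qed
  then have "lookup (hall_mult f g) X = conv f g (rep X)" for X
    unfolding hall_mult_def using finite_conv by (simp add: Abs_poly_mapping_inverse)
  then show ?thesis using conv_iso[OF rep(1) h rep(2)] by simp
qed

lemma hall_mult_formula:
  assumes "labeled_feynman_graph (G, \<rho>)"
  shows "lookup (hall_mult f g) (iso_class (G, \<rho>)) =
    (\<Sum>\<gamma> | subgraph \<gamma> G. lookup f (iso_class (\<gamma>, \<rho>)) * lookup g (iso_class (G //\<^sub>G \<gamma>, \<rho>)))"
proof -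
  have G: "lfg_graph G" "inj_on \<rho> (halves G)" using assms by (auto simp: labeled_feynman_graph_def)
  then show ?thesis
    using lookup_hall_mult[of "shape G"] conv_shape[OF G] iso_class_cls[OF G] by (simp add: lfg_graph_shape)
qed

section \<open>The unit and multiplication by a connected class\<close>

definition hempty :: hgraph
  where "hempty = \<lparr>hs = {}, vr = {}, ad = {}\<rparr>"

lemma lfgh_hempty: "lfgh hempty"
  by (simp add: hempty_def lfgh_def cubic_def equiv_def refl_on_def sym_def trans_def irrefl_def)

lemma hempty_iff: "cubic h \<Longrightarrow> hs h = {} \<longleftrightarrow> h = hempty"
  using cubicD(4,8)[of h] by (auto simp: hempty_def intro!: hgraph.equality)

lemma cls_hempty: "cls hempty = iso_class (empty_graph, id)"
proof -
  have "lfg_graph empty_graph" using labeled_feynman_graph_empty[of id] by (simp add: labeled_feynman_graph_def)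
  moreover have "shape empty_graph = hempty"
    by (simp add: shape_def empty_graph_def hempty_def)
  ultimately show ?thesis using iso_class_cls[of empty_graph id] by simp
qed

lemma cls_eq_hempty:
  assumes "lfgh h"
  shows "cls h = cls hempty \<longleftrightarrow> h = hempty"
proof
  assume "cls h = cls hempty"
  then have "iso h hempty" using cls_eq[OF assms lfgh_hempty] by simp
  then have "hs h = {}" by (auto simp: iso_def hempty_def himg_def)
  then show "h = hempty" using hempty_iff lfgh_cubic[OF assms] by blast
qed simp

lemma sub_hempty: "sub hempty h"
  unfolding sub_def using lfgh_hempty by (simp add: hempty_def)

lemma conn_shape:
  assumes "trivalent G"
  shows "connected_graph G \<longleftrightarrow> conn (shape G)"
proof
  assume "connected_graph G"
  then have c: "verts G \<noteq> {}" "\<And>v w. v \<in> verts G \<Longrightarrow> w \<in> verts G \<Longrightarrow> (v, w) \<in> (linked G)\<^sup>*"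
    by (auto simp: connected_graph_def)
  have "(x, y) \<in> cn (shape G)" if "x \<in> halves G" "y \<in> halves G" for x y
    using that c(2) trivalentD(3,10)[OF assms] linked_cn[OF assms] by meson
  moreover have "halves G \<noteq> {}" using c(1) half_edges_at_ne[OF assms] trivalentD(4)[OF assms] by blast
  ultimately show "conn (shape G)" by (simp add: conn_def)
next
  assume "conn (shape G)"
  then have c: "halves G \<noteq> {}" "\<And>x y. x \<in> halves G \<Longrightarrow> y \<in> halves G \<Longrightarrow> (x, y) \<in> cn (shape G)"
    by (auto simp: conn_def)
  have "(v, w) \<in> (linked G)\<^sup>*" if "v \<in> verts G" "w \<in> verts G" for v w
    using that c(2) half_edges_at_ne[OF assms] trivalentD(4)[OF assms] linked_cn[OF assms] by meson
  moreover have "verts G \<noteq> {}" using c(1) trivalentD(3,10)[OF assms] by blast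
  ultimately show "connected_graph G" by (simp add: connected_graph_def)
qed

lemma conn_iso: "lfgh h \<Longrightarrow> lfgh h' \<Longrightarrow> cls h = cls h' \<Longrightarrow> conn h \<Longrightarrow> conn h'"
  using conn_himg bij_is_inj by (metis cls_eq iso_iff_bij lfgh_cubic)

lemma connected_class_rep: "connected_class X \<longleftrightarrow> conn (rep X)"
  using conn_shape representative_lfg[of X]
  by (auto simp: connected_class_def rep_def labeled_feynman_graph_def lfg_graph_shape)

lemma connected_class_cls: "lfgh h \<Longrightarrow> connected_class (cls h) \<longleftrightarrow> conn h"
  using conn_iso rep connected_class_rep by metis

definition copies :: "lfg_class \<Rightarrow> hgraph \<Rightarrow> hgraph set"
  where "copies A h = {c. csub c h \<and> cls c = A}"

lemma copies_sub: "connected_class A \<Longrightarrow> copies A h = {k. sub k h \<and> cls k = A}"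
  using connected_class_cls subD(1) by (auto simp: copies_def csub_def)

lemma finite_copies: "cubic h \<Longrightarrow> finite (copies A h)"
  by (rule finite_subset[OF _ finite_sub]) (auto simp: copies_def csub_def)

lemma hall_eqI: "(\<And>h. lfgh h \<Longrightarrow> lookup f (cls h) = lookup g (cls h)) \<Longrightarrow> f = (g :: hall)"
  by (rule poly_mapping_eqI) (metis rep)

lemma sum_single_class:
  assumes "lfgh h"
  shows "(\<Sum>k | sub k h. lookup (single A (a::rat)) (cls k) * F k) = a * (\<Sum>k | sub k h \<and> cls k = A. F k)"
proof -
  have "(\<Sum>k | sub k h. lookup (single A a) (cls k) * F k) = (\<Sum>k | sub k h. if cls k = A then a * F k else 0)"
    by (intro sum.cong) (auto simp: lookup_single when_def)
  also have "\<dots> = (\<Sum>k\<in>{k. sub k h} \<inter> {k. cls k = A}. a * F k)"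
    using finite_sub[OF lfgh_cubic[OF assms]] by (subst sum.inter_restrict) auto
  finally show ?thesis by (simp add: sum_distrib_left Collect_conj_eq)
qed

lemma lookup_mult_connected:
  assumes "lfgh h" "connected_class A"
  shows "lookup (hall_mult (single A 1) f) (cls h) = (\<Sum>c\<in>copies A h. lookup f (cls (quo h c)))"
  unfolding lookup_hall_mult[OF assms(1)] conv_def sum_single_class[OF assms(1)] copies_sub[OF assms(2)] by simp

lemma hall_one_left: "hall_mult hall_one f = f"
proof (rule hall_eqI)
  fix h assume h: "lfgh h"
  have "{k. sub k h \<and> cls k = cls hempty} = {hempty}"
    using sub_hempty cls_eq_hempty subD(1) by auto
  then show "lookup (hall_mult hall_one f) (cls h) = lookup f (cls h)"
    unfolding lookup_hall_mult[OF h] conv_def hall_one_def cls_hempty[symmetric] sum_single_class[OF h]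
    using quo_empty[OF lfgh_cubic[OF h], of hempty] by (simp add: hempty_def)
qed

text \<open>Both sides count the chains \<open>c \<subseteq> g \<subseteq> h\<close>, by \<open>quo_bij\<close> and \<open>quo_quo\<close>.\<close>

lemma hall_assoc_connected:
  assumes A: "connected_class A"
  shows "hall_mult (hall_mult (single A 1) f) g = hall_mult (single A 1) (hall_mult f g)"
proof (rule hall_eqI)
  fix h assume h: "lfgh h"
  have fin: "finite {k. sub k h}" "finite (copies A h)"
    using finite_sub finite_copies lfgh_cubic[OF h] by auto
  have sub_lfgh: "lfgh k" if "sub k h" for k using subD(1)[OF that] .
  have "lookup (hall_mult (hall_mult (single A 1) f) g) (cls h)
      = (\<Sum>k | sub k h. \<Sum>c\<in>copies A k. lookup f (cls (quo k c)) * lookup g (cls (quo h k)))"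
    unfolding lookup_hall_mult[OF h] conv_def
    by (intro sum.cong refl) (simp add: lookup_mult_connected[OF sub_lfgh A] sum_distrib_right)
  also have "\<dots> = (\<Sum>k | sub k h. \<Sum>c\<in>{c \<in> copies A h. csub c k}. lookup f (cls (quo k c)) * lookup g (cls (quo h k)))"
    using csub_nested by (intro sum.cong refl) (auto simp: copies_def)
  also have "\<dots> = (\<Sum>c\<in>copies A h. \<Sum>k\<in>{k \<in> {k. sub k h}. csub c k}. lookup f (cls (quo k c)) * lookup g (cls (quo h k)))"
    by (rule sum.swap_restrict[OF fin])
  also have "\<dots> = (\<Sum>c\<in>copies A h. \<Sum>e | sub e (quo h c). lookup f (cls e) * lookup g (cls (quo (quo h c) e)))"
  proof (rule sum.cong[OF refl])
    fix c assume "c \<in> copies A h"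
    then have c: "csub c h" by (simp add: copies_def)
    have "(\<Sum>k\<in>{k \<in> {k. sub k h}. csub c k}. lookup f (cls (quo k c)) * lookup g (cls (quo h k)))
      = (\<Sum>k | sub k h \<and> csub c k. lookup f (cls (quo k c)) * lookup g (cls (quo (quo h c) (quo k c))))"
    proof (rule sum.cong)
      fix k assume "k \<in> {k. sub k h \<and> csub c k}"
      then interpret nested_contraction h k c using h by unfold_locales auto
      show "lookup f (cls (quo k c)) * lookup g (cls (quo h k))
          = lookup f (cls (quo k c)) * lookup g (cls (quo (quo h c) (quo k c)))"
        by (simp add: quo_quo)
    qed simp
    then show "(\<Sum>k\<in>{k \<in> {k. sub k h}. csub c k}. lookup f (cls (quo k c)) * lookup g (cls (quo h k)))
      = (\<Sum>e | sub e (quo h c). lookup f (cls e) * lookup g (cls (quo (quo h c) e)))"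
      using sum.reindex_bij_betw[OF quo_bij[OF h c], of "\<lambda>e. lookup f (cls e) * lookup g (cls (quo (quo h c) e))"]
      by simp
  qed
  also have "\<dots> = lookup (hall_mult (single A 1) (hall_mult f g)) (cls h)"
    unfolding lookup_mult_connected[OF h A]
  proof (rule sum.cong[OF refl])
    fix c assume "c \<in> copies A h"
    then have "lfgh (quo h c)" using lfgh_quo_sub[OF h] by (auto simp: copies_def csub_def)
    then show "(\<Sum>e | sub e (quo h c). lookup f (cls e) * lookup g (cls (quo (quo h c) e)))
      = lookup (hall_mult f g) (cls (quo h c))" by (simp add: lookup_hall_mult conv_def)
  qed
  finally show "lookup (hall_mult (hall_mult (single A 1) f) g) (cls h)
      = lookup (hall_mult (single A 1) (hall_mult f g)) (cls h)" .
qed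

section \<open>Disjoint unions\<close>

definition hun :: "hgraph \<Rightarrow> hgraph \<Rightarrow> hgraph"
  where "hun h k = \<lparr>hs = hs h \<union> hs k, vr = vr h \<union> vr k, ad = ad h \<union> ad k\<rparr>"

lemma hun_simps [simp]: "hs (hun h k) = hs h \<union> hs k" "vr (hun h k) = vr h \<union> vr k" "ad (hun h k) = ad h \<union> ad k"
  by (simp_all add: hun_def)

lemma hun_commute: "hun h k = hun k h"
  by (simp add: hun_def Un_commute)

context
  fixes h k assumes h: "lfgh h" and k: "lfgh k" and disj: "hs h \<inter> hs k = {}"
begin

lemmas hpk = cubic_pairs[OF lfgh_cubic[OF h]] cubic_pairs[OF lfgh_cubic[OF k]]

lemma cubic_hun: "cubic (hun h k)"
proof -
  note H = lfgh_cubic[OF h] and K = lfgh_cubic[OF k]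
  note Dh = cubicD[OF H] and Dk = cubicD[OF K]
  have closed: "x \<in> hs h \<longleftrightarrow> y \<in> hs h" if "(x, y) \<in> vr k" for x y
    using that cubic_pairs(1,2)[OF K that] disj by blast
  have vr: "vr k \<inter> (hs k - hs h) \<times> (hs k - hs h) = vr k"
    using Dk(8) disj by auto
  note u = cubic_union_vr[OF H K closed, of "hun h k", unfolded vr, OF _ hun_simps(1,2)]
  have "ad (hun h k) \<subseteq> hs (hun h k) \<times> hs (hun h k)" "sym (ad (hun h k))" "irrefl (ad (hun h k))"
    using Dh(4,5,6) Dk(4,5,6) by (auto simp: sym_def irrefl_def)
  moreover have "single_valued (ad (hun h k))"
    using Dh(4,7) Dk(4,7) disj unfolding single_valued_def hun_simps by blast
  ultimately show ?thesis using u unfolding cubic_def by blast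
qed

lemma cn_hun: "x \<in> hs h \<Longrightarrow> (x, y) \<in> cn (hun h k) \<longleftrightarrow> (x, y) \<in> cn h"
proof
  assume x: "x \<in> hs h"
  assume "(x, y) \<in> cn (hun h k)"
  then have "(x, y) \<in> cn h \<and> y \<in> hs h"
  proof (induction rule: cn_induct)
    case (vr y z)
    then have "(y, z) \<in> vr h" using hpk(10) disj by auto
    then show ?case using vr cn_step(1) hpk(2) by blast
  next
    case (ad y z)
    then have "(y, z) \<in> ad h" using hpk(12) disj by auto
    then show ?case using ad cn_step(2) hpk(4) by blast
  qed (use x in simp)
  then show "(x, y) \<in> cn h" by simp
next
  assume "(x, y) \<in> cn h"
  then show "(x, y) \<in> cn (hun h k)"
    unfolding cn_def by (rule rtrancl_mono[THEN subsetD, rotated]) auto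
qed

lemma ext_hun: "ext (hun h k) \<inter> hs h = ext h"
  using hpk(12) disj by (auto simp: ext_def)

lemma cext_hun: "x \<in> hs h \<Longrightarrow> cext (hun h k) x = cext h x"
proof -
  assume x: "x \<in> hs h"
  have "cn h `` {x} \<subseteq> hs h" using cn_hs[OF _ lfgh_cubic[OF h], of x] x by auto
  then show ?thesis using cn_hun[OF x] ext_hun unfolding cext_def by blast
qed

lemma sub_hun: "sub h (hun h k)"
proof -
  have "vr h = vr (hun h k) \<inter> hs h \<times> UNIV" using hpk(1,10) disj by auto
  moreover have "cext h x \<subseteq> ext (hun h k)" for x using ext_hun by (auto simp: cext_def)
  ultimately show ?thesis unfolding sub_def using h by simp
qed

lemma comp_hun: "x \<in> hs h \<Longrightarrow> comp (hun h k) x = comp h x"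
proof -
  assume x: "x \<in> hs h"
  have S: "cn (hun h k) `` {x} = cn h `` {x}" using cn_hun[OF x] by auto
  have "cn h `` {x} \<subseteq> hs h" using cn_hs[OF _ lfgh_cubic[OF h], of x] x by auto
  then have "vr k \<inter> cn h `` {x} \<times> cn h `` {x} = {}" "ad k \<inter> cn h `` {x} \<times> cn h `` {x} = {}"
    using cubicD(4,8)[OF lfgh_cubic[OF k]] disj by blast+
  then show ?thesis by (intro hgraph.equality) (auto simp: S)
qed

lemma sub_of_hun:
  assumes c: "sub c (hun h k)" and hs: "hs c \<subseteq> hs h"
  shows "sub c h"
proof -
  note D = subD[OF c]
  have "vr c = vr h \<inter> hs c \<times> UNIV"
    unfolding D(6) using hs hpk(10) disj by auto
  moreover have "ad c \<subseteq> ad h"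
  proof
    fix e assume e: "e \<in> ad c"
    obtain x y where xy: "e = (x, y)" by fastforce
    then have "x \<in> hs h" using e cubic_pairs(3)[OF D(2)] hs by blast
    then have "e \<notin> ad k" using hpk(12)[of x y] disj xy by blast
    then show "e \<in> ad h" using e D(5) by auto
  qed
  moreover have "cext c x \<subseteq> ext h \<or> cext c x \<inter> ext h = {}" if "x \<in> hs c" "card (cext c x) = 2" for x
  proof -
    have "cext c x \<subseteq> hs h" using hs by (auto simp: cext_def ext_def)
    moreover have "cext c x \<subseteq> ext (hun h k) \<or> cext c x \<inter> ext (hun h k) = {}"
      using c that by (simp add: sub_def)
    ultimately show ?thesis using ext_hun by blast
  qed
  ultimately show ?thesis unfolding sub_def using D(1) hs by blast
qed

end

lemma lfgh_hun:
  assumes "lfgh h" "lfgh k" "hs h \<inter> hs k = {}"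
  shows "lfgh (hun h k)"
proof -
  have d: "hs k \<inter> hs h = {}" using assms(3) by blast
  have "vr (hun h k) `` {x} \<inter> Domain (ad (hun h k)) \<noteq> {}" if "x \<in> hs h \<union> hs k" for x
    using that assms(1,2) unfolding lfgh_def hun_simps by blast
  moreover have "card (cext (hun h k) x) = 2 \<or> card (cext (hun h k) x) = 3" if "x \<in> hs h \<union> hs k" for x
    using that cext_hun[OF assms] cext_hun[OF assms(2,1) d] assms(1,2)
    unfolding hun_commute[of k h] lfgh_def by auto
  ultimately show ?thesis using cubic_hun[OF assms] unfolding lfgh_def by simp
qed

lemma comps_hun:
  assumes "lfgh h" "lfgh k" "hs h \<inter> hs k = {}"
  shows "comps (hun h k) = comps h \<union> comps k" "comps h \<inter> comps k = {}"
proof -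
  have d: "hs k \<inter> hs h = {}" using assms(3) by blast
  show "comps (hun h k) = comps h \<union> comps k"
    using comp_hun[OF assms] comp_hun[OF assms(2,1) d] unfolding hun_commute[of k h] comps_def
    by (auto simp: image_Un)
  show "comps h \<inter> comps k = {}"
  proof (rule ccontr)
    assume "comps h \<inter> comps k \<noteq> {}"
    then obtain x y where xy: "x \<in> hs h" "y \<in> hs k" "comp h x = comp k y" by (auto simp: comps_def)
    have "x \<in> hs (comp h x)" by simp
    then have "(y, x) \<in> cn k" unfolding xy(3) by simp
    then have "x \<in> hs k" using cn_hs lfgh_cubic[OF assms(2)] xy(2) by blast
    then show False using xy(1) assms(3) by blast
  qed
qed

text \<open>Connections in \<open>hun h k\<close> do not cross from one summand to the other. This
  is what makes connected classes primitive for the coproduct.\<close>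

lemma csub_hun:
  assumes "lfgh h" "lfgh k" "hs h \<inter> hs k = {}"
  shows "csub c (hun h k) \<longleftrightarrow> csub c h \<or> csub c k"
proof
  have d: "hs k \<inter> hs h = {}" using assms(3) by blast
  note comm = hun_commute[of k h]
  assume c: "csub c (hun h k)"
  then have s: "sub c (hun h k)" and conn: "conn c" by (auto simp: csub_def)
  then obtain x where x: "x \<in> hs c" by (auto simp: conn_def)
  have *: "(x, y) \<in> cn (hun h k)" if "y \<in> hs c" for y
    using conn x that sub_cn[OF _ s] by (auto simp: conn_def)
  show "csub c h \<or> csub c k"
  proof (cases "x \<in> hs h")
    case True
    then have "hs c \<subseteq> hs h" using * cn_hun[OF assms True] cn_hs[OF _ lfgh_cubic[OF assms(1)], of x] by blast
    then show ?thesis using sub_of_hun[OF assms s] conn by (simp add: csub_def)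
  next
    case False
    then have xk: "x \<in> hs k" using x subD(3)[OF s] by auto
    then have "hs c \<subseteq> hs k"
      using * cn_hun[OF assms(2,1) d xk, unfolded comm] cn_hs[OF _ lfgh_cubic[OF assms(2)], of x] by blast
    then show ?thesis using sub_of_hun[OF assms(2,1) d, unfolded comm, OF s] conn by (simp add: csub_def)
  qed
next
  have d: "hs k \<inter> hs h = {}" using assms(3) by blast
  assume "csub c h \<or> csub c k"
  then show "csub c (hun h k)"
    using csub_nested sub_hun[OF assms] sub_hun[OF assms(2,1) d, unfolded hun_commute[of k h]] by blast
qed

lemma quo_hun:
  assumes "lfgh h" "lfgh k" "hs h \<inter> hs k = {}" "csub c h"
  shows "quo (hun h k) c = hun (quo h c) k"
proof -
  interpret H: contraction h c by (rule contraction_lfgh[OF assms(1,4)])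
  have cu: "csub c (hun h k)" using csub_hun[OF assms(1-3)] assms(4) by blast
  interpret U: contraction "hun h k" c by (rule contraction_lfgh[OF lfgh_hun[OF assms(1-3)] cu])
  note e = ext_hun[OF assms(1-3)]
  have ck: "hs c \<inter> hs k = {}" using H.subD'(3) assms(3) by blast
  have sub: "ext c \<subseteq> ext (hun h k) \<longleftrightarrow> ext c \<subseteq> ext h"
    using e H.ext_c_hs H.subD'(3) by blast
  have k1: "(x, y) \<in> vr k \<Longrightarrow> x \<in> hs k \<and> y \<in> hs k" "(x, y) \<in> ad k \<Longrightarrow> x \<in> hs k \<and> y \<in> hs k" for x y
    using cubic_pairs(1-4)[OF lfgh_cubic[OF assms(2)]] by blast+
  have k2: "x \<in> hs c \<Longrightarrow> x \<notin> hs k" for x using ck by blast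
  have R: "(r \<union> s) \<inter> ((H \<union> K) - C) \<times> ((H \<union> K) - C) = (r \<inter> (H - C) \<times> (H - C)) \<union> s"
    if "r \<subseteq> H \<times> H" "s \<subseteq> K \<times> K" "C \<inter> K = {}" "H \<inter> K = {}" for r s :: "(nat \<times> nat) set" and H K C
    using that by blast
  have HK: "vr h \<subseteq> hs h \<times> hs h" "ad h \<subseteq> hs h \<times> hs h" "vr k \<subseteq> hs k \<times> hs k" "ad k \<subseteq> hs k \<times> hs k"
    using cubicD(4,8) lfgh_cubic assms(1,2) by blast+
  have hsd: "(hs h \<union> hs k) - hs c = (hs h - hs c) \<union> hs k" using ck by blast
  show ?thesis
  proof (cases rule: H.kinds)
    case comp
    then have "ext c \<subseteq> ext (hun h k)" using sub by simp
    note q = U.quo_comp[OF this] H.quo_comp[OF comp]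
    show ?thesis unfolding q hun_simps R[OF HK(1,3) ck assms(3)] R[OF HK(2,4) ck assms(3)]
      by (simp add: hun_def hsd)
  next
    case three
    then have "\<not> ext c \<subseteq> ext (hun h k)" using sub by simp
    note q = U.quo_three[OF three(1) this] H.quo_three[OF three]
    have E: "hs c - ext c \<subseteq> hs c" "(hs c - ext c) \<inter> hs k = {}" using ck by auto
    have eq: "(hs h \<union> hs k - hs c) \<union> ext c = (hs h \<union> hs k) - (hs c - ext c)"
      "(hs h - hs c) \<union> ext c = hs h - (hs c - ext c)"
      using H.ext_c_hs H.subD'(3) by blast+
    show ?thesis unfolding q eq hun_simps R[OF HK(1,3) ck assms(3)] R[OF HK(2,4) E(2) assms(3)]
      using E(2) by (auto simp: hun_def)
  next
    case (two a b p q)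
    then have "(a, p) \<in> ad (hun h k)" "(b, q) \<in> ad (hun h k)" by auto
    note qq = U.quo_two(1)[OF two(1,2) this] H.quo_two(1)[OF two(1-4)]
    show ?thesis unfolding qq hun_simps R[OF HK(1,3) ck assms(3)] R[OF HK(2,4) ck assms(3)]
      by (auto simp: hun_def hsd)
  qed
qed

section \<open>The multiset of components as a complete invariant\<close>

definition cmh :: "hgraph \<Rightarrow> lfg_class multiset"
  where "cmh h = image_mset cls (mset_set (comps h))"

lemma finite_comps: "cubic h \<Longrightarrow> finite (comps h)"
  using cubicD(1) by (simp add: comps_def)

lemma size_cmh: "size (cmh h) = card (comps h)"
  by (simp add: cmh_def)

lemma comps_himg:
  assumes "inj f"
  shows "comps (himg f h) = himg f ` comps h"
proof -
  have "comp (himg f h) (f x) = himg f (comp h x)" for x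
  proof (rule hgraph.equality)
    have "map_prod f f ` r \<inter> f ` S \<times> f ` S = map_prod f f ` (r \<inter> S \<times> S)" for r S
      using inj_eq[OF assms] by auto
    then show "vr (comp (himg f h) (f x)) = vr (himg f (comp h x))" "ad (comp (himg f h) (f x)) = ad (himg f (comp h x))"
      using cn_himg_class[OF assms, of h x] by simp_all
  qed (use cn_himg_class[OF assms, of h x] in simp_all)
  then show ?thesis by (auto simp: comps_def image_iff)
qed

lemma comps_lfgh: "lfgh h \<Longrightarrow> c \<in> comps h \<Longrightarrow> csub c h \<and> ext c \<subseteq> ext h \<and> lfgh c"
  using comp_props subD(1) by (fastforce simp: comps_def csub_def)

lemma himg_inj: "inj f \<Longrightarrow> inj (himg f)"
proof (rule injI)
  fix a b assume inj: "inj f" and eq: "himg f a = himg f b"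
  have "f ` hs a = f ` hs b" "map_prod f f ` vr a = map_prod f f ` vr b" "map_prod f f ` ad a = map_prod f f ` ad b"
    using arg_cong[OF eq, of hs] arg_cong[OF eq, of vr] arg_cong[OF eq, of ad] by simp_all
  then show "a = b"
    by (intro hgraph.equality) (simp_all add: inj_image_eq_iff inj prod.inj_map)
qed

lemma cmh_himg:
  assumes "lfgh h" "inj f"
  shows "cmh (himg f h) = cmh h"
proof -
  have "cmh (himg f h) = image_mset (\<lambda>c. cls (himg f c)) (mset_set (comps h))"
    unfolding cmh_def comps_himg[OF assms(2)]
      image_mset_mset_set[OF inj_on_subset[OF himg_inj[OF assms(2)] subset_UNIV], symmetric]
    by (simp add: multiset.map_comp o_def)
  also have "\<dots> = cmh h"
    unfolding cmh_def using comps_lfgh[OF assms(1)] cls_himg assms(2) finite_comps[OF lfgh_cubic[OF assms(1)]]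
    by (intro image_mset_cong) auto
  finally show ?thesis .
qed

lemma cmh_cls: "lfgh h \<Longrightarrow> lfgh h' \<Longrightarrow> cls h = cls h' \<Longrightarrow> cmh h = cmh h'"
  using cmh_himg bij_is_inj by (metis cls_eq iso_iff_bij lfgh_cubic)

lemma cmh_hun:
  assumes "lfgh h" "lfgh k" "hs h \<inter> hs k = {}"
  shows "cmh (hun h k) = cmh h + cmh k"
  unfolding cmh_def comps_hun(1)[OF assms]
  using comps_hun(2)[OF assms] finite_comps lfgh_cubic assms by (simp add: mset_set_Union)

lemma cmh_quo_comp:
  assumes "lfgh h" "c \<in> comps h"
  shows "cmh h = add_mset (cls c) (cmh (quo h c))"
proof -
  have "comps h = insert c (comps h - {c})" using assms(2) by auto
  then show ?thesis
    unfolding cmh_def comps_quo[OF assms] using finite_comps[OF lfgh_cubic[OF assms(1)]]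
    by (metis Diff_iff finite_Diff image_mset_add_mset insertI1 mset_set.insert)
qed

lemma comps_conn:
  assumes "lfgh h" "conn h"
  shows "comps h = {h}"
proof -
  have "comp h x = h" if x: "x \<in> hs h" for x
  proof -
    have S: "cn h `` {x} = hs h"
    proof
      show "cn h `` {x} \<subseteq> hs h" using cn_hs[OF _ lfgh_cubic[OF assms(1)], of x] x by blast
      show "hs h \<subseteq> cn h `` {x}" using assms(2) x unfolding conn_def by blast
    qed
    show ?thesis
      using cubicD(4,8)[OF lfgh_cubic[OF assms(1)]]
      by (intro hgraph.equality) (simp_all add: S Int_absorb2)
  qed
  then have "comp h ` hs h = (\<lambda>_. h) ` hs h" by (intro image_cong) auto
  then show ?thesis using assms(2) by (simp add: comps_def conn_def image_constant_conv)
qed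

text \<open>Serves to compare the components of a graph and of its quotient, which are different
  graphs indexed by the same half-edges.\<close>

lemma card_image_eq_fibres:
  assumes "\<And>x y. x \<in> S \<Longrightarrow> y \<in> S \<Longrightarrow> f x = f y \<longleftrightarrow> g x = g y"
  shows "card (f ` S) = card (g ` S)"
proof -
  have "bij_betw (\<lambda>v. g (inv_into S f v)) (f ` S) (g ` S)"
  proof (rule bij_betwI[of _ _ _ "\<lambda>v. f (inv_into S g v)"])
    have 1: "g (inv_into S f (f x)) = g x" "f (inv_into S g (g x)) = f x" if "x \<in> S" for x
      using assms that by (metis f_inv_into_f image_eqI inv_into_into)+
    then show "(\<lambda>v. g (inv_into S f v)) \<in> f ` S \<rightarrow> g ` S" "(\<lambda>v. f (inv_into S g v)) \<in> g ` S \<rightarrow> f ` S" by auto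
    show "f (inv_into S g (g (inv_into S f v))) = v" if "v \<in> f ` S" for v using that 1 by auto
    show "g (inv_into S f (f (inv_into S g v))) = v" if "v \<in> g ` S" for v using that 1 by auto
  qed
  then show ?thesis by (rule bij_betw_same_card)
qed

lemma comp_eq_iff: "cubic h \<Longrightarrow> comp h x = comp h y \<longleftrightarrow> (x, y) \<in> cn h"
proof
  assume "cubic h" "comp h x = comp h y"
  moreover have "y \<in> hs (comp h y)" by simp
  ultimately show "(x, y) \<in> cn h" by (metis Image_singleton_iff comp_simps(1))
qed (rule comp_eq)

text \<open>With no way out through its external edges, \<open>c\<close> fills the component of
  \<open>h\<close> in which it lies.\<close>

lemma csub_comps:
  assumes "lfgh h" "csub c h" "ext c \<subseteq> ext h"
  shows "c \<in> comps h"
proof -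
  interpret contraction h c by (rule contraction_lfgh[OF assms(1,2)])
  obtain x where x: "x \<in> hs c" using c_ne by blast
  have S: "cn h `` {x} = hs c" using comp_closed[OF assms(3) x] cn_h_c[OF x] by blast
  have adc: "ad h \<inter> hs c \<times> hs c = ad c"
  proof -
    have "(y, z) \<in> ad c" if "(y, z) \<in> ad h" "y \<in> hs c" for y z
      using that internal(1)[OF that(2) _ that(1)] assms(3) by (auto simp: ext_def)
    then show ?thesis using subD'(5) cp(3,4) by auto
  qed
  have "comp h x = c"
    by (rule hgraph.equality) (use S adc subD'(6) cp(2) in auto)
  then show ?thesis using x subD'(3) by (auto simp: comps_def)
qed

text \<open>By \<open>class_meets\<close> every component of \<open>h\<close> meets the quotient,
  and by \<open>cn_quo\<close> connectivity there is the same as in \<open>h\<close>.\<close>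

lemma size_cmh_quo:
  assumes "lfgh h" "csub c h" "\<not> ext c \<subseteq> ext h"
  shows "size (cmh (quo h c)) = size (cmh h)"
proof -
  interpret contraction h c by (rule contraction_lfgh[OF assms(1,2)])
  have "comps h = comp h ` hs (quo h c)"
  proof
    show "comps h \<subseteq> comp h ` hs (quo h c)"
    proof
      fix d assume "d \<in> comps h"
      then obtain x where x: "x \<in> hs h" "d = comp h x" by (auto simp: comps_def)
      then obtain y where "y \<in> hs (quo h c)" "(x, y) \<in> cn h" using class_meets assms(3) by blast
      then show "d \<in> comp h ` hs (quo h c)" using x comp_eq[OF cub] by blast
    qed
  qed (use hs_quo(2) in \<open>auto simp: comps_def\<close>)
  moreover have "card (comp h ` hs (quo h c)) = card (comp (quo h c) ` hs (quo h c))"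
    by (rule card_image_eq_fibres) (simp add: comp_eq_iff[OF cub] comp_eq_iff[OF cubic_quo] cn_quo)
  ultimately show ?thesis by (simp add: size_cmh comps_def)
qed

lemma hun_comp:
  assumes "lfgh h" "c \<in> comps h"
  shows "h = hun c (quo h c)" "hs c \<inter> hs (quo h c) = {}"
proof -
  have c: "csub c h" "ext c \<subseteq> ext h" using comps_lfgh[OF assms] by auto
  interpret contraction h c by (rule contraction_lfgh[OF assms(1) c(1)])
  note q = quo_comp[OF c(2)]
  show "hs c \<inter> hs (quo h c) = {}" by (auto simp: q)
  have vr: "(x, y) \<in> vr h \<longleftrightarrow> (x, y) \<in> vr c \<or> (x, y) \<in> vr (quo h c)" for x y
    using subD'(4)[of x y] hp(1,2)[of x y] outside_c[of x y] by (auto simp: q)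
  have ad: "(x, y) \<in> ad h \<longleftrightarrow> (x, y) \<in> ad c \<or> (x, y) \<in> ad (quo h c)" for x y
  proof -
    have "x \<in> hs c \<longleftrightarrow> y \<in> hs c" if "(x, y) \<in> ad h"
      using comp_closed[OF c(2)] cn_base(2)[OF that] cn_base(2)[OF hp(6)[OF that]] by blast
    moreover have "(x, y) \<in> ad c" if "(x, y) \<in> ad h" "x \<in> hs c"
      using internal(1)[OF that(2) _ that(1)] that c(2) by (auto simp: ext_def)
    ultimately show ?thesis using subD'(5) hp(3,4)[of x y] by (auto simp: q)
  qed
  show "h = hun c (quo h c)"
  proof (rule hgraph.equality)
    show "hs h = hs (hun c (quo h c))" using subD'(3) by (auto simp: q)
    show "vr h = vr (hun c (quo h c))" using vr by auto
    show "ad h = ad (hun c (quo h c))" using ad by auto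
  qed simp
qed

lemma iso_hun:
  assumes "lfgh h" "lfgh k" "hs h \<inter> hs k = {}" "lfgh h'" "lfgh k'" "hs h' \<inter> hs k' = {}"
    and "iso h h'" "iso k k'"
  shows "iso (hun h k) (hun h' k')"
proof -
  obtain f where f: "inj_on f (hs h)" "himg f h = h'" using assms by (auto simp: iso_def)
  obtain g where g: "inj_on g (hs k)" "himg g k = k'" using assms by (auto simp: iso_def)
  let ?f = "\<lambda>x. if x \<in> hs h then f x else g x"
  have fg: "himg ?f h = h'" "himg ?f k = k'"
  proof -
    have "himg ?f h = himg f h" by (rule himg_cong[OF lfgh_cubic[OF assms(1)]]) simp
    then show "himg ?f h = h'" using f by simp
    have "himg ?f k = himg g k" by (rule himg_cong[OF lfgh_cubic[OF assms(2)]]) (use assms(3) in auto)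
    then show "himg ?f k = k'" using g by simp
  qed
  have im: "f ` hs h = hs h'" "g ` hs k = hs k'" using f(2) g(2) by auto
  have "inj_on ?f (hs h \<union> hs k)"
  proof -
    have ne: "f x \<noteq> g y" if "x \<in> hs h" "y \<in> hs k" for x y
      using that im assms(6) by blast
    then have "g y \<noteq> f x" if "x \<in> hs h" "y \<in> hs k" for x y using that by metis
    with ne show ?thesis
      unfolding inj_on_def using f(1) g(1) assms(3) by (auto dest: inj_onD)
  qed
  moreover have "himg F (hun h k) = hun (himg F h) (himg F k)" for F
    by (simp add: himg_def hun_def image_Un)
  ultimately show ?thesis unfolding iso_def using fg by (intro exI[of _ ?f]) simp
qed

text \<open>Splits off components of the same class on both sides and reassembles the isomorphisms
  with \<open>iso_hun\<close>.\<close>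

lemma cmh_inj:
  assumes "lfgh h" "lfgh h'" "cmh h = cmh h'"
  shows "iso h h'"
  using assms
proof (induction "card (comps h)" arbitrary: h h')
  case 0
  have "comps h = {}" "comps h' = {}"
    using 0 finite_comps lfgh_cubic size_cmh[of h] size_cmh[of h'] by (metis card_eq_0_iff)+
  then have "h = hempty" "h' = hempty" using hempty_iff lfgh_cubic 0 by (auto simp: comps_def)
  then show ?case by (simp add: iso_refl)
next
  case (Suc n)
  then have "comps h \<noteq> {}" by auto
  then obtain c where c: "c \<in> comps h" by blast
  have "cls c \<in># cmh h"
    using c finite_comps[OF lfgh_cubic[OF Suc(3)]] by (auto simp: cmh_def)
  then have "cls c \<in># cmh h'" unfolding Suc(5) .
  then obtain c' where c': "c' \<in> comps h'" "cls c' = cls c"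
    using finite_comps[OF lfgh_cubic[OF Suc(4)]] by (auto simp: cmh_def)
  have l: "lfgh (quo h c)" "lfgh (quo h' c')" "lfgh c" "lfgh c'"
    using lfgh_quo_sub comps_lfgh Suc(3,4) c c' by (auto simp: csub_def)
  have "cmh (quo h c) = cmh (quo h' c')"
    using cmh_quo_comp[OF Suc(3) c] cmh_quo_comp[OF Suc(4) c'(1)] Suc(5) c'(2) by simp
  moreover have "n = card (comps (quo h c))"
    using Suc(2) cmh_quo_comp[OF Suc(3) c] by (metis diff_Suc_1 size_add_mset size_cmh)
  ultimately have "iso (quo h c) (quo h' c')" using Suc(1) l by blast
  moreover have "iso c c'" using c'(2) l cls_eq by metis
  ultimately show ?case
    using iso_hun[OF l(3,1) hun_comp(2)[OF Suc(3) c] l(4,2) hun_comp(2)[OF Suc(4) c'(1)]]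
      hun_comp(1)[OF Suc(3) c] hun_comp(1)[OF Suc(4) c'(1)] by simp
qed

section \<open>Ordered monomials\<close>

text \<open>Makes the coproduct a finite sum: a given class has only finitely many summands.\<close>

lemma finite_msubsets: "finite {M. M \<subseteq># N}"
proof (rule finite_subset)
  show "{M. M \<subseteq># N} \<subseteq> {M. set_mset M \<subseteq> set_mset N \<and> size M \<le> size N}"
    using set_mset_mono size_mset_mono by fastforce
  have "{M. set_mset M \<subseteq> set_mset N \<and> size M \<le> size N} = mset ` {w. set w \<subseteq> set_mset N \<and> length w \<le> size N}"
  proof (intro set_eqI iffI)
    fix M assume "M \<in> {M. set_mset M \<subseteq> set_mset N \<and> size M \<le> size N}"
    moreover obtain w where "mset w = M" using ex_mset by blast
    ultimately show "M \<in> mset ` {w. set w \<subseteq> set_mset N \<and> length w \<le> size N}"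
      by (intro image_eqI[of _ _ w]) auto
  qed auto
  then show "finite {M. set_mset M \<subseteq> set_mset N \<and> size M \<le> size N}"
    using finite_lists_length_le[of "set_mset N" "size N"] by simp
qed

definition CM :: "lfg_class \<Rightarrow> lfg_class multiset"
  where "CM X = cmh (rep X)"

lemma CM_cls: "lfgh h \<Longrightarrow> CM (cls h) = cmh h"
  unfolding CM_def using cmh_cls rep by blast

lemma CM_inj: "CM X = CM Y \<Longrightarrow> X = Y"
  unfolding CM_def using cmh_inj[OF rep(1) rep(1)] cls_eq[OF rep(1) rep(1)] rep(2) by metis

lemma cmh_connected:
  assumes "lfgh h" "A \<in># cmh h"
  shows "connected_class A"
proof -
  obtain c where "c \<in> comps h" "A = cls c"
    using assms finite_comps[OF lfgh_cubic[OF assms(1)]] by (auto simp: cmh_def)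
  then show ?thesis using comps_lfgh[OF assms(1)] connected_class_cls by (auto simp: csub_def)
qed

lemma CM_connected: "A \<in># CM X \<Longrightarrow> connected_class A"
  unfolding CM_def by (rule cmh_connected[OF rep(1)])

lemma cmh_hempty: "cmh hempty = {#}"
  by (simp add: cmh_def comps_def hempty_def)

lemma CM_single: "connected_class A \<Longrightarrow> CM A = {#A#}"
  unfolding CM_def connected_class_rep cmh_def using comps_conn[OF rep(1)] rep(2) by simp

section \<open>Disjoint unions of labeled graphs\<close>

lemma shape_relabel:
  assumes i: "inj i" and G: "trivalent G"
  shows "shape (relabel i G) = himg i (shape G)" "trivalent (relabel i G)"
proof -
  note g = trivalentD[OF G] and ii = inj_eq[OF i]
  let ?R = "relabel i G"
  have mem: "(i v, i x) \<in> inc ?R \<longleftrightarrow> (v, x) \<in> inc G" for v x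
    unfolding relabel_def using map_prod_mem[OF i] by simp
  show "shape ?R = himg i (shape G)"
  proof (rule hgraph.equality)
    have "(x, y) \<in> vr (shape ?R) \<longleftrightarrow> (x, y) \<in> vr (himg i (shape G))" for x y
    proof
      assume "(x, y) \<in> vr (shape ?R)"
      then obtain v where "(v, x) \<in> inc ?R" "(v, y) \<in> inc ?R" by auto
      then obtain w a b where "x = i a" "y = i b" "(w, a) \<in> inc G" "(w, b) \<in> inc G"
        using ii by (auto simp: relabel_def)
      then show "(x, y) \<in> vr (himg i (shape G))" by force
    next
      assume "(x, y) \<in> vr (himg i (shape G))"
      then obtain a b v where "x = i a" "y = i b" "(v, a) \<in> inc G" "(v, b) \<in> inc G" by auto
      then show "(x, y) \<in> vr (shape ?R)" using mem by auto
    qed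
    then show "vr (shape ?R) = vr (himg i (shape G))" by (simp add: set_eq_iff split_paired_All)
  qed (auto simp: relabel_def)
  have "half_edges_at ?R (i v) = i ` half_edges_at G v" for v
    using ii by (auto simp: half_edges_at_def relabel_def)
  then have "card (half_edges_at ?R v) = 3" if "v \<in> verts ?R" for v
    using that g(12) card_image[OF inj_on_subset[OF i subset_UNIV]] by (auto simp: relabel_def)
  moreover have "finite (verts ?R)" "finite (halves ?R)" using g(1,2) by (auto simp: relabel_def)
  moreover have "inc ?R \<subseteq> verts ?R \<times> halves ?R" "adj ?R \<subseteq> halves ?R \<times> halves ?R"
    using g(3-6) by (auto simp: relabel_def)
  moreover have "sym (adj ?R)" "irrefl (adj ?R)"
    using g(7,8) ii by (auto simp: relabel_def sym_def irrefl_def)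
  moreover have "\<exists>!v. (v, x) \<in> inc ?R" if x: "x \<in> halves ?R" for x
  proof -
    obtain a where a: "x = i a" "a \<in> halves G" using x by (auto simp: relabel_def)
    obtain v where v: "(v, a) \<in> inc G" using g(10)[OF a(2)] by blast
    show ?thesis
    proof
      show "(i v, x) \<in> inc ?R" using v a mem by simp
      fix w assume "(w, x) \<in> inc ?R"
      then obtain u where "w = i u" "(u, a) \<in> inc G" using a ii by (auto simp: relabel_def)
      then show "w = i v" using g(9)[OF v, of u] by simp
    qed
  qed
  moreover have "k = k'" if kk: "(x, k) \<in> adj ?R" "(x, k') \<in> adj ?R" for x k k'
  proof -
    obtain a b where 1: "x = i a" "k = i b" "(a, b) \<in> adj G" using kk(1) by (auto simp: relabel_def)
    obtain a' c where 2: "x = i a'" "k' = i c" "(a', c) \<in> adj G" using kk(2) by (auto simp: relabel_def)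
    have "a' = a" using 1(1) 2(1) ii by simp
    then show ?thesis using 1 2 g(11) by blast
  qed
  ultimately show "trivalent ?R" unfolding trivalent_def finite_graph_def by blast
qed

lemma shape_graph_union:
  assumes G: "trivalent G" and K: "trivalent K"
    and disj: "verts G \<inter> verts K = {}" "halves G \<inter> halves K = {}"
  shows "shape (graph_union G K) = hun (shape G) (shape K)" "trivalent (graph_union G K)"
proof -
  note g = trivalentD[OF G] and k = trivalentD[OF K]
  let ?U = "graph_union G K"
  have U: "verts ?U = verts G \<union> verts K" "halves ?U = halves G \<union> halves K"
    "inc ?U = inc G \<union> inc K" "adj ?U = adj G \<union> adj K" by (simp_all add: graph_union_def)
  have x1: "(v, x) \<in> inc G \<Longrightarrow> (v, y) \<notin> inc K" for v x y using g(3) k(3) disj by blast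
  have x2: "(v, x) \<in> inc G \<Longrightarrow> (w, x) \<notin> inc K" for v w x using g(4) k(4) disj by blast
  have x3: "(x, y) \<in> adj G \<Longrightarrow> (x, z) \<notin> adj K" for x y z using g(5) k(5) disj by blast
  have "(x, y) \<in> vr (shape ?U) \<longleftrightarrow> (x, y) \<in> vr (hun (shape G) (shape K))" for x y
    using x1 U by auto
  then show "shape ?U = hun (shape G) (shape K)"
    by (intro hgraph.equality) (auto simp: U)
  have "half_edges_at ?U v = half_edges_at G v" if "v \<in> verts G" for v
    using that k(3) disj(1) unfolding half_edges_at_def U by blast
  moreover have "half_edges_at ?U v = half_edges_at K v" if "v \<in> verts K" for v
    using that g(3) disj(1) unfolding half_edges_at_def U by blast
  ultimately have "card (half_edges_at ?U v) = 3" if "v \<in> verts ?U" for v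
    using that g(12) k(12) U by auto
  moreover have "finite (verts ?U)" "finite (halves ?U)" using g(1,2) k(1,2) U by auto
  moreover have "inc ?U \<subseteq> verts ?U \<times> halves ?U" "adj ?U \<subseteq> halves ?U \<times> halves ?U"
    using g(3-6) k(3-6) U by auto
  moreover have "sym (adj ?U)" "irrefl (adj ?U)"
    using g(7,8) k(7,8) U by (auto simp: sym_def irrefl_def)
  moreover have "\<exists>!v. (v, x) \<in> inc ?U" if x: "x \<in> halves ?U" for x
  proof -
    obtain v where v: "(v, x) \<in> inc ?U" using x U g(10) k(10) by blast
    have "w = v" if w: "(w, x) \<in> inc ?U" for w
    proof (cases "(v, x) \<in> inc G")
      case True
      then show ?thesis using w x2[OF True] g(9)[OF _ True] unfolding U by blast
    next
      case False
      then have vK: "(v, x) \<in> inc K" using v unfolding U by blast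
      have "(w, x) \<notin> inc G" using x2 vK by blast
      then show ?thesis using w k(9)[OF _ vK] unfolding U by blast
    qed
    with v show ?thesis by blast
  qed
  moreover have "y = z" if "(x, y) \<in> adj ?U" "(x, z) \<in> adj ?U" for x y z
    using that g(11)[of x y z] k(11)[of x y z] x3[of x y z] x3[of x z y] unfolding U by blast
  ultimately show "trivalent ?U" unfolding trivalent_def finite_graph_def by blast
qed

lemma disjoint_union_class:
  assumes 1: "labeled_feynman_graph \<Gamma>" and 2: "labeled_feynman_graph \<Gamma>'"
  shows "labeled_feynman_graph (\<Gamma> \<oplus> \<Gamma>')"
    "iso_class (\<Gamma> \<oplus> \<Gamma>') = cls (hun (himg (\<lambda>n. 2 * n) (shape (fst \<Gamma>))) (himg (\<lambda>n. 2 * n + 1) (shape (fst \<Gamma>'))))"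
    "CM (iso_class (\<Gamma> \<oplus> \<Gamma>')) = CM (iso_class \<Gamma>) + CM (iso_class \<Gamma>')"
proof -
  obtain G \<rho> H \<sigma> where e: "\<Gamma> = (G, \<rho>)" "\<Gamma>' = (H, \<sigma>)" by fastforce
  have G: "trivalent G" "lfgh (shape G)" "inj_on \<rho> (halves G)" "lfg_graph G"
    and H: "trivalent H" "lfgh (shape H)" "inj_on \<sigma> (halves H)" "lfg_graph H"
    using 1 2 e by (auto simp: labeled_feynman_graph_def lfg_graph_shape)
  have i: "inj (\<lambda>n::nat. 2 * n)" "inj (\<lambda>n::nat. 2 * n + 1)" by (auto intro: injI)
  note L = shape_relabel[OF i(1) G(1), folded left_copy_def]
  note R = shape_relabel[OF i(2) H(1), folded right_copy_def]
  have L1: "verts (left_copy G) = (\<lambda>n. 2 * n) ` verts G" "halves (left_copy G) = (\<lambda>n. 2 * n) ` halves G"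
    by (simp_all add: left_copy_def relabel_def)
  have R1: "verts (right_copy H) = (\<lambda>n. 2 * n + 1) ` verts H" "halves (right_copy H) = (\<lambda>n. 2 * n + 1) ` halves H"
    by (simp_all add: right_copy_def relabel_def)
  have odd: "2 * a \<noteq> 2 * b + (1::nat)" for a b by presburger
  have d: "verts (left_copy G) \<inter> verts (right_copy H) = {}" "halves (left_copy G) \<inter> halves (right_copy H) = {}"
    unfolding L1 R1 using odd by (auto simp del: One_nat_def)
  let ?U = "graph_union (left_copy G) (right_copy H)"
  let ?l = "himg (\<lambda>n. 2 * n) (shape G)" and ?r = "himg (\<lambda>n. 2 * n + 1) (shape H)"
  note U = shape_graph_union[OF L(2) R(2) d, unfolded L(1) R(1)]
  have l: "lfgh ?l" "lfgh ?r" using lfgh_himg i G H by auto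
  have dl: "hs ?l \<inter> hs ?r = {}" using odd by (auto simp del: One_nat_def)
  have lU: "lfg_graph ?U" using U lfgh_hun[OF l dl] by (simp add: lfg_graph_shape)
  have inj: "inj_on (join_labels \<rho> \<sigma>) (halves ?U)"
  proof (rule inj_onI)
    fix x y assume xy: "x \<in> halves ?U" "y \<in> halves ?U" "join_labels \<rho> \<sigma> x = join_labels \<rho> \<sigma> y"
    have jl: "join_labels \<rho> \<sigma> (2 * a) = 2 * \<rho> a" "join_labels \<rho> \<sigma> (2 * a + 1) = 2 * \<sigma> a + 1" for a
      by (simp_all add: join_labels_def)
    have "\<exists>a. (a \<in> halves G \<and> z = 2 * a) \<or> (a \<in> halves H \<and> z = 2 * a + 1)" if "z \<in> halves ?U" for z
      using that by (auto simp: graph_union_def L1 R1)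
    then obtain a b where "(a \<in> halves G \<and> x = 2 * a) \<or> (a \<in> halves H \<and> x = 2 * a + 1)"
      "(b \<in> halves G \<and> y = 2 * b) \<or> (b \<in> halves H \<and> y = 2 * b + 1)" using xy by meson
    then show "x = y"
      using xy(3) jl[of a] jl[of b] odd[of "\<rho> a" "\<sigma> b"] odd[of "\<rho> b" "\<sigma> a"] inj_onD[OF G(3), of a b] inj_onD[OF H(3), of a b]
      by (elim disjE conjE) (simp_all del: One_nat_def)
  qed
  show "labeled_feynman_graph (\<Gamma> \<oplus> \<Gamma>')"
    using lU inj by (simp add: e disjoint_union_def labeled_feynman_graph_def)
  show cl: "iso_class (\<Gamma> \<oplus> \<Gamma>') = cls (hun (himg (\<lambda>n. 2 * n) (shape (fst \<Gamma>))) (himg (\<lambda>n. 2 * n + 1) (shape (fst \<Gamma>'))))"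
    using iso_class_cls[OF lU inj] U by (simp add: e disjoint_union_def)
  have "CM (iso_class (\<Gamma> \<oplus> \<Gamma>')) = CM (cls (hun ?l ?r))" unfolding cl by (simp only: e fst_conv)
  also have "\<dots> = cmh ?l + cmh ?r"
    using CM_cls[OF lfgh_hun[OF l dl]] cmh_hun[OF l dl] by simp
  finally have "CM (iso_class (\<Gamma> \<oplus> \<Gamma>')) = cmh ?l + cmh ?r" .
  then show "CM (iso_class (\<Gamma> \<oplus> \<Gamma>')) = CM (iso_class \<Gamma>) + CM (iso_class \<Gamma>')"
    using cmh_himg[OF G(2) i(1)] cmh_himg[OF H(2) i(2)] CM_cls G H iso_class_cls[OF G(4,3)] iso_class_cls[OF H(4,3)]
    by (simp add: e)
qed

text \<open>Through \<open>CM\<close> this is addition of multisets, so the classes form the free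
  commutative monoid on the connected ones.\<close>

definition uni :: "lfg_class \<Rightarrow> lfg_class \<Rightarrow> lfg_class"
  where "uni X Y = iso_class (representative X \<oplus> representative Y)"

lemma CM_uni: "CM (uni X Y) = CM X + CM Y"
  unfolding uni_def using disjoint_union_class(3)[OF representative_lfg representative_lfg]
  by (simp add: Quotient3_abs_rep[OF Quotient3_lfg_class])

lemma iso_class_disjoint_union:
  "labeled_feynman_graph \<Gamma> \<Longrightarrow> labeled_feynman_graph \<Gamma>' \<Longrightarrow> iso_class (\<Gamma> \<oplus> \<Gamma>') = uni (iso_class \<Gamma>) (iso_class \<Gamma>')"
  by (rule CM_inj) (simp add: CM_uni disjoint_union_class(3))

lemma CM_surj: "(\<And>A. A \<in># M \<Longrightarrow> connected_class A) \<Longrightarrow> \<exists>X. CM X = M"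
proof (induction M)
  case empty
  show ?case using CM_cls[OF lfgh_hempty] cmh_hempty by metis
next
  case (add A M)
  then obtain X where "CM X = M" by auto
  then have "CM (uni A X) = add_mset A M" using CM_single[of A] add.prems by (simp add: CM_uni)
  then show ?case by blast
qed

lemma hall_bilinear:
  "hall_mult (f + g) k = hall_mult f k + hall_mult g k" "hall_mult k (f + g) = hall_mult k f + hall_mult k g"
  "hall_mult (r *\<^sub>Q f) k = r *\<^sub>Q hall_mult f k" "hall_mult k (r *\<^sub>Q f) = r *\<^sub>Q hall_mult k f"
  by (rule hall_eqI;
      simp add: lookup_hall_mult conv_def lookup_add lookup_scaleQ scaleQ_rat_def algebra_simps sum.distrib sum_distrib_left)+

lemma qbilinear_hall: "qbilinear hall_mult"
  unfolding qbilinear_def by (auto intro!: qlinearI simp: hall_bilinear)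

section \<open>Products of connected classes\<close>

definition pw :: "lfg_class list \<Rightarrow> hall"
  where "pw w = foldr (\<lambda>A f. hall_mult (single A 1) f) w hall_one"

lemma pw_simps [simp]: "pw [] = hall_one" "pw (A # w) = hall_mult (single A 1) (pw w)"
  by (simp_all add: pw_def)

text \<open>Passing from \<open>h/c\<close> back to \<open>h\<close> adds a component if
  \<open>c\<close> is one (\<open>cmh_quo_comp\<close>) and otherwise keeps their number
  (\<open>size_cmh_quo\<close>). So \<open>length w\<close> components are reached only by the
  disjoint union of the letters. Positivity, rather than being nonzero, is carried along so that the
  contributions of several copies of a letter cannot cancel.\<close>

lemma pw_triangular:
  assumes "\<And>A. A \<in> set w \<Longrightarrow> connected_class A" "lfgh h"
  shows "(lookup (pw w) (cls h) \<noteq> 0 \<longrightarrow> size (cmh h) < length w \<or> cmh h = mset w) \<and>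
    (cmh h = mset w \<longrightarrow> lookup (pw w) (cls h) > 0)"
  using assms
proof (induction w arbitrary: h)
  case Nil
  have "cmh h = {#} \<longleftrightarrow> cls h = cls hempty"
    using cmh_hempty cmh_cls lfgh_hempty Nil(2) cmh_inj[OF Nil(2) lfgh_hempty] cls_eq by metis
  then show ?case by (simp add: hall_one_def lookup_single when_def cls_hempty)
next
  case (Cons A w)
  have A: "connected_class A" using Cons.prems by simp
  note h = Cons.prems(2)
  have sum: "lookup (pw (A # w)) (cls h) = (\<Sum>c\<in>copies A h. lookup (pw w) (cls (quo h c)))"
    using lookup_mult_connected[OF h A] by simp
  have lq: "lfgh (quo h c)" if "c \<in> copies A h" for c
    using that lfgh_quo_sub[OF h] by (auto simp: copies_def csub_def)
  have IH: "lookup (pw w) (cls (quo h c)) \<noteq> 0 \<longrightarrow> size (cmh (quo h c)) < length w \<or> cmh (quo h c) = mset w"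
    "cmh (quo h c) = mset w \<longrightarrow> lookup (pw w) (cls (quo h c)) > 0" if "c \<in> copies A h" for c
    using Cons.IH[OF _ lq[OF that]] Cons.prems(1) by auto
  have comp: "cmh h = add_mset A (cmh (quo h c))" if "c \<in> copies A h" "ext c \<subseteq> ext h" for c
    using cmh_quo_comp[OF h csub_comps[OF h]] that by (auto simp: copies_def)
  have size: "size (cmh h) = size (cmh (quo h c))" if "c \<in> copies A h" "\<not> ext c \<subseteq> ext h" for c
    using size_cmh_quo[OF h] that by (auto simp: copies_def)
  show ?case
  proof (intro conjI impI)
    assume "lookup (pw (A # w)) (cls h) \<noteq> 0"
    then obtain c where c: "c \<in> copies A h" "lookup (pw w) (cls (quo h c)) \<noteq> 0"
      unfolding sum by (rule sum.not_neutral_contains_not_neutral)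
    then have *: "size (cmh (quo h c)) < length w \<or> cmh (quo h c) = mset w" using IH by blast
    show "size (cmh h) < length (A # w) \<or> cmh h = mset (A # w)"
    proof (cases "ext c \<subseteq> ext h")
      case True then show ?thesis using comp[OF c(1)] * by auto
    next
      case False then show ?thesis using size[OF c(1)] * by auto
    qed
  next
    assume eq: "cmh h = mset (A # w)"
    have nonneg: "lookup (pw w) (cls (quo h c)) \<ge> 0" if c: "c \<in> copies A h" for c
    proof (cases "ext c \<subseteq> ext h")
      case True
      then have "cmh (quo h c) = mset w" using comp[OF c] eq by simp
      then show ?thesis using IH(2)[OF c] by simp
    next
      case False
      \<comment> \<open>A copy that is not a component leaves one component too many for
        \<open>pw w\<close> to reach.\<close>
      then have "size (cmh (quo h c)) = Suc (length w)" using size[OF c] eq by simp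
      then have "\<not> (size (cmh (quo h c)) < length w \<or> cmh (quo h c) = mset w)" by auto
      then show ?thesis using IH(1)[OF c] by auto
    qed
    have "A \<in># cmh h" using eq by simp
    then obtain c where c: "c \<in> comps h" "cls c = A"
      using finite_comps[OF lfgh_cubic[OF h]] by (auto simp: cmh_def)
    then have cc: "c \<in> copies A h" "ext c \<subseteq> ext h" using comps_lfgh[OF h] by (auto simp: copies_def)
    then have "lookup (pw w) (cls (quo h c)) > 0" using comp IH(2) eq by simp
    then show "lookup (pw (A # w)) (cls h) > 0"
      unfolding sum using nonneg cc(1) finite_copies[OF lfgh_cubic[OF h]] by (intro sum_pos2) auto
  qed
qed

lemma pw_top:
  assumes "\<And>A. A \<in> set w \<Longrightarrow> connected_class A"
  shows "lookup (pw w) X \<noteq> 0 \<Longrightarrow> size (CM X) < length w \<or> CM X = mset w"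
    "CM X = mset w \<Longrightarrow> lookup (pw w) X > 0"
  using pw_triangular[OF assms rep(1), of w X] by (auto simp: CM_def rep(2))

definition words :: "hall set"
  where "words = pw ` {w. \<forall>A\<in>set w. connected_class A}"

text \<open>Solves a triangular system: the top term of \<open>pw w\<close> is a nonzero multiple of
  the class \<open>X\<close>, and all its other terms have fewer components.\<close>

lemma single_in_span_words: "single X 1 \<in> ratvec.span words"
proof (induction "size (CM X)" arbitrary: X rule: less_induct)
  case less
  obtain w where w: "mset w = CM X" using ex_mset by blast
  then have cw: "\<And>A. A \<in> set w \<Longrightarrow> connected_class A" using CM_connected by (metis set_mset_mset)
  let ?p = "pw w"
  have pos: "lookup ?p X > 0" using pw_top(2)[OF cw] w by simp
  have "?p = (\<Sum>Y\<in>keys ?p. lookup ?p Y *\<^sub>Q single Y 1)" by (rule poly_mapping_expand)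
  also have "\<dots> = lookup ?p X *\<^sub>Q single X 1 + (\<Sum>Y\<in>keys ?p - {X}. lookup ?p Y *\<^sub>Q single Y 1)"
    using pos by (intro sum.remove) (auto simp: in_keys_iff)
  finally have "?p - (\<Sum>Y\<in>keys ?p - {X}. lookup ?p Y *\<^sub>Q single Y 1) = lookup ?p X *\<^sub>Q single X 1"
    by (metis add_diff_cancel_right')
  then have eq: "single X (1::rat) = (1 / lookup ?p X) *\<^sub>Q (?p - (\<Sum>Y\<in>keys ?p - {X}. lookup ?p Y *\<^sub>Q single Y 1))"
    using pos by (simp add: scaleQ_scaleQ scaleQ_one)
  have "single Y 1 \<in> ratvec.span words" if Y: "Y \<in> keys ?p - {X}" for Y
  proof -
    have "size (CM Y) < length w \<or> CM Y = mset w" using pw_top(1)[OF cw] Y by (auto simp: in_keys_iff)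
    moreover have "CM Y \<noteq> mset w" using Y w CM_inj by auto
    ultimately have "size (CM Y) < size (CM X)" using w by (metis size_mset)
    then show ?thesis by (rule less)
  qed
  moreover have "?p \<in> words" using cw by (auto simp: words_def)
  ultimately show ?case
    unfolding eq by (intro ratvec.span_scale ratvec.span_diff ratvec.span_sum) (auto intro: ratvec.span_base)
qed

lemma span_words: "f \<in> ratvec.span words"
proof -
  have "(\<Sum>Y\<in>keys f. lookup f Y *\<^sub>Q single Y 1) \<in> ratvec.span words"
    by (intro ratvec.span_sum ratvec.span_scale single_in_span_words)
  then show ?thesis using poly_mapping_expand[of f] by simp
qed

text \<open>Reduces associativity and the right unit law to left multiplication by a connected
  class, where \<open>hall_assoc_connected\<close> is available.\<close>

lemma hall_word_induct [case_names one mult add scale zero]: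
  assumes "P hall_one" "\<And>A f. connected_class A \<Longrightarrow> P f \<Longrightarrow> P (hall_mult (single A 1) f)"
    "\<And>f g. P f \<Longrightarrow> P g \<Longrightarrow> P (f + g)" "\<And>r f. P f \<Longrightarrow> P (r *\<^sub>Q f)" "P 0"
  shows "P f"
proof -
  have "P (pw w)" if "\<forall>A\<in>set w. connected_class A" for w
    using that by (induction w) (use assms(1,2) in auto)
  then have w: "P f" if "f \<in> words" for f using that by (auto simp: words_def)
  from span_words[of f] show ?thesis
    by (induction rule: ratvec.span_induct_alt) (use w assms(3-5) in auto)
qed

lemma hall_zero: "hall_mult 0 g = 0" "hall_mult g 0 = 0"
  using hall_bilinear(3)[of 0 0 g] hall_bilinear(4)[of g 0 0] by simp_all

lemma hall_one_right: "hall_mult f hall_one = f"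
  by (induction f rule: hall_word_induct)
     (simp_all add: hall_one_left hall_assoc_connected hall_bilinear hall_zero)

lemma hall_assoc: "hall_mult (hall_mult f g) k = hall_mult f (hall_mult g k)"
  by (induction f rule: hall_word_induct)
     (simp_all add: hall_one_left hall_assoc_connected hall_bilinear hall_zero)

lemma hall_unital_algebra: "unital_algebra hall_mult hall_one"
  unfolding unital_algebra_def using qbilinear_hall hall_assoc hall_one_left hall_one_right by blast

text \<open>Here \<open>s\<close> chooses an order for each multiset and \<open>c\<close> a nonzero
  weight. Among the monomials in \<open>p\<close>, the class of a multiset of maximal size is hit by
  its own monomial only, so its coefficient must vanish.\<close>

lemma triangular_independent:
  fixes p :: "lfg_class multiset \<Rightarrow>\<^sub>0 rat"
  assumes keys: "\<And>M A. M \<in> keys p \<Longrightarrow> A \<in># M \<Longrightarrow> connected_class A"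
    and s: "\<And>M. mset (s M) = M" and c: "\<And>M. c M \<noteq> 0"
    and zero: "lin_ext (\<lambda>M. c M *\<^sub>Q pw (s M)) p = 0"
  shows "p = 0"
proof (rule ccontr)
  assume "p \<noteq> 0"
  then have ne: "keys p \<noteq> {}" by simp
  have "Max (size ` keys p) \<in> size ` keys p" using ne by (intro Max_in) auto
  then obtain M where M: "M \<in> keys p" "Max (size ` keys p) = size M" by blast
  have max: "size N \<le> size M" if "N \<in> keys p" for N
    using that Max_ge[of "size ` keys p" "size N"] by (simp add: M(2))
  note M = M(1)
  obtain X where X: "CM X = M" using CM_surj keys M by blast
  have cw: "A \<in> set (s N) \<Longrightarrow> connected_class A" if "N \<in> keys p" for N A
    using keys[OF that] s[of N] by (metis set_mset_mset)
  have other: "lookup (pw (s N)) X = 0" if N: "N \<in> keys p" "N \<noteq> M" for N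
  proof (rule ccontr)
    assume "lookup (pw (s N)) X \<noteq> 0"
    then have "size M < length (s N) \<or> M = mset (s N)" using pw_top(1)[OF cw[OF N(1)]] X by blast
    then show False using max[OF N(1)] N(2) s[of N] by (metis not_le size_mset)
  qed
  have "0 = lookup (lin_ext (\<lambda>M. c M *\<^sub>Q pw (s M)) p) X" by (simp add: zero)
  also have "\<dots> = (\<Sum>N\<in>keys p. lookup p N * (c N * lookup (pw (s N)) X))"
    by (simp add: lin_ext_def lookup_sum lookup_scaleQ scaleQ_rat_def mult.assoc)
  also have "\<dots> = lookup p M * (c M * lookup (pw (s M)) X)"
    using M other by (subst sum.remove[OF finite_keys M]) simp
  finally have "lookup p M * (c M * lookup (pw (s M)) X) = 0" by simp
  moreover have "lookup (pw (s M)) X > 0" using pw_top(2)[OF cw[OF M]] X s by simp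
  ultimately show False using M c by (simp add: in_keys_iff)
qed

section \<open>Tensor products and enveloping algebras\<close>

lemma qlinear_add_fun: "qlinear f \<Longrightarrow> qlinear g \<Longrightarrow> qlinear (\<lambda>x. f x + g x)"
  by (rule qlinearI) (simp_all add: qlinear_add qlinear_scale scaleQ_add_right add_ac)

lemma qlinear_diff_fun: "qlinear f \<Longrightarrow> qlinear g \<Longrightarrow> qlinear (\<lambda>x. f x - g x)"
  by (rule qlinearI) (simp_all add: qlinear_add qlinear_scale ratvec.scale_right_diff_distrib)

lemma qlinear_scale_fun: "qlinear f \<Longrightarrow> qlinear (\<lambda>x. r *\<^sub>Q f x)"
  by (rule qlinearI) (simp_all add: qlinear_add qlinear_scale scaleQ_add_right scaleQ_scaleQ mult.commute)

lemma qlinear_compose: "qlinear f \<Longrightarrow> qlinear g \<Longrightarrow> qlinear (\<lambda>x. f (g x))"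
  by (rule qlinearI) (simp_all add: qlinear_add qlinear_scale)

lemma qlinear_id: "qlinear (\<lambda>x. x)"
  by (rule qlinearI) simp_all

lemma qbilinearI:
  assumes "\<And>a b x. B (a + b) x = B a x + B b x" "\<And>a x y. B a (x + y) = B a x + B a y"
    "\<And>r a x. B (r *\<^sub>Q a) x = r *\<^sub>Q B a x" "\<And>r a x. B a (r *\<^sub>Q x) = r *\<^sub>Q B a x"
  shows "qbilinear B"
  unfolding qbilinear_def using assms by (auto intro!: qlinearI)

lemma qbilinearD:
  assumes "qbilinear B"
  shows "B (a + b) x = B a x + B b x" "B a (x + y) = B a x + B a y"
    "B (r *\<^sub>Q a) x = r *\<^sub>Q B a x" "B a (r *\<^sub>Q x) = r *\<^sub>Q B a x" "qlinear (B a)" "qlinear (\<lambda>a. B a x)"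
    "B (a - b) x = B a x - B b x" "B a (x - y) = B a x - B a y" "B 0 x = 0" "B a 0 = 0"
    "B (- a) x = - B a x" "B a (- x) = - B a x"
proof -
  have l: "qlinear (B a)" "qlinear (\<lambda>a. B a x)" for a x using assms by (auto simp: qbilinear_def)
  show "B (a + b) x = B a x + B b x" "B a (x + y) = B a x + B a y"
    "B (r *\<^sub>Q a) x = r *\<^sub>Q B a x" "B a (r *\<^sub>Q x) = r *\<^sub>Q B a x" "qlinear (B a)" "qlinear (\<lambda>a. B a x)"
    "B (a - b) x = B a x - B b x" "B a (x - y) = B a x - B a y" "B 0 x = 0" "B a 0 = 0"
    using l qlinear_add[OF l(1)] qlinear_add[OF l(2)] qlinear_scale[OF l(1)] qlinear_scale[OF l(2)]
      qlinear_diff[OF l(1)] qlinear_diff[OF l(2)] qlinear_zero[OF l(1)] qlinear_zero[OF l(2)] by auto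
  show "B (- a) x = - B a x" "B a (- x) = - B a x"
    using qlinear_diff[OF l(2), of 0 a x] qlinear_zero[OF l(2)] qlinear_diff[OF l(1), of a 0 x] qlinear_zero[OF l(1)]
    by simp_all
qed

lemma tens_add_left: "(a + a') \<otimes> b = a \<otimes> b + a' \<otimes> b"
  unfolding tens.abs_eq plus_tensor.abs_eq tensor.abs_eq_iff tensor_rel_def
  using ratvec.span_base[OF tensor_relations.intros(1)[of a a' b]] by (simp add: diff_diff_eq)

lemma tens_add_right: "a \<otimes> (b + b') = a \<otimes> b + a \<otimes> b'"
  unfolding tens.abs_eq plus_tensor.abs_eq tensor.abs_eq_iff tensor_rel_def
  using ratvec.span_base[OF tensor_relations.intros(2)[of a b b']] by (simp add: diff_diff_eq)

lemma scaleQ_single: "r *\<^sub>Q single k (c::rat) = single k (r * c)"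
  by (rule poly_mapping_eqI) (simp add: lookup_scaleQ scaleQ_rat_def lookup_single when_def)

lemma tens_scale_left: "(r *\<^sub>Q a) \<otimes> b = r *\<^sub>Q (a \<otimes> b)"
  unfolding tens.abs_eq scaleQ_tensor.abs_eq tensor.abs_eq_iff tensor_rel_def scaleQ_single
  using ratvec.span_base[OF tensor_relations.intros(3)[of r a b]] by simp

lemma tens_scale_right: "a \<otimes> (r *\<^sub>Q b) = r *\<^sub>Q (a \<otimes> b)"
  unfolding tens.abs_eq scaleQ_tensor.abs_eq tensor.abs_eq_iff tensor_rel_def scaleQ_single
  using ratvec.span_base[OF tensor_relations.intros(4)[of a r b]] by simp

lemma qbilinear_tens: "qbilinear tens"
  by (rule qbilinearI) (rule tens_add_left tens_add_right tens_scale_left tens_scale_right)+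

lemmas tens_simps = qbilinearD[OF qbilinear_tens]

lemma qlinear_abs_tensor: "qlinear abs_tensor"
  by (rule qlinearI) (simp_all add: plus_tensor.abs_eq scaleQ_tensor.abs_eq)

text \<open>Pure tensors span, and 0 is one of them.\<close>

lemma tensor_induct [case_names tens add scale]:
  assumes "\<And>a b. P (a \<otimes> b)" "\<And>s t. P s \<Longrightarrow> P t \<Longrightarrow> P (s + t)" "\<And>r t. P t \<Longrightarrow> P (r *\<^sub>Q t)"
  shows "P t"
proof -
  have zero: "P 0" using assms(1)[of 0 0] by (simp add: tens_simps)
  obtain p where t: "t = abs_tensor p" by (metis Quotient3_abs_rep[OF Quotient3_tensor])
  have "t = (\<Sum>k\<in>keys p. lookup p k *\<^sub>Q abs_tensor (single k 1))"
    unfolding t by (subst poly_mapping_expand)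
      (simp add: qlinear_sum[OF qlinear_abs_tensor] qlinear_scale[OF qlinear_abs_tensor])
  moreover have "P (abs_tensor (single k 1))" for k
    using assms(1)[of "fst k" "snd k"] by (simp add: tens.abs_eq)
  moreover have "P (\<Sum>k\<in>K. lookup p k *\<^sub>Q abs_tensor (single k 1))" for K
    by (induction K rule: infinite_finite_induct) (use zero assms(2,3) calculation(2) in auto)
  ultimately show ?thesis by simp
qed

lemma tensor_eqI:
  assumes "qlinear F" "qlinear G" "\<And>a b. F (a \<otimes> b) = G (a \<otimes> b)"
  shows "F t = G t"
  by (induction t rule: tensor_induct)
     (simp_all add: assms(3) qlinear_add[OF assms(1)] qlinear_add[OF assms(2)]
       qlinear_scale[OF assms(1)] qlinear_scale[OF assms(2)])

lemma qbilinear_tens_map: "qlinear f \<Longrightarrow> qlinear g \<Longrightarrow> qbilinear (\<lambda>a b. f a \<otimes> g b)"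
  by (rule qbilinearI) (simp_all add: qlinear_add qlinear_scale tens_simps)

lemma tensor_map_tens: "qlinear f \<Longrightarrow> qlinear g \<Longrightarrow> tensor_map f g (a \<otimes> b) = f a \<otimes> g b"
  unfolding tensor_map_def by (rule tensor_lift_tens[OF qbilinear_tens_map])

lemma qlinear_tensor_map: "qlinear f \<Longrightarrow> qlinear g \<Longrightarrow> qlinear (tensor_map f g)"
  unfolding tensor_map_def by (rule qlinear_tensor_lift[OF qbilinear_tens_map])

lemma qbilinear_inner:
  assumes "qbilinear B"
  shows "qbilinear (\<lambda>a b. a \<otimes> B b x)"
  using qbilinearD[OF assms] by (auto intro!: qbilinearI simp: tens_simps)

lemma qbilinear_assoc: "qbilinear (\<lambda>s c. tensor_lift (\<lambda>a b. a \<otimes> (b \<otimes> c)) s)"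
proof -
  have b: "qbilinear (\<lambda>a b. a \<otimes> (b \<otimes> c))" for c by (rule qbilinear_inner[OF qbilinear_tens])
  note l = qlinear_tensor_lift[OF b] and t = tensor_lift_tens[OF b]
  have add: "tensor_lift (\<lambda>a b. a \<otimes> (b \<otimes> (c + d))) s = tensor_lift (\<lambda>a b. a \<otimes> (b \<otimes> c)) s + tensor_lift (\<lambda>a b. a \<otimes> (b \<otimes> d)) s" for s c d
    by (rule tensor_eqI[OF l qlinear_add_fun[OF l l]]) (simp only: t, simp add: tens_simps)
  have scale: "tensor_lift (\<lambda>a b. a \<otimes> (b \<otimes> (r *\<^sub>Q c))) s = r *\<^sub>Q tensor_lift (\<lambda>a b. a \<otimes> (b \<otimes> c)) s" for s c r
    by (rule tensor_eqI[OF l qlinear_scale_fun[OF l]]) (simp only: t, simp add: tens_simps)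
  show ?thesis by (rule qbilinearI) (simp_all add: qlinear_add[OF l] qlinear_scale[OF l] add scale)
qed

lemma tensor_assoc_tens: "tensor_assoc ((a \<otimes> b) \<otimes> c) = a \<otimes> (b \<otimes> c)"
  unfolding tensor_assoc_def tensor_lift_tens[OF qbilinear_assoc]
  by (rule tensor_lift_tens[OF qbilinear_inner[OF qbilinear_tens]])

lemma qlinear_tensor_assoc: "qlinear tensor_assoc"
  unfolding tensor_assoc_def by (rule qlinear_tensor_lift[OF qbilinear_assoc])

context
  fixes m :: "'a::rat_vector \<Rightarrow> 'a \<Rightarrow> 'a" assumes m: "qbilinear m"
begin

lemmas m_simps = qbilinearD[OF m]

lemma qbilinear_mult_inner: "qbilinear (\<lambda>c d. m a c \<otimes> m b d)"
  by (rule qbilinear_tens_map[OF m_simps(5) m_simps(5)])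

lemma qbilinear_mult_outer: "qbilinear (\<lambda>a b. tensor_lift (\<lambda>c d. m a c \<otimes> m b d) t)"
proof -
  note l = qlinear_tensor_lift[OF qbilinear_mult_inner] and t = tensor_lift_tens[OF qbilinear_mult_inner]
  show ?thesis
  proof (rule qbilinearI)
    show "tensor_lift (\<lambda>c d. m (a + a') c \<otimes> m b d) t = tensor_lift (\<lambda>c d. m a c \<otimes> m b d) t + tensor_lift (\<lambda>c d. m a' c \<otimes> m b d) t" for a a' b
      by (rule tensor_eqI[OF l qlinear_add_fun[OF l l]]) (simp only: t, simp add: tens_simps m_simps)
    show "tensor_lift (\<lambda>c d. m a c \<otimes> m (b + b') d) t = tensor_lift (\<lambda>c d. m a c \<otimes> m b d) t + tensor_lift (\<lambda>c d. m a c \<otimes> m b' d) t" for a b b'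
      by (rule tensor_eqI[OF l qlinear_add_fun[OF l l]]) (simp only: t, simp add: tens_simps m_simps)
    show "tensor_lift (\<lambda>c d. m (r *\<^sub>Q a) c \<otimes> m b d) t = r *\<^sub>Q tensor_lift (\<lambda>c d. m a c \<otimes> m b d) t" for a b r
      by (rule tensor_eqI[OF l qlinear_scale_fun[OF l]]) (simp only: t, simp add: tens_simps m_simps)
    show "tensor_lift (\<lambda>c d. m a c \<otimes> m (r *\<^sub>Q b) d) t = r *\<^sub>Q tensor_lift (\<lambda>c d. m a c \<otimes> m b d) t" for a b r
      by (rule tensor_eqI[OF l qlinear_scale_fun[OF l]]) (simp only: t, simp add: tens_simps m_simps)
  qed
qed

lemma tensor_mult_tens: "tensor_mult m (a \<otimes> b) (c \<otimes> d) = m a c \<otimes> m b d"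
  unfolding tensor_mult_def tensor_lift_tens[OF qbilinear_mult_outer] by (rule tensor_lift_tens[OF qbilinear_mult_inner])

text \<open>The outer lift is over the first argument, so linearity there is immediate; linearity in
  the second argument follows by induction on the first.\<close>

lemma qbilinear_tensor_mult: "qbilinear (tensor_mult m)"
proof -
  have l1: "qlinear (\<lambda>s. tensor_mult m s t)" for t
    unfolding tensor_mult_def by (rule qlinear_tensor_lift[OF qbilinear_mult_outer])
  note l = qlinear_tensor_lift[OF qbilinear_mult_inner]
  have l2: "qlinear (tensor_mult m s)" for s
  proof (induction s rule: tensor_induct)
    case (tens a b)
    show ?case unfolding tensor_mult_def tensor_lift_tens[OF qbilinear_mult_outer] by (rule l)
  next
    case (add s t)
    then show ?case using qlinear_add_fun[OF add] qlinear_add[OF l1] by (simp add: fun_eq_iff)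
  next
    case (scale r t)
    then show ?case using qlinear_scale_fun[OF scale] qlinear_scale[OF l1] by simp
  qed
  show ?thesis unfolding qbilinear_def using l1 l2 by blast
qed

end

lemma tensor_unital_algebra:
  assumes "unital_algebra m e"
  shows "unital_algebra (tensor_mult m) (e \<otimes> e)"
proof -
  have m: "qbilinear m" and assoc: "\<And>x y z. m (m x y) z = m x (m y z)" and e: "\<And>x. m e x = x" "\<And>x. m x e = x"
    using assms by (auto simp: unital_algebra_def)
  note B = qbilinearD[OF qbilinear_tensor_mult[OF m]] and t = tensor_mult_tens[OF m]
  have "tensor_mult m (tensor_mult m x y) z = tensor_mult m x (tensor_mult m y z)" for x y z
  proof (induction x rule: tensor_induct)
    case (tens a b)
    show ?case
    proof (induction y rule: tensor_induct)
      case (tens c d)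
      show ?case by (induction z rule: tensor_induct) (simp_all add: t B assoc)
    qed (simp_all add: B)
  qed (simp_all add: B)
  moreover have "tensor_mult m (e \<otimes> e) x = x" "tensor_mult m x (e \<otimes> e) = x" for x
    by (induction x rule: tensor_induct) (simp_all add: t B e)
  ultimately show ?thesis unfolding unital_algebra_def using qbilinear_tensor_mult[OF m] by blast
qed

section \<open>The Hopf structure of an enveloping algebra\<close>

lemma uea_bilinear: "qbilinear (uea_mult :: 'g::lie_bracket uea \<Rightarrow> _)"
proof -
  have ex: "\<exists>p. u = abs_uea p" for u :: "'g uea" by (metis Quotient3_abs_rep[OF Quotient3_uea])
  show ?thesis
  proof (rule qbilinearI)
    fix a b c :: "'g uea" and r
    obtain p q s where abc: "a = abs_uea p" "b = abs_uea q" "c = abs_uea s" using ex by metis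
    note rules = uea_mult.abs_eq plus_uea.abs_eq scaleQ_uea.abs_eq free_mult_add_left free_mult_add_right
      free_mult_scale_left free_mult_scale_right
    show "uea_mult (a + b) c = uea_mult a c + uea_mult b c" "uea_mult a (b + c) = uea_mult a b + uea_mult a c"
      "uea_mult (r *\<^sub>Q a) b = r *\<^sub>Q uea_mult a b" "uea_mult a (r *\<^sub>Q b) = r *\<^sub>Q uea_mult a b"
      by (simp_all add: abc rules)
  qed
qed

lemma free_mult_one: "free_mult (single [] 1) p = p" "free_mult p (single [] 1) = p"
  by (rule qlinear_eq_on_basis[where f = "free_mult (single [] 1)" and g = "\<lambda>p. p"]
      qlinear_eq_on_basis[where f = "\<lambda>p. free_mult p (single [] 1)" and g = "\<lambda>p. p"];
      (rule qlinearI)?; simp add: free_mult_add_right free_mult_add_left free_mult_scale_right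
        free_mult_scale_left free_mult_single)+

lemma uea_unital_algebra: "unital_algebra (uea_mult :: 'g::lie_bracket uea \<Rightarrow> _) uea_one"
proof -
  have ex: "\<exists>p. u = abs_uea p" for u :: "'g uea" by (metis Quotient3_abs_rep[OF Quotient3_uea])
  have "uea_mult (uea_mult x y) z = uea_mult x (uea_mult y z)" for x y z :: "'g uea"
  proof -
    obtain p q s where "x = abs_uea p" "y = abs_uea q" "z = abs_uea s" using ex by metis
    then show ?thesis by (simp add: uea_mult.abs_eq free_mult_assoc)
  qed
  moreover have "uea_mult uea_one x = x \<and> uea_mult x uea_one = x" for x :: "'g uea"
  proof -
    obtain p where "x = abs_uea p" using ex by metis
    then show ?thesis by (simp add: uea_one.abs_eq uea_mult.abs_eq free_mult_one)
  qed
  ultimately show ?thesis unfolding unital_algebra_def using uea_bilinear by blast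
qed

lemmas uea_assoc = uea_unital_algebra[unfolded unital_algebra_def, THEN conjunct2, THEN conjunct1, rule_format]
lemmas uea_one_mult = uea_unital_algebra[unfolded unital_algebra_def, THEN conjunct2, THEN conjunct2, rule_format,
  THEN conjunct1] uea_unital_algebra[unfolded unital_algebra_def, THEN conjunct2, THEN conjunct2, rule_format,
  THEN conjunct2]
lemmas uea_simps = qbilinearD[OF uea_bilinear]

lemma uea_relation: "r \<in> uea_relations \<Longrightarrow> r \<in> uea_ideal"
  unfolding uea_ideal_def
  by (intro ratvec.span_base CollectI exI[of _ "single [] 1"] exI[of _ r] conjI) (simp_all add: free_mult_one)

lemma uea_incl_linear: "qlinear (uea_incl :: 'g::lie_bracket \<Rightarrow> _)"
proof (rule qlinearI)
  fix x y :: 'g and r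
  show "uea_incl (x + y) = uea_incl x + uea_incl y"
    unfolding uea_incl.abs_eq plus_uea.abs_eq uea.abs_eq_iff uea_rel_def
    using uea_relation[OF uea_relations.intros(1)[of x y]] by (simp add: diff_diff_eq)
  show "uea_incl (r *\<^sub>Q x) = r *\<^sub>Q uea_incl x"
    unfolding uea_incl.abs_eq scaleQ_uea.abs_eq uea.abs_eq_iff uea_rel_def scaleQ_single
    using uea_relation[OF uea_relations.intros(2)[of r x]] by simp
qed

lemma uea_incl_bracket:
  "uea_incl (lie_bracket x y) = uea_mult (uea_incl x) (uea_incl y) - uea_mult (uea_incl y) (uea_incl x)"
proof -
  have "single [x, y] 1 - single [y, x] 1 - single [lie_bracket x y] (1::rat) \<in> uea_ideal"
    by (rule uea_relation) (rule uea_relations.intros(3))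
  then have "abs_uea (single [x, y] 1 - single [y, x] 1) = abs_uea (single [lie_bracket x y] 1)"
    unfolding uea.abs_eq_iff uea_rel_def .
  then show ?thesis
    by (simp add: uea_incl.abs_eq uea_mult.abs_eq minus_uea.abs_eq free_mult_single)
qed

lemma uea_word: "abs_uea (single (x # w) 1) = uea_mult (uea_incl x) (abs_uea (single w 1))"
  by (simp add: uea_incl.abs_eq uea_mult.abs_eq free_mult_single)

lemma qlinear_abs_uea: "qlinear abs_uea"
  by (rule qlinearI) (simp_all add: plus_uea.abs_eq scaleQ_uea.abs_eq)

text \<open>Words span the enveloping algebra and are built by left multiplication with letters; 0
  is a multiple of the unit.\<close>

lemma uea_induct [case_names one mult add scale]:
  assumes "P uea_one" "\<And>x u. P u \<Longrightarrow> P (uea_mult (uea_incl x) u)" "\<And>u v. P u \<Longrightarrow> P v \<Longrightarrow> P (u + v)"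
    "\<And>r u. P u \<Longrightarrow> P (r *\<^sub>Q u)"
  shows "P (u :: 'g::lie_bracket uea)"
proof -
  have zero: "P 0" using assms(4)[OF assms(1), of 0] by simp
  have word: "P (abs_uea (single w 1))" for w
    by (induction w) (use assms(1,2) in \<open>simp_all add: uea_word flip: uea_one.abs_eq\<close>)
  obtain p where u: "u = abs_uea p" by (metis Quotient3_abs_rep[OF Quotient3_uea])
  have "u = (\<Sum>k\<in>keys p. lookup p k *\<^sub>Q abs_uea (single k 1))"
    unfolding u by (subst poly_mapping_expand)
      (simp add: qlinear_sum[OF qlinear_abs_uea] qlinear_scale[OF qlinear_abs_uea])
  moreover have "P (\<Sum>k\<in>K. lookup p k *\<^sub>Q abs_uea (single k 1))" for K
    by (induction K rule: infinite_finite_induct) (use zero assms(3,4) word in auto)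
  ultimately show ?thesis by simp
qed

abbreviation primitive :: "'g::lie_bracket \<Rightarrow> 'g uea \<otimes>\<^sub>Q 'g uea"
  where "primitive x \<equiv> uea_incl x \<otimes> uea_one + uea_one \<otimes> uea_incl x"

lemma qlinear_primitive: "qlinear primitive"
  by (rule qlinearI) (simp_all add: qlinear_add[OF uea_incl_linear] qlinear_scale[OF uea_incl_linear]
      tens_simps scaleQ_add_right add_ac)

lemmas tmult_simps = qbilinearD[OF qbilinear_tensor_mult[OF uea_bilinear]] tensor_mult_tens[OF uea_bilinear]

text \<open>The mixed terms of the two products cancel in the commutator. This is the condition that
  makes \<open>uea_comult\<close> a well-defined lift.\<close>

lemma primitive_bracket: "primitive (lie_bracket x y)
    = tensor_mult uea_mult (primitive x) (primitive y) - tensor_mult uea_mult (primitive y) (primitive x)"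
  by (simp add: tmult_simps uea_one_mult uea_incl_bracket tens_simps)

lemmas uea_comult_simps = uea_lift[OF tensor_unital_algebra[OF uea_unital_algebra] qlinear_primitive primitive_bracket,
  folded uea_comult_def]

lemma rat_unital_algebra: "unital_algebra (*) (1::rat)"
  unfolding unital_algebra_def by (auto intro!: qbilinearI simp: scaleQ_rat_def algebra_simps)

lemma qlinear_zero_fun: "qlinear (\<lambda>_. 0)"
  by (rule qlinearI) simp_all

lemma uea_counit_simps:
  "qlinear uea_counit" "uea_counit (uea_mult u v) = uea_counit u * uea_counit v"
  "uea_counit uea_one = 1" "uea_counit (uea_incl x) = 0"
  unfolding uea_counit_def by (subst uea_lift[OF rat_unital_algebra qlinear_zero_fun]; simp)+

lemma uea_comult_primitive_mult: "uea_comult (uea_mult (uea_incl x) u) = tensor_mult uea_mult (primitive x) (uea_comult u)"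
  by (simp add: uea_comult_simps)

lemma primitive_mult_tens: "tensor_mult uea_mult (primitive x) (a \<otimes> b)
    = uea_mult (uea_incl x) a \<otimes> b + a \<otimes> uea_mult (uea_incl x) b"
  by (simp add: tmult_simps uea_one_mult)

text \<open>Both sides turn left multiplication by \<open>x\<close> into the same operator on the
  triple tensor product, so the equation passes from \<open>u\<close> to the product of
  \<open>x\<close> and \<open>u\<close>.\<close>

lemma uea_coassoc:
  "tensor_assoc (tensor_map uea_comult id (uea_comult u)) = tensor_map id uea_comult (uea_comult u)"
proof (induction u rule: uea_induct)
  note D = uea_comult_simps(1)
  have idl: "qlinear id" using qlinear_id by (simp add: id_def)
  note T1 = tensor_map_tens[OF D idl] and T2 = tensor_map_tens[OF idl D]
  note l1 = qlinear_tensor_map[OF D idl] and l2 = qlinear_tensor_map[OF idl D] and la = qlinear_tensor_assoc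
  case one
  show ?case by (simp only: uea_comult_simps(3) T1 T2 tensor_assoc_tens) simp
next
  note D = uea_comult_simps(1)
  have idl: "qlinear id" using qlinear_id by (simp add: id_def)
  note T1 = tensor_map_tens[OF D idl] and T2 = tensor_map_tens[OF idl D]
  note l1 = qlinear_tensor_map[OF D idl] and l2 = qlinear_tensor_map[OF idl D] and la = qlinear_tensor_assoc
  case (mult x u)
  let ?x = "uea_mult (uea_incl x)"
  let ?L = "tensor_mult uea_mult (primitive x)"
  \<comment> \<open>The action of \<open>x\<close> on a triple tensor product, with one summand for
    each factor.\<close>
  let ?M = "\<lambda>t. tensor_map ?x id t + tensor_map id ?L t"
  have lx: "qlinear ?x" by (rule uea_simps(5))
  have lL: "qlinear ?L" by (rule tmult_simps(5))
  have lM: "qlinear ?M" by (rule qlinear_add_fun[OF qlinear_tensor_map[OF lx idl] qlinear_tensor_map[OF idl lL]])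
  have M: "?M (a \<otimes> t) = ?x a \<otimes> t + a \<otimes> ?L t" for a t
    by (simp add: tensor_map_tens[OF lx idl] tensor_map_tens[OF idl lL])
  have A: "tensor_assoc (?L s \<otimes> b + s \<otimes> ?x b) = ?M (tensor_assoc (s \<otimes> b))" for s b
  proof (rule tensor_eqI[where F = "\<lambda>s. tensor_assoc (?L s \<otimes> b + s \<otimes> ?x b)" and G = "\<lambda>s. ?M (tensor_assoc (s \<otimes> b))"])
    show "qlinear (\<lambda>s. tensor_assoc (?L s \<otimes> b + s \<otimes> ?x b))"
      by (intro qlinear_compose[OF la] qlinear_add_fun qlinear_compose[OF tens_simps(6) lL] tens_simps(6))
    show "qlinear (\<lambda>s. ?M (tensor_assoc (s \<otimes> b)))"
      by (rule qlinear_compose[OF lM qlinear_compose[OF la tens_simps(6)]])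
    fix p q
    have "?M (p \<otimes> (q \<otimes> b)) = ?x p \<otimes> (q \<otimes> b) + p \<otimes> (?x q \<otimes> b + q \<otimes> ?x b)"
      unfolding M primitive_mult_tens ..
    moreover have "tensor_assoc (?L (p \<otimes> q) \<otimes> b + (p \<otimes> q) \<otimes> ?x b)
        = ?x p \<otimes> (q \<otimes> b) + p \<otimes> (?x q \<otimes> b) + p \<otimes> (q \<otimes> ?x b)"
      unfolding primitive_mult_tens tens_simps(1) qlinear_add[OF la] tensor_assoc_tens ..
    ultimately show "tensor_assoc (?L (p \<otimes> q) \<otimes> b + (p \<otimes> q) \<otimes> ?x b) = ?M (tensor_assoc ((p \<otimes> q) \<otimes> b))"
      unfolding tensor_assoc_tens by (simp add: tens_simps(2) add.assoc)
  qed
  have F1: "tensor_assoc (tensor_map uea_comult id (?L t)) = ?M (tensor_assoc (tensor_map uea_comult id t))" for t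
  proof (rule tensor_eqI[where F = "\<lambda>t. tensor_assoc (tensor_map uea_comult id (?L t))"
        and G = "\<lambda>t. ?M (tensor_assoc (tensor_map uea_comult id t))"])
    show "qlinear (\<lambda>t. tensor_assoc (tensor_map uea_comult id (?L t)))"
      by (rule qlinear_compose[OF la qlinear_compose[OF l1 lL]])
    show "qlinear (\<lambda>t. ?M (tensor_assoc (tensor_map uea_comult id t)))"
      by (rule qlinear_compose[OF lM qlinear_compose[OF la l1]])
    show "tensor_assoc (tensor_map uea_comult id (?L (a \<otimes> b))) = ?M (tensor_assoc (tensor_map uea_comult id (a \<otimes> b)))" for a b
      unfolding primitive_mult_tens qlinear_add[OF l1] T1 uea_comult_primitive_mult id_apply A ..
  qed
  have F2: "tensor_map id uea_comult (?L t) = ?M (tensor_map id uea_comult t)" for t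
  proof (rule tensor_eqI[where F = "\<lambda>t. tensor_map id uea_comult (?L t)" and G = "\<lambda>t. ?M (tensor_map id uea_comult t)"])
    show "qlinear (\<lambda>t. tensor_map id uea_comult (?L t))" by (rule qlinear_compose[OF l2 lL])
    show "qlinear (\<lambda>t. ?M (tensor_map id uea_comult t))" by (rule qlinear_compose[OF lM l2])
    show "tensor_map id uea_comult (?L (a \<otimes> b)) = ?M (tensor_map id uea_comult (a \<otimes> b))" for a b
      unfolding primitive_mult_tens qlinear_add[OF l2] T2 uea_comult_primitive_mult id_apply M ..
  qed
  show ?case unfolding uea_comult_primitive_mult F1 F2 mult.IH ..
next
  note D = uea_comult_simps(1)
  have idl: "qlinear id" using qlinear_id by (simp add: id_def)
  note l1 = qlinear_tensor_map[OF D idl] and l2 = qlinear_tensor_map[OF idl D] and la = qlinear_tensor_assoc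
  {
    case (add u v)
    then show ?case by (simp only: qlinear_add[OF D] qlinear_add[OF l1] qlinear_add[OF l2] qlinear_add[OF la])
  next
    case (scale r u)
    then show ?case by (simp only: qlinear_scale[OF D] qlinear_scale[OF l1] qlinear_scale[OF l2] qlinear_scale[OF la])
  }
qed

lemma uea_counital:
  "tensor_lift (\<lambda>a b. uea_counit a *\<^sub>Q b) (uea_comult u) = u"
  "tensor_lift (\<lambda>a b. uea_counit b *\<^sub>Q a) (uea_comult u) = (u :: 'g::lie_bracket uea)"
proof -
  note D = uea_comult_simps and c = uea_counit_simps
  have b1: "qbilinear (\<lambda>a b :: 'g uea. uea_counit a *\<^sub>Q b)"
    by (rule qbilinearI) (simp_all add: qlinear_add[OF c(1)] qlinear_scale[OF c(1)] scaleQ_add_left scaleQ_add_right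
        scaleQ_scaleQ scaleQ_rat_def mult.commute)
  have b2: "qbilinear (\<lambda>a b :: 'g uea. uea_counit b *\<^sub>Q a)"
    by (rule qbilinearI) (simp_all add: qlinear_add[OF c(1)] qlinear_scale[OF c(1)] scaleQ_add_left scaleQ_add_right
        scaleQ_scaleQ scaleQ_rat_def mult.commute)
  note l1 = qlinear_tensor_lift[OF b1] and l2 = qlinear_tensor_lift[OF b2]
  note t1 = tensor_lift_tens[OF b1] and t2 = tensor_lift_tens[OF b2]
  show "tensor_lift (\<lambda>a b. uea_counit a *\<^sub>Q b) (uea_comult u) = u"
  proof (induction u rule: uea_induct)
    case (mult x u)
    have "tensor_lift (\<lambda>a b. uea_counit a *\<^sub>Q b) (tensor_mult uea_mult (primitive x) t)
        = uea_mult (uea_incl x) (tensor_lift (\<lambda>a b. uea_counit a *\<^sub>Q b) t)" for t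
      by (rule tensor_eqI[OF qlinear_compose[OF l1 tmult_simps(5)] qlinear_compose[OF uea_simps(5) l1]])
         (simp only: primitive_mult_tens qlinear_add[OF l1] t1, simp add: c uea_simps)
    then show ?case by (simp only: uea_comult_primitive_mult mult)
  qed (simp_all add: D(3) t1 c scaleQ_one qlinear_add[OF D(1)] qlinear_add[OF l1] qlinear_scale[OF D(1)] qlinear_scale[OF l1])
  show "tensor_lift (\<lambda>a b. uea_counit b *\<^sub>Q a) (uea_comult u) = u"
  proof (induction u rule: uea_induct)
    case (mult x u)
    have "tensor_lift (\<lambda>a b. uea_counit b *\<^sub>Q a) (tensor_mult uea_mult (primitive x) t)
        = uea_mult (uea_incl x) (tensor_lift (\<lambda>a b. uea_counit b *\<^sub>Q a) t)" for t
      by (rule tensor_eqI[OF qlinear_compose[OF l2 tmult_simps(5)] qlinear_compose[OF uea_simps(5) l2]])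
         (simp only: primitive_mult_tens qlinear_add[OF l2] t2, simp add: c uea_simps)
    then show ?case by (simp only: uea_comult_primitive_mult mult)
  qed (simp_all add: D(3) t2 c scaleQ_one qlinear_add[OF D(1)] qlinear_add[OF l2] qlinear_scale[OF D(1)] qlinear_scale[OF l2])
qed

text \<open>The lift of \<open>- x\<close> into the opposite algebra. For a word beginning with
  \<open>x\<close>, the left identity cancels term by term, while the right one produces the
  commutator of \<open>x\<close> with a multiple of the unit.\<close>

lemma uea_antipode: "\<exists>S. antipode uea_mult uea_one uea_comult uea_counit (S :: 'g::lie_bracket uea \<Rightarrow> _)"
proof -
  let ?op = "\<lambda>x y :: 'g uea. uea_mult y x"
  have alg: "unital_algebra ?op uea_one"
    unfolding unital_algebra_def
    by (intro conjI allI qbilinearI; simp add: uea_simps uea_one_mult uea_assoc)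
  have lin: "qlinear (\<lambda>x :: 'g. - uea_incl x)"
    using qlinear_diff_fun[OF qlinear_zero_fun uea_incl_linear] by simp
  have lie: "- uea_incl (lie_bracket x y) = ?op (- uea_incl x) (- uea_incl y) - ?op (- uea_incl y) (- uea_incl x)" for x y :: 'g
    by (simp add: uea_incl_bracket uea_simps)
  define S where "S = uea_lift ?op uea_one (\<lambda>x. - uea_incl x)"
  note S = uea_lift[OF alg lin lie, folded S_def]
  note D = uea_comult_simps and c = uea_counit_simps
  have b1: "qbilinear (\<lambda>a b. uea_mult (S a) b)" and b2: "qbilinear (\<lambda>a b. uea_mult a (S b))"
    by (rule qbilinearI; simp add: qlinear_add[OF S(1)] qlinear_scale[OF S(1)] uea_simps)+
  note l1 = qlinear_tensor_lift[OF b1] and l2 = qlinear_tensor_lift[OF b2]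
  note t1 = tensor_lift_tens[OF b1] and t2 = tensor_lift_tens[OF b2]
  have cx: "uea_counit (uea_mult (uea_incl x) u) = 0" for x :: 'g and u by (simp add: c)
  have "tensor_lift (\<lambda>a b. uea_mult (S a) b) (uea_comult u) = uea_counit u *\<^sub>Q uea_one" for u
  proof (induction u rule: uea_induct)
    case (mult x u)
    have "tensor_lift (\<lambda>a b. uea_mult (S a) b) (tensor_mult uea_mult (primitive x) t) = 0" for t
      by (rule tensor_eqI[OF qlinear_compose[OF l1 tmult_simps(5)] qlinear_zero_fun])
         (simp only: primitive_mult_tens qlinear_add[OF l1] t1 S(2,4), simp add: uea_simps uea_assoc)
    then show ?case by (simp only: uea_comult_primitive_mult cx ratvec.scale_zero_left)
  qed (simp_all add: D(3) t1 c S uea_one_mult scaleQ_one qlinear_add[OF D(1)] qlinear_add[OF l1] qlinear_scale[OF D(1)]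
      qlinear_scale[OF l1] qlinear_add[OF c(1)] qlinear_scale[OF c(1)] scaleQ_add_left scaleQ_scaleQ scaleQ_rat_def)
  moreover have "tensor_lift (\<lambda>a b. uea_mult a (S b)) (uea_comult u) = uea_counit u *\<^sub>Q uea_one" for u
  proof (induction u rule: uea_induct)
    case (mult x u)
    let ?x = "uea_incl x"
    have "tensor_lift (\<lambda>a b. uea_mult a (S b)) (tensor_mult uea_mult (primitive x) t)
      = uea_mult ?x (tensor_lift (\<lambda>a b. uea_mult a (S b)) t) - uea_mult (tensor_lift (\<lambda>a b. uea_mult a (S b)) t) ?x" for t
      by (rule tensor_eqI[OF qlinear_compose[OF l2 tmult_simps(5)]
            qlinear_diff_fun[OF qlinear_compose[OF uea_simps(5) l2] qlinear_compose[OF uea_simps(6) l2]]])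
         (simp only: primitive_mult_tens qlinear_add[OF l2] t2 S(2,4), simp add: uea_simps uea_assoc)
    then show ?case by (simp only: uea_comult_primitive_mult mult cx) (simp add: uea_simps uea_one_mult)
  qed (simp_all add: D(3) t2 c S uea_one_mult scaleQ_one qlinear_add[OF D(1)] qlinear_add[OF l2] qlinear_scale[OF D(1)]
      qlinear_scale[OF l2] qlinear_add[OF c(1)] qlinear_scale[OF c(1)] scaleQ_add_left scaleQ_scaleQ scaleQ_rat_def)
  ultimately show ?thesis unfolding antipode_def using S(1) by (intro exI[of _ S]) blast
qed

lemma uea_hopf_algebra: "hopf_algebra (uea_mult :: 'g::lie_bracket uea \<Rightarrow> _) uea_one uea_comult uea_counit"
  unfolding hopf_algebra_def bialgebra_def counital_coalgebra_def
  using uea_unital_algebra uea_comult_simps(1,2,3) uea_counit_simps(1,2,3) uea_coassoc uea_counital uea_antipode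
  by blast

section \<open>Counting insertions\<close>

text \<open>Extensional maps, so that isomorphisms agreeing on the half-edges of \<open>h\<close>
  are counted once.\<close>

definition Iso :: "hgraph \<Rightarrow> hgraph \<Rightarrow> (nat \<Rightarrow> nat) set"
  where "Iso h k = {f \<in> extensional (hs h). inj_on f (hs h) \<and> himg f h = k}"

definition aut :: "lfg_class \<Rightarrow> nat"
  where "aut X = card (Iso (rep X) (rep X))"

lemma himg_restrict: "cubic h \<Longrightarrow> himg (restrict f (hs h)) h = himg f h"
  by (rule himg_cong) auto

lemma Iso_restrict: "cubic h \<Longrightarrow> inj_on f (hs h) \<Longrightarrow> himg f h = k \<Longrightarrow> restrict f (hs h) \<in> Iso h k"
  by (simp add: Iso_def himg_restrict)

lemma finite_Iso: "cubic h \<Longrightarrow> finite (Iso h k)"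
proof (cases "Iso h k = {}")
  case False
  assume h: "cubic h"
  obtain f where "f \<in> Iso h k" using False by blast
  then have fin: "finite (hs k)" using cubicD(1)[OF h] by (auto simp: Iso_def)
  have "Iso h k \<subseteq> hs h \<rightarrow>\<^sub>E hs k" by (auto simp: Iso_def PiE_def)
  then show ?thesis using finite_PiE[OF cubicD(1)[OF h], of "\<lambda>_. hs k"] fin finite_subset by blast
qed simp

lemma card_Iso_cong:
  assumes h: "cubic h" and k: "cubic k" and p: "bij p" and q: "bij q"
  shows "card (Iso (himg p h) (himg q k)) = card (Iso h k)"
proof (rule bij_betw_same_card[OF bij_betwI[of
      "\<lambda>f. restrict (\<lambda>x. inv q (f (p x))) (hs h)" _ _ "\<lambda>f. restrict (\<lambda>x. q (f (inv p x))) (hs (himg p h))"]])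
  have hp: "cubic (himg p h)" using cubic_himg[OF bij_is_inj[OF p] h] .
  note pi = bij_is_inj[OF p] bij_is_inj[OF q] bij_is_surj[OF p] bij_is_surj[OF q]
  have qi: "inj (inv q)" using bij_is_inj[OF bij_imp_bij_inv[OF q]] .
  show "(\<lambda>f. restrict (\<lambda>x. inv q (f (p x))) (hs h)) \<in> Iso (himg p h) (himg q k) \<rightarrow> Iso h k"
  proof
    fix f assume f: "f \<in> Iso (himg p h) (himg q k)"
    have "himg (\<lambda>x. inv q (f (p x))) h = himg (inv q) (himg f (himg p h))"
      by (simp add: himg_comp o_def)
    also have "\<dots> = k" using f himg_inv[OF q refl] by (simp add: Iso_def)
    finally have 1: "himg (\<lambda>x. inv q (f (p x))) h = k" .
    have "inj_on (\<lambda>x. inv q (f (p x))) (hs h)"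
      using f inj_eq[OF qi] inj_eq[OF pi(1)] by (auto simp: Iso_def inj_on_def)
    then show "restrict (\<lambda>x. inv q (f (p x))) (hs h) \<in> Iso h k" using 1 by (rule Iso_restrict[OF h])
  qed
  show "(\<lambda>f. restrict (\<lambda>x. q (f (inv p x))) (hs (himg p h))) \<in> Iso h k \<rightarrow> Iso (himg p h) (himg q k)"
  proof
    fix f assume f: "f \<in> Iso h k"
    have "himg (\<lambda>x. q (f (inv p x))) (himg p h) = himg q (himg f h)"
      using pi by (simp add: himg_comp o_def)
    then have 1: "himg (\<lambda>x. q (f (inv p x))) (himg p h) = himg q k" using f by (simp add: Iso_def)
    have "inj_on (\<lambda>x. q (f (inv p x))) (hs (himg p h))"
      using f inj_eq[OF pi(2)] pi(1) by (auto simp: Iso_def inj_on_def)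
    then show "restrict (\<lambda>x. q (f (inv p x))) (hs (himg p h)) \<in> Iso (himg p h) (himg q k)"
      using 1 by (rule Iso_restrict[OF hp])
  qed
  show "restrict (\<lambda>x. q (restrict (\<lambda>x. inv q (f (p x))) (hs h) (inv p x))) (hs (himg p h)) = f"
    if "f \<in> Iso (himg p h) (himg q k)" for f
    using that pi by (intro extensionalityI[of _ "hs (himg p h)"]) (auto simp: Iso_def surj_f_inv_f)
  show "restrict (\<lambda>x. inv q (restrict (\<lambda>x. q (f (inv p x))) (hs (himg p h)) (p x))) (hs h) = f"
    if "f \<in> Iso h k" for f
    using that pi by (intro extensionalityI[of _ "hs h"]) (auto simp: Iso_def)
qed

text \<open>The isomorphisms between two graphs of one class are a torsor for the automorphism
  group.\<close>

lemma card_Iso: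
  assumes "lfgh h" "lfgh k"
  shows "card (Iso h k) = (if cls h = cls k then aut (cls h) else 0)"
proof (cases "cls h = cls k")
  case True
  note c = lfgh_cubic[OF rep(1)[of "cls h"]]
  have "iso (rep (cls h)) h" "iso (rep (cls h)) k"
    using cls_eq[OF rep(1)] assms rep(2) True by auto
  then obtain p q where "bij p" "himg p (rep (cls h)) = h" "bij q" "himg q (rep (cls h)) = k"
    using iso_iff_bij[OF c] by blast
  then show ?thesis using card_Iso_cong[OF c c, of p q] True by (simp add: aut_def)
next
  case False
  then have "Iso h k = {}" using assms cls_eq by (auto simp: Iso_def iso_def)
  then show ?thesis using False by simp
qed

lemma aut_pos: "aut X > 0"
proof -
  note c = lfgh_cubic[OF rep(1)[of X]]
  have "restrict id (hs (rep X)) \<in> Iso (rep X) (rep X)" by (rule Iso_restrict[OF c]) (auto simp: himg_id)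
  then show ?thesis unfolding aut_def using finite_Iso[OF c] card_gt_0_iff by blast
qed

lemma himg_expand:
  assumes p: "inj p"
  shows "himg p (expand c e N L) = expand (himg p c) (himg p e) (map_prod p p ` N) (map_prod p p ` L)"
proof -
  have "map_prod p p ` (r \<inter> S \<times> S) = map_prod p p ` r \<inter> p ` S \<times> p ` S" for r S
    using inj_eq[OF p] by auto
  moreover have "map_prod p p ` (r - s) = map_prod p p ` r - map_prod p p ` s" for r s
    using image_set_diff[OF prod.inj_map[OF p p]] .
  ultimately show ?thesis
    by (simp add: expand_def himg_def image_Un image_set_diff[OF p])
qed

context contraction
begin

lemma vr_split: "vr c \<union> vr h \<inter> (hs h - hs c) \<times> (hs h - hs c) = vr h"
proof -
  have "(x, y) \<in> vr c \<or> (x, y) \<in> vr h \<inter> (hs h - hs c) \<times> (hs h - hs c)" if "(x, y) \<in> vr h" for x y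
    using that subD'(4)[of x y] hp(1)[OF that] outside_c[of x y] by blast
  then show ?thesis using subD'(6) by auto
qed

text \<open>Together with \<open>expand_quo_two\<close>, this recognizes a graph as an insertion
  once a subgraph and the corresponding quotient have been identified.\<close>

lemma expand_quo_three:
  assumes "card (ext c) = 3" "\<not> ext c \<subseteq> ext h"
  shows "expand c (quo h c) {} {} = h"
proof -
  note q = quo_three[OF assms]
  have d: "(hs h - hs c) \<union> ext c - hs c = hs h - hs c" using ext_c_hs by blast
  have v: "(vr h \<inter> (hs h - hs c) \<times> (hs h - hs c) \<union> ext c \<times> ext c) \<inter> (hs h - hs c) \<times> (hs h - hs c)
      = vr h \<inter> (hs h - hs c) \<times> (hs h - hs c)" using ext_c_hs by blast
  have "(x, y) \<in> ad c" if "(x, y) \<in> ad h" "\<not> (x \<in> (hs h - hs c) \<union> ext c \<and> y \<in> (hs h - hs c) \<union> ext c)" for x y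
  proof (cases "x \<in> (hs h - hs c) \<union> ext c")
    case False
    then show ?thesis using internal(1)[OF _ _ that(1)] hp(3)[OF that(1)] by blast
  next
    case True
    then have "y \<in> hs c" "y \<notin> ext c" using that hp(4)[OF that(1)] by auto
    then show ?thesis using internal(1)[OF _ _ hp(6)[OF that(1)]] cp(6) by blast
  qed
  then have a: "ad c \<union> ad h \<inter> ((hs h - hs c) \<union> ext c) \<times> ((hs h - hs c) \<union> ext c) = ad h"
    using subD'(5) by auto
  have hh: "hs c \<union> (hs h - hs c \<union> ext c) = hs h" using subD'(3) ext_c_hs by blast
  show ?thesis
    by (rule hgraph.equality) (simp_all add: expand_def q d v a vr_split hh)
qed

lemma expand_quo_two:
  assumes "ext c = {a, b}" "a \<noteq> b" "(a, p) \<in> ad h" "(b, q) \<in> ad h"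
  shows "expand c (quo h c) {(p, q), (q, p)} {(a, p), (b, q), (p, a), (q, b)} = h"
proof -
  note qq = quo_two[OF assms]
  have ab: "a \<in> hs c" "b \<in> hs c" using assms(1) ext_c_hs by auto
  have hh: "hs c \<union> (hs h - hs c) = hs h" using subD'(3) by blast
  have npq: "(p, q) \<notin> ad h" "(q, p) \<notin> ad h"
    using hp(7)[OF hp(6)[OF assms(3)], of q] hp(7)[OF hp(6)[OF assms(4)], of p] ab qq(2,3) by auto
  have "(x, y) \<in> ad c \<union> (ad h \<inter> (hs h - hs c) \<times> (hs h - hs c)) \<union> {(a, p), (b, q), (p, a), (q, b)}"
    if xy: "(x, y) \<in> ad h" for x y
  proof -
    have one: "(x, y) \<in> ad c \<or> (x, y) = (a, p) \<or> (x, y) = (b, q)" if xy: "(x, y) \<in> ad h" "x \<in> hs c" for x y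
    proof (cases "x \<in> ext c")
      case True
      then show ?thesis using assms(1) hp(7)[OF assms(3), of y] hp(7)[OF assms(4), of y] xy by auto
    next
      case False then show ?thesis using internal(1)[OF xy(2) _ xy(1)] by blast
    qed
    show ?thesis
    proof (cases "x \<in> hs c")
      case True then show ?thesis using one[OF xy] by blast
    next
      case x: False
      show ?thesis
      proof (cases "y \<in> hs c")
        case True
        then show ?thesis using one[OF hp(6)[OF xy]] cp(6)[of y x] by blast
      next
        case False
        then show ?thesis using x hp(3,4)[OF xy] xy by blast
      qed
    qed
  qed
  then have "ad c \<union> (ad h \<inter> (hs h - hs c) \<times> (hs h - hs c)) \<union> {(a, p), (b, q), (p, a), (q, b)} = ad h"
    using subD'(5) assms(3,4) hp(6)[OF assms(3)] hp(6)[OF assms(4)] by auto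
  moreover have "(ad h \<inter> (hs h - hs c) \<times> (hs h - hs c) \<union> {(p, q), (q, p)}) - {(p, q), (q, p)}
      = ad h \<inter> (hs h - hs c) \<times> (hs h - hs c)" using npq by blast
  ultimately have a: "ad c \<union> ((ad h \<inter> (hs h - hs c) \<times> (hs h - hs c) \<union> {(p, q), (q, p)}) - {(p, q), (q, p)})
      \<union> {(a, p), (b, q), (p, a), (q, b)} = ad h" by simp
  have v: "vr c \<union> vr h \<inter> (hs h - hs c) \<times> (hs h - hs c) \<inter> (hs h - hs c - hs c) \<times> (hs h - hs c - hs c) = vr h"
    using vr_split by (simp add: Diff_idemp)
  show ?thesis
    by (rule hgraph.equality; simp only: expand_def qq(1) hgraph.simps a v hh; simp)
qed

end

section \<open>Insertions of half-edge graphs\<close>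

definition glue :: "hgraph \<Rightarrow> (nat \<Rightarrow> nat) \<Rightarrow> nat \<Rightarrow> nat"
  where "glue a f h = (if card (ext a) = 3 \<and> h \<in> ext a then f h else h)"

text \<open>With three external edges, \<open>glue\<close> first gives them the names of the
  half-edges at the chosen vertex, and the insertion is the expansion of that vertex. With two, the
  edge to be cut is the image of \<open>ext a\<close> and each external edge is joined to its
  image.\<close>

definition ins :: "hgraph \<Rightarrow> hgraph \<Rightarrow> (nat \<Rightarrow> nat) \<Rightarrow> hgraph"
  where "ins a b f = (if card (ext a) = 3 then expand (himg (glue a f) a) b {} {}
    else expand a b {(f x, f y) | x y. x \<in> ext a \<and> y \<in> ext a \<and> x \<noteq> y} (\<Union>x\<in>ext a. {(x, f x), (f x, x)}))"

text \<open>The place of the insertion is not recorded separately, as the image of \<open>f\<close>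
  determines the vertex or edge.\<close>

definition ins_maps :: "hgraph \<Rightarrow> hgraph \<Rightarrow> (nat \<Rightarrow> nat) set"
  where "ins_maps a b = (if card (ext a) = 3
    then {f \<in> extensional (ext a). inj_on f (ext a) \<and> (\<exists>y\<in>hs b. f ` ext a = vr b `` {y})}
    else {f \<in> extensional (ext a). \<forall>x\<in>ext a. \<forall>y\<in>ext a. x \<noteq> y \<longrightarrow> (f x, f y) \<in> ad b})"

locale insertion =
  fixes a b assumes a: "lfgh a" "conn a" and b: "lfgh b" and disj: "hs a \<inter> hs b = {}"
begin

lemmas ac = lfgh_cubic[OF a(1)]
lemmas bc = lfgh_cubic[OF b]

lemma card_ext_a: "card (ext a) = 2 \<or> card (ext a) = 3"
proof -
  obtain x where x: "x \<in> hs a" using a(2) by (auto simp: conn_def)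
  then have "cext a x = ext a" using conn_cext[OF ac a(2)] by blast
  then show ?thesis using a(1) x by (auto simp: lfgh_def)
qed

lemma ext_a_hs: "ext a \<subseteq> hs a"
  by (auto simp: ext_def)

text \<open>The renamed copy of \<open>a\<close> meets \<open>b\<close> exactly in one vertex, which
  is the situation of \<open>expand_vertex\<close>.\<close>

lemma
  assumes f: "f \<in> ins_maps a b" and three: "card (ext a) = 3"
  shows glue_inj: "inj_on (glue a f) (hs a)"
    and three_int: "hs (himg (glue a f) a) \<inter> hs b = f ` ext a" "f ` ext a \<subseteq> hs b"
    and three_hs: "hs (ins a b f) = hs b \<union> (hs a - ext a)"
    and three_lfgh: "lfgh (himg (glue a f) a)" "conn (himg (glue a f) a)"
    and three_ext: "ext (himg (glue a f) a) = f ` ext a"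
    and three_contraction: "contraction (ins a b f) (himg (glue a f) a)" "quo (ins a b f) (himg (glue a f) a) = b"
      "\<not> ext (himg (glue a f) a) \<subseteq> ext (ins a b f)"
proof -
  let ?F = "glue a f"
  obtain y where y: "y \<in> hs b" "f ` ext a = vr b `` {y}" and inj: "inj_on f (ext a)"
    using f three by (auto simp: ins_maps_def)
  show fb: "f ` ext a \<subseteq> hs b" using y cubic_pairs(2)[OF bc] by auto
  have F: "?F x = f x" if "x \<in> ext a" for x using that three by (simp add: glue_def)
  have F': "?F x = x" if "x \<notin> ext a" for x using that by (simp add: glue_def)
  have ne: "f x \<noteq> z" if "x \<in> ext a" "z \<in> hs a" for x z using that fb disj by blast
  show inj': "inj_on ?F (hs a)"
  proof (rule inj_onI)
    fix x z assume xz: "x \<in> hs a" "z \<in> hs a" "?F x = ?F z"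
    show "x = z"
    proof (cases "x \<in> ext a"; cases "z \<in> ext a")
      assume "x \<in> ext a" "z \<in> ext a" then show ?thesis using xz F inj by (simp add: inj_on_def)
    next
      assume "x \<in> ext a" "z \<notin> ext a" then show ?thesis using xz F F' ne by metis
    next
      assume "x \<notin> ext a" "z \<in> ext a" then show ?thesis using xz F F' ne by metis
    next
      assume "x \<notin> ext a" "z \<notin> ext a" then show ?thesis using xz F' by simp
    qed
  qed
  have im: "?F ` hs a = f ` ext a \<union> (hs a - ext a)"
  proof -
    have "?F ` hs a = ?F ` ext a \<union> ?F ` (hs a - ext a)" using ext_a_hs by blast
    also have "?F ` ext a = f ` ext a" using F by (intro image_cong) auto
    also have "?F ` (hs a - ext a) = hs a - ext a" using F' by force
    finally show ?thesis .
  qed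
  show int: "hs (himg ?F a) \<inter> hs b = f ` ext a" using im fb disj by auto
  show "hs (ins a b f) = hs b \<union> (hs a - ext a)" using im fb three by (auto simp: ins_def expand_def)
  obtain p where p: "bij p" "himg p a = himg ?F a" "\<And>x. x \<in> hs a \<Longrightarrow> p x = ?F x"
    using iso_bij[OF ac inj' refl] by blast
  note pi = bij_is_inj[OF p(1)]
  show l: "lfgh (himg ?F a)" "conn (himg ?F a)"
    using lfgh_himg[OF pi a(1)] conn_himg[OF pi a(2)] p(2) by auto
  show e: "ext (himg ?F a) = f ` ext a"
  proof -
    have "ext (himg ?F a) = p ` ext a" using ext_himg[OF pi, of a] p(2) by simp
    also have "\<dots> = f ` ext a" using p(3) F ext_a_hs by (intro image_cong) auto
    finally show ?thesis .
  qed
  have cls_v: "vr b `` {x} = ext (himg ?F a)" if "x \<in> ext (himg ?F a)" for x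
  proof -
    have "(y, x) \<in> vr b" using that e y(2) by blast
    then have "vr b `` {y} = vr b `` {x}" using cubicD(2)[OF bc] by (meson equiv_class_eq)
    then show ?thesis using e y(2) by simp
  qed
  have card: "card (ext (himg ?F a)) = 3" using e card_image[OF inj] three by simp
  \<comment> \<open>The vertex of insertion is not bare in \<open>b\<close>, so the inserted copy is
    not a component of the result.\<close>
  have "vr b `` {y} \<inter> Domain (ad b) \<noteq> {}" using b y(1) by (simp add: lfgh_def)
  then have nb: "\<not> ext (himg ?F a) \<subseteq> ext b" unfolding e y(2) by (auto simp: ext_def)
  have int': "hs (himg ?F a) \<inter> hs b = ext (himg ?F a)" using int e by simp
  note ev = expand_vertex[OF l bc int' cls_v card nb]
  show "contraction (ins a b f) (himg ?F a)" "quo (ins a b f) (himg ?F a) = b"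
    "\<not> ext (himg ?F a) \<subseteq> ext (ins a b f)"
    using ev three by (simp_all add: ins_def)
qed

lemma
  assumes f: "f \<in> ins_maps a b" and two: "card (ext a) \<noteq> 3"
  shows two_hs: "hs (ins a b f) = hs a \<union> hs b"
    and two_contraction: "contraction (ins a b f) a" "quo (ins a b f) a = b" "\<not> ext a \<subseteq> ext (ins a b f)"
    and two_ad: "x \<in> ext a \<Longrightarrow> (x, f x) \<in> ad (ins a b f)" "x \<in> ext a \<Longrightarrow> f x \<in> hs b"
    and two_ins: "ext a = {x, y} \<Longrightarrow> x \<noteq> y \<Longrightarrow>
      ins a b f = expand a b {(f x, f y), (f y, f x)} {(x, f x), (y, f y), (f x, x), (f y, y)}"
proof -
  show ins: "ins a b f = expand a b {(f x, f y), (f y, f x)} {(x, f x), (y, f y), (f x, x), (f y, y)}"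
    if "ext a = {x, y}" "x \<noteq> y" for x y
  proof -
    have "{(f u, f v) | u v. u \<in> ext a \<and> v \<in> ext a \<and> u \<noteq> v} = {(f x, f y), (f y, f x)}"
      using that by auto
    moreover have "(\<Union>x\<in>ext a. {(x, f x), (f x, x)}) = {(x, f x), (y, f y), (f x, x), (f y, y)}"
      using that by auto
    ultimately show ?thesis using two by (simp add: ins_def)
  qed
  have "card (ext a) = 2" using two card_ext_a by simp
  then obtain x y where xy: "ext a = {x, y}" "x \<noteq> y" by (auto simp: card_2_iff)
  have ad: "(f x, f y) \<in> ad b" using f two xy by (auto simp: ins_maps_def)
  note ee = expand_edge[OF a bc disj xy ad, folded ins[OF xy]]
  show "contraction (ins a b f) a" "quo (ins a b f) a = b" by (rule ee)+
  have "ext a \<noteq> {}" using xy by simp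
  then show "\<not> ext a \<subseteq> ext (ins a b f)" using ee(3) by blast
  show "hs (ins a b f) = hs a \<union> hs b" unfolding ins[OF xy] by (simp add: expand_def)
  show "x \<in> ext a \<Longrightarrow> f x \<in> hs b" for x
    using xy cubic_pairs(3,4)[OF bc ad] by auto
  show "x \<in> ext a \<Longrightarrow> (x, f x) \<in> ad (ins a b f)" for x
    using two by (auto simp: ins_def expand_def)
qed

text \<open>A common interface to both kinds of insertion: for two external edges
  \<open>glue a f\<close> is the identity, so the same expression describes the inserted copy of
  \<open>a\<close>.\<close>

lemma ins_contraction:
  assumes "f \<in> ins_maps a b"
  shows "contraction (ins a b f) (himg (glue a f) a)" "quo (ins a b f) (himg (glue a f) a) = b"
    "\<not> ext (himg (glue a f) a) \<subseteq> ext (ins a b f)" "inj_on (glue a f) (hs a)" "cubic (ins a b f)"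
    "lfgh (ins a b f)" "glue a f ` hs a \<subseteq> hs (ins a b f)" "hs b \<subseteq> hs (ins a b f)"
proof -
  have id: "himg (glue a f) a = a" "glue a f = id" if "card (ext a) \<noteq> 3"
  proof -
    show g: "glue a f = id" using that by (simp add: glue_def fun_eq_iff)
    show "himg (glue a f) a = a" unfolding g by (rule himg_id)
  qed
  show 1: "contraction (ins a b f) (himg (glue a f) a)" "quo (ins a b f) (himg (glue a f) a) = b"
    "\<not> ext (himg (glue a f) a) \<subseteq> ext (ins a b f)" "inj_on (glue a f) (hs a)"
    using three_contraction[OF assms] two_contraction[OF assms] glue_inj[OF assms] id
    by (cases "card (ext a) = 3"; simp)+
  interpret contraction "ins a b f" "himg (glue a f) a" by (rule 1(1))
  show "cubic (ins a b f)" by (rule cub)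
  show "lfgh (ins a b f)" using lfgh_quo 1(2) b by simp
  show "glue a f ` hs a \<subseteq> hs (ins a b f)" using subD'(3) by simp
  show "hs b \<subseteq> hs (ins a b f)" using hs_quo(2) 1(2) by simp
qed

lemma ins_hs_eq: "f \<in> ins_maps a b \<Longrightarrow> f' \<in> ins_maps a b \<Longrightarrow> hs (ins a b f) = hs (ins a b f')"
  using three_hs two_hs by (cases "card (ext a) = 3") auto

lemma ins_hs: "f \<in> ins_maps a b \<Longrightarrow> x \<in> hs (ins a b f) \<Longrightarrow> x \<in> hs b \<or> (x \<in> hs a \<and> glue a f x = x)"
  using three_hs two_hs by (cases "card (ext a) = 3") (auto simp: glue_def)

text \<open>An identification \<open>t\<close> of the insertion along \<open>f\<close> with \<open>g\<close> amounts to a subgraph \<open>c\<close> of \<open>g\<close>, the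
  image of \<open>a\<close>, with isomorphisms from \<open>a\<close> to \<open>c\<close> and from \<open>b\<close> to \<open>g/c\<close>.\<close>

definition split_iso :: "(nat \<Rightarrow> nat) \<times> (nat \<Rightarrow> nat) \<Rightarrow> hgraph \<times> (nat \<Rightarrow> nat) \<times> (nat \<Rightarrow> nat)"
  where "split_iso = (\<lambda>(f, t). (himg t (himg (glue a f) a), restrict (\<lambda>x. t (glue a f x)) (hs a), restrict t (hs b)))"

abbreviation "proper_subs g \<equiv> {c. csub c g \<and> \<not> ext c \<subseteq> ext g}"

lemma split_iso_mem:
  assumes f: "f \<in> ins_maps a b" and t: "t \<in> Iso (ins a b f) g"
  shows "split_iso (f, t) \<in> Sigma (proper_subs g) (\<lambda>c. Iso a c \<times> Iso b (quo g c))"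
proof -
  note I = ins_contraction[OF f]
  interpret contraction "ins a b f" "himg (glue a f) a" by (rule I(1))
  let ?a = "himg (glue a f) a"
  obtain p where p: "bij p" "himg p (ins a b f) = g" "\<And>x. x \<in> hs (ins a b f) \<Longrightarrow> p x = t x"
    using iso_bij[OF cub, of t g] t by (auto simp: Iso_def)
  note pi = bij_is_inj[OF p(1)]
  have ta: "himg t ?a = himg p ?a"
    by (rule himg_cong[OF subD'(2)]) (use p(3) subD'(3) in auto)
  have csub: "csub (himg p ?a) g"
    using csub_himg[OF pi, of ?a "ins a b f"] sub conn p(2) by (simp add: csub_def)
  have np: "\<not> ext (himg p ?a) \<subseteq> ext g"
    using I(3) unfolding p(2)[symmetric] ext_himg[OF pi] inj_image_subset_iff[OF pi] .
  have tb: "himg t b = quo g (himg p ?a)"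
  proof -
    have "himg t b = himg p b" by (rule himg_cong[OF bc]) (use p(3) I(8) in auto)
    then show ?thesis using quo_himg[OF pi, of "ins a b f" ?a] p(2) I(2) by simp
  qed
  have inj_t: "inj_on t (hs (ins a b f))" using t by (simp add: Iso_def)
  have "inj_on (\<lambda>x. t (glue a f x)) (hs a)"
    using inj_on_subset[OF inj_t I(7)] I(4) by (simp add: inj_on_def)
  moreover have "himg (\<lambda>x. t (glue a f x)) a = himg t ?a" by (simp add: himg_comp o_def)
  ultimately have "restrict (\<lambda>x. t (glue a f x)) (hs a) \<in> Iso a (himg t ?a)" by (intro Iso_restrict[OF ac])
  moreover have "restrict t (hs b) \<in> Iso b (quo g (himg t ?a))"
    using inj_on_subset[OF inj_t I(8)] tb ta by (intro Iso_restrict[OF bc]) auto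
  ultimately show ?thesis using csub np ta by (simp add: split_iso_def)
qed

text \<open>The copies of \<open>a\<close> and \<open>b\<close> cover the insertion, which
  determines \<open>t\<close>. Then \<open>f\<close> is recovered because \<open>t\<close> is
  injective: directly from the gluing for three external edges, and from the partners of the
  external edges for two.\<close>

lemma split_iso_inj:
  assumes f: "f \<in> ins_maps a b" "t \<in> Iso (ins a b f) g" and f': "f' \<in> ins_maps a b" "t' \<in> Iso (ins a b f') g"
    and eq: "split_iso (f, t) = split_iso (f', t')"
  shows "f = f'" "t = t'"
proof -
  have r: "restrict (\<lambda>x. t (glue a f x)) (hs a) = restrict (\<lambda>x. t' (glue a f' x)) (hs a)"
    "restrict t (hs b) = restrict t' (hs b)" using eq by (auto simp: split_iso_def)
  have ra: "t (glue a f x) = t' (glue a f' x)" if "x \<in> hs a" for x using r(1) that by (metis restrict_apply')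
  have rb: "t x = t' x" if "x \<in> hs b" for x using r(2) that by (metis restrict_apply')
  have hs: "hs (ins a b f) = hs (ins a b f')" by (rule ins_hs_eq[OF f(1) f'(1)])
  show tt: "t = t'"
  proof (rule extensionalityI)
    show "t \<in> extensional (hs (ins a b f))" "t' \<in> extensional (hs (ins a b f))"
      using f f' hs by (auto simp: Iso_def)
    fix x assume x: "x \<in> hs (ins a b f)"
    then show "t x = t' x" using ins_hs[OF f(1) x] ins_hs[OF f'(1), of x] hs rb ra[of x] by metis
  qed
  have inj_t: "inj_on t (hs (ins a b f))" using f by (simp add: Iso_def)
  show "f = f'"
  proof (rule extensionalityI)
    show "f \<in> extensional (ext a)" "f' \<in> extensional (ext a)"
      using f(1) f'(1) by (auto simp: ins_maps_def split: if_splits)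
    fix x assume x: "x \<in> ext a"
    show "f x = f' x"
    proof (cases "card (ext a) = 3")
      case True
      have "t (f x) = t (f' x)" using ra[of x] x ext_a_hs tt True by (auto simp: glue_def)
      moreover have "f x \<in> hs b" "f' x \<in> hs b" using three_int(2)[OF f(1) True] three_int(2)[OF f'(1) True] x by auto
      ultimately show ?thesis using inj_t ins_contraction(8)[OF f(1)] by (meson inj_onD subsetD)
    next
      case False
      have g: "himg t (ins a b f) = g" "himg t (ins a b f') = g" using f(2) f'(2) tt by (auto simp: Iso_def)
      have "(t x, t (f x)) \<in> ad g" "(t x, t (f' x)) \<in> ad g"
        using two_ad(1)[OF f(1) False x] two_ad(1)[OF f'(1) False x] g by (metis himg_simps(3) image_eqI map_prod_simp)+
      moreover have "cubic g"
      proof -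
        obtain p where "bij p" "himg p (ins a b f) = g"
          using iso_bij[OF ins_contraction(5)[OF f(1)] inj_t g(1)] by blast
        then show ?thesis using cubic_himg[OF bij_is_inj] ins_contraction(5)[OF f(1)] by blast
      qed
      ultimately have "t (f x) = t (f' x)" using cubic_pairs(7) by blast
      moreover have "f x \<in> hs b" "f' x \<in> hs b" using two_ad(2)[OF f(1) False x] two_ad(2)[OF f'(1) False x] by auto
      ultimately show ?thesis using inj_t ins_contraction(8)[OF f(1)] by (meson inj_onD subsetD)
    qed
  qed
qed

text \<open>Take \<beta> on \<open>b\<close> and \<alpha> on the rest for \<open>t\<close>. An
  external edge of \<open>a\<close> must be sent by \<open>f\<close> to the half-edge of
  \<open>b\<close> that \<beta> maps to its \<alpha>-image if there are three of them, and to the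
  partner of that image in \<open>g\<close> if there are two.\<close>

lemma split_iso_surj:
  assumes g: "lfgh g" and c: "csub c g" "\<not> ext c \<subseteq> ext g" and \<alpha>: "\<alpha> \<in> Iso a c" and \<beta>: "\<beta> \<in> Iso b (quo g c)"
  shows "\<exists>f t. f \<in> ins_maps a b \<and> t \<in> Iso (ins a b f) g \<and> split_iso (f, t) = (c, \<alpha>, \<beta>)"
proof -
  interpret contraction g c by (rule contraction_lfgh[OF g c(1)])
  have \<alpha>': "inj_on \<alpha> (hs a)" "himg \<alpha> a = c" "\<alpha> \<in> extensional (hs a)" using \<alpha> by (auto simp: Iso_def)
  have \<beta>': "inj_on \<beta> (hs b)" "himg \<beta> b = quo g c" "\<beta> \<in> extensional (hs b)" using \<beta> by (auto simp: Iso_def)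
  have im: "\<alpha> ` hs a = hs c" "\<beta> ` hs b = hs (quo g c)"
    using arg_cong[OF \<alpha>'(2), of hs] arg_cong[OF \<beta>'(2), of hs] by simp_all
  obtain p where p: "bij p" "himg p a = c" "\<And>x. x \<in> hs a \<Longrightarrow> p x = \<alpha> x" using iso_bij[OF ac \<alpha>'(1,2)] by blast
  have ext: "ext c = \<alpha> ` ext a"
    using ext_himg[OF bij_is_inj[OF p(1)], of a] p(2,3) ext_a_hs by (metis (no_types, lifting) image_cong subsetD)
  have inj_ext: "inj_on \<alpha> (ext a)" using inj_on_subset[OF \<alpha>'(1) ext_a_hs] .
  have card: "card (ext c) = card (ext a)" unfolding ext by (rule card_image[OF inj_ext])
  note bi = inv_into_into[of _ \<beta> "hs b", unfolded im] f_inv_into_f[of _ \<beta> "hs b", unfolded im]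
  have fin: ?thesis if f: "f \<in> ins_maps a b"
    and t: "\<And>x. x \<in> hs a \<Longrightarrow> t (glue a f x) = \<alpha> x" "\<And>x. x \<in> hs b \<Longrightarrow> t x = \<beta> x"
    and inj: "inj_on t (hs (ins a b f))" and g: "himg t (ins a b f) = g" for f t
  proof -
    let ?t = "restrict t (hs (ins a b f))"
    note I = ins_contraction[OF f]
    have "?t \<in> Iso (ins a b f) g" using I(5) inj g by (rule Iso_restrict)
    moreover have "split_iso (f, ?t) = (c, \<alpha>, \<beta>)"
    proof -
      have 1: "restrict (\<lambda>x. ?t (glue a f x)) (hs a) = \<alpha>"
        using t(1) I(7) \<alpha>'(3) by (intro extensionalityI[of _ "hs a"]) auto
      have 2: "restrict ?t (hs b) = \<beta>"
        using t(2) I(8) \<beta>'(3) by (intro extensionalityI[of _ "hs b"]) auto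
      have "himg ?t (himg (glue a f) a) = himg (\<lambda>x. ?t (glue a f x)) a" by (simp add: himg_comp o_def)
      also have "\<dots> = himg \<alpha> a" by (rule himg_cong[OF ac]) (use t(1) I(7) in auto)
      finally show ?thesis using 1 2 \<alpha>'(2) by (simp add: split_iso_def)
    qed
    ultimately show ?thesis using f by blast
  qed
  show ?thesis
  proof (cases "card (ext a) = 3")
    case True
    note three = True[folded card] c(2)
    note q = quo_three[OF three]
    define f where "f = restrict (\<lambda>x. inv_into (hs b) \<beta> (\<alpha> x)) (ext a)"
    have ax: "\<alpha> x \<in> hs (quo g c)" if "x \<in> ext a" for x using that ext by (auto simp: q)
    have f1: "f x \<in> hs b" "\<beta> (f x) = \<alpha> x" if "x \<in> ext a" for x
      using bi[OF ax[OF that]] that by (simp_all add: f_def)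
    have f_inj: "inj_on f (ext a)"
      using f1 inj_ext by (metis inj_on_def)
    have "ext a \<noteq> {}" using True by auto
    then obtain x0 where x0: "x0 \<in> ext a" by blast
    have fcl: "f ` ext a = vr b `` {f x0}"
    proof -
      have cl: "(\<beta> u, \<beta> v) \<in> vr (quo g c) \<longleftrightarrow> (u, v) \<in> vr b" if "u \<in> hs b" "v \<in> hs b" for u v
      proof
        assume "(\<beta> u, \<beta> v) \<in> vr (quo g c)"
        then obtain u' v' where "(u', v') \<in> vr b" "\<beta> u = \<beta> u'" "\<beta> v = \<beta> v'"
          unfolding \<beta>'(2)[symmetric] by auto
        moreover from this have "u' = u" "v' = v" using that cubic_pairs(1,2)[OF bc] \<beta>'(1) by (metis inj_onD)+
        ultimately show "(u, v) \<in> vr b" by simp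
      next
        assume "(u, v) \<in> vr b" then show "(\<beta> u, \<beta> v) \<in> vr (quo g c)" unfolding \<beta>'(2)[symmetric] by auto
      qed
      have qc: "vr (quo g c) `` {\<alpha> x0} = ext c" using x0 ext ext_c_hs by (auto simp: q)
      show ?thesis
      proof (intro set_eqI iffI)
        fix z assume "z \<in> f ` ext a"
        then obtain x where x: "x \<in> ext a" "z = f x" by blast
        then have "(\<alpha> x0, \<alpha> x) \<in> vr (quo g c)" using qc ext by blast
        then show "z \<in> vr b `` {f x0}" using cl[of "f x0" "f x"] f1 x x0 by simp
      next
        fix z assume z: "z \<in> vr b `` {f x0}"
        then have zb: "z \<in> hs b" using cubic_pairs(2)[OF bc] by blast
        then have "(\<alpha> x0, \<beta> z) \<in> vr (quo g c)" using cl[of "f x0" z] f1[OF x0] z by simp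
        then have "\<beta> z \<in> ext c" using qc by blast
        then obtain x where "x \<in> ext a" "\<beta> z = \<alpha> x" using ext by auto
        then have "z = f x" using f1[of x] zb \<beta>'(1) by (metis inj_onD)
        then show "z \<in> f ` ext a" using \<open>x \<in> ext a\<close> by blast
      qed
    qed
    have f: "f \<in> ins_maps a b"
      using True f_inj fcl f1(1)[OF x0] by (auto simp: ins_maps_def f_def)
    define t where "t x = (if x \<in> hs b then \<beta> x else \<alpha> x)" for x
    have tF: "t (glue a f x) = \<alpha> x" if "x \<in> hs a" for x
      using that True f1[of x] disj by (auto simp: t_def glue_def)
    have tb: "t x = \<beta> x" if "x \<in> hs b" for x using that by (simp add: t_def)
    have ta: "t x = \<alpha> x" if "x \<in> hs a" for x using that disj by (auto simp: t_def)
    have hsu: "hs (ins a b f) = hs b \<union> (hs a - ext a)" by (rule three_hs[OF f True])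
    have inj: "inj_on t (hs (ins a b f))"
    proof -
      have "inj_on t (hs b)" using \<beta>'(1) tb by (simp add: inj_on_def)
      moreover have "inj_on t (hs a - ext a)" using \<alpha>'(1) ta by (simp add: inj_on_def)
      moreover have "t ` hs b \<inter> t ` (hs a - ext a) = {}"
      proof -
        have "t ` hs b = hs (quo g c)" using im(2) tb by (metis image_cong)
        moreover have "t ` (hs a - ext a) = hs c - ext c"
          using ta im(1) ext inj_on_image_set_diff[OF \<alpha>'(1), of "hs a" "ext a"] ext_a_hs by auto
        ultimately show ?thesis by (auto simp: q)
      qed
      ultimately show ?thesis unfolding hsu by (simp add: inj_on_Un) blast
    qed
    \<comment> \<open>\<open>himg_expand\<close> concerns injections on all of \<open>nat\<close>,
      so \<open>t\<close> is first extended to a permutation.\<close>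
    obtain r where r: "bij r" "himg r (ins a b f) = himg t (ins a b f)" "\<And>x. x \<in> hs (ins a b f) \<Longrightarrow> r x = t x"
      using iso_bij[OF ins_contraction(5)[OF f] inj refl] by blast
    have "himg r (himg (glue a f) a) = c"
    proof -
      have "himg r (himg (glue a f) a) = himg (\<lambda>x. r (glue a f x)) a" by (simp add: himg_comp o_def)
      also have "\<dots> = himg \<alpha> a"
        by (rule himg_cong[OF ac]) (use r(3) tF ins_contraction(7)[OF f] in auto)
      finally show ?thesis using \<alpha>'(2) by simp
    qed
    moreover have "himg r b = quo g c"
    proof -
      have "r x = \<beta> x" if "x \<in> hs b" for x
        using r(3)[of x] tb[OF that] ins_contraction(8)[OF f] that by auto
      then show ?thesis using himg_cong[OF bc, of r \<beta>] \<beta>'(2) by simp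
    qed
    ultimately have "himg r (ins a b f) = expand c (quo g c) {} {}"
      using True himg_expand[OF bij_is_inj[OF r(1)]] by (simp add: ins_def)
    then have "himg t (ins a b f) = g" using expand_quo_three[OF three] r(2) by simp
    with f tF tb inj show ?thesis by (rule fin)
  next
    case False
    have cardc: "card (ext c) \<noteq> 3" using False card by simp
    obtain u v p q where two: "ext c = {u, v}" "u \<noteq> v" "(u, p) \<in> ad g" "(v, q) \<in> ad g"
      using c(2) cardc by (cases rule: kinds) auto
    note qq = quo_two[OF two]
    obtain x where x: "x \<in> ext a" "u = \<alpha> x" using two(1) ext by (metis imageE insertI1)
    obtain y where y: "y \<in> ext a" "v = \<alpha> y" using two(1) ext by (metis imageE insertI1 insert_commute)
    have xy: "x \<noteq> y" "ext a = {x, y}"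
    proof -
      show ne: "x \<noteq> y" using x y two(2) by blast
      have "card (ext a) = 2" using card_ext_a False by simp
      then show "ext a = {x, y}" using x(1) y(1) ne by (auto simp: card_2_iff)
    qed
    define f where "f = restrict (\<lambda>z. inv_into (hs b) \<beta> (if z = x then p else q)) (ext a)"
    have pq: "p \<in> hs (quo g c)" "q \<in> hs (quo g c)" using qq(2,3) by (simp_all add: qq(1))
    have fx: "f x \<in> hs b" "\<beta> (f x) = p" "f y \<in> hs b" "\<beta> (f y) = q"
      using bi[OF pq(1)] bi[OF pq(2)] x(1) y(1) xy(1) by (simp_all add: f_def)
    have "(p, q) \<in> ad (quo g c)" by (simp add: qq(1))
    then obtain m n where mn: "(m, n) \<in> ad b" "p = \<beta> m" "q = \<beta> n" unfolding \<beta>'(2)[symmetric] by auto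
    have "m = f x" "n = f y"
      using mn fx cubic_pairs(3,4)[OF bc mn(1)] \<beta>'(1) by (metis inj_onD)+
    then have fad: "(f x, f y) \<in> ad b" "(f y, f x) \<in> ad b" using mn(1) cubic_pairs(6)[OF bc] by auto
    have f: "f \<in> ins_maps a b"
      using False xy fad by (auto simp: ins_maps_def f_def)
    define t where "t z = (if z \<in> hs b then \<beta> z else \<alpha> z)" for z
    have gl: "glue a f z = z" for z using False by (simp add: glue_def)
    have tb: "t z = \<beta> z" if "z \<in> hs b" for z using that by (simp add: t_def)
    have ta: "t z = \<alpha> z" if "z \<in> hs a" for z using that disj by (auto simp: t_def)
    have tF: "t (glue a f z) = \<alpha> z" if "z \<in> hs a" for z using ta that gl by simp
    have hsu: "hs (ins a b f) = hs a \<union> hs b" by (rule two_hs[OF f False])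
    have inj: "inj_on t (hs (ins a b f))"
    proof -
      have "inj_on t (hs b)" using \<beta>'(1) tb by (simp add: inj_on_def)
      moreover have "inj_on t (hs a)" using \<alpha>'(1) ta by (simp add: inj_on_def)
      moreover have "t ` hs a \<inter> t ` hs b = {}"
      proof -
        have "t ` hs b = hs (quo g c)" using im(2) tb by (metis image_cong)
        moreover have "t ` hs a = hs c" using im(1) ta by (metis image_cong)
        ultimately show ?thesis by (auto simp: qq(1))
      qed
      ultimately show ?thesis unfolding hsu by (simp add: inj_on_Un) blast
    qed
    obtain r where r: "bij r" "himg r (ins a b f) = himg t (ins a b f)" "\<And>x. x \<in> hs (ins a b f) \<Longrightarrow> r x = t x"
      using iso_bij[OF ins_contraction(5)[OF f] inj refl] by blast
    have "himg r a = c" using himg_cong[OF ac, of r \<alpha>] r(3) ta hsu \<alpha>'(2) by auto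
    moreover have "himg r b = quo g c" using himg_cong[OF bc, of r \<beta>] r(3) tb hsu \<beta>'(2) by auto
    moreover have "r x = u" "r y = v" "r (f x) = p" "r (f y) = q"
      using r(3) ta tb fx x y ext_a_hs hsu by auto
    ultimately have "himg r (ins a b f) = expand c (quo g c) {(p, q), (q, p)} {(u, p), (v, q), (p, u), (q, v)}"
      unfolding two_ins[OF f False xy(2,1)] himg_expand[OF bij_is_inj[OF r(1)]] by simp
    then have "himg t (ins a b f) = g" using expand_quo_two[OF two] r(2) by simp
    with f tF tb inj show ?thesis by (rule fin)
  qed
qed

lemma finite_ins_maps: "finite (ins_maps a b)"
proof -
  have "ins_maps a b \<subseteq> ext a \<rightarrow>\<^sub>E hs b"
  proof
    fix f assume f: "f \<in> ins_maps a b"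
    have "f ` ext a \<subseteq> hs b"
      using three_int(2)[OF f] two_ad(2)[OF f] by (cases "card (ext a) = 3") auto
    moreover have "f \<in> extensional (ext a)" using f by (simp add: ins_maps_def split: if_splits)
    ultimately show "f \<in> ext a \<rightarrow>\<^sub>E hs b" by (auto simp: PiE_def)
  qed
  moreover have "finite (ext a)" using finite_subset[OF ext_a_hs cubicD(1)[OF ac]] .
  ultimately show ?thesis using finite_PiE[of "ext a" "\<lambda>_. hs b"] cubicD(1)[OF bc] finite_subset by blast
qed

text \<open>Both sides count the ways to write \<open>g\<close> as \<open>a\<close> inserted into \<open>b\<close>, with all identifications
  recorded.\<close>

lemma insertion_count:
  assumes g: "lfgh g"
  shows "(\<Sum>f\<in>ins_maps a b. card (Iso (ins a b f) g)) = (\<Sum>c\<in>proper_subs g. card (Iso a c) * card (Iso b (quo g c)))"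
proof -
  have fin: "finite (proper_subs g)"
    by (rule finite_subset[OF _ finite_sub[OF lfgh_cubic[OF g]]]) (auto simp: csub_def)
  have "bij_betw split_iso (Sigma (ins_maps a b) (\<lambda>f. Iso (ins a b f) g))
      (Sigma (proper_subs g) (\<lambda>c. Iso a c \<times> Iso b (quo g c)))"
    unfolding bij_betw_def
  proof (intro conjI set_eqI iffI inj_onI)
    fix u v
    assume "u \<in> Sigma (ins_maps a b) (\<lambda>f. Iso (ins a b f) g)" "v \<in> Sigma (ins_maps a b) (\<lambda>f. Iso (ins a b f) g)"
      "split_iso u = split_iso v"
    then show "u = v" using split_iso_inj by (metis mem_Sigma_iff surj_pair)
  next
    fix u assume "u \<in> split_iso ` Sigma (ins_maps a b) (\<lambda>f. Iso (ins a b f) g)"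
    then show "u \<in> Sigma (proper_subs g) (\<lambda>c. Iso a c \<times> Iso b (quo g c))" using split_iso_mem by blast
  next
    fix u assume u: "u \<in> Sigma (proper_subs g) (\<lambda>c. Iso a c \<times> Iso b (quo g c))"
    obtain c \<alpha> \<beta> where e: "u = (c, \<alpha>, \<beta>)" by (cases u) auto
    with u split_iso_surj[OF g] show "u \<in> split_iso ` Sigma (ins_maps a b) (\<lambda>f. Iso (ins a b f) g)"
      by (metis (no_types, lifting) image_eqI mem_Collect_eq mem_Sigma_iff)
  qed
  then have "card (Sigma (ins_maps a b) (\<lambda>f. Iso (ins a b f) g))
      = card (Sigma (proper_subs g) (\<lambda>c. Iso a c \<times> Iso b (quo g c)))" by (rule bij_betw_same_card)
  then show ?thesis
    using finite_ins_maps fin finite_Iso[OF ac] finite_Iso[OF bc] finite_Iso[OF ins_contraction(5)]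
    by (simp add: card_SigmaI card_cartesian_product)
qed

end

section \<open>Insertions of graphs with vertices\<close>

locale graph_insertion =
  fixes GA GB :: graph
  assumes GA: "trivalent GA" and GB: "trivalent GB"
    and la: "lfgh (shape GA)" and ca: "conn (shape GA)" and lb: "lfgh (shape GB)"
    and disj_v: "verts GA \<inter> verts GB = {}" and disj_h: "halves GA \<inter> halves GB = {}"
begin

abbreviation "a \<equiv> shape GA"
abbreviation "b \<equiv> shape GB"

sublocale insertion a b
  by unfold_locales (use la ca lb disj_h in auto)

lemmas ga = trivalentD[OF GA]
lemmas gb = trivalentD[OF GB]

lemma ext_a: "external_edges GA = ext a"
  by (rule external_edges_shape)

lemma trivalentI_shape:
  assumes "cubic (shape G)" "finite (verts G)" "inc G \<subseteq> verts G \<times> halves G"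
    "\<And>x. x \<in> halves G \<Longrightarrow> \<exists>!v. (v, x) \<in> inc G" "\<And>v. v \<in> verts G \<Longrightarrow> card (half_edges_at G v) = 3"
  shows "trivalent G"
  using assms(2-5) cubicD[OF assms(1)] cubic_pairs(7)[OF assms(1)]
  unfolding trivalent_def finite_graph_def by auto

lemma bijections_iff: "f \<in> bijections S T \<longleftrightarrow> f \<in> extensional S \<and> inj_on f S \<and> f ` S = T"
  by (auto simp: bijections_def bij_betw_def PiE_def)

lemma half_edges_b: "(v, x) \<in> inc GB \<Longrightarrow> half_edges_at GB v = vr b `` {x}"
  using vr_shape_class[OF GB] by simp

text \<open>Both \<open>insert_at_vertex\<close> and \<open>glue\<close> keep the half-edge names at
  the vertex of \<open>GB\<close>, so the shapes are equal and not merely isomorphic.\<close>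

lemma insert_vertex:
  assumes three: "card (ext a) = 3" and v: "v \<in> verts GB" and f: "f \<in> bijections (ext a) (half_edges_at GB v)"
  shows "f \<in> ins_maps a b" "shape (insert_at_vertex GB v f GA) = ins a b f"
    "lfg_graph (insert_at_vertex GB v f GA)"
    "halves (insert_at_vertex GB v f GA) \<subseteq> halves GA \<union> halves GB"
proof -
  let ?I = "insert_at_vertex GB v f GA" and ?F = "glue a f"
  obtain x0 where x0: "(v, x0) \<in> inc GB" using half_edges_at_ne[OF GB v] by blast
  have fim: "f ` ext a = half_edges_at GB v" "inj_on f (ext a)" "f \<in> extensional (ext a)"
    using f by (auto simp: bijections_iff)
  have "x0 \<in> hs b" using gb(4)[OF x0] by simp
  then show fm: "f \<in> ins_maps a b"
    using three fim half_edges_b[OF x0] by (auto simp: ins_maps_def)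
  note T = three_int[OF fm three] three_hs[OF fm three] three_contraction[OF fm three] glue_inj[OF fm three]
  have F: "?F x = (if x \<in> ext a then f x else x)" for x using three by (simp add: glue_def)
  have I: "verts ?I = (verts GB - {v}) \<union> verts GA" "halves ?I = halves GB \<union> (halves GA - ext a)"
    "inc ?I = {(w, h) \<in> inc GB. w \<noteq> v} \<union> (\<lambda>(w, h). (w, ?F h)) ` inc GA" "adj ?I = adj GB \<union> adj GA"
    by (simp_all add: insert_at_vertex_def ext_a F)
  have incI: "(w, x) \<in> inc ?I \<longleftrightarrow> (w, x) \<in> inc GB \<and> w \<noteq> v \<or> (\<exists>h. (w, h) \<in> inc GA \<and> x = ?F h)" for w x
    unfolding I(3) by auto
  have in_v: "(w, x) \<in> inc GB \<Longrightarrow> w = v \<longleftrightarrow> x \<in> f ` ext a" for w x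
    using gb(9) unfolding fim(1) half_edges_at_def by blast
  have hsF: "?F ` halves GA \<inter> halves GB = f ` ext a" using T(1) by simp
  have FA: "?F h \<in> halves GB \<longleftrightarrow> h \<in> ext a" if "h \<in> halves GA" for h
  proof
    assume "?F h \<in> halves GB"
    then have "?F h \<in> f ` ext a" using hsF that by blast
    then obtain k where k: "k \<in> ext a" "?F h = ?F k" using F by auto
    then show "h \<in> ext a" using T(7) that ext_a_hs by (metis inj_onD shape_simps(1) subsetD)
  next
    assume "h \<in> ext a" then show "?F h \<in> halves GB" using F T(2) by auto
  qed
  show sh: "shape ?I = ins a b f"
  proof (rule hgraph.equality)
    show "hs (shape ?I) = hs (ins a b f)" unfolding T(3) by (simp add: I)
    have "map_prod ?F ?F ` ad a = id ` ad a"
    proof (rule image_cong[OF refl])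
      fix e assume "e \<in> ad a"
      then obtain u w where uw: "e = (u, w)" "(u, w) \<in> adj GA" by (cases e) auto
      then have "u \<notin> ext a" "w \<notin> ext a" using ga(7)[OF uw(2)] by (auto simp: ext_def)
      then show "map_prod ?F ?F e = id e" using F uw(1) by simp
    qed
    then show "ad (shape ?I) = ad (ins a b f)"
      using three by (auto simp: I ins_def expand_def)
    have "(x, y) \<in> vr (shape ?I) \<longleftrightarrow> (x, y) \<in> vr (ins a b f)" for x y
    proof -
      have R: "(x, y) \<in> vr (ins a b f) \<longleftrightarrow> (x, y) \<in> map_prod ?F ?F ` vr a \<or>
          (x, y) \<in> vr b \<and> x \<in> halves GB - ?F ` halves GA \<and> y \<in> halves GB - ?F ` halves GA"
        using three by (auto simp: ins_def expand_def)
      show ?thesis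
      proof
        assume "(x, y) \<in> vr (shape ?I)"
        then obtain w where w: "(w, x) \<in> inc ?I" "(w, y) \<in> inc ?I" by auto
        show "(x, y) \<in> vr (ins a b f)"
        proof (cases "w \<in> verts GA")
          case True
          then have "w \<notin> verts GB" using disj_v by blast
          then obtain h k where "(w, h) \<in> inc GA" "x = ?F h" "(w, k) \<in> inc GA" "y = ?F k"
            using w gb(3) unfolding incI by blast
          then have "(h, k) \<in> vr a" "x = ?F h" "y = ?F k" by auto
          then show ?thesis unfolding R by force
        next
          case False
          then have wb: "(w, x) \<in> inc GB" "(w, y) \<in> inc GB" "w \<noteq> v" using w ga(3) unfolding incI by blast+
          then have "x \<notin> f ` ext a" "y \<notin> f ` ext a" using in_v by blast+
          then have "x \<in> halves GB - ?F ` halves GA" "y \<in> halves GB - ?F ` halves GA"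
            using gb(4) wb hsF by blast+
          then show ?thesis unfolding R using wb by auto
        qed
      next
        assume "(x, y) \<in> vr (ins a b f)"
        then consider h k where "x = ?F h" "y = ?F k" "(h, k) \<in> vr a"
          | "(x, y) \<in> vr b" "x \<in> halves GB - ?F ` halves GA" "y \<in> halves GB - ?F ` halves GA"
          unfolding R by auto
        then show "(x, y) \<in> vr (shape ?I)"
        proof cases
          case 1
          then obtain w where "(w, h) \<in> inc GA" "(w, k) \<in> inc GA" by auto
          then have "(w, x) \<in> inc ?I" "(w, y) \<in> inc ?I" unfolding incI using 1 by blast+
          then show ?thesis by auto
        next
          case 2
          then obtain w where w: "(w, x) \<in> inc GB" "(w, y) \<in> inc GB" by auto
          have "x \<notin> f ` ext a" using 2(2) hsF by blast
          then have "w \<noteq> v" using in_v[OF w(1)] by simp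
          then have "(w, x) \<in> inc ?I" "(w, y) \<in> inc ?I" unfolding incI using w by blast+
          then show ?thesis by auto
        qed
      qed
    qed
    then show "vr (shape ?I) = vr (ins a b f)" by (simp only: set_eq_iff split_paired_All) simp
  qed simp
  have "trivalent ?I"
  proof (rule trivalentI_shape)
    show "cubic (shape ?I)" unfolding sh by (rule ins_contraction(5)[OF fm])
    show "finite (verts ?I)" using ga(1) gb(1) I by simp
    show "inc ?I \<subseteq> verts ?I \<times> halves ?I"
    proof clarify
      fix w x assume "(w, x) \<in> inc ?I"
      then consider "(w, x) \<in> inc GB" "w \<noteq> v" | h where "(w, h) \<in> inc GA" "x = ?F h" unfolding incI by blast
      then show "w \<in> verts ?I \<and> x \<in> halves ?I"
      proof cases
        case 1 then show ?thesis using gb(3,4) I by blast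
      next
        case 2
        then have "h \<in> halves GA" "w \<in> verts GA" using ga(3,4) by blast+
        then show ?thesis using 2 FA[of h] F[of h] I by auto
      qed
    qed
    fix x assume x: "x \<in> halves ?I"
    show "\<exists>!w. (w, x) \<in> inc ?I"
    proof (cases "x \<in> ?F ` halves GA")
      case True
      then obtain h where h: "h \<in> halves GA" "x = ?F h" by blast
      then obtain w where w: "(w, h) \<in> inc GA" using ga(10) by blast
      have "u = w" if "(u, x) \<in> inc ?I" for u
      proof -
        consider "(u, x) \<in> inc GB" "u \<noteq> v" | k where "(u, k) \<in> inc GA" "x = ?F k"
          using \<open>(u, x) \<in> inc ?I\<close> unfolding incI by blast
        then show ?thesis
        proof cases
          case 1
          then have "x \<in> f ` ext a" using gb(4) hsF True by blast
          then show ?thesis using in_v[OF 1(1)] 1(2) by simp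
        next
          case 2
          then have "k = h" using T(7) h ga(4) by (metis inj_onD shape_simps(1))
          then show ?thesis using 2 w ga(9) by blast
        qed
      qed
      moreover have "(w, x) \<in> inc ?I" unfolding incI using w h by blast
      ultimately show ?thesis by blast
    next
      case False
      have xb: "x \<in> halves GB"
      proof (rule ccontr)
        assume "x \<notin> halves GB"
        then have "x \<in> halves GA - ext a" using x I by auto
        then have "x = ?F x" "x \<in> halves GA" using F by auto
        then show False using False by blast
      qed
      then obtain w where w: "(w, x) \<in> inc GB" using gb(10) by blast
      have "x \<notin> f ` ext a" using False hsF by blast
      then have "w \<noteq> v" using in_v[OF w] by simp
      then have "(w, x) \<in> inc ?I" unfolding incI using w by blast
      moreover have "u = w" if "(u, x) \<in> inc ?I" for u
        using that w gb(9) False ga(4) unfolding incI by blast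
      ultimately show ?thesis by blast
    qed
  next
    fix w assume w: "w \<in> verts ?I"
    show "card (half_edges_at ?I w) = 3"
    proof (cases "w \<in> verts GA")
      case True
      then have "w \<notin> verts GB" using disj_v by blast
      then have "half_edges_at ?I w = ?F ` half_edges_at GA w"
        using gb(3) incI by (auto simp: half_edges_at_def)
      moreover have "inj_on ?F (half_edges_at GA w)"
        by (rule inj_on_subset[OF T(7)]) (use ga(4) in \<open>auto simp: half_edges_at_def\<close>)
      ultimately show ?thesis using ga(12)[OF True] by (simp add: card_image)
    next
      case False
      then have "w \<in> verts GB" "w \<noteq> v" using w I by auto
      moreover have "half_edges_at ?I w = half_edges_at GB w"
        using ga(3) False \<open>w \<noteq> v\<close> incI by (auto simp: half_edges_at_def)
      ultimately show ?thesis using gb(12) by simp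
    qed
  qed
  then show "lfg_graph ?I" using ins_contraction(6)[OF fm] sh by (simp add: lfg_graph_shape)
  show "halves ?I \<subseteq> halves GA \<union> halves GB" using I by auto
qed

lemma insert_edge:
  assumes two: "card (ext a) \<noteq> 3" and e: "e \<in> internal_edges GB" and f: "f \<in> bijections (ext a) e"
  shows "f \<in> ins_maps a b" "shape (insert_at_edge GB e f GA) = ins a b f"
    "lfg_graph (insert_at_edge GB e f GA)"
    "halves (insert_at_edge GB e f GA) \<subseteq> halves GA \<union> halves GB"
proof -
  let ?I = "insert_at_edge GB e f GA"
  obtain p q where pq: "e = {p, q}" "(p, q) \<in> adj GB" using e by (auto simp: internal_edges_def)
  have fim: "f ` ext a = {p, q}" "inj_on f (ext a)" "f \<in> extensional (ext a)"
    using f pq by (auto simp: bijections_iff)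
  have "card (ext a) = 2" using two card_ext_a by simp
  then obtain x y where xy: "ext a = {x, y}" "x \<noteq> y" by (auto simp: card_2_iff)
  have fxy: "{f x, f y} = {p, q}" using fim(1) xy by simp
  then have fadj: "(f x, f y) \<in> adj GB" "(f y, f x) \<in> adj GB"
    using pq(2) gb(7)[OF pq(2)] by (auto simp: doubleton_eq_iff)
  show fm: "f \<in> ins_maps a b"
    using two fim(3) fadj xy by (auto simp: ins_maps_def)
  note T = two_hs[OF fm two] two_ins[OF fm two xy]
  have "{(h, k) \<in> adj GB. {h, k} \<noteq> e} = adj GB - {(f x, f y), (f y, f x)}"
    unfolding pq(1) fxy[symmetric] by (auto simp: doubleton_eq_iff)
  moreover have "(\<Union>h\<in>ext a. {(h, f h), (f h, h)}) = {(x, f x), (y, f y), (f x, x), (f y, y)}"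
    using xy by auto
  ultimately have I: "verts ?I = verts GB \<union> verts GA" "halves ?I = halves GB \<union> halves GA"
    "inc ?I = inc GB \<union> inc GA"
    "adj ?I = (adj GB - {(f x, f y), (f y, f x)}) \<union> adj GA \<union> {(x, f x), (y, f y), (f x, x), (f y, y)}"
    by (simp_all add: insert_at_edge_def ext_a)
  have x1: "w \<notin> verts GB" if "(w, h) \<in> inc GA" for w h using that ga(3) disj_v by blast
  have x2: "h \<notin> halves GB" if "(w, h) \<in> inc GA" for w h using that ga(4) disj_h by blast
  show sh: "shape ?I = ins a b f"
  proof (rule hgraph.equality)
    show "hs (shape ?I) = hs (ins a b f)" using T(1) I by auto
    show "ad (shape ?I) = ad (ins a b f)" unfolding T(2) by (auto simp: I expand_def)
    have "vr b \<inter> (hs b - hs a) \<times> (hs b - hs a) = vr b" using cubicD(8)[OF bc] disj_h by auto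
    then have R: "vr (ins a b f) = vr a \<union> vr b" unfolding T(2) by (simp add: expand_def)
    have "(u, v) \<in> vr (shape ?I) \<longleftrightarrow> (u, v) \<in> vr a \<union> vr b" for u v
    proof -
      have x3: "(w, h) \<in> inc GA \<Longrightarrow> (w, k) \<notin> inc GB" for w h k using x1 gb(3) by blast
      show ?thesis by (auto simp: I dest: x3)
    qed
    then show "vr (shape ?I) = vr (ins a b f)" unfolding R by (simp only: set_eq_iff split_paired_All) simp
  qed simp
  have "trivalent ?I"
  proof (rule trivalentI_shape)
    show "cubic (shape ?I)" unfolding sh by (rule ins_contraction(5)[OF fm])
    show "finite (verts ?I)" using ga(1) gb(1) I by simp
    show "inc ?I \<subseteq> verts ?I \<times> halves ?I" using ga(3,4) gb(3,4) I by auto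
    fix u assume "u \<in> halves ?I"
    then obtain w where w: "(w, u) \<in> inc ?I" using ga(10) gb(10) unfolding I by blast
    have "w' = w" if "(w', u) \<in> inc ?I" for w'
    proof (cases "u \<in> halves GB")
      case True
      then have "(w, u) \<in> inc GB" "(w', u) \<in> inc GB" using w that x2 unfolding I by blast+
      then show ?thesis using gb(9) by blast
    next
      case False
      then have "(w, u) \<in> inc GA" "(w', u) \<in> inc GA" using w that gb(4) unfolding I by blast+
      then show ?thesis using ga(9) by blast
    qed
    with w show "\<exists>!w. (w, u) \<in> inc ?I" by blast
  next
    fix w assume w: "w \<in> verts ?I"
    show "card (half_edges_at ?I w) = 3"
    proof (cases "w \<in> verts GA")
      case True
      then have "half_edges_at ?I w = half_edges_at GA w"
        using gb(3) disj_v I by (auto simp: half_edges_at_def)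
      then show ?thesis using ga(12)[OF True] by simp
    next
      case False
      then have "half_edges_at ?I w = half_edges_at GB w"
        using ga(3) I by (auto simp: half_edges_at_def)
      then show ?thesis using gb(12) w False I by simp
    qed
  qed
  then show "lfg_graph ?I" using ins_contraction(6)[OF fm] sh by (simp add: lfg_graph_shape)
  show "halves ?I \<subseteq> halves GA \<union> halves GB" using I by auto
qed

lemma ins_maps_three:
  assumes "card (ext a) = 3"
  shows "ins_maps a b = (\<Union>v\<in>verts GB. bijections (ext a) (half_edges_at GB v))"
proof (intro set_eqI iffI)
  fix f assume "f \<in> ins_maps a b"
  then obtain y where y: "f \<in> extensional (ext a)" "inj_on f (ext a)" "y \<in> halves GB" "f ` ext a = vr b `` {y}"
    using assms by (auto simp: ins_maps_def)
  obtain v where v: "(v, y) \<in> inc GB" using gb(10) y(3) by blast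
  then have "f \<in> bijections (ext a) (half_edges_at GB v)" using y half_edges_b[OF v] by (simp add: bijections_iff)
  then show "f \<in> (\<Union>v\<in>verts GB. bijections (ext a) (half_edges_at GB v))" using gb(3) v by blast
qed (use insert_vertex(1)[OF assms] in blast)

lemma ins_maps_two:
  assumes "card (ext a) \<noteq> 3"
  shows "ins_maps a b = (\<Union>e\<in>internal_edges GB. bijections (ext a) e)"
proof (intro set_eqI iffI)
  fix f assume f: "f \<in> ins_maps a b"
  have "card (ext a) = 2" using assms card_ext_a by simp
  then obtain x y where xy: "ext a = {x, y}" "x \<noteq> y" by (auto simp: card_2_iff)
  then have fx: "(f x, f y) \<in> adj GB" "f \<in> extensional (ext a)" using f assms by (auto simp: ins_maps_def)
  then have "f x \<noteq> f y" using gb(8) by metis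
  then have "f \<in> bijections (ext a) {f x, f y}" using fx xy by (auto simp: bijections_iff inj_on_def)
  moreover have "{f x, f y} \<in> internal_edges GB" using fx by (auto simp: internal_edges_def)
  ultimately show "f \<in> (\<Union>e\<in>internal_edges GB. bijections (ext a) e)" by blast
qed (use insert_edge(1)[OF assms] in blast)

text \<open>Distinct vertices, like distinct internal edges, have distinct sets of half-edges, so
  the double sum runs over \<open>ins_maps\<close> without repetition.\<close>

lemma sum_insertions:
  assumes \<rho>: "inj_on \<rho> (halves GA \<union> halves GB)"
  shows "(if card (external_edges GA) = 3 then
       \<Sum>v\<in>verts GB. \<Sum>f\<in>bijections (external_edges GA) (half_edges_at GB v).
         single (iso_class (insert_at_vertex GB v f GA, \<rho>)) 1
     else
       \<Sum>e\<in>internal_edges GB. \<Sum>f\<in>bijections (external_edges GA) e.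
         single (iso_class (insert_at_edge GB e f GA, \<rho>)) (1::rat))
    = (\<Sum>f\<in>ins_maps a b. single (cls (ins a b f)) 1)"
proof -
  have fin: "finite (bijections (ext a) T)" if "bijections (ext a) T \<subseteq> ins_maps a b" for T
    using finite_subset[OF that finite_ins_maps] .
  have djb: "bijections (ext a) S \<inter> bijections (ext a) T = {}" if "S \<noteq> T" for S T
    using that by (auto simp: bijections_iff)
  show ?thesis
  proof (cases "card (ext a) = 3")
    case True
    have "half_edges_at GB v \<noteq> half_edges_at GB w" if "v \<in> verts GB" "v \<noteq> w" for v w
      using half_edges_at_ne[OF GB that(1)] gb(9) that(2) by (auto simp: half_edges_at_def)
    then have "(\<Sum>f\<in>ins_maps a b. single (cls (ins a b f)) (1::rat))
      = (\<Sum>v\<in>verts GB. \<Sum>f\<in>bijections (ext a) (half_edges_at GB v). single (cls (ins a b f)) 1)"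
      unfolding ins_maps_three[OF True]
      by (intro sum.UNION_disjoint ballI impI gb(1) djb fin) (auto simp: ins_maps_three[OF True])
    also have "\<dots> = (\<Sum>v\<in>verts GB. \<Sum>f\<in>bijections (ext a) (half_edges_at GB v).
         single (iso_class (insert_at_vertex GB v f GA, \<rho>)) 1)"
    proof (intro sum.cong refl)
      fix v f assume "v \<in> verts GB" "f \<in> bijections (ext a) (half_edges_at GB v)"
      note I = insert_vertex[OF True this]
      show "single (cls (ins a b f)) (1::rat) = single (iso_class (insert_at_vertex GB v f GA, \<rho>)) 1"
        using iso_class_cls[OF I(3) inj_on_subset[OF \<rho> I(4)]] I(2) by simp
    qed
    finally show ?thesis using True by (simp add: ext_a)
  next
    case False
    have "finite (internal_edges GB)"
    proof -
      have "internal_edges GB \<subseteq> Pow (halves GB)" using gb(5,6) by (auto simp: internal_edges_def)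
      then show ?thesis using gb(2) finite_subset by blast
    qed
    then have "(\<Sum>f\<in>ins_maps a b. single (cls (ins a b f)) (1::rat))
      = (\<Sum>e\<in>internal_edges GB. \<Sum>f\<in>bijections (ext a) e. single (cls (ins a b f)) 1)"
      unfolding ins_maps_two[OF False]
      by (intro sum.UNION_disjoint ballI impI djb fin) (auto simp: ins_maps_two[OF False])
    also have "\<dots> = (\<Sum>e\<in>internal_edges GB. \<Sum>f\<in>bijections (ext a) e.
         single (iso_class (insert_at_edge GB e f GA, \<rho>)) 1)"
    proof (intro sum.cong refl)
      fix e f assume "e \<in> internal_edges GB" "f \<in> bijections (ext a) e"
      note I = insert_edge[OF False this]
      show "single (cls (ins a b f)) (1::rat) = single (iso_class (insert_at_edge GB e f GA, \<rho>)) 1"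
        using iso_class_cls[OF I(3) inj_on_subset[OF \<rho> I(4)]] I(2) by simp
    qed
    finally show ?thesis using False by (simp add: ext_a)
  qed
qed

end

lemma doubling_inj: "inj (\<lambda>n::nat. 2 * n)" "inj (\<lambda>n::nat. 2 * n + 1)"
  by (auto intro: injI)

lemma doubling_disjoint: "(\<lambda>n::nat. 2 * n) ` S \<inter> (\<lambda>n. 2 * n + 1) ` T = {}"
proof -
  have "2 * x \<noteq> 2 * y + 1" for x y :: nat by presburger
  then show ?thesis by blast
qed

abbreviation lcopy :: "lfg_class \<Rightarrow> hgraph" where "lcopy X \<equiv> himg (\<lambda>n. 2 * n) (rep X)"
abbreviation rcopy :: "lfg_class \<Rightarrow> hgraph" where "rcopy Y \<equiv> himg (\<lambda>n. 2 * n + 1) (rep Y)"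

lemma copies_props: "lfgh (lcopy X)" "lfgh (rcopy X)" "cls (lcopy X) = X" "cls (rcopy X) = X"
  "hs (lcopy X) \<inter> hs (rcopy Y) = {}"
  using lfgh_himg doubling_inj rep cls_himg doubling_disjoint by (simp_all del: One_nat_def)

lemma insertion_sum_rep:
  assumes A: "connected_class A"
  shows "insertion_sum (representative A) (representative B)
    = (\<Sum>f\<in>ins_maps (lcopy A) (rcopy B). single (cls (ins (lcopy A) (rcopy B) f)) 1)"
proof -
  obtain G \<rho> H \<sigma> where e: "representative A = (G, \<rho>)" "representative B = (H, \<sigma>)" by fastforce
  have G: "trivalent G" "lfgh (shape G)" and H: "trivalent H" "lfgh (shape H)"
    using representative_lfg[of A] representative_lfg[of B] e
    by (auto simp: labeled_feynman_graph_def lfg_graph_shape)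
  have r: "rep A = shape G" "rep B = shape H" using e by (simp_all add: rep_def)
  note L = shape_relabel[OF doubling_inj(1) G(1), folded left_copy_def]
  note R = shape_relabel[OF doubling_inj(2) H(1), folded right_copy_def]
  have d: "verts (left_copy G) \<inter> verts (right_copy H) = {}" "halves (left_copy G) \<inter> halves (right_copy H) = {}"
    using doubling_disjoint by (simp_all add: left_copy_def right_copy_def relabel_def del: One_nat_def)
  have c: "conn (shape (left_copy G))"
    unfolding L(1) using A conn_himg[OF doubling_inj(1)] r by (simp add: connected_class_rep)
  interpret graph_insertion "left_copy G" "right_copy H"
    using L R d c lfgh_himg[OF doubling_inj(1) G(2)] lfgh_himg[OF doubling_inj(2) H(2)]
    by unfold_locales simp_all
  have "labeled_feynman_graph (representative A \<oplus> representative B)"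
    by (rule disjoint_union_class(1)[OF representative_lfg representative_lfg])
  then have "inj_on (join_labels \<rho> \<sigma>) (halves (left_copy G) \<union> halves (right_copy H))"
    by (simp add: labeled_feynman_graph_def disjoint_union_def e graph_union_def)
  from sum_insertions[OF this] show ?thesis
    by (simp add: insertion_sum_def Let_def e r L(1) R(1))
qed

lemma insertion_copies: "connected_class A \<Longrightarrow> insertion (lcopy A) (rcopy B)"
  by unfold_locales
    (use copies_props conn_himg[OF doubling_inj(1)] connected_class_rep in \<open>auto simp del: himg_simps\<close>)

section \<open>The isomorphism\<close>

text \<open>The change of basis between counting insertions, which are maps, and counting subgraphs,
  which are images of maps.\<close>

definition weigh :: "hall \<Rightarrow> hall"
  where "weigh = lin_ext (\<lambda>X. of_nat (aut X) *\<^sub>Q single X 1)"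

lemma qlinear_weigh: "qlinear weigh"
  unfolding weigh_def by (rule qlinear_lin_ext)

lemma weigh_single: "weigh (single X 1) = of_nat (aut X) *\<^sub>Q single X 1"
  by (simp add: weigh_def scaleQ_one)

lemma lookup_weigh: "lookup (weigh f) X = of_nat (aut X) * lookup f X"
  by (simp add: weigh_def lin_ext_def lookup_sum lookup_scaleQ scaleQ_rat_def lookup_single when_def
      if_distrib sum.delta in_keys_iff cong: if_cong)

lemma weigh_inj: "weigh f = weigh g \<Longrightarrow> f = g"
  by (rule poly_mapping_eqI) (metis aut_pos lookup_weigh mult_cancel_left of_nat_eq_0_iff less_irrefl)

definition star :: "lfg_class \<Rightarrow> lfg_class \<Rightarrow> hall"
  where "star A B = insertion_sum (representative A) (representative B)"

text \<open>The factor \<open>aut (cls g)\<close> replaces each insertion isomorphic to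
  \<open>g\<close> by the set of its isomorphisms to \<open>g\<close>. By
  \<open>insertion_count\<close> these are distributed over the subgraphs of \<open>g\<close> that
  are no components, and each copy of \<open>A\<close> with quotient \<open>B\<close> receives
  \<open>aut A * aut B\<close> of them.\<close>

lemma lookup_weigh_star:
  assumes A: "connected_class A" and g: "lfgh g"
  shows "lookup (weigh (star A B)) (cls g)
    = of_nat (aut A) * of_nat (aut B) * of_nat (card {c \<in> copies A g. cls (quo g c) = B \<and> \<not> ext c \<subseteq> ext g})"
proof -
  interpret insertion "lcopy A" "rcopy B" by (rule insertion_copies[OF A])
  let ?M = "ins_maps (lcopy A) (rcopy B)" and ?ins = "ins (lcopy A) (rcopy B)"
  have lq: "lfgh (quo g c)" if "csub c g" for c using lfgh_quo_sub[OF g] that by (simp add: csub_def)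
  have fin: "finite {c. csub c g}"
    by (rule finite_subset[OF _ finite_sub[OF lfgh_cubic[OF g]]]) (auto simp: csub_def)
  have "lookup (weigh (star A B)) (cls g)
      = (\<Sum>f\<in>?M. of_nat (aut (cls g)) * (1 when cls (?ins f) = cls g))"
    by (simp only: lookup_weigh star_def insertion_sum_rep[OF A] lookup_sum lookup_single sum_distrib_left)
  also have "\<dots> = (\<Sum>f\<in>?M. of_nat (card (Iso (?ins f) g)))"
  proof (rule sum.cong[OF refl])
    fix f assume "f \<in> ?M"
    note c = card_Iso[OF ins_contraction(6)[OF this] g]
    show "of_nat (aut (cls g)) * (1 when cls (?ins f) = cls g) = rat_of_nat (card (Iso (?ins f) g))"
      unfolding c when_def by (cases "cls (?ins f) = cls g") (simp_all only: if_True if_False mult_1_right mult_zero_right of_nat_0 simp_thms)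
  qed
  also have "\<dots> = of_nat (\<Sum>c\<in>{c. csub c g \<and> \<not> ext c \<subseteq> ext g}. card (Iso (lcopy A) c) * card (Iso (rcopy B) (quo g c)))"
    by (simp only: insertion_count[OF g, symmetric] of_nat_sum)
  also have "(\<Sum>c\<in>{c. csub c g \<and> \<not> ext c \<subseteq> ext g}. card (Iso (lcopy A) c) * card (Iso (rcopy B) (quo g c)))
      = (\<Sum>c\<in>{c. csub c g} \<inter> {c. \<not> ext c \<subseteq> ext g}. if cls c = A \<and> cls (quo g c) = B then aut A * aut B else 0)"
  proof (rule sum.cong)
    fix c assume c: "c \<in> {c. csub c g} \<inter> {c. \<not> ext c \<subseteq> ext g}"
    then have l: "lfgh c" "lfgh (quo g c)" using lq subD(1) by (auto simp: csub_def)
    show "card (Iso (lcopy A) c) * card (Iso (rcopy B) (quo g c)) = (if cls c = A \<and> cls (quo g c) = B then aut A * aut B else 0)"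
      using card_Iso[OF copies_props(1)[of A] l(1)] card_Iso[OF copies_props(2)[of B] l(2)] copies_props(3,4) by auto
  qed auto
  also have "\<dots> = aut A * aut B * card {c \<in> copies A g. cls (quo g c) = B \<and> \<not> ext c \<subseteq> ext g}"
  proof -
    have "{c \<in> {c. csub c g} \<inter> {c. \<not> ext c \<subseteq> ext g}. cls c = A \<and> cls (quo g c) = B}
        = {c \<in> copies A g. cls (quo g c) = B \<and> \<not> ext c \<subseteq> ext g}" by (auto simp: copies_def)
    then show ?thesis using fin by (simp add: sum.If_cases Int_def)
  qed
  finally show ?thesis by simp
qed

lemma lookup_mult_singles:
  assumes A: "connected_class A" and g: "lfgh g"
  shows "lookup (hall_mult (single A 1) (single B 1)) (cls g) = of_nat (card {c \<in> copies A g. cls (quo g c) = B})"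
proof -
  have "(\<Sum>c\<in>copies A g. lookup (single B (1::rat)) (cls (quo g c))) = (\<Sum>c\<in>copies A g. if cls (quo g c) = B then 1 else 0)"
    by (intro sum.cong) (auto simp: lookup_single when_def)
  then show ?thesis using finite_copies[OF lfgh_cubic[OF g], of A]
    by (simp add: lookup_mult_connected[OF g A] sum.If_cases Int_def)
qed

lemma count_image_mset_set: "finite S \<Longrightarrow> count (image_mset f (mset_set S)) y = card {x \<in> S. f x = y}"
proof (induction S rule: finite_induct)
  case (insert x S)
  have "{z \<in> insert x S. f z = y} = (if f x = y then insert x {z \<in> S. f z = y} else {z \<in> S. f z = y})" by auto
  then show ?case using insert by auto
qed simp

text \<open>The terms of the commutator supported on disconnected graphs cancel.\<close>

lemma card_component_copies:
  assumes A: "connected_class A" and B: "connected_class B" and g: "lfgh g"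
  shows "card {c \<in> copies A g. cls (quo g c) = B \<and> ext c \<subseteq> ext g}
    = card {c \<in> copies B g. cls (quo g c) = A \<and> ext c \<subseteq> ext g}"
proof -
  have eq: "card {c \<in> copies A g. cls (quo g c) = B \<and> ext c \<subseteq> ext g}
      = (if cmh g = {#A, B#} then count (cmh g) A else 0)"
    if A: "connected_class A" and B: "connected_class B" for A B
  proof -
    \<comment> \<open>A copy whose external edges stay external is a component, and the quotient has
      class \<open>B\<close> exactly when a single component of that class remains.\<close>
    have iff: "c \<in> copies A g \<and> cls (quo g c) = B \<and> ext c \<subseteq> ext g \<longleftrightarrow> c \<in> comps g \<and> cls c = A \<and> cmh g = {#A, B#}" for c
    proof (cases "c \<in> comps g")
      case True
      note p = comps_lfgh[OF g True]
      have lq: "lfgh (quo g c)" using lfgh_quo_sub[OF g] p by (simp add: csub_def)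
      have "cls (quo g c) = B \<longleftrightarrow> cmh (quo g c) = {#B#}"
        using CM_cls[OF lq] CM_single[OF B] CM_inj by metis
      then show ?thesis using True p cmh_quo_comp[OF g True] by (auto simp: copies_def)
    next
      case False
      then show ?thesis using csub_comps[OF g] by (auto simp: copies_def)
    qed
    show ?thesis
      unfolding iff using count_image_mset_set[OF finite_comps[OF lfgh_cubic[OF g]], of cls A] by (auto simp: cmh_def)
  qed
  \<comment> \<open>In a multiset of two classes both have the same multiplicity, 2 if they agree
    and 1 otherwise.\<close>
  show ?thesis unfolding eq[OF A B] eq[OF B A] by (auto simp: add_mset_commute)
qed

lemma weigh_star_commutator:
  assumes A: "connected_class A" and B: "connected_class B"
  shows "weigh (star A B) - weigh (star B A)
    = hall_mult (weigh (single A 1)) (weigh (single B 1)) - hall_mult (weigh (single B 1)) (weigh (single A 1))"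
proof (rule hall_eqI)
  fix g assume g: "lfgh g"
  have split: "card {c \<in> copies A g. cls (quo g c) = B} = card {c \<in> copies A g. cls (quo g c) = B \<and> \<not> ext c \<subseteq> ext g}
      + card {c \<in> copies A g. cls (quo g c) = B \<and> ext c \<subseteq> ext g}" for A B
  proof -
    have "{c \<in> copies A g. cls (quo g c) = B} = {c \<in> copies A g. cls (quo g c) = B \<and> \<not> ext c \<subseteq> ext g}
      \<union> {c \<in> copies A g. cls (quo g c) = B \<and> ext c \<subseteq> ext g}" by blast
    then show ?thesis
      using finite_copies[OF lfgh_cubic[OF g], of A] by (simp add: card_Un_disjoint Int_def) 
  qed
  have m: "hall_mult (weigh (single A 1)) (weigh (single B 1)) = (of_nat (aut A) * of_nat (aut B)) *\<^sub>Q hall_mult (single A 1) (single B 1)" for A B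
    by (simp add: weigh_single hall_bilinear scaleQ_scaleQ)
  show "lookup (weigh (star A B) - weigh (star B A)) (cls g)
    = lookup (hall_mult (weigh (single A 1)) (weigh (single B 1)) - hall_mult (weigh (single B 1)) (weigh (single A 1))) (cls g)"
    by (simp add: lookup_minus m lookup_scaleQ scaleQ_rat_def lookup_weigh_star[OF A g] lookup_weigh_star[OF B g]
        lookup_mult_singles[OF A g] lookup_mult_singles[OF B g] split[of A B] split[of B A]
        card_component_copies[OF A B g] algebra_simps)
qed

text \<open>The inserted graph is not a component, so contracting it preserves the number of
  components, and the quotient is the connected \<open>B\<close>.\<close>

lemma star_connected:
  assumes A: "connected_class A" and B: "connected_class B" and X: "X \<in> keys (star A B)"
  shows "connected_class X"
proof -
  interpret insertion "lcopy A" "rcopy B" by (rule insertion_copies[OF A])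
  obtain f where f: "f \<in> ins_maps (lcopy A) (rcopy B)" "X = cls (ins (lcopy A) (rcopy B) f)"
    using X unfolding star_def insertion_sum_rep[OF A] in_keys_iff lookup_sum
    by (auto elim!: sum.not_neutral_contains_not_neutral simp: lookup_single when_def split: if_splits)
  note I = ins_contraction[OF f(1)]
  interpret contraction "ins (lcopy A) (rcopy B) f" "himg (glue (lcopy A) f) (lcopy A)" by (rule I(1))
  have "size (cmh (ins (lcopy A) (rcopy B) f)) = size (cmh (rcopy B))"
    using size_cmh_quo[OF I(6) _ I(3)] I(2) sub conn by (simp add: csub_def)
  also have "cmh (rcopy B) = {#B#}"
    using CM_cls[OF copies_props(2)[of B]] CM_single[OF B] copies_props(4) by simp
  finally have "size (CM X) = 1" using CM_cls[OF I(6)] f(2) by simp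
  then obtain C where C: "CM X = {#C#}" using size_1_singleton_mset by blast
  then have "connected_class C" using CM_connected[of C X] by simp
  then have "X = C" using CM_single C CM_inj by metis
  then show ?thesis using \<open>connected_class C\<close> by simp
qed

section \<open>The insertion bracket as a commutator\<close>

lemma pre_lie_sum: "pre_lie f g = (\<Sum>X\<in>keys f. \<Sum>Y\<in>keys g. (lookup f X * lookup g Y) *\<^sub>Q star X Y)"
  by (simp add: pre_lie_def lin_ext_def star_def ratvec.scale_sum_right scaleQ_scaleQ)

lemma sum_keys_connected:
  fixes F :: "'b \<Rightarrow> hall"
  assumes "\<And>i. i \<in> I \<Longrightarrow> \<forall>X\<in>keys (F i). connected_class X"
  shows "\<forall>X\<in>keys (\<Sum>i\<in>I. F i). connected_class X"
proof (rule ccontr)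
  assume "\<not> ?thesis"
  then obtain X where X: "lookup (\<Sum>i\<in>I. F i) X \<noteq> 0" "\<not> connected_class X" by (auto simp: in_keys_iff)
  then have "(\<Sum>i\<in>I. lookup (F i) X) \<noteq> 0" by (simp add: lookup_sum)
  then obtain i where "i \<in> I" "lookup (F i) X \<noteq> 0" by (rule sum.not_neutral_contains_not_neutral)
  then show False using assms X(2) by (auto simp: in_keys_iff)
qed

lemma pre_lie_connected:
  assumes "\<forall>X\<in>keys f. connected_class X" "\<forall>X\<in>keys g. connected_class X"
  shows "\<forall>X\<in>keys (pre_lie f g). connected_class X"
  unfolding pre_lie_sum
proof (intro sum_keys_connected ballI)
  fix X Y Z assume "X \<in> keys f" "Y \<in> keys g" "Z \<in> keys ((lookup f X * lookup g Y) *\<^sub>Q star X Y)"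
  then show "connected_class Z"
    using star_connected[of X Y Z] assms by (auto simp: in_keys_iff lookup_scaleQ scaleQ_rat_def)
qed

lemma Rep_connected: "\<forall>X\<in>keys (Rep_nlfg x). connected_class X"
  using Rep_nlfg[of x] by simp

text \<open>\<open>Abs_nlfg\<close> can be inverted only on combinations of connected classes, which
  is where \<open>pre_lie_connected\<close> enters.\<close>

lemma Rep_bracket: "Rep_nlfg (lie_bracket x y) = pre_lie (Rep_nlfg x) (Rep_nlfg y) - pre_lie (Rep_nlfg y) (Rep_nlfg x)"
proof -
  have "\<forall>X\<in>keys (pre_lie (Rep_nlfg x) (Rep_nlfg y) - pre_lie (Rep_nlfg y) (Rep_nlfg x)). connected_class X"
    using pre_lie_connected[OF Rep_connected Rep_connected, of x y] pre_lie_connected[OF Rep_connected Rep_connected, of y x]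
    by (auto simp: in_keys_iff lookup_minus)
  then show ?thesis unfolding lie_bracket_nlfg_def by (subst Abs_nlfg_inverse) auto
qed

definition psi :: "nlfg \<Rightarrow> hall"
  where "psi x = weigh (Rep_nlfg x)"

lemma Rep_linear: "Rep_nlfg (x + y) = Rep_nlfg x + Rep_nlfg y" "Rep_nlfg (r *\<^sub>Q x) = r *\<^sub>Q Rep_nlfg x"
  by (transfer, simp)+

lemma qlinear_psi: "qlinear psi"
  by (rule qlinearI) (simp_all add: psi_def Rep_linear qlinear_add[OF qlinear_weigh] qlinear_scale[OF qlinear_weigh])

lemma psi_inj: "psi x = psi y \<Longrightarrow> x = y"
  unfolding psi_def using weigh_inj Rep_nlfg_inject by blast

lemma psi_bracket: "psi (lie_bracket x y) = hall_mult (psi x) (psi y) - hall_mult (psi y) (psi x)"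
proof -
  let ?f = "Rep_nlfg x" and ?g = "Rep_nlfg y"
  note W = qlinear_sum[OF qlinear_weigh] qlinear_scale[OF qlinear_weigh]
  have prod: "hall_mult (weigh f) (weigh g) = (\<Sum>X\<in>keys f. \<Sum>Y\<in>keys g. (lookup f X * lookup g Y) *\<^sub>Q
      hall_mult (weigh (single X 1)) (weigh (single Y 1)))" for f g
  proof -
    have e: "weigh f = (\<Sum>X\<in>keys f. lookup f X *\<^sub>Q weigh (single X 1))" for f
      by (subst poly_mapping_expand[of f]) (simp only: W)
    have l: "qlinear (\<lambda>u. hall_mult u v)" "qlinear (hall_mult v)" for v
      using qbilinear_hall by (auto simp: qbilinear_def)
    show ?thesis
      unfolding e[of f] e[of g] qlinear_sum[OF l(1)] qlinear_sum[OF l(2)] hall_bilinear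
      by (simp add: ratvec.scale_sum_right scaleQ_scaleQ mult.commute, rule sum.swap)
  qed
  have swap: "(\<Sum>X\<in>keys ?g. \<Sum>Y\<in>keys ?f. (lookup ?g X * lookup ?f Y) *\<^sub>Q F X Y)
      = (\<Sum>X\<in>keys ?f. \<Sum>Y\<in>keys ?g. (lookup ?f X * lookup ?g Y) *\<^sub>Q F Y X)" for F :: "_ \<Rightarrow> _ \<Rightarrow> hall"
    by (subst sum.swap) (simp add: mult.commute)
  have "psi (lie_bracket x y) = (\<Sum>X\<in>keys ?f. \<Sum>Y\<in>keys ?g. (lookup ?f X * lookup ?g Y) *\<^sub>Q (weigh (star X Y) - weigh (star Y X)))"
    unfolding psi_def Rep_bracket qlinear_diff[OF qlinear_weigh] pre_lie_sum W swap
    by (simp add: sum_subtractf ratvec.scale_right_diff_distrib)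
  also have "\<dots> = (\<Sum>X\<in>keys ?f. \<Sum>Y\<in>keys ?g. (lookup ?f X * lookup ?g Y) *\<^sub>Q
      (hall_mult (weigh (single X 1)) (weigh (single Y 1)) - hall_mult (weigh (single Y 1)) (weigh (single X 1))))"
    by (intro sum.cong refl arg_cong[where f = "\<lambda>u. _ *\<^sub>Q u"] weigh_star_commutator) (use Rep_connected in blast)+
  also have "\<dots> = hall_mult (psi x) (psi y) - hall_mult (psi y) (psi x)"
    unfolding psi_def prod[of ?f ?g] prod[of ?g ?f] swap by (simp add: sum_subtractf ratvec.scale_right_diff_distrib)
  finally show ?thesis .
qed

lemmas hall_simps = qbilinearD[OF qbilinear_hall]

text \<open>The injection \<open>psi\<close> carries the bracket to the commutator of an associative
  algebra, where the Jacobi identity is automatic. In this way no insertions have to be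
  composed.\<close>

lemma lie_algebra_nlfg: "lie_algebra (lie_bracket :: nlfg \<Rightarrow> nlfg \<Rightarrow> nlfg)"
proof -
  note P = qlinear_add[OF qlinear_psi] qlinear_scale[OF qlinear_psi] qlinear_zero[OF qlinear_psi] psi_bracket
  have "qbilinear (lie_bracket :: nlfg \<Rightarrow> nlfg \<Rightarrow> nlfg)"
    by (rule qbilinearI; rule psi_inj; simp add: P hall_simps ratvec.scale_right_diff_distrib)
  moreover have "lie_bracket x x = 0" for x :: nlfg by (rule psi_inj) (simp add: P)
  moreover have "lie_bracket x (lie_bracket y z) + lie_bracket y (lie_bracket z x) + lie_bracket z (lie_bracket x y) = 0"
    for x y z :: nlfg
    by (rule psi_inj) (simp add: P hall_simps hall_assoc)
  ultimately show ?thesis by (simp add: lie_algebra_def)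
qed

definition phi :: "nlfg uea \<Rightarrow> hall"
  where "phi = uea_lift hall_mult hall_one psi"

lemmas phi_simps = uea_lift[OF hall_unital_algebra qlinear_psi psi_bracket, folded phi_def]

definition basis :: "lfg_class \<Rightarrow> nlfg"
  where "basis A = Abs_nlfg (single A 1)"

lemma Rep_basis: "connected_class A \<Longrightarrow> Rep_nlfg (basis A) = single A 1"
  unfolding basis_def by (subst Abs_nlfg_inverse) auto

lemma psi_basis: "connected_class A \<Longrightarrow> psi (basis A) = of_nat (aut A) *\<^sub>Q single A 1"
  by (simp add: psi_def Rep_basis weigh_single)

lemma qlinear_Rep: "qlinear Rep_nlfg"
  by (rule qlinearI) (simp_all add: Rep_linear)

lemma basis_expand: "x = (\<Sum>A\<in>keys (Rep_nlfg x). lookup (Rep_nlfg x) A *\<^sub>Q basis A)"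
proof -
  have "Rep_nlfg (\<Sum>A\<in>keys (Rep_nlfg x). lookup (Rep_nlfg x) A *\<^sub>Q basis A)
      = (\<Sum>A\<in>keys (Rep_nlfg x). lookup (Rep_nlfg x) A *\<^sub>Q single A 1)"
    unfolding qlinear_sum[OF qlinear_Rep] Rep_linear
    using Rep_connected[of x] by (intro sum.cong refl) (simp add: Rep_basis)
  then show ?thesis using poly_mapping_expand[of "Rep_nlfg x"] Rep_nlfg_inject by metis
qed

lemma phi_surj: "surj phi"
proof -
  have "\<exists>u. phi u = f" for f
  proof (induction f rule: hall_word_induct)
    case one
    show ?case using phi_simps(3) by blast
  next
    case (mult A f)
    then obtain u where u: "phi u = f" by blast
    \<comment> \<open>The scalar undoes the weight that \<open>psi\<close> puts on
      \<open>A\<close>.\<close>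
    have "phi ((1 / of_nat (aut A)) *\<^sub>Q uea_mult (uea_incl (basis A)) u) = hall_mult (single A 1) f"
      using aut_pos[of A] mult(1) u
      by (simp add: qlinear_scale[OF phi_simps(1)] phi_simps(2,4) psi_basis hall_bilinear scaleQ_scaleQ scaleQ_one)
    then show ?case by blast
  next
    case (add f g) then show ?case using qlinear_add[OF phi_simps(1)] by metis
  next
    case (scale r f) then show ?case using qlinear_scale[OF phi_simps(1)] by metis
  next
    case zero show ?case using qlinear_zero[OF phi_simps(1)] by blast
  qed
  then show ?thesis by (metis surjI)
qed

section \<open>Spanning monomials of the enveloping algebra\<close>

definition uw :: "lfg_class list \<Rightarrow> nlfg uea"
  where "uw w = foldr (\<lambda>A. uea_mult (uea_incl (basis A))) w uea_one"

lemma uw_simps [simp]: "uw [] = uea_one" "uw (A # w) = uea_mult (uea_incl (basis A)) (uw w)"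
  by (simp_all add: uw_def)

text \<open>The filtration by word length with a strict bound, so that working modulo
  \<open>cwords (length w)\<close> means up to shorter words.\<close>

definition cwords :: "nat \<Rightarrow> nlfg uea set"
  where "cwords n = ratvec.span (uw ` {w. (\<forall>A\<in>set w. connected_class A) \<and> length w < n})"

lemma cwords_mult:
  assumes A: "connected_class A" and u: "u \<in> cwords n"
  shows "uea_mult (uea_incl (basis A)) u \<in> cwords (Suc n)"
  using u unfolding cwords_def
proof (induction rule: ratvec.span_induct_alt)
  case base show ?case by (simp add: uea_simps ratvec.span_zero)
next
  case (step c v y)
  then obtain w where w: "\<forall>A\<in>set w. connected_class A" "length w < n" "v = uw w" by auto
  have "uea_mult (uea_incl (basis A)) v \<in> ratvec.span (uw ` {w. (\<forall>A\<in>set w. connected_class A) \<and> length w < Suc n})"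
    by (intro ratvec.span_base image_eqI[of _ _ "A # w"]) (use w A in auto)
  with step show ?case by (simp add: uea_simps ratvec.span_add ratvec.span_scale)
qed

text \<open>Every \<open>x\<close> of the Lie algebra, in particular a bracket, is a combination of
  single letters. The product thus has words of \<open>Suc (length w)\<close> letters, just below
  the strict bound.\<close>

lemma cwords_bracket:
  assumes w: "\<forall>A\<in>set w. connected_class A"
  shows "uea_mult (uea_incl x) (uw w) \<in> cwords (Suc (Suc (length w)))"
proof -
  have l: "qlinear (\<lambda>x. uea_mult (uea_incl x) (uw w))" by (rule qlinear_compose[OF uea_simps(6) uea_incl_linear])
  have "uea_mult (uea_incl x) (uw w)
      = (\<Sum>A\<in>keys (Rep_nlfg x). lookup (Rep_nlfg x) A *\<^sub>Q uea_mult (uea_incl (basis A)) (uw w))"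
    by (subst basis_expand) (simp only: qlinear_sum[OF l] qlinear_scale[OF l])
  also have "\<dots> \<in> cwords (Suc (Suc (length w)))"
    unfolding cwords_def
  proof (intro ratvec.span_sum ratvec.span_scale ratvec.span_base)
    fix A assume "A \<in> keys (Rep_nlfg x)"
    then have "connected_class A" using Rep_connected by blast
    then show "uea_mult (uea_incl (basis A)) (uw w)
        \<in> uw ` {v. (\<forall>A\<in>set v. connected_class A) \<and> length v < Suc (Suc (length w))}"
      using w by (intro image_eqI[of _ _ "A # w"]) auto
  qed
  finally show ?thesis .
qed

text \<open>Each exchange of neighbours costs a bracket, which replaces two letters by one.\<close>

lemma uw_move_front:
  assumes "\<forall>A\<in>set (p @ x # q). connected_class A"
  shows "uw (p @ x # q) - uw (x # p @ q) \<in> cwords (length (p @ x # q))"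
  using assms
proof (induction p)
  case Nil show ?case by (simp add: cwords_def ratvec.span_zero)
next
  case (Cons y p)
  have 1: "uea_mult (uea_incl (basis y)) (uw (p @ x # q) - uw (x # p @ q)) \<in> cwords (length ((y # p) @ x # q))"
    using cwords_mult[OF _ Cons.IH] Cons.prems by simp
  have "uw (y # x # p @ q) - uw (x # y # p @ q) = uea_mult (uea_incl (lie_bracket (basis y) (basis x))) (uw (p @ q))"
    by (simp add: uea_incl_bracket uea_simps uea_assoc)
  moreover have "uea_mult (uea_incl (lie_bracket (basis y) (basis x))) (uw (p @ q)) \<in> cwords (Suc (Suc (length (p @ q))))"
    by (rule cwords_bracket) (use Cons.prems in auto)
  ultimately have 2: "uw (y # x # p @ q) - uw (x # y # p @ q) \<in> cwords (length ((y # p) @ x # q))" by simp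
  have eq: "uw ((y # p) @ x # q) - uw (x # (y # p) @ q)
      = uea_mult (uea_incl (basis y)) (uw (p @ x # q) - uw (x # p @ q)) + (uw (y # x # p @ q) - uw (x # y # p @ q))"
    by (simp add: uea_simps)
  show ?case unfolding eq using 1 2 unfolding cwords_def by (rule ratvec.span_add)
qed

lemma uw_perm:
  assumes "\<forall>A\<in>set w. connected_class A" "mset w = mset w'"
  shows "uw w - uw w' \<in> cwords (length w)"
  using assms
proof (induction w arbitrary: w')
  case Nil then show ?case by (simp add: cwords_def ratvec.span_zero)
next
  case (Cons x u)
  have "x \<in> set w'" using Cons.prems(2) by (metis list.set_intros(1) mset_eq_setD)
  then obtain p q where w': "w' = p @ x # q" by (meson split_list)
  have m: "mset u = mset (p @ q)" using Cons.prems(2) w' by simp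
  have len: "length w' = Suc (length u)" using Cons.prems(2) by (metis length_Cons size_mset)
  have "uw u - uw (p @ q) \<in> cwords (length u)" using Cons.IH[OF _ m] Cons.prems(1) by simp
  then have 1: "uw (x # u) - uw (x # p @ q) \<in> cwords (length (x # u))"
    using cwords_mult[of x] Cons.prems(1) by (simp add: uea_simps flip: uea_simps(8))
  have "\<forall>A\<in>set (p @ x # q). connected_class A"
    using Cons.prems w' by (metis mset_eq_setD)
  then have "uw (p @ x # q) - uw (x # p @ q) \<in> cwords (length (x # u))"
    using uw_move_front[of p x q] len w' by simp
  then have "uw (x # u) - uw (x # p @ q) - (uw (p @ x # q) - uw (x # p @ q)) \<in> cwords (length (x # u))"
    using 1 unfolding cwords_def by (rule ratvec.span_diff[rotated])
  then show ?case by (simp add: w')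
qed

text \<open>Any choice of order will do, since by \<open>uw_perm\<close> two orders differ by
  shorter words.\<close>

definition list_of :: "lfg_class multiset \<Rightarrow> lfg_class list"
  where "list_of M = (SOME w. mset w = M)"

lemma mset_list_of: "mset (list_of M) = M"
  unfolding list_of_def by (rule someI_ex) (rule ex_mset)

definition msets :: "lfg_class multiset set"
  where "msets = {M. \<forall>A\<in>#M. connected_class A}"

lemma uw_in_span:
  "\<forall>A\<in>set w. connected_class A \<Longrightarrow> uw w \<in> ratvec.span ((\<lambda>M. uw (list_of M)) ` msets)"
proof (induction "length w" arbitrary: w rule: less_induct)
  case less
  let ?V = "ratvec.span ((\<lambda>M. uw (list_of M)) ` msets)"
  have "uw w - uw (list_of (mset w)) \<in> cwords (length w)"
    using uw_perm[OF less.prems, of "list_of (mset w)"] by (simp add: mset_list_of)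
  moreover have "cwords (length w) \<subseteq> ?V"
    unfolding cwords_def by (rule ratvec.span_minimal) (use less.hyps in \<open>auto simp: ratvec.subspace_span\<close>)
  moreover have "uw (list_of (mset w)) \<in> ?V"
    by (intro ratvec.span_base) (use less.prems in \<open>auto simp: msets_def\<close>)
  ultimately have "(uw w - uw (list_of (mset w))) + uw (list_of (mset w)) \<in> ?V"
    by (intro ratvec.span_add) auto
  then show ?case by simp
qed

lemma uea_span: "u \<in> ratvec.span (uw ` {w. \<forall>A\<in>set w. connected_class A})"
proof (induction u rule: uea_induct)
  case one
  show ?case by (intro ratvec.span_base image_eqI[of _ _ "[]"]) auto
next
  case (mult x u)
  then show ?case
  proof (induction rule: ratvec.span_induct_alt)
    case base show ?case by (simp add: uea_simps ratvec.span_zero)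
  next
    case (step c v y)
    then obtain w where w: "\<forall>A\<in>set w. connected_class A" "v = uw w" by auto
    have "uea_mult (uea_incl x) v \<in> cwords (Suc (Suc (length w)))" using cwords_bracket[OF w(1)] w(2) by simp
    moreover have "cwords n \<subseteq> ratvec.span (uw ` {w. \<forall>A\<in>set w. connected_class A})" for n
      unfolding cwords_def by (rule ratvec.span_mono) auto
    ultimately show ?case using step by (auto simp: uea_simps intro!: ratvec.span_add ratvec.span_scale)
  qed
qed (auto intro: ratvec.span_add ratvec.span_scale)

text \<open>The easy half of the Poincare-Birkhoff-Witt theorem; uniqueness of \<open>p\<close> is
  obtained in \<open>phi_inj\<close> from the images of the monomials.\<close>

lemma uea_normal_form:
  "\<exists>p. (\<forall>M\<in>keys p. M \<in> msets) \<and> u = lin_ext (\<lambda>M. uw (list_of M)) p"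
proof -
  let ?V = "ratvec.span ((\<lambda>M. uw (list_of M)) ` msets)"
  have "ratvec.span (uw ` {w. \<forall>A\<in>set w. connected_class A}) \<subseteq> ?V"
    by (rule ratvec.span_minimal) (use uw_in_span in \<open>auto simp: ratvec.subspace_span\<close>)
  then have "u \<in> ?V" using uea_span by blast
  then show ?thesis
  proof (induction rule: ratvec.span_induct_alt)
    case base
    show ?case by (intro exI[of _ 0]) (simp add: lin_ext_def)
  next
    case (step c v y)
    then obtain M p where M: "M \<in> msets" "v = uw (list_of M)" and p: "\<forall>M\<in>keys p. M \<in> msets" "y = lin_ext (\<lambda>M. uw (list_of M)) p"
      by auto
    let ?p = "single M c + p"
    have "\<forall>M\<in>keys ?p. M \<in> msets"
      using M(1) p(1) by (auto simp: in_keys_iff lookup_add lookup_single when_def split: if_splits)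
    moreover have "c *\<^sub>Q v + y = lin_ext (\<lambda>M. uw (list_of M)) ?p"
      by (simp add: qlinear_add[OF qlinear_lin_ext] M p)
    ultimately show ?case by blast
  qed
qed

lemma phi_uw: "\<forall>A\<in>set w. connected_class A \<Longrightarrow> phi (uw w) = (\<Prod>A\<leftarrow>w. of_nat (aut A)) *\<^sub>Q pw w"
  by (induction w) (simp_all add: phi_simps psi_basis hall_bilinear scaleQ_scaleQ scaleQ_one mult.commute)

lemma phi_inj: "inj phi"
proof (rule injI)
  fix u v assume "phi u = phi v"
  then have 0: "phi (u - v) = 0" by (simp add: qlinear_diff[OF phi_simps(1)])
  obtain p where p: "\<forall>M\<in>keys p. M \<in> msets" "u - v = lin_ext (\<lambda>M. uw (list_of M)) p" using uea_normal_form by blast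
  let ?c = "\<lambda>M. (\<Prod>A\<leftarrow>list_of M. of_nat (aut A)) :: rat"
  have conn: "\<forall>A\<in>set (list_of M). connected_class A" if "M \<in> keys p" for M
  proof -
    have "set (list_of M) = set_mset M" by (metis mset_list_of set_mset_mset)
    then show ?thesis using p(1) that by (auto simp: msets_def)
  qed
  have "lin_ext (\<lambda>M. ?c M *\<^sub>Q pw (list_of M)) p = phi (u - v)"
    unfolding p(2) lin_ext_def qlinear_sum[OF phi_simps(1)] qlinear_scale[OF phi_simps(1)]
    using conn by (intro sum.cong refl) (simp add: phi_uw)
  moreover have "?c M \<noteq> 0" for M
    using aut_pos by (auto simp: prod_list_zero_iff) (metis less_irrefl)
  ultimately have "p = 0"
    using p(1) mset_list_of 0
    by (intro triangular_independent[of p list_of ?c]) (auto simp: msets_def)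
  then show "u = v" using p(2) by (simp add: lin_ext_def)
qed

section \<open>The coproduct\<close>

lemma qbilinear_lookup: "qbilinear (\<lambda>f g :: hall. lookup f X * lookup g Y)"
  by (rule qbilinearI) (simp_all add: lookup_add lookup_scaleQ scaleQ_rat_def algebra_simps)

lemma qlinear_tensor_lookup: "qlinear (\<lambda>t. tensor_lookup t X Y)"
  unfolding tensor_lookup_def by (rule qlinear_tensor_lift[OF qbilinear_lookup])

lemma tensor_lookup_tens: "tensor_lookup (f \<otimes> g) X Y = lookup f X * lookup g Y"
  unfolding tensor_lookup_def by (rule tensor_lift_tens[OF qbilinear_lookup])

lemma tensor_basis_expand:
  fixes t :: "hall \<otimes>\<^sub>Q hall"
  shows "\<exists>p :: lfg_class \<times> lfg_class \<Rightarrow>\<^sub>0 rat. t = lin_ext (\<lambda>(X, Y). single X 1 \<otimes> single Y 1) p"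
    (is "\<exists>p. t = lin_ext ?T p")
proof (induction t rule: tensor_induct)
  case (tens f g)
  have "f \<otimes> g = (\<Sum>X\<in>keys f. \<Sum>Y\<in>keys g. (lookup f X * lookup g Y) *\<^sub>Q (single X 1 \<otimes> single Y 1))"
    by (subst poly_mapping_expand[of f], subst poly_mapping_expand[of g])
       (simp only: qlinear_sum[OF tens_simps(5)] qlinear_sum[OF tens_simps(6)] tens_simps(3,4) ratvec.scale_sum_right scaleQ_scaleQ sum.swap[of _ "keys g"] mult.commute)
  also have "\<dots> = lin_ext ?T (\<Sum>X\<in>keys f. \<Sum>Y\<in>keys g. single (X, Y) (lookup f X * lookup g Y))"
    by (simp add: qlinear_sum[OF qlinear_lin_ext])
  finally show ?case by - (erule exI)
next
  case (add s t)
  then obtain p q where "s = lin_ext ?T p" "t = lin_ext ?T q" by blast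
  then have "s + t = lin_ext ?T (p + q)" by (simp only: qlinear_add[OF qlinear_lin_ext])
  then show ?case by - (erule exI)
next
  case (scale r t)
  then obtain p where "t = lin_ext ?T p" by blast
  then have "r *\<^sub>Q t = lin_ext ?T (r *\<^sub>Q p)" by (simp only: qlinear_scale[OF qlinear_lin_ext])
  then show ?case by - (erule exI)
qed

lemma tensor_lookup_lin_ext:
  "tensor_lookup (lin_ext (\<lambda>(X, Y). single X 1 \<otimes> single Y 1) p) X Y = lookup p (X, Y)"
proof -
  have "tensor_lookup (lin_ext (\<lambda>(X, Y). single X 1 \<otimes> single Y 1) p) X Y
      = (\<Sum>k\<in>keys p. lookup p k * tensor_lookup (single (fst k) 1 \<otimes> single (snd k) 1) X Y)"
    by (simp only: lin_ext_def qlinear_sum[OF qlinear_tensor_lookup] qlinear_scale[OF qlinear_tensor_lookup]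
        scaleQ_rat_def case_prod_unfold)
  also have "\<dots> = (\<Sum>k\<in>keys p. if k = (X, Y) then lookup p k else 0)"
    by (intro sum.cong refl) (auto simp: tensor_lookup_tens lookup_single when_def)
  finally show ?thesis by (simp add: in_keys_iff)
qed

text \<open>Allows identities in the tensor product to be checked as identities of functions of two
  classes, the form in which the coproduct is given.\<close>

lemma tensor_lookup_eqI:
  assumes "\<And>X Y. tensor_lookup s X Y = tensor_lookup t X Y"
  shows "s = t"
proof -
  obtain p q :: "lfg_class \<times> lfg_class \<Rightarrow>\<^sub>0 rat"
    where "s = lin_ext (\<lambda>(X, Y). single X 1 \<otimes> single Y 1) p" "t = lin_ext (\<lambda>(X, Y). single X 1 \<otimes> single Y 1) q"
    using tensor_basis_expand by blast
  moreover from this have "p = q"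
    using assms by (intro poly_mapping_eqI) (auto simp: tensor_lookup_lin_ext)
  ultimately show ?thesis by simp
qed

lemma tensor_lookup_comult: "tensor_lookup (hall_comult f) X Y = lookup f (uni X Y)"
proof -
  let ?s = "\<lambda>(X, Y). lookup f (uni X Y)"
  \<comment> \<open>Over an infinite index set the sum in \<open>hall_comult\<close> would be 0 by
    convention. A class has only finitely many decompositions because \<open>CM\<close> is
    injective.\<close>
  have fin: "finite {(X, Y). ?s (X, Y) \<noteq> 0}"
  proof (rule finite_subset)
    show "{(X, Y). ?s (X, Y) \<noteq> 0} \<subseteq> (\<Union>Z\<in>keys f. {X. CM X \<subseteq># CM Z} \<times> {X. CM X \<subseteq># CM Z})"
    proof (rule subsetI)
      fix z assume z: "z \<in> {(X, Y). ?s (X, Y) \<noteq> 0}"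
      obtain X Y where [simp]: "z = (X, Y)" by (cases z)
      have "uni X Y \<in> keys f" using z by (simp add: in_keys_iff)
      moreover have "CM X \<subseteq># CM (uni X Y)" "CM Y \<subseteq># CM (uni X Y)" by (simp_all add: CM_uni)
      ultimately show "z \<in> (\<Union>Z\<in>keys f. {X. CM X \<subseteq># CM Z} \<times> {X. CM X \<subseteq># CM Z})" by auto
    qed
    have "finite {X. CM X \<subseteq># M}" for M
      using finite_vimageI[OF finite_msubsets[of M], of CM] CM_inj by (simp add: inj_def vimage_def)
    then show "finite (\<Union>Z\<in>keys f. {X. CM X \<subseteq># CM Z} \<times> {X. CM X \<subseteq># CM Z})" by simp
  qed
  have "tensor_lookup (hall_comult f) X Y
      = (\<Sum>k\<in>{(X, Y). ?s (X, Y) \<noteq> 0}. ?s k * tensor_lookup (single (fst k) 1 \<otimes> single (snd k) 1) X Y)"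
    unfolding hall_comult_def Let_def uni_def[symmetric] qlinear_sum[OF qlinear_tensor_lookup]
    by (intro sum.cong refl) (auto simp: qlinear_scale[OF qlinear_tensor_lookup] scaleQ_rat_def)
  also have "\<dots> = (\<Sum>k\<in>{(X, Y). ?s (X, Y) \<noteq> 0}. if k = (X, Y) then ?s k else 0)"
    by (intro sum.cong refl) (auto simp: tensor_lookup_tens lookup_single when_def)
  also have "\<dots> = lookup f (uni X Y)" using fin by (simp add: sum.delta)
  finally show ?thesis .
qed

lemma qlinear_hall_comult: "qlinear hall_comult"
  by (rule qlinearI; rule tensor_lookup_eqI)
     (simp_all add: tensor_lookup_comult lookup_add lookup_scaleQ qlinear_add[OF qlinear_tensor_lookup]
       qlinear_scale[OF qlinear_tensor_lookup])

lemmas htens = qbilinearD[OF qbilinear_tensor_mult[OF qbilinear_hall]] tensor_mult_tens[OF qbilinear_hall]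

lemma tensor_lookup_mult_left:
  assumes A: "connected_class A" and h: "lfgh h"
  shows "tensor_lookup (tensor_mult hall_mult (single A 1 \<otimes> hall_one) t) (cls h) Y
    = (\<Sum>c\<in>copies A h. tensor_lookup t (cls (quo h c)) Y)"
  by (induction t rule: tensor_induct)
     (simp_all add: htens tensor_lookup_tens hall_one_left lookup_mult_connected[OF h A] sum_distrib_right
       qlinear_add[OF qlinear_tensor_lookup] qlinear_scale[OF qlinear_tensor_lookup] sum.distrib
       scaleQ_rat_def sum_distrib_left)

lemma tensor_lookup_mult_right:
  assumes A: "connected_class A" and h: "lfgh h"
  shows "tensor_lookup (tensor_mult hall_mult (hall_one \<otimes> single A 1) t) X (cls h)
    = (\<Sum>c\<in>copies A h. tensor_lookup t X (cls (quo h c)))"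
  by (induction t rule: tensor_induct)
     (simp_all add: htens tensor_lookup_tens hall_one_left lookup_mult_connected[OF h A] sum_distrib_left
       qlinear_add[OF qlinear_tensor_lookup] qlinear_scale[OF qlinear_tensor_lookup] sum.distrib
       scaleQ_rat_def)

lemma cls_hun:
  assumes "lfgh h" "lfgh k" "hs h \<inter> hs k = {}"
  shows "cls (hun h k) = uni (cls h) (cls k)"
  by (rule CM_inj) (simp add: CM_uni CM_cls lfgh_hun assms cmh_hun)

text \<open>A copy of \<open>A\<close> in a disjoint union lies in one summand
  (\<open>csub_hun\<close>), and contracting it leaves the other summand alone
  (\<open>quo_hun\<close>). The two kinds of copies give the two terms of the primitive
  element.\<close>

lemma hall_comult_connected_mult:
  assumes A: "connected_class A"
  shows "hall_comult (hall_mult (single A 1) f)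
    = tensor_mult hall_mult (single A 1 \<otimes> hall_one + hall_one \<otimes> single A 1) (hall_comult f)"
proof (rule tensor_lookup_eqI)
  fix X Y
  define h k where "h = lcopy X" and "k = rcopy Y"
  have l: "lfgh h" "lfgh k" "hs h \<inter> hs k = {}" "hs k \<inter> hs h = {}" "cls h = X" "cls k = Y"
    using copies_props[of X] copies_props[of Y] copies_props(5)[of X Y] by (auto simp: h_def k_def simp del: himg_simps)
  note lu = lfgh_hun[OF l(1-3)]
  have lq: "lfgh (quo g c)" "hs (quo g c) \<subseteq> hs g" if "c \<in> copies A g" "lfgh g" for c g
    using that lfgh_quo_sub hs_quo_sub by (auto simp: copies_def csub_def)
  have ch: "hs c \<subseteq> hs g" "hs c \<noteq> {}" if "c \<in> copies A g" for c g
    using that subD(3) by (auto simp: copies_def csub_def conn_def)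
  have split: "copies A (hun h k) = copies A h \<union> copies A k"
    using csub_hun[OF l(1-3)] by (auto simp: copies_def)
  have dj: "copies A h \<inter> copies A k = {}" using ch l(3) by blast
  have "lookup (hall_mult (single A 1) f) (uni X Y)
      = (\<Sum>c\<in>copies A (hun h k). lookup f (cls (quo (hun h k) c)))"
    using lookup_mult_connected[OF lu A] cls_hun[OF l(1-3)] l by simp
  also have "\<dots> = (\<Sum>c\<in>copies A h. lookup f (cls (quo (hun h k) c))) + (\<Sum>c\<in>copies A k. lookup f (cls (quo (hun h k) c)))"
    unfolding split using finite_copies lfgh_cubic l dj by (intro sum.union_disjoint) auto
  also have "(\<Sum>c\<in>copies A h. lookup f (cls (quo (hun h k) c))) = (\<Sum>c\<in>copies A h. lookup f (uni (cls (quo h c)) Y))"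
  proof (intro sum.cong refl)
    fix c assume c: "c \<in> copies A h"
    then have "quo (hun h k) c = hun (quo h c) k" using quo_hun[OF l(1-3)] by (simp add: copies_def)
    moreover have "hs (quo h c) \<inter> hs k = {}" using lq(2)[OF c l(1)] l(3) by blast
    ultimately show "lookup f (cls (quo (hun h k) c)) = lookup f (uni (cls (quo h c)) Y)"
      using cls_hun[OF lq(1)[OF c l(1)] l(2)] l by simp
  qed
  also have "(\<Sum>c\<in>copies A k. lookup f (cls (quo (hun h k) c))) = (\<Sum>c\<in>copies A k. lookup f (uni X (cls (quo k c))))"
  proof (intro sum.cong refl)
    fix c assume c: "c \<in> copies A k"
    then have "quo (hun h k) c = hun h (quo k c)"
      using quo_hun[OF l(2,1,4)] hun_commute by (simp add: copies_def)
    moreover have "hs h \<inter> hs (quo k c) = {}" using lq(2)[OF c l(2)] l(3) by blast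
    ultimately show "lookup f (cls (quo (hun h k) c)) = lookup f (uni X (cls (quo k c)))"
      using cls_hun[OF l(1) lq(1)[OF c l(2)]] l by simp
  qed
  finally show "tensor_lookup (hall_comult (hall_mult (single A 1) f)) X Y
    = tensor_lookup (tensor_mult hall_mult (single A 1 \<otimes> hall_one + hall_one \<otimes> single A 1) (hall_comult f)) X Y"
    using tensor_lookup_mult_left[OF A l(1)] tensor_lookup_mult_right[OF A l(2)] l
    by (simp add: tensor_lookup_comult htens qlinear_add[OF qlinear_tensor_lookup])
qed

lemma psi_expand: "psi x = (\<Sum>A\<in>keys (Rep_nlfg x). (lookup (Rep_nlfg x) A * of_nat (aut A)) *\<^sub>Q single A 1)"
  unfolding psi_def by (subst poly_mapping_expand[of "Rep_nlfg x"])
    (simp only: qlinear_sum[OF qlinear_weigh] qlinear_scale[OF qlinear_weigh] weigh_single scaleQ_scaleQ)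

lemma psi_linear_eqI:
  assumes "qlinear F" "qlinear G" "\<And>A. connected_class A \<Longrightarrow> F (single A 1) = G (single A 1)"
  shows "F (psi x) = G (psi x)"
  unfolding psi_expand qlinear_sum[OF assms(1)] qlinear_sum[OF assms(2)] qlinear_scale[OF assms(1)] qlinear_scale[OF assms(2)]
  using assms(3) Rep_connected[of x] by (intro sum.cong refl) simp

lemma hall_comult_psi_mult:
  "hall_comult (hall_mult (psi x) f)
    = tensor_mult hall_mult (psi x \<otimes> hall_one + hall_one \<otimes> psi x) (hall_comult f)"
proof (rule psi_linear_eqI[where F = "\<lambda>u. hall_comult (hall_mult u f)"
      and G = "\<lambda>u. tensor_mult hall_mult (u \<otimes> hall_one + hall_one \<otimes> u) (hall_comult f)"])
  show "qlinear (\<lambda>u. hall_comult (hall_mult u f))"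
    by (rule qlinear_compose[OF qlinear_hall_comult hall_simps(6)])
  show "qlinear (\<lambda>u. tensor_mult hall_mult (u \<otimes> hall_one + hall_one \<otimes> u) (hall_comult f))"
    by (rule qlinear_compose[OF htens(6) qlinear_add_fun[OF tens_simps(6) tens_simps(5)]])
qed (rule hall_comult_connected_mult)

lemma qlinear_hall_counit: "qlinear hall_counit"
  by (rule qlinearI) (simp_all add: hall_counit_def lookup_add lookup_scaleQ)

text \<open>The counit evaluates at the empty graph, which contains no copy of a connected
  class.\<close>

lemma hall_counit_psi_mult: "hall_counit (hall_mult (psi x) f) = 0"
proof (rule psi_linear_eqI[where F = "\<lambda>u. hall_counit (hall_mult u f)" and G = "\<lambda>_. 0"])
  show "qlinear (\<lambda>u. hall_counit (hall_mult u f))"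
    by (rule qlinear_compose[OF qlinear_hall_counit hall_simps(6)])
  show "qlinear (\<lambda>_ :: hall. 0 :: rat)" by (rule qlinear_zero_fun)
  fix A assume A: "connected_class A"
  have "copies A hempty = {}"
    using subD(3) by (fastforce simp: copies_def csub_def conn_def hempty_def)
  then show "hall_counit (hall_mult (single A 1) f) = 0"
    by (simp add: hall_counit_def flip: cls_hempty) (simp add: lookup_mult_connected[OF lfgh_hempty A])
qed

lemma hall_one_comult: "hall_comult hall_one = hall_one \<otimes> hall_one"
proof (rule tensor_lookup_eqI)
  fix X Y
  let ?E = "cls hempty"
  have E: "X = ?E \<longleftrightarrow> CM X = {#}" for X using CM_inj CM_cls[OF lfgh_hempty] cmh_hempty by metis
  have "uni X Y = ?E \<longleftrightarrow> X = ?E \<and> Y = ?E" unfolding E CM_uni by simp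
  then show "tensor_lookup (hall_comult hall_one) X Y = tensor_lookup (hall_one \<otimes> hall_one) X Y"
    by (auto simp: tensor_lookup_comult tensor_lookup_tens hall_one_def lookup_single when_def simp flip: cls_hempty)
qed

lemma phi_comult: "hall_comult (phi u) = tensor_map phi phi (uea_comult u)"
proof (induction u rule: uea_induct)
  note pl = phi_simps(1) and T = tensor_map_tens[OF phi_simps(1) phi_simps(1)] and tl = qlinear_tensor_map[OF phi_simps(1) phi_simps(1)]
  {
    case one
    show ?case by (simp add: phi_simps(3) hall_one_comult uea_comult_simps(3) T)
  next
    case (mult x u)
    have "tensor_map phi phi (tensor_mult uea_mult (primitive x) t)
        = tensor_mult hall_mult (psi x \<otimes> hall_one + hall_one \<otimes> psi x) (tensor_map phi phi t)" for t
      by (rule tensor_eqI[OF qlinear_compose[OF tl tmult_simps(5)] qlinear_compose[OF htens(5) tl]])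
         (simp only: primitive_mult_tens qlinear_add[OF tl] T phi_simps htens hall_one_left)
    then show ?case by (simp only: uea_comult_primitive_mult phi_simps(2,4) hall_comult_psi_mult mult)
  next
    case (add u v)
    then show ?case by (simp only: qlinear_add[OF pl] qlinear_add[OF qlinear_hall_comult] qlinear_add[OF uea_comult_simps(1)] qlinear_add[OF tl])
  next
    case (scale r u)
    then show ?case by (simp only: qlinear_scale[OF pl] qlinear_scale[OF qlinear_hall_comult] qlinear_scale[OF uea_comult_simps(1)] qlinear_scale[OF tl])
  }
qed

lemma phi_counit: "hall_counit (phi u) = uea_counit u"
proof (induction u rule: uea_induct)
  case one show ?case by (simp add: phi_simps(3) uea_counit_simps(3)) (simp add: hall_counit_def hall_one_def)
next
  case (mult x u) show ?case by (simp add: phi_simps(2,4) hall_counit_psi_mult uea_counit_simps)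
next
  case (add u v) then show ?case
    by (simp only: qlinear_add[OF phi_simps(1)] qlinear_add[OF qlinear_hall_counit] qlinear_add[OF uea_counit_simps(1)])
next
  case (scale r u) then show ?case
    by (simp only: qlinear_scale[OF phi_simps(1)] qlinear_scale[OF qlinear_hall_counit] qlinear_scale[OF uea_counit_simps(1)])
qed

lemma hopf_iso_phi:
  "hopf_iso uea_mult uea_one uea_comult uea_counit hall_mult hall_one hall_comult hall_counit phi"
  unfolding hopf_iso_def bij_def
  using phi_simps(1-3) phi_inj phi_surj phi_comult phi_counit by blast

section \<open>Transport of the Hopf structure\<close>

lemma hopf_algebra_transport:
  assumes H: "hopf_algebra m e D c" and iso: "hopf_iso m e D c m' e' D' c' \<phi>"
    and alg: "unital_algebra m' e'" and D': "qlinear D'" and c': "qlinear c'"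
  shows "hopf_algebra m' e' D' c'"
proof -
  from iso have l: "qlinear \<phi>" and bij: "bij \<phi>" and \<phi>m: "\<And>x y. \<phi> (m x y) = m' (\<phi> x) (\<phi> y)" and \<phi>e: "\<phi> e = e'"
    and \<phi>D: "\<And>x. D' (\<phi> x) = tensor_map \<phi> \<phi> (D x)" and \<phi>c: "\<And>x. c' (\<phi> x) = c x"
    by (auto simp: hopf_iso_def)
  from H obtain S where bi: "bialgebra m e D c" and S: "antipode m e D c S" by (auto simp: hopf_algebra_def)
  from bi have m: "qbilinear m" and D: "qlinear D" and c: "qlinear c"
    and coassoc: "\<And>x. tensor_assoc (tensor_map D id (D x)) = tensor_map id D (D x)"
    and counit: "\<And>x. tensor_lift (\<lambda>a b. c a *\<^sub>Q b) (D x) = x" "\<And>x. tensor_lift (\<lambda>a b. c b *\<^sub>Q a) (D x) = x"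
    and Dm: "\<And>x y. D (m x y) = tensor_mult m (D x) (D y)" and De: "D e = e \<otimes> e"
    and cm: "\<And>x y. c (m x y) = c x * c y" and ce: "c e = 1"
    by (auto simp: bialgebra_def counital_coalgebra_def unital_algebra_def)
  have m': "qbilinear m'" using alg by (simp add: unital_algebra_def)
  have ex: "\<exists>x. y = \<phi> x" for y using bij by (metis bij_pointE)
  let ?P = "tensor_map \<phi> \<phi>"
  note P = tensor_map_tens[OF l l] and Pl = qlinear_tensor_map[OF l l]
  have idl: "qlinear id" using qlinear_id by (simp add: id_def)
  note t1 = tensor_map_tens[OF D' idl] and t2 = tensor_map_tens[OF idl D'] and l1 = qlinear_tensor_map[OF D' idl]
    and l2 = qlinear_tensor_map[OF idl D'] and s1 = tensor_map_tens[OF D idl] and s2 = tensor_map_tens[OF idl D]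
    and k1 = qlinear_tensor_map[OF D idl] and k2 = qlinear_tensor_map[OF idl D]
    and la = qlinear_tensor_assoc
  note Q = tensor_map_tens[OF l Pl] and Ql = qlinear_tensor_map[OF l Pl]
  \<comment> \<open>\<open>tensor_map\<close> of \<phi> with itself has to intertwine every map
    occurring in the axioms. By \<open>tensor_eqI\<close> pure tensors suffice, with a second
    application where the coproduct produces a third factor.\<close>
  have A1: "tensor_assoc (tensor_map D' id (?P t)) = tensor_map \<phi> ?P (tensor_assoc (tensor_map D id t))" for t
  proof (rule tensor_eqI[where F = "\<lambda>t. tensor_assoc (tensor_map D' id (?P t))" and G = "\<lambda>t. tensor_map \<phi> ?P (tensor_assoc (tensor_map D id t))"])
    show "qlinear (\<lambda>t. tensor_assoc (tensor_map D' id (?P t)))" by (rule qlinear_compose[OF la qlinear_compose[OF l1 Pl]])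
    show "qlinear (\<lambda>t. tensor_map \<phi> ?P (tensor_assoc (tensor_map D id t)))" by (rule qlinear_compose[OF Ql qlinear_compose[OF la k1]])
    fix a b
    have "tensor_assoc (?P s \<otimes> \<phi> b) = tensor_map \<phi> ?P (tensor_assoc (s \<otimes> b))" for s
    proof (rule tensor_eqI[where F = "\<lambda>s. tensor_assoc (?P s \<otimes> \<phi> b)" and G = "\<lambda>s. tensor_map \<phi> ?P (tensor_assoc (s \<otimes> b))"])
      show "qlinear (\<lambda>s. tensor_assoc (?P s \<otimes> \<phi> b))" by (rule qlinear_compose[OF la qlinear_compose[OF tens_simps(6) Pl]])
      show "qlinear (\<lambda>s. tensor_map \<phi> ?P (tensor_assoc (s \<otimes> b)))" by (rule qlinear_compose[OF Ql qlinear_compose[OF la tens_simps(6)]])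
    qed (simp only: P tensor_assoc_tens Q)
    then show "tensor_assoc (tensor_map D' id (?P (a \<otimes> b))) = tensor_map \<phi> ?P (tensor_assoc (tensor_map D id (a \<otimes> b)))"
      unfolding P t1 s1 \<phi>D id_apply .
  qed
  have A2: "tensor_map id D' (?P t) = tensor_map \<phi> ?P (tensor_map id D t)" for t
    by (rule tensor_eqI[OF qlinear_compose[OF l2 Pl] qlinear_compose[OF Ql k2]]) (simp only: P t2 s2 Q \<phi>D id_apply)
  have coassoc': "tensor_assoc (tensor_map D' id (D' y)) = tensor_map id D' (D' y)" for y
    using ex[of y] A1 A2 coassoc \<phi>D by metis
  have b: "qbilinear (\<lambda>a b. k a *\<^sub>Q b)" "qbilinear (\<lambda>a b. k b *\<^sub>Q a)" if "qlinear k" for k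
    by (rule qbilinearI; simp add: qlinear_add[OF that] qlinear_scale[OF that] scaleQ_add_left scaleQ_add_right
        scaleQ_scaleQ scaleQ_rat_def mult.commute)+
  have U1: "tensor_lift (\<lambda>a b. c' a *\<^sub>Q b) (?P t) = \<phi> (tensor_lift (\<lambda>a b. c a *\<^sub>Q b) t)" for t
    by (rule tensor_eqI[OF qlinear_compose[OF qlinear_tensor_lift[OF b(1)[OF c']] Pl] qlinear_compose[OF l qlinear_tensor_lift[OF b(1)[OF c]]]])
       (simp only: P tensor_lift_tens[OF b(1)[OF c]] tensor_lift_tens[OF b(1)[OF c']] \<phi>c qlinear_scale[OF l])
  have U2: "tensor_lift (\<lambda>a b. c' b *\<^sub>Q a) (?P t) = \<phi> (tensor_lift (\<lambda>a b. c b *\<^sub>Q a) t)" for t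
    by (rule tensor_eqI[OF qlinear_compose[OF qlinear_tensor_lift[OF b(2)[OF c']] Pl] qlinear_compose[OF l qlinear_tensor_lift[OF b(2)[OF c]]]])
       (simp only: P tensor_lift_tens[OF b(2)[OF c]] tensor_lift_tens[OF b(2)[OF c']] \<phi>c qlinear_scale[OF l])
  have counit': "tensor_lift (\<lambda>a b. c' a *\<^sub>Q b) (D' y) = y" "tensor_lift (\<lambda>a b. c' b *\<^sub>Q a) (D' y) = y" for y
    using ex[of y] U1 U2 counit \<phi>D by metis+
  note Mb = qbilinearD[OF qbilinear_tensor_mult[OF m]] and Mb' = qbilinearD[OF qbilinear_tensor_mult[OF m']]
  have M: "?P (tensor_mult m s t) = tensor_mult m' (?P s) (?P t)" for s t
  proof (induction s rule: tensor_induct)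
    case (tens a b)
    show ?case
      by (induction t rule: tensor_induct)
         (simp_all add: tensor_mult_tens[OF m] tensor_mult_tens[OF m'] P \<phi>m Mb Mb' qlinear_add[OF Pl] qlinear_scale[OF Pl])
  qed (simp_all add: Mb Mb' qlinear_add[OF Pl] qlinear_scale[OF Pl])
  have Dm': "D' (m' x y) = tensor_mult m' (D' x) (D' y)" for x y
    using ex[of x] ex[of y] \<phi>m \<phi>D Dm M by metis
  have De': "D' e' = e' \<otimes> e'" using \<phi>e \<phi>D De P by metis
  have cm': "c' (m' x y) = c' x * c' y" for x y using ex[of x] ex[of y] \<phi>m \<phi>c cm by metis
  have ce': "c' e' = 1" using \<phi>e \<phi>c ce by metis
  have bi': "bialgebra m' e' D' c'"
    unfolding bialgebra_def counital_coalgebra_def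
    using alg D' c' coassoc' counit' Dm' De' cm' ce' by blast
  have Sl: "qlinear S" and S1: "\<And>x. tensor_lift (\<lambda>a b. m (S a) b) (D x) = c x *\<^sub>Q e"
    and S2: "\<And>x. tensor_lift (\<lambda>a b. m a (S b)) (D x) = c x *\<^sub>Q e" using S by (auto simp: antipode_def)
  define S' where "S' y = \<phi> (S (inv \<phi> y))" for y
  have S': "S' (\<phi> x) = \<phi> (S x)" for x using bij by (simp add: S'_def bij_is_inj)
  have Sl': "qlinear S'"
  proof (rule qlinearI)
    fix x y r
    obtain u v where "x = \<phi> u" "y = \<phi> v" using ex by metis
    then show "S' (x + y) = S' x + S' y" "S' (r *\<^sub>Q x) = r *\<^sub>Q S' x"
      using S' by (simp_all add: qlinear_add[OF l] qlinear_add[OF Sl] qlinear_scale[OF l] qlinear_scale[OF Sl]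
          flip: qlinear_add[OF l] qlinear_scale[OF l])
  qed
  have bS: "qbilinear (\<lambda>a b. n (T a) b)" "qbilinear (\<lambda>a b. n a (T b))" if "qlinear T" "qbilinear n" for T n
    by (rule qbilinearI; simp add: qlinear_add[OF that(1)] qlinear_scale[OF that(1)] qbilinearD[OF that(2)])+
  have V1: "tensor_lift (\<lambda>a b. m' (S' a) b) (?P t) = \<phi> (tensor_lift (\<lambda>a b. m (S a) b) t)" for t
    by (rule tensor_eqI[OF qlinear_compose[OF qlinear_tensor_lift[OF bS(1)[OF Sl' m']] Pl] qlinear_compose[OF l qlinear_tensor_lift[OF bS(1)[OF Sl m]]]])
       (simp only: P tensor_lift_tens[OF bS(1)[OF Sl' m']] tensor_lift_tens[OF bS(1)[OF Sl m]] S' \<phi>m)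
  have V2: "tensor_lift (\<lambda>a b. m' a (S' b)) (?P t) = \<phi> (tensor_lift (\<lambda>a b. m a (S b)) t)" for t
    by (rule tensor_eqI[OF qlinear_compose[OF qlinear_tensor_lift[OF bS(2)[OF Sl' m']] Pl] qlinear_compose[OF l qlinear_tensor_lift[OF bS(2)[OF Sl m]]]])
       (simp only: P tensor_lift_tens[OF bS(2)[OF Sl' m']] tensor_lift_tens[OF bS(2)[OF Sl m]] S' \<phi>m)
  have "tensor_lift (\<lambda>a b. m' (S' a) b) (D' y) = c' y *\<^sub>Q e' \<and> tensor_lift (\<lambda>a b. m' a (S' b)) (D' y) = c' y *\<^sub>Q e'" for y
  proof -
    obtain x where x: "y = \<phi> x" using ex by blast
    show ?thesis unfolding x \<phi>D V1 V2 S1 S2 \<phi>c qlinear_scale[OF l] \<phi>e by simp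
  qed
  then have "antipode m' e' D' c' S'" using Sl' by (simp add: antipode_def)
  then show ?thesis using bi' by (auto simp: hopf_algebra_def)
qed

text \<open>\<open>hall_mult\<close> and \<open>hall_comult\<close> are defined through chosen
  representatives; the first two conjuncts say that the intended formulas hold for all labeled
  graphs.\<close>

theorem theorem7p2:
  shows "(\<forall>f g G \<rho>. labeled_feynman_graph (G, \<rho>) \<longrightarrow>
      lookup (hall_mult f g) (iso_class (G, \<rho>)) =
        (\<Sum>\<gamma> | subgraph \<gamma> G. lookup f (iso_class (\<gamma>, \<rho>)) * lookup g (iso_class (G //\<^sub>G \<gamma>, \<rho>)))) \<and>
    (\<forall>f \<Gamma>\<^sub>1 \<Gamma>\<^sub>2. labeled_feynman_graph \<Gamma>\<^sub>1 \<longrightarrow> labeled_feynman_graph \<Gamma>\<^sub>2 \<longrightarrow>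
      tensor_lookup (hall_comult f) (iso_class \<Gamma>\<^sub>1) (iso_class \<Gamma>\<^sub>2) = lookup f (iso_class (\<Gamma>\<^sub>1 \<oplus> \<Gamma>\<^sub>2))) \<and>
    hopf_algebra hall_mult hall_one hall_comult hall_counit \<and>
    lie_algebra (lie_bracket :: nlfg \<Rightarrow> nlfg \<Rightarrow> nlfg) \<and>
    hopf_algebra (uea_mult :: nlfg uea \<Rightarrow> _) uea_one uea_comult uea_counit \<and>
    (\<exists>\<phi> :: nlfg uea \<Rightarrow> hall.
      hopf_iso uea_mult uea_one uea_comult uea_counit hall_mult hall_one hall_comult hall_counit \<phi>)"
proof (intro conjI allI impI)
  show "hopf_algebra hall_mult hall_one hall_comult hall_counit"
    by (rule hopf_algebra_transport[OF uea_hopf_algebra hopf_iso_phi hall_unital_algebra qlinear_hall_comult qlinear_hall_counit])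
  show "\<exists>\<phi> :: nlfg uea \<Rightarrow> hall.
      hopf_iso uea_mult uea_one uea_comult uea_counit hall_mult hall_one hall_comult hall_counit \<phi>"
    using hopf_iso_phi by blast
qed (simp_all add: hall_mult_formula tensor_lookup_comult iso_class_disjoint_union lie_algebra_nlfg uea_hopf_algebra)

end
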